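(* Let $(\mathcal G,\nu)$ be a countable p.m.p. groupoid with unit space $(\mathcal G^{(0)},\mu)$. Let $\pi:(\mathcal G^{(0)},\mu)\to(Z,\zeta)$ be the space of ergodic components, let $\mu_z\in\mathrm{Prob}(\pi^{-1}(\{z\}))$ be the ergodic decomposition of $\mu$, and consider the disintegration $(\mathcal G,\nu)=\int_Z(\mathcal G_z,\nu_z)\,d\zeta(z)$. The following hold: (1) If $(\mathcal G,\nu)$ is properly proximal, then $(\mathcal G_z,\nu_z)$ is properly proximal for $\zeta$-almost every $z\in Z$. (2) Assume $\mathcal G^{(0)}$ is completely atomic. Then the converse holds, i.e. if $(\mathcal G_z,\nu_z)$ is properly proximal for $\zeta$-almost every $z\in Z$, then $(\mathcal G,\nu)$ is properly proximal.
   Context: **Countable p.m.p. groupoids.** Borel spaces are standard; sets and maps are considered modulo null sets. A countable p.m.p. groupoid $(\mathcal G,\nu)$ with unit space $(\mathcal G^{(0)},\mu)$ is a Borel groupoid with countable-to-one Borel source and range maps $s,r:\mathcal G\to\mathcal G^{(0)}$ (Borel multiplication and inversion) and a probability measure $\mu$ on $\mathcal G^{(0)}$ such that $\nu(C):=\int|r^{-1}(x)\cap C|\,d\mu(x)=\int|s^{-1}(x)\cap C|\,d\mu(x)$ for all Borel $C\subset\mathcal G$. For $A,B\subset\mathcal G^{(0)}$: $\mathcal G^B=r^{-1}(B)$, $\mathcal G_A=s^{-1}(A)$, $\mathcal G_A^B=\mathcal G_A\cap\mathcal G^B$. A Borel $A\subset\mathcal G^{(0)}$ is invariant if $r(s^{-1}(x))\subset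 A$ for a.e. $x\in A$; $\mathcal G$ is ergodic if invariant sets are null or conull. A local bisection is a Borel $\theta\subset\mathcal G$ on which $s,r$ are injective, with source set $s(\theta)$ and range set $r(\theta)$; $[[\mathcal G]]$ is the set of local bisections. For $x\in r(\theta)$, $r_\theta^{-1}(x)$ is the arrow of $\theta$ with range $x$. For $f\in L^\infty(\mathcal G,\nu)$, $(L_\theta f)(\gamma)=f([r_\theta^{-1}(r(\gamma))]^{-1}\gamma)$ if $r(\gamma)\in r(\theta)$, else $0$; $(R_\theta f)(\gamma)=f(\gamma\,r_\theta^{-1}(s(\gamma)))$ if $s(\gamma)\in r(\theta)$, else $0$. **Proper proximality.** $c_0(\mathcal G)$ is the set of $f\in L^\infty(\mathcal G,\nu)$ such that for every $\varepsilon>0$ there are measurable $B,B'\subset\mathcal G^{(0)}$ with $\mu(B),\mu(B')<\varepsilon$ and $F\subset\mathcal G$ with $\nu(F)<\infty$ such that $\|(1-\chi_{\mathcal G^B})(1-\chi_{\mathcal G_{B'}})f(1-\chi_F)\|_\infty\le\varepsilon$. $\mathbb S(\mathcal G)$ is the $C^*$-algebra of $f\in L^\infty(\mathcal G,\nu)$ with $f\chi_{\mathcal G_{r(\theta)}}-R_\theta f\in c_0(\mathcal G)$ for all $\theta\in[[\mathcal G]]$; it contains $L^\infty(\mathcal G^{(0)})$ via $f\mapsto f\circ r$. $\mathcal G$ is properly proximal if there is no state $\varphi$ on $\mathbb S(\mathcal G)$ with $\varphi(f\chi_{\mathcal G^{s(\theta)}}-L_\theta f)=0$ for all $f\in\mathbb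 S(\mathcal G)$, $\theta\in[[\mathcal G]]$, whose restriction to $L^\infty(\mathcal G^{(0)})$ is normal. **Ergodic decomposition.** There are a standard probability space $(Z,\zeta)$, a Borel measure-preserving map $\pi:\mathcal G^{(0)}\to Z$ and probability measures $\mu_z$ on $\pi^{-1}(\{z\})$ such that for a.e. $z$ the set $\pi^{-1}(\{z\})$ is $\mathcal G$-invariant, $\mathcal G_z:=\mathcal G^{\pi^{-1}(\{z\})}_{\pi^{-1}(\{z\})}$ is an ergodic countable p.m.p. groupoid with unit space $(\pi^{-1}(\{z\}),\mu_z)$, and $\int f\,d\mu=\int_Z\int f\,d\mu_z\,d\zeta(z)$ for bounded Borel $f$ on $\mathcal G^{(0)}$ (with $z\mapsto\int f\,d\mu_z$ Borel). $\nu_z$ is the measure on $\mathcal G_z$ induced by $\mu_z$ and counting measure on fibres. "Completely atomic" means that $\mu$ is purely atomic. *)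

theory Defs
  imports "HOL-Probability.Probability"
begin

section \<open>Standard Borel spaces and atomic measures\<close>

definition standard_borel :: "'a measure \<Rightarrow> bool" where
  "standard_borel M \<longleftrightarrow>
     (\<exists>T. completely_metrizable_space T \<and> second_countable T \<and>
          topspace T = space M \<and> sets M = sigma_sets (topspace T) {U. openin T U})"

definition atom :: "'a measure \<Rightarrow> 'a set \<Rightarrow> bool" where
  "atom M A \<longleftrightarrow> A \<in> sets M \<and> emeasure M A > 0 \<and>
     (\<forall>B\<in>sets M. B \<subseteq> A \<longrightarrow> emeasure M B = 0 \<or> emeasure M (A - B) = 0)"

definition purely_atomic :: "'a measure \<Rightarrow> bool" where
  "purely_atomic M \<longleftrightarrow>
     (\<forall>A\<in>sets M. emeasure M A > 0 \<longrightarrow> (\<exists>B. B \<subseteq> A \<and> atom M B))"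

section \<open>Countable p.m.p. groupoids\<close>

text \<open>The measure carried by \<open>units\<close> is \<open>\<mu>\<close> and the one carried by \<open>arrows\<close> is \<open>\<nu>\<close>.
  The functions below are only meaningful on these spaces, and \<open>gmul \<alpha> \<beta>\<close> only for
  \<open>src \<alpha> = rng \<beta>\<close>. Units are kept apart from arrows; \<open>gunit\<close> is the inclusion of
  the unit space.\<close>

record ('g, 'x) groupoid =
  arrows :: "'g measure"
  units :: "'x measure"
  src :: "'g \<Rightarrow> 'x"
  rng :: "'g \<Rightarrow> 'x"
  gmul :: "'g \<Rightarrow> 'g \<Rightarrow> 'g"
  ginv :: "'g \<Rightarrow> 'g"
  gunit :: "'x \<Rightarrow> 'g"

definition algebraic_groupoid :: "('g, 'x) groupoid \<Rightarrow> bool" where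
  "algebraic_groupoid G \<longleftrightarrow>
     src G \<in> space (arrows G) \<rightarrow> space (units G) \<and>
     rng G \<in> space (arrows G) \<rightarrow> space (units G) \<and>
     ginv G \<in> space (arrows G) \<rightarrow> space (arrows G) \<and>
     gunit G \<in> space (units G) \<rightarrow> space (arrows G) \<and>
     (\<forall>x\<in>space (units G). src G (gunit G x) = x \<and> rng G (gunit G x) = x) \<and>
     (\<forall>\<alpha>\<in>space (arrows G). \<forall>\<beta>\<in>space (arrows G). src G \<alpha> = rng G \<beta> \<longrightarrow>
        gmul G \<alpha> \<beta> \<in> space (arrows G) \<and>
        src G (gmul G \<alpha> \<beta>) = src G \<beta> \<and> rng G (gmul G \<alpha> \<beta>) = rng G \<alpha>) \<and>
     (\<forall>\<alpha>\<in>space (arrows G). \<forall>\<beta>\<in>space (arrows G). \<forall>\<gamma>\<in>space (arrows G).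
        src G \<alpha> = rng G \<beta> \<longrightarrow> src G \<beta> = rng G \<gamma> \<longrightarrow>
        gmul G (gmul G \<alpha> \<beta>) \<gamma> = gmul G \<alpha> (gmul G \<beta> \<gamma>)) \<and>
     (\<forall>\<gamma>\<in>space (arrows G).
        gmul G \<gamma> (gunit G (src G \<gamma>)) = \<gamma> \<and> gmul G (gunit G (rng G \<gamma>)) \<gamma> = \<gamma> \<and>
        src G (ginv G \<gamma>) = rng G \<gamma> \<and> rng G (ginv G \<gamma>) = src G \<gamma> \<and>
        gmul G \<gamma> (ginv G \<gamma>) = gunit G (rng G \<gamma>) \<and>
        gmul G (ginv G \<gamma>) \<gamma> = gunit G (src G \<gamma>))"

definition borel_groupoid :: "('g, 'x) groupoid \<Rightarrow> bool" where
  "borel_groupoid G \<longleftrightarrow>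
     algebraic_groupoid G \<and>
     standard_borel (arrows G) \<and> standard_borel (units G) \<and>
     src G \<in> arrows G \<rightarrow>\<^sub>M units G \<and>
     rng G \<in> arrows G \<rightarrow>\<^sub>M units G \<and>
     ginv G \<in> arrows G \<rightarrow>\<^sub>M arrows G \<and>
     gunit G \<in> units G \<rightarrow>\<^sub>M arrows G \<and>
     (\<lambda>(\<alpha>, \<beta>). gmul G \<alpha> \<beta>) \<in>
       restrict_space (arrows G \<Otimes>\<^sub>M arrows G) {(\<alpha>, \<beta>). src G \<alpha> = rng G \<beta>} \<rightarrow>\<^sub>M arrows G"

text \<open>\<open>fibre_count p m C\<close> is the integral over \<open>m\<close> of the (possibly infinite) number of
  points of \<open>C\<close> in the fibre of \<open>p\<close>.\<close>

definition fibre_count :: "('g \<Rightarrow> 'x) \<Rightarrow> 'x measure \<Rightarrow> 'g set \<Rightarrow> ennreal" where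
  "fibre_count p m C =
     (\<integral>\<^sup>+ x. emeasure (count_space UNIV) {\<gamma> \<in> C. p \<gamma> = x} \<partial>m)"

definition countable_pmp_groupoid :: "('g, 'x) groupoid \<Rightarrow> bool" where
  "countable_pmp_groupoid G \<longleftrightarrow>
     borel_groupoid G \<and> prob_space (units G) \<and>
     (\<forall>x\<in>space (units G). countable {\<gamma> \<in> space (arrows G). src G \<gamma> = x}) \<and>
     (\<forall>x\<in>space (units G). countable {\<gamma> \<in> space (arrows G). rng G \<gamma> = x}) \<and>
     (\<forall>C\<in>sets (arrows G).
        emeasure (arrows G) C = fibre_count (rng G) (units G) C \<and>
        emeasure (arrows G) C = fibre_count (src G) (units G) C)"

definition arrows_from :: "('g, 'x) groupoid \<Rightarrow> 'x set \<Rightarrow> 'g set" where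
  "arrows_from G A = {\<gamma> \<in> space (arrows G). src G \<gamma> \<in> A}"

definition arrows_to :: "('g, 'x) groupoid \<Rightarrow> 'x set \<Rightarrow> 'g set" where
  "arrows_to G B = {\<gamma> \<in> space (arrows G). rng G \<gamma> \<in> B}"

text \<open>Invariance modulo null sets of \<open>m\<close>, a measure on the unit space. It is used with
  \<open>m = units G\<close>, and with the conditional measures of a disintegration, for which
  the fibres may be \<open>units G\<close>-null.\<close>

definition invariant_mod :: "('g, 'x) groupoid \<Rightarrow> 'x measure \<Rightarrow> 'x set \<Rightarrow> bool" where
  "invariant_mod G m A \<longleftrightarrow> (AE x in m. x \<in> A \<longrightarrow> rng G ` arrows_from G {x} \<subseteq> A)"

definition ergodic :: "('g, 'x) groupoid \<Rightarrow> bool" where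
  "ergodic G \<longleftrightarrow>
     (\<forall>A\<in>sets (units G). invariant_mod G (units G) A \<longrightarrow>
        emeasure (units G) A = 0 \<or> emeasure (units G) (space (units G) - A) = 0)"

definition local_bisections :: "('g, 'x) groupoid \<Rightarrow> 'g set set" where
  "local_bisections G = {\<theta> \<in> sets (arrows G). inj_on (src G) \<theta> \<and> inj_on (rng G) \<theta>}"

definition left_translate ::
  "('g, 'x) groupoid \<Rightarrow> 'g set \<Rightarrow> ('g \<Rightarrow> complex) \<Rightarrow> 'g \<Rightarrow> complex" where
  "left_translate G \<theta> f \<gamma> =
     (if rng G \<gamma> \<in> rng G ` \<theta>
      then f (gmul G (ginv G (the_inv_into \<theta> (rng G) (rng G \<gamma>))) \<gamma>) else 0)"

definition right_translate ::
  "('g, 'x) groupoid \<Rightarrow> 'g set \<Rightarrow> ('g \<Rightarrow> complex) \<Rightarrow> 'g \<Rightarrow> complex" where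
  "right_translate G \<theta> f \<gamma> =
     (if src G \<gamma> \<in> rng G ` \<theta>
      then f (gmul G \<gamma> (the_inv_into \<theta> (rng G) (src G \<gamma>))) else 0)"

section \<open>Proper proximality\<close>

text \<open>Elements of \<open>L\<^sup>\<infinity>\<close> are represented by measurable, essentially bounded functions;
  they are identified when they agree almost everywhere, so functionals on spaces of
  such functions are required to respect almost everywhere equality.\<close>

definition Linf :: "'a measure \<Rightarrow> ('a \<Rightarrow> complex) set" where
  "Linf M = {f \<in> borel_measurable M. \<exists>C. AE x in M. norm (f x) \<le> C}"

definition c0 :: "('g, 'x) groupoid \<Rightarrow> ('g \<Rightarrow> complex) set" where
  "c0 G = {f \<in> Linf (arrows G). \<forall>\<epsilon>>0.
     \<exists>B\<in>sets (units G). \<exists>B'\<in>sets (units G). \<exists>F\<in>sets (arrows G).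
       measure (units G) B < \<epsilon> \<and> measure (units G) B' < \<epsilon> \<and> emeasure (arrows G) F < \<infinity> \<and>
       (AE \<gamma> in arrows G.
          norm ((1 - indicator (arrows_to G B) \<gamma>) * (1 - indicator (arrows_from G B') \<gamma>)
                * f \<gamma> * (1 - indicator F \<gamma>)) \<le> \<epsilon>)}"

definition S_algebra :: "('g, 'x) groupoid \<Rightarrow> ('g \<Rightarrow> complex) set" where
  "S_algebra G = {f \<in> Linf (arrows G). \<forall>\<theta>\<in>local_bisections G.
     (\<lambda>\<gamma>. f \<gamma> * indicator (arrows_from G (rng G ` \<theta>)) \<gamma> - right_translate G \<theta> f \<gamma>) \<in> c0 G}"

text \<open>A state on a unital \<open>*\<close>-closed algebra \<open>\<A>\<close> of (classes of) functions in \<open>Linf M\<close>.\<close>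

definition state_on ::
  "'a measure \<Rightarrow> ('a \<Rightarrow> complex) set \<Rightarrow> (('a \<Rightarrow> complex) \<Rightarrow> complex) \<Rightarrow> bool" where
  "state_on M \<A> \<phi> \<longleftrightarrow>
     (\<forall>f\<in>\<A>. \<forall>g\<in>\<A>. (AE x in M. f x = g x) \<longrightarrow> \<phi> f = \<phi> g) \<and>
     (\<forall>f\<in>\<A>. \<forall>g\<in>\<A>. \<phi> (\<lambda>x. f x + g x) = \<phi> f + \<phi> g) \<and>
     (\<forall>c. \<forall>f\<in>\<A>. \<phi> (\<lambda>x. c * f x) = c * \<phi> f) \<and>
     (\<forall>f\<in>\<A>. \<phi> (\<lambda>x. cnj (f x) * f x) \<in> \<real>\<^sub>\<ge>\<^sub>0) \<and>
     \<phi> (\<lambda>_. 1) = 1"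

definition Linf_real :: "'a measure \<Rightarrow> ('a \<Rightarrow> real) set" where
  "Linf_real M = {f \<in> borel_measurable M. \<exists>C. AE x in M. \<bar>f x\<bar> \<le> C}"

definition Linf_is_sup :: "'a measure \<Rightarrow> ('a \<Rightarrow> real) set \<Rightarrow> ('a \<Rightarrow> real) \<Rightarrow> bool" where
  "Linf_is_sup M D g \<longleftrightarrow> g \<in> Linf_real M \<and>
     (\<forall>f\<in>D. AE x in M. f x \<le> g x) \<and>
     (\<forall>h\<in>Linf_real M. (\<forall>f\<in>D. AE x in M. f x \<le> h x) \<longrightarrow> (AE x in M. g x \<le> h x))"

text \<open>A positive functional on \<open>Linf M\<close> is normal if it preserves suprema of bounded
  increasing nets of self-adjoint elements. Nets are given here by their ranges, i.e. by
  upward directed sets.\<close>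

definition normal_functional ::
  "'a measure \<Rightarrow> (('a \<Rightarrow> complex) \<Rightarrow> complex) \<Rightarrow> bool" where
  "normal_functional M \<psi> \<longleftrightarrow>
     (\<forall>D g. D \<noteq> {} \<and> D \<subseteq> Linf_real M \<and>
        (\<forall>f1\<in>D. \<forall>f2\<in>D. \<exists>f\<in>D. (AE x in M. f1 x \<le> f x) \<and> (AE x in M. f2 x \<le> f x)) \<and>
        Linf_is_sup M D g \<longrightarrow>
        Re (\<psi> (\<lambda>x. complex_of_real (g x))) =
          (SUP f\<in>D. Re (\<psi> (\<lambda>x. complex_of_real (f x)))))"

definition properly_proximal :: "('g, 'x) groupoid \<Rightarrow> bool" where
  "properly_proximal G \<longleftrightarrow>
     \<not> (\<exists>\<phi>. state_on (arrows G) (S_algebra G) \<phi> \<and>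
          (\<forall>f\<in>S_algebra G. \<forall>\<theta>\<in>local_bisections G.
             \<phi> (\<lambda>\<gamma>. f \<gamma> * indicator (arrows_to G (src G ` \<theta>)) \<gamma> - left_translate G \<theta> f \<gamma>) = 0) \<and>
          normal_functional (units G) (\<lambda>f. \<phi> (f \<circ> rng G)))"

section \<open>Ergodic decomposition\<close>

text \<open>Restriction of \<open>G\<close> to a set of units \<open>A\<close>, equipped with a measure \<open>m\<close> on the
  unit space of \<open>G\<close> that is concentrated on \<open>A\<close>. The measure on the arrows is the one
  induced by \<open>m\<close> and counting on the fibres of the range map.\<close>

definition restrict_groupoid ::
  "('g, 'x) groupoid \<Rightarrow> 'x set \<Rightarrow> 'x measure \<Rightarrow> ('g, 'x) groupoid" where
  "restrict_groupoid G A m =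
     (let N = restrict_space (arrows G) (arrows_from G A \<inter> arrows_to G A);
          m' = restrict_space m A
      in G\<lparr>arrows := measure_of (space N) (sets N) (fibre_count (rng G) m'),
           units := m'\<rparr>)"

definition component ::
  "('g, 'x) groupoid \<Rightarrow> ('x \<Rightarrow> 'z) \<Rightarrow> ('z \<Rightarrow> 'x measure) \<Rightarrow> 'z \<Rightarrow> ('g, 'x) groupoid" where
  "component G \<pi> \<mu> z = restrict_groupoid G (\<pi> -` {z} \<inter> space (units G)) (\<mu> z)"

text \<open>The conditional measures \<open>\<mu> z\<close> are regarded as measures on the whole unit space,
  concentrated on the fibre over \<open>z\<close> for almost every \<open>z\<close>; thus \<open>\<pi>\<close> need not be onto.\<close>

definition ergodic_decomposition ::
  "('g, 'x) groupoid \<Rightarrow> 'z measure \<Rightarrow> ('x \<Rightarrow> 'z) \<Rightarrow> ('z \<Rightarrow> 'x measure) \<Rightarrow> bool" where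
  "ergodic_decomposition G Z \<pi> \<mu> \<longleftrightarrow>
     standard_borel Z \<and> prob_space Z \<and>
     \<pi> \<in> units G \<rightarrow>\<^sub>M Z \<and> distr (units G) Z \<pi> = Z \<and>
     (\<forall>z\<in>space Z. prob_space (\<mu> z) \<and> sets (\<mu> z) = sets (units G)) \<and>
     (AE z in Z. emeasure (\<mu> z) (\<pi> -` {z} \<inter> space (units G)) = 1) \<and>
     (AE z in Z. invariant_mod G (\<mu> z) (\<pi> -` {z} \<inter> space (units G))) \<and>
     (AE z in Z. countable_pmp_groupoid (component G \<pi> \<mu> z) \<and>
                 ergodic (component G \<pi> \<mu> z)) \<and>
     (\<forall>f :: 'x \<Rightarrow> real. f \<in> borel_measurable (units G) \<and> bounded (f ` space (units G)) \<longrightarrow>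
        (\<lambda>z. \<integral>x. f x \<partial>\<mu> z) \<in> borel_measurable Z \<and>
        (\<integral>x. f x \<partial>units G) = (\<integral>z. (\<integral>x. f x \<partial>\<mu> z) \<partial>Z))"

end

theory Submission
  imports Defs
begin

text \<open>
  A groupoid fails to be properly proximal when \<open>S_algebra G\<close> carries a state that is invariant
  under left translations and normal on the functions of the range, that is, an \<open>invariant_state\<close>.

  Descent to the components. Suppose that the set \<open>W\<close> of all \<open>z\<close> whose component carries an
  invariant state \<open>\<Phi> z\<close> is not null. The choice of \<open>\<Phi> z\<close> is not measurable in \<open>z\<close>, so
  \<open>z \<mapsto> \<Phi> z f\<close> is integrated against a finitely additive extension of the normalised measure to
  all subsets of \<open>W\<close> (\<open>finitely_additive_mean\<close>). A mean of this kind need not preserve normality.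
  Ergodicity repairs this: an invariant state of an ergodic groupoid integrates functions of the
  range against the given measure on the units (\<open>state_rng_integral\<close>), so on these functions
  \<open>\<Phi> z\<close> is the integral against \<open>\<mu> z\<close>, which is measurable in \<open>z\<close>, and the mean becomes the
  integral against a density. It remains to see that \<open>\<Phi> z f\<close> makes sense: a function of
  \<open>S_algebra G\<close> belongs to the algebra of almost every component (\<open>S_component\<close>). Membership
  quantifies over uncountably many local bisections, but countably many of them cover the
  groupoid up to a null set of units (\<open>bisection_cover\<close>), they still cover almost every
  component, and each of the resulting countably many conditions passes to almost every \<open>z\<close>.

  Ascent from the components. If the units are purely atomic, the fibres of \<open>\<pi>\<close> of positive
  measure exhaust the units, and a normal state gives positive weight to one of them
  (\<open>properly_proximal_if_components\<close>). Extension by zero embeds the algebra of that component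
  into \<open>S_algebra G\<close> (\<open>extend_S\<close>), so the state restricts, after normalisation, to an invariant
  state of the component.

  Both directions rest on descriptive set theory. Translations by bisections are Borel because
  injective Borel images of Borel sets are Borel (\<open>injective_image_measurable\<close>), and the
  countable cover by bisections is a form of the Lusin-Novikov theorem up to a null set
  (\<open>countable_to_one_sections\<close>). Both are derived by coding a standard Borel space as a closed
  set of sequences of naturals in which prescribed Borel sets become clopen
  (\<open>code_with_clopen_sets\<close>).
\<close>

section \<open>Zero-dimensional codes of standard Borel spaces\<close>

definition agree :: "nat \<Rightarrow> (nat \<Rightarrow> nat) \<Rightarrow> (nat \<Rightarrow> nat) \<Rightarrow> bool" where
  "agree k a b \<longleftrightarrow> (\<forall>i<k. a i = b i)"

text \<open>The last condition says that the range of \<open>e\<close> is closed in the Baire space. So a code is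
  a zero-dimensional Polish topology on the space whose open sets are measurable.\<close>

definition polish_code :: "'a measure \<Rightarrow> ('a \<Rightarrow> nat \<Rightarrow> nat) \<Rightarrow> bool" where
  "polish_code M e \<longleftrightarrow>
     (\<forall>i. (\<lambda>y. e y i) \<in> M \<rightarrow>\<^sub>M count_space UNIV) \<and> inj_on e (space M) \<and>
     (\<forall>a. (\<forall>k. \<exists>y\<in>space M. agree k (e y) a) \<longrightarrow> (\<exists>y\<in>space M. e y = a))"

text \<open>One depth \<open>k\<close> serves for all points. This uniform form is stable under joins of codes, and
  \<open>make_clopen\<close> produces it by adding a single coordinate.\<close>

definition clopen_in :: "'a measure \<Rightarrow> ('a \<Rightarrow> nat \<Rightarrow> nat) \<Rightarrow> 'a set \<Rightarrow> bool" where
  "clopen_in M e B \<longleftrightarrow>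
     (\<exists>k. \<forall>y\<in>space M. \<forall>y'\<in>space M. agree k (e y) (e y') \<longrightarrow> (y \<in> B \<longleftrightarrow> y' \<in> B))"

definition open_in :: "'a measure \<Rightarrow> ('a \<Rightarrow> nat \<Rightarrow> nat) \<Rightarrow> 'a set \<Rightarrow> bool" where
  "open_in M e B \<longleftrightarrow>
     (\<forall>y\<in>B \<inter> space M. \<exists>k. \<forall>y'\<in>space M. agree k (e y) (e y') \<longrightarrow> y' \<in> B)"

text \<open>The topology of \<open>e'\<close> refines that of \<open>e\<close>, with a modulus that does not depend on the point.\<close>

definition finer :: "'a measure \<Rightarrow> ('a \<Rightarrow> nat \<Rightarrow> nat) \<Rightarrow> ('a \<Rightarrow> nat \<Rightarrow> nat) \<Rightarrow> bool" where
  "finer M e' e \<longleftrightarrow>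
     (\<forall>k. \<exists>m. \<forall>y\<in>space M. \<forall>y'\<in>space M. agree m (e' y) (e' y') \<longrightarrow> agree k (e y) (e y'))"

lemma agree_mono: "agree k a b \<Longrightarrow> j \<le> k \<Longrightarrow> agree j a b"
  by (auto simp: agree_def)

lemma agree_refl [simp]: "agree k a a"
  by (auto simp: agree_def)

lemma agree_sym: "agree k a b \<Longrightarrow> agree k b a"
  by (auto simp: agree_def)

lemma agree_trans: "agree k a b \<Longrightarrow> agree k b c \<Longrightarrow> agree k a c"
  by (auto simp: agree_def)

lemma agree_eqI: "(\<And>k. agree k a b) \<Longrightarrow> a = b"
  by (rule ext) (auto simp: agree_def)

lemma polish_codeD:
  assumes "polish_code M e"
  shows "(\<lambda>y. e y i) \<in> M \<rightarrow>\<^sub>M count_space UNIV" "inj_on e (space M)"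
    "(\<And>k. \<exists>y\<in>space M. agree k (e y) a) \<Longrightarrow> (\<exists>y\<in>space M. e y = a)"
proof -
  show "(\<lambda>y. e y i) \<in> M \<rightarrow>\<^sub>M count_space UNIV" "inj_on e (space M)"
    using assms by (simp_all add: polish_code_def)
  assume "\<And>k. \<exists>y\<in>space M. agree k (e y) a"
  then show "\<exists>y\<in>space M. e y = a"
    using assms unfolding polish_code_def by (elim conjE allE[of _ a]) simp
qed

lemma finer_refl: "finer M e e"
  unfolding finer_def by blast

lemma finer_trans: "finer M e2 e1 \<Longrightarrow> finer M e1 e0 \<Longrightarrow> finer M e2 e0"
  unfolding finer_def by meson

lemma clopen_in_finer: "finer M e' e \<Longrightarrow> clopen_in M e B \<Longrightarrow> clopen_in M e' B"
  unfolding finer_def clopen_in_def by meson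

lemma clopen_imp_open: "clopen_in M e B \<Longrightarrow> open_in M e B"
  unfolding clopen_in_def open_in_def by blast

lemma clopen_in_compl: "clopen_in M e B \<Longrightarrow> clopen_in M e (space M - B)"
  unfolding clopen_in_def by blast

lemma open_in_UN: "(\<And>i. i \<in> I \<Longrightarrow> open_in M e (B i)) \<Longrightarrow> open_in M e (\<Union>i\<in>I. B i)"
  unfolding open_in_def
proof
  fix y assume B: "\<And>i. i \<in> I \<Longrightarrow> \<forall>y\<in>B i \<inter> space M. \<exists>k. \<forall>y'\<in>space M. agree k (e y) (e y') \<longrightarrow> y' \<in> B i"
    and "y \<in> (\<Union>i\<in>I. B i) \<inter> space M"
  then obtain i where "i \<in> I" "y \<in> B i \<inter> space M" by blast
  then show "\<exists>k. \<forall>y'\<in>space M. agree k (e y) (e y') \<longrightarrow> y' \<in> (\<Union>i\<in>I. B i)"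
    using B[OF \<open>i \<in> I\<close>] by (meson UN_I)
qed

lemma measurable_agree [measurable]:
  assumes "polish_code M e"
  shows "{y\<in>space M. agree k (e y) a} \<in> sets M"
proof -
  note [measurable] = polish_codeD(1)[OF assms]
  show ?thesis unfolding agree_def by measurable
qed

text \<open>The codes are interleaved. Closedness of the range is the point to check: a limit in the
  interleaved code is a limit \<open>Y j\<close> in each code \<open>E j\<close>, and these limits coincide because all codes
  refine the same injective \<open>e0\<close>.\<close>

lemma join_codes:
  fixes E :: "nat \<Rightarrow> 'a \<Rightarrow> nat \<Rightarrow> nat"
  assumes E: "\<And>j. polish_code M (E j)" "\<And>j. finer M (E j) e0" and e0: "inj_on e0 (space M)"
  obtains e where "polish_code M e" "\<And>j. finer M e (E j)"
proof
  let ?e = "\<lambda>y i. E (fst (prod_decode i)) y (snd (prod_decode i))"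
  have bound: "\<exists>m. \<forall>y y'. agree m (?e y) y' \<longrightarrow> agree k (E j y) (\<lambda>i. y' (prod_encode (j, i)))" for j k
  proof -
    have "finite ((\<lambda>i. prod_encode (j, i)) ` {..<k})" by simp
    then obtain m where m: "\<forall>i<k. prod_encode (j, i) < m"
      by (auto simp: finite_nat_set_iff_bounded)
    show ?thesis
    proof (intro exI[of _ m] allI impI)
      fix y y' assume "agree m (?e y) y'"
      then show "agree k (E j y) (\<lambda>i. y' (prod_encode (j, i)))"
        unfolding agree_def using m by (metis fst_conv prod_encode_inverse snd_conv)
    qed
  qed
  show fin: "finer M ?e (E j)" for j
    unfolding finer_def
  proof
    fix k
    obtain m where m: "\<And>y y'. agree m (?e y) y' \<Longrightarrow> agree k (E j y) (\<lambda>i. y' (prod_encode (j, i)))"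
      using bound[of k j] by blast
    have "agree k (E j y) (E j y')" if "agree m (?e y) (?e y')" for y y'
      using m[OF that] by simp
    then show "\<exists>m. \<forall>y\<in>space M. \<forall>y'\<in>space M. agree m (?e y) (?e y') \<longrightarrow> agree k (E j y) (E j y')"
      by blast
  qed
  show "polish_code M ?e"
    unfolding polish_code_def
  proof (intro conjI allI impI)
    fix i show "(\<lambda>y. ?e y i) \<in> M \<rightarrow>\<^sub>M count_space UNIV"
      using polish_codeD(1)[OF E(1)] by simp
  next
    show "inj_on ?e (space M)"
    proof (rule inj_onI)
      fix y y' assume y: "y \<in> space M" "y' \<in> space M" and eq: "?e y = ?e y'"
      have "E 0 y = E 0 y'"
      proof (rule ext)
        fix k show "E 0 y k = E 0 y' k"
          using fun_cong[OF eq, of "prod_encode (0, k)"] by simp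
      qed
      then show "y = y'" using polish_codeD(2)[OF E(1)[of 0]] y by (auto dest: inj_onD)
    qed
  next
    fix a assume a: "\<forall>k. \<exists>y\<in>space M. agree k (?e y) a"
    have "\<exists>y\<in>space M. E j y = (\<lambda>i. a (prod_encode (j, i)))" for j
    proof (rule polish_codeD(3)[OF E(1)])
      fix k
      show "\<exists>y\<in>space M. agree k (E j y) (\<lambda>i. a (prod_encode (j, i)))"
        using bound[of k j] a by blast
    qed
    then obtain Y where Y: "\<And>j. Y j \<in> space M" "\<And>j. E j (Y j) = (\<lambda>i. a (prod_encode (j, i)))"
      by metis
    have "Y j = Y 0" for j
    proof -
      have "e0 (Y j) = e0 (Y 0)"
      proof (rule agree_eqI)
        fix k
        obtain m1 where m1: "\<forall>y\<in>space M. \<forall>y'\<in>space M. agree m1 (E j y) (E j y') \<longrightarrow> agree k (e0 y) (e0 y')"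
          using E(2)[of j] unfolding finer_def by blast
        obtain m2 where m2: "\<forall>y\<in>space M. \<forall>y'\<in>space M. agree m2 (E 0 y) (E 0 y') \<longrightarrow> agree k (e0 y) (e0 y')"
          using E(2)[of 0] unfolding finer_def by blast
        obtain n1 where n1: "\<And>y y'. agree n1 (?e y) y' \<Longrightarrow> agree m1 (E j y) (\<lambda>i. y' (prod_encode (j, i)))"
          using bound[of m1 j] by blast
        obtain n2 where n2: "\<And>y y'. agree n2 (?e y) y' \<Longrightarrow> agree m2 (E 0 y) (\<lambda>i. y' (prod_encode (0, i)))"
          using bound[of m2 0] by blast
        obtain y where y: "y \<in> space M" "agree (max n1 n2) (?e y) a" using a by blast
        have "agree m1 (E j y) (E j (Y j))" using n1[of y a] y(2) agree_mono by (auto simp: Y(2))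
        moreover have "agree m2 (E 0 y) (E 0 (Y 0))" using n2[of y a] y(2) agree_mono by (auto simp: Y(2))
        ultimately show "agree k (e0 (Y j)) (e0 (Y 0))"
          using m1 m2 y(1) Y(1) agree_trans agree_sym by blast
      qed
      then show ?thesis using e0 Y(1) by (auto dest: inj_onD)
    qed
    then have "?e (Y 0) = a"
    proof -
      have "?e (Y 0) i = a i" for i
        using Y(2)[of "fst (prod_decode i)"] by (simp add: \<open>\<And>j. Y j = Y 0\<close>[of "fst (prod_decode i)"])
      then show ?thesis by blast
    qed
    then show "\<exists>y\<in>space M. ?e y = a" using Y(1) by blast
  qed
qed

text \<open>An open set is the disjoint union of the maximal cylinders that it contains. The new first
  coordinate \<open>l\<close> is one plus the depth of the maximal cylinder around the point, and zero outside
  the set. The range stays closed since the depth is decided by finitely many coordinates.\<close>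

lemma make_clopen:
  assumes e: "polish_code M e" and B: "open_in M e B"
  obtains e' where "polish_code M e'" "finer M e' e" "clopen_in M e' B"
proof
  define P where "P y k \<longleftrightarrow> (\<forall>y'\<in>space M. agree k (e y) (e y') \<longrightarrow> y' \<in> B)" for y k
  define l where "l y = (if \<exists>k. P y k then Suc (LEAST k. P y k) else 0)" for y
  let ?e = "\<lambda>y i. case i of 0 \<Rightarrow> l y | Suc j \<Rightarrow> e y j"
  have P_cong: "P y k \<longleftrightarrow> P y' k" if "agree k (e y) (e y')" for y y' k
    unfolding P_def using that agree_trans agree_sym by metis
  have P_B: "(\<exists>k. P y k) \<longleftrightarrow> y \<in> B" if "y \<in> space M" for y
    using B that unfolding P_def open_in_def by auto
  have l_0: "l y = 0 \<longleftrightarrow> y \<notin> B" if "y \<in> space M" for y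
    using P_B[OF that] by (auto simp: l_def)
  have agree_Suc: "agree (Suc k) (?e y) a \<longleftrightarrow> l y = a 0 \<and> agree k (e y) (\<lambda>i. a (Suc i))" for y a k
    unfolding agree_def by (simp add: All_less_Suc2)
  have measP [measurable]: "Measurable.pred M (\<lambda>y. P y k)" for k
  proof -
    note [measurable] = polish_codeD(1)[OF e]
    define C where "C = (\<lambda>y. map (e y) [0..<k]) ` {y\<in>space M. P y k}"
    have "P y k \<longleftrightarrow> (\<exists>c\<in>C. length c = k \<and> (\<forall>i<k. e y i = c ! i))" if "y \<in> space M" for y
    proof
      assume "P y k" then show "\<exists>c\<in>C. length c = k \<and> (\<forall>i<k. e y i = c ! i)"
        unfolding C_def using that by (auto intro!: bexI[of _ y])
    next
      assume "\<exists>c\<in>C. length c = k \<and> (\<forall>i<k. e y i = c ! i)"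
      then obtain y' where "y' \<in> space M" "P y' k" "\<forall>i<k. e y i = e y' i"
        unfolding C_def by auto
      then show "P y k" using P_cong[of k y y'] by (auto simp: agree_def)
    qed
    then have "{y\<in>space M. P y k} = {y\<in>space M. \<exists>c\<in>C. length c = k \<and> (\<forall>i<k. e y i = c ! i)}" by blast
    also have "\<dots> \<in> sets M" by measurable
    finally show ?thesis by (simp add: pred_def)
  qed
  show "polish_code M ?e"
    unfolding polish_code_def
  proof (intro conjI allI impI)
    fix i show "(\<lambda>y. ?e y i) \<in> M \<rightarrow>\<^sub>M count_space UNIV"
    proof (cases i)
      case 0 then show ?thesis unfolding l_def by simp
    next
      case (Suc j) then show ?thesis using polish_codeD(1)[OF e] by simp
    qed
  next
    show "inj_on ?e (space M)"
    proof (rule inj_onI)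
      fix y y' assume y: "y \<in> space M" "y' \<in> space M" and eq: "?e y = ?e y'"
      have "e y k = e y' k" for k using fun_cong[OF eq, of "Suc k"] by simp
      then have "e y = e y'" by blast
      then show "y = y'" using polish_codeD(2)[OF e] y by (auto dest: inj_onD)
    qed
  next
    fix a assume a: "\<forall>k. \<exists>y\<in>space M. agree k (?e y) a"
    then have a': "\<exists>y\<in>space M. l y = a 0 \<and> agree k (e y) (\<lambda>i. a (Suc i))" for k
      using agree_Suc by blast
    then have "\<exists>y\<in>space M. e y = (\<lambda>i. a (Suc i))"
      using polish_codeD(3)[OF e, of "\<lambda>i. a (Suc i)"] by blast
    then obtain y where y: "y \<in> space M" "e y = (\<lambda>i. a (Suc i))" by blast
    have y': "\<exists>y'\<in>space M. l y' = a 0 \<and> agree k (e y') (e y)" for k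
      using a' by (simp add: y)
    have "l y = a 0"
    proof (cases "y \<in> B")
      case False
      show ?thesis
      proof (rule ccontr)
        assume "l y \<noteq> a 0"
        then have "a 0 \<noteq> 0" using l_0[OF y(1)] False by auto
        obtain z where z: "z \<in> space M" "l z = a 0" "agree (a 0) (e z) (e y)" using y' by blast
        have "z \<in> B" using z \<open>a 0 \<noteq> 0\<close> l_0[OF z(1)] by auto
        then have ex: "\<exists>k. P z k" using P_B z by blast
        then have "P z (LEAST k. P z k)" by (rule LeastI_ex)
        moreover have "(LEAST k. P z k) < a 0" using z(2) ex unfolding l_def by auto
        ultimately have "y \<in> B" using z y(1) unfolding P_def by (meson agree_mono less_imp_le)
        then show False using False by blast
      qed
    next
      case True
      then have ex: "\<exists>k. P y k" using P_B y by blast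
      let ?k = "LEAST k. P y k"
      have Py: "P y ?k" using ex by (rule LeastI_ex)
      obtain z where z: "z \<in> space M" "l z = a 0" "agree ?k (e z) (e y)" using y' by blast
      have Pz: "P z j \<longleftrightarrow> P y j" if "j \<le> ?k" for j
        using P_cong[of j z y] z(3) that agree_mono by blast
      have "(LEAST k. P z k) = ?k"
      proof (rule Least_equality)
        show "P z ?k" using Pz Py by simp
        show "?k \<le> j" if "P z j" for j
          using Pz[of j] that Least_le[of "P y" j] by linarith
      qed
      then have "l z = l y" using Pz Py ex unfolding l_def by auto
      then show ?thesis using z by simp
    qed
    then have "?e y = a" using y(2) by (auto simp: fun_eq_iff split: nat.split)
    then show "\<exists>y\<in>space M. ?e y = a" using y(1) by blast
  qed
  show "finer M ?e e"
    unfolding finer_def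
  proof
    fix k
    show "\<exists>m. \<forall>y\<in>space M. \<forall>y'\<in>space M. agree m (?e y) (?e y') \<longrightarrow> agree k (e y) (e y')"
      by (rule exI[of _ "Suc k"]) (simp add: agree_Suc)
  qed
  show "clopen_in M ?e B"
    unfolding clopen_in_def
  proof (rule exI[of _ "Suc 0"], intro ballI impI)
    fix y y' assume y: "y \<in> space M" "y' \<in> space M" and "agree (Suc 0) (?e y) (?e y')"
    then have "l y = l y'" unfolding agree_Suc by simp
    then show "y \<in> B \<longleftrightarrow> y' \<in> B" using l_0[OF y(1)] l_0[OF y(2)] by auto
  qed
qed

text \<open>Joining codes makes countable unions of clopen sets open, and \<open>make_clopen\<close> makes them clopen.\<close>

lemma sigma_sets_clopen:
  assumes e0: "polish_code M e0" and A: "\<And>A. A \<in> \<A> \<Longrightarrow> open_in M e0 A"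
    and B: "B \<in> sigma_sets (space M) \<A>"
  shows "\<exists>e. polish_code M e \<and> finer M e e0 \<and> clopen_in M e B"
  using B
proof induction
  case (Basic a)
  then show ?case using make_clopen[OF e0 A] by metis
next
  case Empty
  have "clopen_in M e0 {}" by (auto simp: clopen_in_def)
  then show ?case using e0 finer_refl by blast
next
  case (Compl a)
  then show ?case using clopen_in_compl by blast
next
  case (Union a)
  then obtain E where E: "\<And>i. polish_code M (E i)" "\<And>i. finer M (E i) e0" "\<And>i::nat. clopen_in M (E i) (a i)"
    by metis
  obtain e where e: "polish_code M e" "\<And>j. finer M e (E j)"
    using join_codes[of M E e0] E polish_codeD(2)[OF e0] by metis
  have "open_in M e (\<Union>i. a i)"
    by (intro open_in_UN clopen_imp_open) (use E e clopen_in_finer in blast)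
  then obtain e' where "polish_code M e'" "finer M e' e" "clopen_in M e' (\<Union>i. a i)"
    using make_clopen e by blast
  then show ?case using finer_trans e(2) E(2) by blast
qed

definition dyad :: "nat \<Rightarrow> real \<Rightarrow> nat" where
  "dyad k t = nat \<lfloor>2 ^ k * t\<rfloor>"

lemma dyad_bounds:
  assumes "0 \<le> t" shows "real (dyad k t) \<le> 2 ^ k * t" "2 ^ k * t < real (dyad k t) + 1"
proof -
  have "0 \<le> \<lfloor>2 ^ k * t\<rfloor>" using assms by simp
  then have "real (dyad k t) = of_int \<lfloor>2 ^ k * t\<rfloor>" unfolding dyad_def by simp
  then show "real (dyad k t) \<le> 2 ^ k * t" "2 ^ k * t < real (dyad k t) + 1" by linarith+
qed

lemma dyad_eqI:
  assumes "real m \<le> 2 ^ k * t" "2 ^ k * t < real m + 1" shows "dyad k t = m"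
proof -
  have "\<lfloor>2 ^ k * t\<rfloor> = int m" using assms by (intro floor_unique) auto
  then show ?thesis by (simp add: dyad_def)
qed

lemma dyad_Suc:
  assumes "0 \<le> t" shows "dyad (Suc k) t = 2 * dyad k t \<or> dyad (Suc k) t = 2 * dyad k t + 1"
proof -
  have "real (dyad (Suc k) t) < 2 * real (dyad k t) + 2" "2 * real (dyad k t) < real (dyad (Suc k) t) + 1"
    using dyad_bounds[OF assms, of k] dyad_bounds[OF assms, of "Suc k"] by auto
  then show ?thesis by linarith
qed

text \<open>Binary digits obtained by rounding down never end in a run of ones: such a run would double
  the distance \<open>\<delta>\<close> to the right end point of the dyadic interval, in units of the length of the interval,
  at every step.\<close>

lemma dyad_zero_digit:
  assumes "0 \<le> t" shows "\<exists>j\<ge>k. dyad (Suc j) t = 2 * dyad j t"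
proof (rule ccontr)
  assume "\<not> ?thesis"
  then have *: "dyad (Suc j) t = 2 * dyad j t + 1" if "j \<ge> k" for j
    using dyad_Suc[OF assms, of j] that by auto
  define \<delta> where "\<delta> j = real (dyad j t) + 1 - 2 ^ j * t" for j
  have "\<delta> (k + n) = 2 ^ n * \<delta> k" for n
    by (induction n) (auto simp: \<delta>_def * algebra_simps)
  moreover have "\<delta> (k + n) \<le> 1" for n using dyad_bounds[OF assms, of "k + n"] by (simp add: \<delta>_def)
  moreover have "\<delta> k > 0" using dyad_bounds[OF assms, of k] by (simp add: \<delta>_def)
  moreover obtain n where "1 / \<delta> k < 2 ^ n" using real_arch_pow[of 2] by auto
  ultimately show False by (metis divide_less_eq not_le)
qed

text \<open>A limit of points of the half-open dyadic intervals with numbers \<open>F k\<close> lies in their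
  closures. It cannot be a right end point, because an interval that is the left half of its
  predecessor has its closure inside the half-open predecessor, and this happens again and again.\<close>

lemma dyad_limit:
  assumes t: "\<And>i. 0 \<le> t i" "t \<longlonglongrightarrow> s"
    and F: "\<And>k. \<forall>\<^sub>F i in sequentially. dyad k (t i) = F k"
    and Z: "\<And>k. \<exists>j\<ge>k. F (Suc j) = 2 * F j"
  shows "dyad k s = F k"
proof (rule dyad_eqI)
  have lim: "(\<lambda>i. 2 ^ j * t i) \<longlonglongrightarrow> 2 ^ j * s" for j
    by (intro tendsto_intros t)
  show "real (F k) \<le> 2 ^ k * s"
    by (rule tendsto_lowerbound[OF lim])
      (use F[of k] in \<open>auto elim!: eventually_mono simp: dyad_bounds t\<close>, metis dyad_bounds(1) t(1))
  have up: "2 ^ j * s \<le> real (F j) + 1" for j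
    by (rule tendsto_upperbound[OF lim])
      (use F[of j] in \<open>auto elim!: eventually_mono\<close>, metis dyad_bounds(2) t(1) less_imp_le)
  obtain J where J: "J \<ge> k" "F (Suc J) = 2 * F J" using Z by blast
  show "2 ^ k * s < real (F k) + 1"
    using J(1)
  proof (induction rule: inc_induct)
    case base
    show ?case using up[of "Suc J"] J(2) by simp
  next
    case (step n)
    obtain i where "dyad (Suc n) (t i) = F (Suc n)" "dyad n (t i) = F n"
      using eventually_happens'[OF _ eventually_conj[OF F[of "Suc n"] F[of n]]] by auto
    then have "F (Suc n) \<le> 2 * F n + 1" using dyad_Suc[OF t(1), of n i] by linarith
    with step.IH show ?case by simp
  qed
qed

lemma measurable_dyad [measurable]: "f \<in> borel_measurable M \<Longrightarrow> (\<lambda>x. dyad k (f x)) \<in> M \<rightarrow>\<^sub>M count_space UNIV"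
  unfolding dyad_def by measurable

text \<open>A point is coded by the dyadic expansions of its distances to a dense sequence \<open>q\<close>. Two
  further entries keep the range closed: \<open>h\<close> tells where the next zero digit occurs, which rules
  out right end points in the limit, and \<open>l\<close> names a point of \<open>q\<close> at distance below \<open>(1/2)^k\<close>, which
  makes sequences with converging codes Cauchy.\<close>

lemma standard_borel_code:
  assumes "standard_borel M"
  obtains e \<A> where "polish_code M e" "sets M = sigma_sets (space M) \<A>"
    "\<And>A. A \<in> \<A> \<Longrightarrow> open_in M e A"
proof (cases "space M = {}")
  case True
  have "polish_code M (\<lambda>_ _. 0)" using True by (auto simp: polish_code_def)
  then show ?thesis
  proof (rule that)
    show "sets M = sigma_sets (space M) (sets M)" by (metis sets.sigma_sets_eq)
    show "open_in M (\<lambda>_ _. 0) A" for A using True by (simp add: open_in_def)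
  qed
next
  case False
  obtain T where T: "completely_metrizable_space T" "second_countable T" "topspace T = space M"
    and sets: "sets M = sigma_sets (space M) {U. openin T U}"
    using assms unfolding standard_borel_def by metis
  obtain S d where S: "Metric_space S d" "Metric_space.mcomplete S d" and T': "T = Metric_space.mtopology S d"
    using T(1) unfolding completely_metrizable_space_def by blast
  interpret Metric_space S d by fact
  have sp: "S = space M" using T(3) T' by simp
  obtain C where C: "countable C" "C \<subseteq> S" "mtopology closure_of C = S"
    using second_countable_imp_separable_space[OF T(2)] unfolding separable_space_def T' by auto
  have "C \<noteq> {}" using C False sp by auto
  then obtain q :: "nat \<Rightarrow> 'a" where q: "range q = C" using C(1) by (metis range_from_nat_into)
  have qS: "q n \<in> S" for n using q C(2) by auto
  have dense: "\<exists>n. d y (q n) < r" if "y \<in> S" "0 < r" for y r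
  proof -
    have "y \<in> mtopology closure_of C" using that C by simp
    then show ?thesis using that q unfolding metric_closure_of by fastforce
  qed
  have open_sets: "U \<in> sets M" if "openin mtopology U" for U
    unfolding sets using that T' by blast
  have [measurable]: "(\<lambda>y. d y (q n)) \<in> borel_measurable M" for n
  proof (rule borel_measurableI_less)
    fix c
    have "{y\<in>space M. d y (q n) < c} = mball (q n) c"
      unfolding sp[symmetric] using qS by (auto simp: commute)
    then show "{y\<in>space M. d y (q n) < c} \<in> sets M" using open_sets by auto
  qed
  define h where "h n k t = (LEAST j. k \<le> j \<and> dyad (Suc j) t = 2 * dyad j t)" for n :: nat and k t
  define l where "l k y = (LEAST n. dyad k (d y (q n)) = 0)" for k y
  define e where "e y i = (case prod_decode i of (n, k) \<Rightarrow>
     prod_encode (dyad k (d y (q n)), prod_encode (h n k (d y (q n)), l k y)))" for y i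
  have h: "k \<le> h n k t" "dyad (Suc (h n k t)) t = 2 * dyad (h n k t) t" if "0 \<le> t" for n k t
    using LeastI_ex[OF dyad_zero_digit[OF that, of k]] unfolding h_def by auto
  have dyad0: "dyad k t = 0 \<longleftrightarrow> t < (1/2) ^ k" if "0 \<le> t" for k t
  proof -
    have "dyad k t = 0 \<longleftrightarrow> 2 ^ k * t < 1"
      using dyad_bounds[OF that, of k] dyad_eqI[of 0 k t] that by auto
    then show ?thesis by (simp add: field_simps power_divide)
  qed
  have l: "d y (q (l k y)) < (1/2) ^ k" if "y \<in> S" for k y
  proof -
    have "\<exists>n. d y (q n) < (1/2) ^ k" by (rule dense[OF that]) simp
    then obtain n where "d y (q n) < (1/2) ^ k" by blast
    then have "dyad k (d y (q n)) = 0" using dyad0 by simp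
    then have "dyad k (d y (q (l k y))) = 0" unfolding l_def by (rule LeastI)
    then show ?thesis using dyad0 by simp
  qed
  have close: "d y y' < 2 * (1/2) ^ k"
    if "y \<in> S" "y' \<in> S" "dyad k (d y (q n)) = 0" "dyad k (d y' (q n)) = 0" for y y' k n
  proof -
    have "d y y' \<le> d y (q n) + d y' (q n)" using triangle[of y "q n" y'] that qS by (simp add: commute)
    also have "\<dots> < 2 * (1/2) ^ k" using that dyad0 by simp
    finally show ?thesis .
  qed
  have small: "\<exists>k. 2 * (1/2) ^ k < r" if "0 < r" for r :: real
    using real_arch_pow_inv[of "r / 2" "1/2"] that by (auto simp: mult.commute)
  have e_dyad: "dyad k (d y (q n)) = dyad k (d y' (q n))" if "e y (prod_encode (n, k)) = e y' (prod_encode (n, k))" for y y' n k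
    using that by (simp add: e_def)
  have lS: "dyad k (d y (q (l k y))) = 0" if "y \<in> S" for k y
    using dyad0 l[OF that] by simp
  have "polish_code M e"
    unfolding polish_code_def
  proof (intro conjI allI impI)
    fix i show "(\<lambda>y. e y i) \<in> M \<rightarrow>\<^sub>M count_space UNIV"
    proof (cases "prod_decode i")
      case (Pair n k)
      have comb: "(\<lambda>y. F (f y) (g y)) \<in> M \<rightarrow>\<^sub>M count_space UNIV"
        if "f \<in> M \<rightarrow>\<^sub>M count_space UNIV" "g \<in> M \<rightarrow>\<^sub>M count_space UNIV"
        for f g :: "'a \<Rightarrow> nat" and F :: "nat \<Rightarrow> nat \<Rightarrow> 'c"
        by (rule measurable_compose_countable[OF measurable_compose_countable[OF _ that(2)] that(1)]) simp
      note enc = comb[of _ _ "\<lambda>a b. prod_encode (a, b)"]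
      have dy: "(\<lambda>y. dyad k (d y (q n))) \<in> M \<rightarrow>\<^sub>M count_space UNIV" for n k
        by (rule measurable_dyad) simp
      have "(\<lambda>y. l k y) \<in> M \<rightarrow>\<^sub>M count_space UNIV"
        unfolding l_def by (rule measurable_Least) (rule comb[of _ _ "\<lambda>a b. a = 0", OF dy dy])
      moreover have "(\<lambda>y. h n k (d y (q n))) \<in> M \<rightarrow>\<^sub>M count_space UNIV"
        unfolding h_def
        by (rule measurable_Least) (rule comb[of _ _ "\<lambda>a b. k \<le> _ \<and> a = 2 * b", OF dy dy])
      ultimately show ?thesis unfolding e_def Pair prod.case by (intro enc dy)
    qed
  next
    show "inj_on e (space M)"
    proof (rule inj_onI)
      fix y y' assume y: "y \<in> space M" "y' \<in> space M" and eq: "e y = e y'"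
      have yS: "y \<in> S" "y' \<in> S" using y sp by auto
      have "d y y' < 2 * (1/2) ^ k" for k
      proof (rule close[OF yS])
        show "dyad k (d y (q (l k y))) = 0" using lS[OF yS(1)] .
        then show "dyad k (d y' (q (l k y))) = 0" using e_dyad[of y "l k y" k y'] eq by simp
      qed
      then have "\<not> 0 < d y y'" using small[of "d y y'"] by (meson less_asym)
      then show "y = y'" using yS by (simp add: less_le)
    qed
  next
    fix a assume "\<forall>k. \<exists>y\<in>space M. agree k (e y) a"
    then obtain Y where Y: "\<And>k. Y k \<in> S" "\<And>k. agree k (e (Y k)) a" using sp by metis
    have ev: "\<forall>\<^sub>F i in sequentially. e (Y i) j = a j" for j
      using Y(2) unfolding agree_def by (intro eventually_sequentiallyI[of "Suc j"]) auto
    define F where "F n k = fst (prod_decode (a (prod_encode (n, k))))" for n k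
    define R where "R n k = fst (prod_decode (snd (prod_decode (a (prod_encode (n, k))))))" for n k
    define L where "L n k = snd (prod_decode (snd (prod_decode (a (prod_encode (n, k))))))" for n k
    have evF: "\<forall>\<^sub>F i in sequentially. dyad k (d (Y i) (q n)) = F n k" for n k
      by (rule eventually_mono[OF ev[of "prod_encode (n, k)"]]) (unfold F_def, drule sym, simp add: e_def)
    have evR: "\<forall>\<^sub>F i in sequentially. h n k (d (Y i) (q n)) = R n k" for n k
      by (rule eventually_mono[OF ev[of "prod_encode (n, k)"]]) (unfold R_def, drule sym, simp add: e_def)
    have evL: "\<forall>\<^sub>F i in sequentially. l k (Y i) = L n k" for n k
      by (rule eventually_mono[OF ev[of "prod_encode (n, k)"]]) (unfold L_def, drule sym, simp add: e_def)
    have evl0: "\<forall>\<^sub>F i in sequentially. dyad k (d (Y i) (q (L 0 k))) = 0" for k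
      using evL[of k 0] by eventually_elim (use lS Y(1) in metis)
    have "MCauchy Y"
      unfolding MCauchy_def
    proof (intro conjI allI impI)
      show "range Y \<subseteq> S" using Y by auto
      fix \<epsilon> :: real assume "\<epsilon> > 0"
      then obtain k where k: "2 * (1/2) ^ k < \<epsilon>" using small by blast
      obtain N where N: "\<forall>i\<ge>N. dyad k (d (Y i) (q (L 0 k))) = 0"
        using evl0[of k] unfolding eventually_sequentially by blast
      have "d (Y i) (Y i') < \<epsilon>" if "N \<le> i" "N \<le> i'" for i i'
        using close[OF Y(1) Y(1), of k i "L 0 k" i'] N that k by fastforce
      then show "\<exists>N. \<forall>n n'. N \<le> n \<longrightarrow> N \<le> n' \<longrightarrow> d (Y n) (Y n') < \<epsilon>" by blast
    qed
    then obtain y where lim: "limitin mtopology Y y sequentially" using S(2) unfolding mcomplete_def by blast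
    then have y: "y \<in> S" by (simp add: limitin_metric)
    have d_lim: "(\<lambda>i. d (Y i) (q n)) \<longlonglongrightarrow> d y (q n)" for n
    proof (rule tendstoI)
      fix r :: real assume "0 < r"
      then have "\<forall>\<^sub>F i in sequentially. Y i \<in> S \<and> d (Y i) y < r" using lim by (simp add: limitin_metric)
      then show "\<forall>\<^sub>F i in sequentially. dist (d (Y i) (q n)) (d y (q n)) < r"
      proof eventually_elim
        case (elim i)
        then show ?case
          using mdist_reverse_triangle[of "Y i" "q n" y] qS y by (simp add: dist_real_def commute)
      qed
    qed
    \<comment> \<open>The zero digits recorded by \<open>h\<close> persist in the limit, as \<open>dyad_limit\<close> requires.\<close>
    have F_R: "k \<le> R n k \<and> F n (Suc (R n k)) = 2 * F n (R n k)" for n k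
    proof -
      have "\<forall>\<^sub>F i in sequentially. h n k (d (Y i) (q n)) = R n k \<and> dyad (Suc (R n k)) (d (Y i) (q n)) = F n (Suc (R n k)) \<and>
         dyad (R n k) (d (Y i) (q n)) = F n (R n k)"
        by (intro eventually_conj evR evF)
      then obtain i where "h n k (d (Y i) (q n)) = R n k" "dyad (Suc (R n k)) (d (Y i) (q n)) = F n (Suc (R n k))"
         "dyad (R n k) (d (Y i) (q n)) = F n (R n k)"
        by (blast dest: eventually_happens'[OF sequentially_bot])
      then show ?thesis using h(1)[of "d (Y i) (q n)" k n] h(2)[of "d (Y i) (q n)" n k] by simp
    qed
    have dy: "dyad k (d y (q n)) = F n k" for n k
      by (rule dyad_limit[OF _ d_lim evF]) (use F_R in auto)
    have hy: "h n k (d y (q n)) = R n k" for n k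
      unfolding h_def dy
    proof (rule Least_equality)
      show "k \<le> R n k \<and> F n (Suc (R n k)) = 2 * F n (R n k)" by (rule F_R)
      fix j assume j: "k \<le> j \<and> F n (Suc j) = 2 * F n j"
      have "\<forall>\<^sub>F i in sequentially. h n k (d (Y i) (q n)) = R n k \<and> dyad (Suc j) (d (Y i) (q n)) = F n (Suc j) \<and>
         dyad j (d (Y i) (q n)) = F n j"
        by (intro eventually_conj evR evF)
      then obtain i where "h n k (d (Y i) (q n)) = R n k" "dyad (Suc j) (d (Y i) (q n)) = F n (Suc j)"
         "dyad j (d (Y i) (q n)) = F n j"
        by (blast dest: eventually_happens'[OF sequentially_bot])
      then have "k \<le> j \<and> dyad (Suc j) (d (Y i) (q n)) = 2 * dyad j (d (Y i) (q n))" using j by simp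
      then have "h n k (d (Y i) (q n)) \<le> j" unfolding h_def by (rule Least_le)
      then show "R n k \<le> j" using \<open>h n k (d (Y i) (q n)) = R n k\<close> by simp
    qed
    have ly: "l k y = L n k" for n k
      unfolding l_def dy
    proof (rule Least_equality)
      have "\<forall>\<^sub>F i in sequentially. l k (Y i) = L n k \<and> dyad k (d (Y i) (q (L n k))) = F (L n k) k"
        by (intro eventually_conj evL evF)
      then obtain i where "l k (Y i) = L n k" "dyad k (d (Y i) (q (L n k))) = F (L n k) k"
        by (blast dest: eventually_happens'[OF sequentially_bot])
      then show "F (L n k) k = 0" using lS[OF Y(1), of k i] by simp
      fix j assume j: "F j k = 0"
      have "\<forall>\<^sub>F i in sequentially. l k (Y i) = L n k \<and> dyad k (d (Y i) (q j)) = F j k"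
        by (intro eventually_conj evL evF)
      then obtain i where "l k (Y i) = L n k" "dyad k (d (Y i) (q j)) = F j k"
        by (blast dest: eventually_happens'[OF sequentially_bot])
      then have "dyad k (d (Y i) (q j)) = 0" using j by simp
      then have "l k (Y i) \<le> j" unfolding l_def by (rule Least_le)
      then show "L n k \<le> j" using \<open>l k (Y i) = L n k\<close> by simp
    qed
    have "e y i = a i" for i
    proof -
      obtain n k where i: "i = prod_encode (n, k)" by (metis prod_decode_inverse surj_pair)
      show ?thesis unfolding i e_def
        by (simp add: dy hy ly[of k n]) (simp add: F_def R_def L_def)
    qed
    then show "\<exists>y\<in>space M. e y = a" using y sp by blast
  qed
  then show ?thesis
  proof (rule that)
    show "sets M = sigma_sets (space M) {U. openin T U}" by fact
    fix U assume "U \<in> {U. openin T U}"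
    then have U: "openin mtopology U" using T' by simp
    show "open_in M e U"
      unfolding open_in_def
    proof
      fix y assume y: "y \<in> U \<inter> space M"
      then obtain r where r: "r > 0" "mball y r \<subseteq> U" using U unfolding openin_mtopology by blast
      obtain k where k: "2 * (1/2) ^ k < r" using small r by blast
      let ?i = "prod_encode (l k y, k)"
      have "y' \<in> U" if "y' \<in> space M" "agree (Suc ?i) (e y) (e y')" for y'
      proof -
        have "e y ?i = e y' ?i" using that(2) by (auto simp: agree_def)
        then have "d y y' < 2 * (1/2) ^ k"
          using close[of y y' k "l k y"] e_dyad[of y "l k y" k y'] lS[of y k] y that sp by auto
        then have "y' \<in> mball y r" using k y that sp unfolding in_mball by auto
        then show ?thesis using r by blast
      qed
      then show "\<exists>k. \<forall>y'\<in>space M. agree k (e y) (e y') \<longrightarrow> y' \<in> U" by blast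
    qed
  qed
qed

theorem code_with_clopen_sets:
  assumes M: "standard_borel M" and B: "\<And>i::nat. B i \<in> sets M"
  obtains e where "polish_code M e" "\<And>i. clopen_in M e (B i)"
proof -
  obtain e0 \<A> where e0: "polish_code M e0" "sets M = sigma_sets (space M) \<A>"
    "\<And>A. A \<in> \<A> \<Longrightarrow> open_in M e0 A"
    using standard_borel_code[OF M] by metis
  have "\<exists>e. polish_code M e \<and> finer M e e0 \<and> clopen_in M e (B i)" for i
    using sigma_sets_clopen[OF e0(1,3)] B e0(2) by blast
  then obtain E where E: "\<And>i. polish_code M (E i)" "\<And>i. finer M (E i) e0" "\<And>i. clopen_in M (E i) (B i)"
    by metis
  obtain e where "polish_code M e" "\<And>j. finer M e (E j)"
    using join_codes[of M E e0] E polish_codeD(2)[OF e0(1)] by metis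
  then show ?thesis using that E(3) clopen_in_finer by metis
qed

section \<open>Measurability of images\<close>

text \<open>A dependent choice of a sequence, one entry at a time, where \<open>P k\<close> looks only at the first \<open>k\<close>
  entries.\<close>

lemma diagonal_choice:
  fixes P :: "nat \<Rightarrow> (nat \<Rightarrow> nat) \<Rightarrow> bool"
  assumes base: "P 0 a0" and step: "\<And>k a. P k a \<Longrightarrow> \<exists>v. P (Suc k) (a(k := v))"
    and cong: "\<And>k a b. P k a \<Longrightarrow> agree k a b \<Longrightarrow> P k b"
  shows "\<exists>a. \<forall>k. P k a"
proof -
  have "\<exists>f. \<forall>n. P n (f n) \<and> agree n (f n) (f (Suc n))"
  proof (rule dependent_nat_choice)
    show "\<exists>a. P 0 a" using base by blast
    fix a k assume "P k a"
    then obtain v where "P (Suc k) (a(k := v))" using step by blast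
    moreover have "agree k a (a(k := v))" by (simp add: agree_def)
    ultimately show "\<exists>b. P (Suc k) b \<and> agree k a b" by blast
  qed
  then obtain f where f: "\<And>n. P n (f n)" "\<And>n. agree n (f n) (f (Suc n))" by blast
  have ff: "f (Suc i) i = f (Suc i + n) i" for i n
  proof (induction n)
    case (Suc n)
    have "f (Suc i + n) i = f (Suc (Suc i + n)) i" using f(2)[of "Suc i + n"] by (simp add: agree_def)
    with Suc show ?case by simp
  qed simp
  have "P k (\<lambda>i. f (Suc i) i)" for k
  proof (rule cong[OF f(1)])
    show "agree k (f k) (\<lambda>i. f (Suc i) i)"
      unfolding agree_def
    proof (intro allI impI)
      fix i assume "i < k"
      then show "f k i = f (Suc i) i" using ff[of i "k - Suc i"] by simp
    qed
  qed
  then show ?thesis by blast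
qed

lemma standard_borel_separating_sets:
  assumes "standard_borel X"
  obtains V :: "nat \<Rightarrow> 'x set" where "\<And>j. V j \<in> sets X"
    "\<And>x x'. x \<in> space X \<Longrightarrow> x' \<in> space X \<Longrightarrow> (\<And>j. x \<in> V j \<longleftrightarrow> x' \<in> V j) \<Longrightarrow> x = x'"
proof -
  obtain e where e: "polish_code X e"
    using code_with_clopen_sets[OF assms, of "\<lambda>_. {}"] by auto
  show ?thesis
  proof (rule that[of "\<lambda>j. {x\<in>space X. e x (fst (prod_decode j)) = snd (prod_decode j)}"])
    fix x x' assume x: "x \<in> space X" "x' \<in> space X"
      "\<And>j. x \<in> {x\<in>space X. e x (fst (prod_decode j)) = snd (prod_decode j)} \<longleftrightarrow>
           x' \<in> {x\<in>space X. e x (fst (prod_decode j)) = snd (prod_decode j)}"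
    have "e x i = e x' i" for i using x(1,2) x(3)[of "prod_encode (i, e x i)"] by simp
    then have "e x = e x'" by blast
    then show "x = x'" by (rule inj_onD[OF polish_codeD(2)[OF e] _ x(1,2)])
  next
    fix j
    have "{x\<in>space X. e x (fst (prod_decode j)) = snd (prod_decode j)} =
        (\<lambda>x. e x (fst (prod_decode j))) -` {snd (prod_decode j)} \<inter> space X" by auto
    then show "{x\<in>space X. e x (fst (prod_decode j)) = snd (prod_decode j)} \<in> sets X"
      using measurable_sets[OF polish_codeD(1)[OF e], of "{snd (prod_decode j)}"] by simp
  qed
qed

text \<open>A Borel map made continuous: the sets \<open>V j\<close>, which separate the points of the target, have
  clopen preimages.\<close>

locale coded_map =
  fixes M :: "'a measure" and X :: "'x measure" and r :: "'a \<Rightarrow> 'x"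
    and V :: "nat \<Rightarrow> 'x set" and e :: "'a \<Rightarrow> nat \<Rightarrow> nat"
  assumes code: "polish_code M e"
    and V_sets: "\<And>j. V j \<in> sets X"
    and V_sep: "\<And>x x'. x \<in> space X \<Longrightarrow> x' \<in> space X \<Longrightarrow> (\<And>j. x \<in> V j \<longleftrightarrow> x' \<in> V j) \<Longrightarrow> x = x'"
    and r_meas: "r \<in> M \<rightarrow>\<^sub>M X"
    and V_clopen: "\<And>j. clopen_in M e (r -` V j \<inter> space M)"
begin

lemma r_space: "y \<in> space M \<Longrightarrow> r y \<in> space X"
  using r_meas by (rule measurable_space)

lemma V_decided:
  obtains k where "\<And>y y'. y \<in> space M \<Longrightarrow> y' \<in> space M \<Longrightarrow> agree k (e y) (e y') \<Longrightarrow> r y \<in> V j \<longleftrightarrow> r y' \<in> V j"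
  using V_clopen[of j] unfolding clopen_in_def by auto

lemma limit_point:
  assumes E: "clopen_in M e E" "E \<subseteq> space M" and a: "\<And>k. \<exists>y\<in>E. agree k (e y) a"
  obtains y where "y \<in> E" "e y = a"
proof -
  have "\<exists>y\<in>space M. agree k (e y) a" for k using a E(2) by blast
  then obtain y where y: "y \<in> space M" "e y = a" using polish_codeD(3)[OF code] by metis
  obtain k where k: "\<forall>y\<in>space M. \<forall>y'\<in>space M. agree k (e y) (e y') \<longrightarrow> (y \<in> E \<longleftrightarrow> y' \<in> E)"
    using E(1) unfolding clopen_in_def by blast
  obtain y' where "y' \<in> E" "agree k (e y') a" using a by blast
  then have "y \<in> E" using k y E(2) by blast
  then show ?thesis using that y by blast
qed

text \<open>A measurable approximation of \<open>r ` C\<close> from outside: every point of it lies in the same ones of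
  the first \<open>m\<close> separating sets as some point of the image.\<close>

definition near :: "'a set \<Rightarrow> nat \<Rightarrow> 'x set" where
  "near C m = {x\<in>space X. \<exists>y\<in>C. \<forall>j<m. x \<in> V j \<longleftrightarrow> r y \<in> V j}"

lemma near_sets [measurable]: "near C m \<in> sets X"
proof -
  define \<T> where "\<T> = (\<lambda>y. {j. j < m \<and> r y \<in> V j}) ` C"
  have "\<T> \<subseteq> Pow {..<m}" by (auto simp: \<T>_def)
  then have "finite \<T>" by (rule finite_subset) simp
  note [measurable] = V_sets
  have "near C m = (\<Union>T\<in>\<T>. {x\<in>space X. \<forall>j<m. x \<in> V j \<longleftrightarrow> j \<in> T})"
    unfolding near_def \<T>_def by auto
  also have "\<dots> \<in> sets X" using \<open>finite \<T>\<close> by (intro sets.finite_UN) auto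
  finally show ?thesis .
qed

lemma near_superset: "C \<subseteq> space M \<Longrightarrow> r ` C \<subseteq> near C m"
  unfolding near_def using r_space by blast

lemma near_mono: "C \<subseteq> D \<Longrightarrow> m \<le> n \<Longrightarrow> near C n \<subseteq> near D m"
  unfolding near_def by fastforce

lemma image_of_limit:
  assumes y: "y \<in> space M" and x: "x \<in> space X"
    and *: "\<And>k m. \<exists>y'\<in>space M. agree k (e y') (e y) \<and> (\<forall>j<m. x \<in> V j \<longleftrightarrow> r y' \<in> V j)"
  shows "r y = x"
proof (rule V_sep[OF r_space[OF y] x])
  fix j
  obtain k where k: "\<And>y y'. y \<in> space M \<Longrightarrow> y' \<in> space M \<Longrightarrow> agree k (e y) (e y') \<Longrightarrow> r y \<in> V j \<longleftrightarrow> r y' \<in> V j"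
    using V_decided by blast
  obtain y' where "y' \<in> space M" "agree k (e y') (e y)" "\<forall>i<Suc j. x \<in> V i \<longleftrightarrow> r y' \<in> V i" using * by blast
  then show "r y \<in> V j \<longleftrightarrow> x \<in> V j" using k y by blast
qed

text \<open>Bounding the coordinates of the code one after the other by \<open>\<tau>\<close> costs arbitrarily little outer
  measure, as outer measures are continuous along increasing unions. What remains is compact, and
  compactness shows that the measurable sets \<open>near\<close> shrink to its image.\<close>

lemma inner_approximation:
  assumes X: "finite_measure X" and E: "clopen_in M e E" "E \<subseteq> space M" and c: "c < outer_measure_of X (r ` E)"
  obtains K where "K \<in> sets X" "K \<subseteq> r ` E" "c \<le> emeasure X K"
proof -
  interpret finite_measure X by fact
  define C where "C \<sigma> k = {y\<in>E. \<forall>i<k. e y i \<le> \<sigma> i}" for \<sigma> :: "nat \<Rightarrow> nat" and k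
  have rX: "r ` D \<subseteq> space X" if "D \<subseteq> E" for D using that E(2) r_space by blast
  have "\<exists>\<tau>. \<forall>k. c < outer_measure_of X (r ` C \<tau> k)"
  proof (rule diagonal_choice[where P = "\<lambda>k \<sigma>. c < outer_measure_of X (r ` C \<sigma> k)"])
    show "c < outer_measure_of X (r ` C (\<lambda>_. 0) 0)" using c by (simp add: C_def)
  next
    fix k \<sigma> assume IH: "c < outer_measure_of X (r ` C \<sigma> k)"
    let ?D = "\<lambda>v. C (\<sigma>(k := v)) (Suc k)"
    have "C \<sigma> k = (\<Union>v. ?D v)"
      unfolding C_def by (auto simp: less_Suc_eq)
    then have "r ` C \<sigma> k = (\<Union>v. r ` ?D v)" by blast
    moreover have "(SUP v. outer_measure_of X (r ` ?D v)) = outer_measure_of X (\<Union>v. r ` ?D v)"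
    proof (rule SUP_outer_measure_of_incseq)
      show "r ` ?D v \<subseteq> space X" for v by (rule rX) (auto simp: C_def)
      show "incseq (\<lambda>v. r ` ?D v)"
        by (intro incseq_SucI image_mono) (auto simp: C_def less_Suc_eq)
    qed
    ultimately have "c < (SUP v. outer_measure_of X (r ` ?D v))" using IH by simp
    then show "\<exists>v. c < outer_measure_of X (r ` ?D v)" by (simp add: less_SUP_iff)
  next
    fix k a b assume *: "c < outer_measure_of X (r ` C a k)" "agree k a b"
    have "C a k = C b k" using *(2) by (auto simp: C_def agree_def)
    then show "c < outer_measure_of X (r ` C b k)" using * by simp
  qed
  then obtain \<tau> where \<tau>: "\<And>k. c < outer_measure_of X (r ` C \<tau> k)" by blast
  have CE: "C \<tau> k \<subseteq> E" for k by (auto simp: C_def)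
  have C_mono: "C \<tau> n \<subseteq> C \<tau> m" if "m \<le> n" for m n using that by (auto simp: C_def)
  define K where "K = (\<Inter>n. near (C \<tau> n) n)"
  have "K \<in> sets X" by (auto simp: K_def)
  moreover have "c \<le> emeasure X K"
  proof -
    have "emeasure X K = (INF n. emeasure X (near (C \<tau> n) n))"
      unfolding K_def
    proof (rule INF_emeasure_decseq[symmetric])
      show "decseq (\<lambda>n. near (C \<tau> n) n)" by (intro decseq_SucI near_mono C_mono) auto
    qed (auto simp: emeasure_finite)
    moreover have "c \<le> emeasure X (near (C \<tau> n) n)" for n
    proof -
      have "C \<tau> n \<subseteq> space M" using CE E(2) by blast
      from outer_measure_of_mono[OF near_superset[OF this, of n], of X] \<tau>[of n] show ?thesis by simp
    qed
    ultimately show ?thesis by (simp add: INF_greatest)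
  qed
  moreover have "K \<subseteq> r ` E"
  proof
    fix x assume x: "x \<in> K"
    then have xX: "x \<in> space X" by (auto simp: K_def near_def)
    have "\<forall>n. \<exists>y\<in>C \<tau> n. \<forall>j<n. x \<in> V j \<longleftrightarrow> r y \<in> V j" using x by (auto simp: K_def near_def)
    then obtain Y where Y: "\<And>n. Y n \<in> C \<tau> n" "\<And>n j. j < n \<Longrightarrow> x \<in> V j \<longleftrightarrow> r (Y n) \<in> V j" by metis
    have "\<exists>a. \<forall>k. infinite {n. agree k (e (Y n)) a}"
    proof (rule diagonal_choice[where P = "\<lambda>k a. infinite {n. agree k (e (Y n)) a}"])
      show "infinite {n. agree 0 (e (Y n)) (\<lambda>_. 0)}" by (simp add: agree_def)
    next
      fix k a assume inf: "infinite {n. agree k (e (Y n)) a}"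
      let ?A = "{n. agree k (e (Y n)) a} - {..k}"
      have A: "infinite ?A" using inf by (simp add: Diff_infinite_finite)
      have "(\<lambda>n. e (Y n) k) ` ?A \<subseteq> {..\<tau> k}"
      proof
        fix v assume "v \<in> (\<lambda>n. e (Y n) k) ` ?A"
        then obtain n where "n \<notin> {..k}" "v = e (Y n) k" by blast
        then have "k < n" "v = e (Y n) k" by auto
        then show "v \<in> {..\<tau> k}" using Y(1)[of n] by (auto simp: C_def)
      qed
      then have "finite ((\<lambda>n. e (Y n) k) ` ?A)" by (rule finite_subset) simp
      from pigeonhole_infinite[OF A this] obtain n0
        where n0: "infinite {n\<in>?A. e (Y n) k = e (Y n0) k}" by blast
      have "{n\<in>?A. e (Y n) k = e (Y n0) k} \<subseteq> {n. agree (Suc k) (e (Y n)) (a(k := e (Y n0) k))}"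
        by (auto simp: agree_def less_Suc_eq)
      then show "\<exists>v. infinite {n. agree (Suc k) (e (Y n)) (a(k := v))}"
        using n0 infinite_super by blast
    next
      fix k a b assume *: "infinite {n. agree k (e (Y n)) a}" "agree k a b"
      have "{n. agree k (e (Y n)) a} = {n. agree k (e (Y n)) b}"
        using *(2) agree_trans agree_sym by blast
      then show "infinite {n. agree k (e (Y n)) b}" using * by simp
    qed
    then obtain a where a: "\<And>k. infinite {n. agree k (e (Y n)) a}" by blast
    have ex: "\<exists>n\<ge>m. agree k (e (Y n)) a" for k m
      using a[of k] unfolding infinite_nat_iff_unbounded_le by blast
    have YE: "Y n \<in> E" for n using Y(1) CE by blast
    obtain y where y: "y \<in> E" "e y = a"
    proof (rule limit_point[OF E])
      show "\<exists>y\<in>E. agree k (e y) a" for k using ex[of 0 k] YE by blast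
    qed
    have "r y = x"
    proof (rule image_of_limit[OF _ xX])
      show "y \<in> space M" using y E by blast
      fix k m
      obtain n where "n \<ge> m" "agree k (e (Y n)) a" using ex by blast
      then show "\<exists>y'\<in>space M. agree k (e y') (e y) \<and> (\<forall>j<m. x \<in> V j \<longleftrightarrow> r y' \<in> V j)"
        using y Y(2)[of _ n] YE E(2) by (intro bexI[of _ "Y n"]) auto
    qed
    then show "x \<in> r ` E" using y by blast
  qed
  ultimately show ?thesis using that by blast
qed

definition separated :: "'a set \<Rightarrow> 'a set \<Rightarrow> bool" where
  "separated C D \<longleftrightarrow> (\<exists>B\<in>sets X. r ` C \<subseteq> B \<and> B \<inter> r ` D = {})"

lemma separated_UN:
  assumes CD: "C \<subseteq> space M" "D \<subseteq> space M"
    and sep: "\<And>i j::nat. separated {y\<in>C. f y = i} {y\<in>D. f y = j}"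
  shows "separated C D"
proof -
  define B where "B i j = (SOME B. B \<in> sets X \<and> r ` {y\<in>C. f y = i} \<subseteq> B \<and> B \<inter> r ` {y\<in>D. f y = j} = {})" for i j
  have B': "B i j \<in> sets X \<and> r ` {y\<in>C. f y = i} \<subseteq> B i j \<and> B i j \<inter> r ` {y\<in>D. f y = j} = {}" for i j
    unfolding B_def by (rule someI_ex) (use sep[of i j] in \<open>auto simp only: separated_def\<close>)
  have B: "B i j \<in> sets X" "y \<in> C \<Longrightarrow> r y \<in> B (f y) j" "y \<in> D \<Longrightarrow> r y \<notin> B i (f y)" for i j y
    using B'[of i j] B'[of "f y" j] B'[of i "f y"] by blast+
  show ?thesis
    unfolding separated_def
  proof (intro bexI conjI)
    show "(\<Union>i. \<Inter>j. B i j) \<in> sets X" using B(1) by auto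
    show "r ` C \<subseteq> (\<Union>i. \<Inter>j. B i j)" using B(2) by blast
    show "(\<Union>i. \<Inter>j. B i j) \<inter> r ` D = {}" using B(3) by blast
  qed
qed

text \<open>If the images were not separated, then by \<open>separated_UN\<close> neither would be the images of two
  smaller cylinders, of every depth. The branches obtained in this way end in two points whose
  images differ; a set \<open>V j\<close> containing only one of these images has a clopen preimage and thus
  separates the images of sufficiently deep cylinders.\<close>

lemma lusin_separation:
  assumes C: "clopen_in M e C" "C \<subseteq> space M" and D: "clopen_in M e D" "D \<subseteq> space M"
    and disj: "r ` C \<inter> r ` D = {}"
  shows "separated C D"
proof (rule ccontr)
  assume nsep: "\<not> separated C D"
  let ?C = "\<lambda>k c. {y\<in>C. agree k (e y) (\<lambda>i. fst (prod_decode (c i)))}"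
  let ?D = "\<lambda>k c. {y\<in>D. agree k (e y) (\<lambda>i. snd (prod_decode (c i)))}"
  have "\<exists>c. \<forall>k. \<not> separated (?C k c) (?D k c)"
  proof (rule diagonal_choice[where P = "\<lambda>k c. \<not> separated (?C k c) (?D k c)"])
    show "\<not> separated (?C 0 (\<lambda>_. 0)) (?D 0 (\<lambda>_. 0))" using nsep by (simp add: agree_def)
  next
    fix k c assume IH: "\<not> separated (?C k c) (?D k c)"
    have "\<exists>i j. \<not> separated {y\<in>?C k c. e y k = i} {y\<in>?D k c. e y k = j}"
      using separated_UN[of "?C k c" "?D k c" "\<lambda>y. e y k"] IH C(2) D(2) by blast
    then obtain i j where ij: "\<not> separated {y\<in>?C k c. e y k = i} {y\<in>?D k c. e y k = j}" by blast
    have "{y\<in>?C k c. e y k = i} = ?C (Suc k) (c(k := prod_encode (i, j)))"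
      "{y\<in>?D k c. e y k = j} = ?D (Suc k) (c(k := prod_encode (i, j)))"
      by (auto simp: agree_def less_Suc_eq)
    then show "\<exists>v. \<not> separated (?C (Suc k) (c(k := v))) (?D (Suc k) (c(k := v)))" using ij by metis
  next
    fix k a b assume *: "\<not> separated (?C k a) (?D k a)" "agree k a b"
    have "?C k a = ?C k b" "?D k a = ?D k b" using *(2) by (auto simp: agree_def)
    then show "\<not> separated (?C k b) (?D k b)" using * by simp
  qed
  then obtain c where c: "\<And>k. \<not> separated (?C k c) (?D k c)" by blast
  let ?a = "\<lambda>i. fst (prod_decode (c i))" and ?b = "\<lambda>i. snd (prod_decode (c i))"
  have ne: "?C k c \<noteq> {}" "?D k c \<noteq> {}" for k
  proof -
    have "separated {} A" "separated A {}" if "A \<subseteq> space M" for A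
      unfolding separated_def using that r_space by (auto intro: bexI[of _ "{}"] bexI[of _ "space X"])
    then show "?C k c \<noteq> {}" "?D k c \<noteq> {}" using c[of k] C(2) D(2) by (metis (no_types, lifting) mem_Collect_eq subset_iff)+
  qed
  obtain y where y: "y \<in> C" "e y = ?a" by (rule limit_point[OF C]) (use ne(1) in blast)
  obtain z where z: "z \<in> D" "e z = ?b" by (rule limit_point[OF D]) (use ne(2) in blast)
  have "r y \<noteq> r z" using disj y z by blast
  have yz: "y \<in> space M" "z \<in> space M" using y z C D by auto
  obtain j where j: "\<not> (r y \<in> V j \<longleftrightarrow> r z \<in> V j)"
    using V_sep[OF r_space[OF yz(1)] r_space[OF yz(2)]] \<open>r y \<noteq> r z\<close> by blast
  obtain k where k: "\<And>y y'. y \<in> space M \<Longrightarrow> y' \<in> space M \<Longrightarrow> agree k (e y) (e y') \<Longrightarrow> r y \<in> V j \<longleftrightarrow> r y' \<in> V j"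
    using V_decided by blast
  have Ck: "r y' \<in> V j \<longleftrightarrow> r y \<in> V j" if "y' \<in> ?C k c" for y'
    using k[of y' y] that y yz C(2) by auto
  have Dk: "r y' \<in> V j \<longleftrightarrow> r z \<in> V j" if "y' \<in> ?D k c" for y'
    using k[of y' z] that z yz D(2) by auto
  let ?B = "if r y \<in> V j then V j else space X - V j"
  have "separated (?C k c) (?D k c)"
    unfolding separated_def
  proof (intro bexI conjI)
    show "?B \<in> sets X" using V_sets by auto
    show "r ` ?C k c \<subseteq> ?B" using Ck C(2) r_space by auto
    show "?B \<inter> r ` ?D k c = {}" using Dk j by auto
  qed
  then show False using c by blast
qed

lemma clopen_cylinder:
  assumes "clopen_in M e E" shows "clopen_in M e {y\<in>E. agree k (e y) a}"
proof -
  obtain m where m: "\<forall>y\<in>space M. \<forall>y'\<in>space M. agree m (e y) (e y') \<longrightarrow> (y \<in> E \<longleftrightarrow> y' \<in> E)"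
    using assms unfolding clopen_in_def by blast
  show ?thesis
    unfolding clopen_in_def
  proof (intro exI[of _ "max m k"] ballI impI)
    fix y y' assume y: "y \<in> space M" "y' \<in> space M" "agree (max m k) (e y) (e y')"
    then have "agree m (e y) (e y')" "agree k (e y) (e y')" by (auto intro: agree_mono)
    then show "y \<in> {y\<in>E. agree k (e y) a} \<longleftrightarrow> y' \<in> {y\<in>E. agree k (e y) a}"
      using m y agree_trans agree_sym by blast
  qed
qed

text \<open>By injectivity, distinct cylinders of equal length have disjoint images, which \<open>lusin_separation\<close>
  puts into disjoint measurable sets \<open>N s\<close>; these are also kept inside the sets \<open>near\<close>. A point
  that lies in some \<open>N s\<close> at every depth, coherently, determines a branch, and the limit of the
  branch is mapped to the point.\<close>

lemma lusin_souslin: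
  assumes E: "clopen_in M e E" "E \<subseteq> space M" and inj: "inj_on r E"
  shows "r ` E \<in> sets X"
proof -
  let ?C = "\<lambda>s. {y\<in>E. agree (length s) (e y) (nth s)}"
  have clop: "clopen_in M e (?C s)" "?C s \<subseteq> space M" for s
    using clopen_cylinder[OF E(1)] E(2) by auto
  have disj: "r ` ?C s \<inter> r ` ?C t = {}" if "length s = length t" "s \<noteq> t" for s t
  proof -
    have "?C s \<inter> ?C t = {}"
    proof (rule ccontr)
      assume "?C s \<inter> ?C t \<noteq> {}"
      then obtain y where "agree (length s) (e y) (nth s)" "agree (length t) (e y) (nth t)" by blast
      then have "s ! i = t ! i" if "i < length s" for i
        using that \<open>length s = length t\<close> by (simp add: agree_def)
      then show False using that nth_equalityI[of s t] by blast
    qed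
    then show ?thesis using inj by (auto simp: inj_on_def)
  qed
  define B where "B s t = (SOME B. B \<in> sets X \<and> r ` ?C s \<subseteq> B \<and> B \<inter> r ` ?C t = {})" for s t
  have B: "B s t \<in> sets X \<and> r ` ?C s \<subseteq> B s t \<and> B s t \<inter> r ` ?C t = {}"
    if "length s = length t" "s \<noteq> t" for s t
    unfolding B_def
    by (rule someI_ex) (use lusin_separation[OF clop clop disj[OF that]] in \<open>auto simp only: separated_def\<close>)
  \<comment> \<open>The terms \<open>space X - B t s\<close> make the sets \<open>N s\<close> of equal length disjoint.\<close>
  define N where "N s = (\<Inter>m. near (?C s) m) \<inter>
     (\<Inter>t\<in>{t. length t = length s \<and> t \<noteq> s}. B s t \<inter> (space X - B t s))" for s
  have N_sets: "N s \<in> sets X" for s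
  proof (cases "{t. length t = length s \<and> t \<noteq> s} = {}")
    case True
    have "(\<Inter>m. near (?C s) m) \<in> sets X" by auto
    then show ?thesis unfolding N_def by (simp only: True INT_empty Int_UNIV_right)
  next
    case False
    have "(\<Inter>t\<in>{t. length t = length s \<and> t \<noteq> s}. B s t \<inter> (space X - B t s)) \<in> sets X"
    proof (rule sets.countable_INT')
      show "(\<lambda>t. B s t \<inter> (space X - B t s)) ` {t. length t = length s \<and> t \<noteq> s} \<subseteq> sets X"
      proof (rule image_subsetI)
        fix t assume t: "t \<in> {t. length t = length s \<and> t \<noteq> s}"
        then have "length s = length t" "s \<noteq> t" by auto
        then have "B s t \<in> sets X" "B t s \<in> sets X" using B[of s t] B[of t s] by auto
        then show "B s t \<inter> (space X - B t s) \<in> sets X" by auto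
      qed
    qed (use False in auto)
    then show ?thesis unfolding N_def by auto
  qed
  have N_sup: "r ` ?C s \<subseteq> N s" for s
  proof -
    have "r ` ?C s \<subseteq> near (?C s) m" for m by (rule near_superset[OF clop(2)])
    moreover have "r ` ?C s \<subseteq> B s t \<inter> (space X - B t s)" if "length t = length s" "t \<noteq> s" for t
    proof -
      have "r ` ?C s \<subseteq> space X" using clop(2) r_space by blast
      moreover have "r ` ?C s \<subseteq> B s t" using B[of s t] that by simp
      moreover have "B t s \<inter> r ` ?C s = {}" using B[of t s] that by simp
      ultimately show ?thesis by blast
    qed
    ultimately show ?thesis unfolding N_def by blast
  qed
  have N_disj: "N s \<inter> N t = {}" if "length s = length t" "s \<noteq> t" for s t
  proof -
    have "N s \<subseteq> B s t" "N t \<subseteq> space X - B s t"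
      unfolding N_def using that by auto
    then show ?thesis by blast
  qed
  define A where "A = (\<Inter>k. \<Union>s\<in>{s. length s = k}. \<Inter>i\<in>{..k}. N (take i s))"
  have "(\<Union>s\<in>{s. length s = k}. \<Inter>i\<in>{..k}. N (take i s)) \<in> sets X" for k :: nat
  proof (rule sets.countable_UN''[OF countableI_type])
    fix s :: "nat list"
    show "(\<Inter>i\<in>{..k}. N (take i s)) \<in> sets X" by (rule sets.finite_INT) (auto simp: N_sets)
  qed
  then have "A \<in> sets X" unfolding A_def by (intro sets.countable_INT) auto
  moreover have "r ` E \<subseteq> A"
  proof
    fix x assume "x \<in> r ` E"
    then obtain y where y: "y \<in> E" "x = r y" by blast
    have "x \<in> N (take i (map (e y) [0..<k]))" for i k
    proof -
      have "y \<in> ?C (take i (map (e y) [0..<k]))" using y by (auto simp: agree_def)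
      then show ?thesis using N_sup y by blast
    qed
    then show "x \<in> A" unfolding A_def by (auto intro!: exI[of _ "map (e y) [0..<_]"])
  qed
  moreover have "A \<subseteq> r ` E"
  proof
    fix x assume "x \<in> A"
    then have "\<exists>s. length s = k \<and> (\<forall>i\<le>k. x \<in> N (take i s))" for k
    proof -
      have "x \<in> (\<Union>s\<in>{s. length s = k}. \<Inter>i\<in>{..k}. N (take i s))" using \<open>x \<in> A\<close> unfolding A_def by blast
      then show ?thesis by auto
    qed
    then obtain s where s: "\<And>k. length (s k) = k" "\<And>k i. i \<le> k \<Longrightarrow> x \<in> N (take i (s k))" by metis
    have s_N: "x \<in> N (s k)" for k using s(2)[of k k] s(1)[of k] by simp
    have take: "take i (s k) = s i" if "i \<le> k" for i k
      using N_disj[of "take i (s k)" "s i"] s(2)[OF that] s_N[of i] s(1) that by auto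
    define a where "a i = s (Suc i) ! i" for i
    have sa: "s k ! i = a i" if "i < k" for i k
    proof -
      have "take (Suc i) (s k) = s (Suc i)" using take that by simp
      then show ?thesis unfolding a_def by (metis lessI nth_take)
    qed
    have near_k: "\<exists>y\<in>E. agree k (e y) a \<and> (\<forall>j<m. x \<in> V j \<longleftrightarrow> r y \<in> V j)" for k m
    proof -
      have "x \<in> near (?C (s k)) m" using s_N[of k] unfolding N_def by blast
      then obtain y where "y \<in> E" "agree k (e y) (nth (s k))" "\<forall>j<m. x \<in> V j \<longleftrightarrow> r y \<in> V j"
        unfolding near_def using s(1) by auto
      then show ?thesis using sa by (auto simp: agree_def)
    qed
    obtain y where y: "y \<in> E" "e y = a" by (rule limit_point[OF E]) (use near_k in blast)
    have "x \<in> space X" using s_N[of 0] N_sets sets.sets_into_space by blast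
    have "r y = x"
      by (rule image_of_limit) (use y near_k E \<open>x \<in> space X\<close> in \<open>auto, blast\<close>)
    then show "x \<in> r ` E" using y by blast
  qed
  ultimately show ?thesis by (metis subset_antisym)
qed

end

lemma coded_map_exists:
  assumes M: "standard_borel M" and X: "standard_borel X" and r: "r \<in> M \<rightarrow>\<^sub>M X" and E: "E \<in> sets M"
  obtains V e where "coded_map M X r V e" "clopen_in M e E"
proof -
  obtain V :: "nat \<Rightarrow> 'b set" where V: "\<And>j. V j \<in> sets X"
    "\<And>x x'. x \<in> space X \<Longrightarrow> x' \<in> space X \<Longrightarrow> (\<And>j. x \<in> V j \<longleftrightarrow> x' \<in> V j) \<Longrightarrow> x = x'"
    using standard_borel_separating_sets[OF X] by blast
  let ?B = "\<lambda>i. case i of 0 \<Rightarrow> E | Suc j \<Rightarrow> r -` V j \<inter> space M"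
  have "?B i \<in> sets M" for i
    using E measurable_sets[OF r V(1)] by (cases i) auto
  then obtain e where e: "polish_code M e" "\<And>i. clopen_in M e (?B i)"
    using code_with_clopen_sets[OF M] by metis
  have "coded_map M X r V e"
    by unfold_locales (use e(1) V r e(2)[of "Suc _"] in auto)
  then show ?thesis using that e(2)[of 0] by simp
qed

theorem injective_image_measurable:
  assumes M: "standard_borel M" and X: "standard_borel X" and r: "r \<in> M \<rightarrow>\<^sub>M X"
    and E: "E \<in> sets M" "inj_on r E"
  shows "r ` E \<in> sets X"
proof -
  obtain V e where c: "coded_map M X r V e" "clopen_in M e E"
    using coded_map_exists[OF M X r E(1)] .
  show ?thesis by (rule coded_map.lusin_souslin[OF c sets.sets_into_space[OF E(1)] E(2)])
qed

theorem image_in_completion: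
  assumes M: "standard_borel M" and X: "standard_borel X" "finite_measure X" and r: "r \<in> M \<rightarrow>\<^sub>M X"
    and E: "E \<in> sets M"
  shows "r ` E \<in> sets (completion X)"
proof -
  interpret finite_measure X by fact
  obtain V e where c: "coded_map M X r V e" "clopen_in M e E"
    using coded_map_exists[OF M X(1) r E] .
  have EM: "E \<subseteq> space M" using E by (rule sets.sets_into_space)
  let ?K = "{K\<in>sets X. K \<subseteq> r ` E}"
  have rE: "r ` E \<subseteq> space X" using EM measurable_space[OF r] by blast
  obtain A' where A': "A' \<in> sets X" "r ` E \<subseteq> A'" "outer_measure_of X (r ` E) = emeasure X A'"
    using outer_measure_of_attain[OF rE] by blast
  have "outer_measure_of X (r ` E) \<le> (SUP K\<in>?K. emeasure X K)"
  proof (rule dense_le)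
    fix c' assume "c' < outer_measure_of X (r ` E)"
    then obtain K where "K \<in> sets X" "K \<subseteq> r ` E" "c' \<le> emeasure X K"
      using coded_map.inner_approximation[OF c(1) X(2) c(2) EM] by metis
    then show "c' \<le> (SUP K\<in>?K. emeasure X K)" by (intro SUP_upper2[of K]) auto
  qed
  moreover have "?K \<noteq> {}" by auto
  from ennreal_SUP_countable_SUP[OF this, of "emeasure X"]
  obtain f :: "nat \<Rightarrow> ennreal" where f: "range f \<subseteq> emeasure X ` ?K" "(SUP K\<in>?K. emeasure X K) = (SUP i. f i)"
    by auto
  from f(1) have "\<forall>i. \<exists>K\<in>?K. f i = emeasure X K" by blast
  then obtain K where K': "\<And>i. K i \<in> ?K" "\<And>i. f i = emeasure X (K i)" by metis
  then have K: "\<And>i. K i \<in> sets X" "\<And>i. K i \<subseteq> r ` E" "\<And>i. f i = emeasure X (K i)" by auto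
  define A where "A = (\<Union>i. K i)"
  have A: "A \<in> sets X" "A \<subseteq> r ` E" using K by (auto simp: A_def)
  have "(SUP i. f i) \<le> emeasure X A"
    unfolding K(3) by (intro SUP_least emeasure_mono A) (auto simp: A_def)
  ultimately have le: "emeasure X A' \<le> emeasure X A" using A' f(2) by simp
  have "emeasure X (A' - A) = emeasure X A' - emeasure X A"
    using A A' by (intro emeasure_Diff) (auto simp: emeasure_finite)
  then have "emeasure X (A' - A) = 0"
    using le emeasure_finite[of A'] by (simp add: diff_eq_0_iff_ennreal less_top[symmetric])
  then have "A' - A \<in> null_sets X" using A A' by auto
  then show ?thesis using A A' by (intro sets_completionI[of "r ` E" A "r ` E - A" "A' - A"]) auto
qed

section \<open>Countable-to-one maps\<close>

text \<open>Given an enumeration \<open>p\<close> of the set, a nested sequence of cylinders is chosen such that the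
  cylinder number \<open>Suc n\<close> avoids \<open>p n\<close>; its limit lies in the set and is not enumerated.\<close>

lemma perfect_uncountable:
  fixes P :: "(nat \<Rightarrow> nat) set"
  assumes closed: "\<And>a. (\<And>k. \<exists>b\<in>P. agree k b a) \<Longrightarrow> a \<in> P"
    and perfect: "\<And>a k. a \<in> P \<Longrightarrow> \<exists>b\<in>P. b \<noteq> a \<and> agree k b a"
    and countable: "countable P"
  shows "P = {}"
proof (rule ccontr)
  assume ne: "P \<noteq> {}"
  define p where "p = from_nat_into P"
  have p: "range p = P" unfolding p_def using ne countable by (rule range_from_nat_into)
  have step: "\<exists>b k'. b \<in> P \<and> k < k' \<and> agree k b a \<and> \<not> agree k' b (p n)" if "a \<in> P" for a k n
  proof -
    have "\<exists>b\<in>P. b \<noteq> a \<and> agree k b a" by (rule perfect[OF that])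
    then obtain b where b: "b \<in> P" "agree k b a" "b \<noteq> p n"
      using \<open>a \<in> P\<close> agree_refl by metis
    then obtain m where "\<not> agree m b (p n)" using agree_eqI by blast
    then have "\<not> agree (max m (Suc k)) b (p n)" using agree_mono max.cobounded1 by blast
    then show ?thesis using b by (intro exI[of _ b] exI[of _ "max m (Suc k)"]) auto
  qed
  have "\<exists>f. \<forall>n. fst (f n) \<in> P \<and> (snd (f n) < snd (f (Suc n)) \<and> agree (snd (f n)) (fst (f (Suc n))) (fst (f n)) \<and>
      \<not> agree (snd (f (Suc n))) (fst (f (Suc n))) (p n))"
  proof (rule dependent_nat_choice)
    show "\<exists>x. fst x \<in> P" using ne by auto
    fix x :: "(nat \<Rightarrow> nat) \<times> nat" and n assume "fst x \<in> P"
    from step[OF this, of "snd x" n] obtain b k' where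
      "b \<in> P" "snd x < k'" "agree (snd x) b (fst x)" "\<not> agree k' b (p n)" by blast
    then show "\<exists>y. fst y \<in> P \<and> (snd x < snd y \<and> agree (snd x) (fst y) (fst x) \<and> \<not> agree (snd y) (fst y) (p n))"
      by (intro exI[of _ "(b, k')"]) simp
  qed
  then obtain f where f: "\<And>n. fst (f n) \<in> P" "\<And>n. snd (f n) < snd (f (Suc n))"
    "\<And>n. agree (snd (f n)) (fst (f (Suc n))) (fst (f n))" "\<And>n. \<not> agree (snd (f (Suc n))) (fst (f (Suc n))) (p n)"
    by blast
  let ?a = "\<lambda>n. fst (f n)" and ?k = "\<lambda>n. snd (f n)"
  have k_mono: "strict_mono ?k" using f(2) by (simp add: strict_mono_Suc_iff)
  have k_ge: "n \<le> ?k n" for n using k_mono by (rule strict_mono_imp_increasing)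
  have ag: "agree (?k n) (?a (n + m)) (?a n)" for n m
  proof (induction m)
    case (Suc m)
    have "?k n \<le> ?k (n + m)" using strict_mono_less_eq[OF k_mono, of n "n + m"] by simp
    then have "agree (?k n) (?a (Suc (n + m))) (?a (n + m))" using f(3) agree_mono by blast
    from agree_trans[OF this Suc] show ?case by simp
  qed simp
  define b where "b i = ?a (Suc i) i" for i
  have b_ag: "agree (?k n) (?a n) b" for n
    unfolding agree_def
  proof (intro allI impI)
    fix i assume i: "i < ?k n"
    have "?a n i = ?a (n + Suc i) i" using ag[of n "Suc i"] i by (simp add: agree_def)
    moreover have "?a (Suc i) i = ?a (Suc i + n) i"
      using ag[of "Suc i" n] k_ge[of "Suc i"] by (simp add: agree_def)
    ultimately show "?a n i = b i" by (simp add: b_def add.commute)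
  qed
  have "b \<in> P"
  proof (rule closed)
    fix k show "\<exists>c\<in>P. agree k c b"
      using f(1)[of k] agree_mono[OF b_ag k_ge] by blast
  qed
  then obtain m where "b = p m" using p by auto
  then show False using f(4)[of m] b_ag[of "Suc m"] by simp
qed

text \<open>Countable intersections of approximate minimisers minimise all the functionals \<open>\<Phi> s\<close> at once.\<close>

lemma minimiser_exists:
  fixes \<Phi> :: "nat \<Rightarrow> 'a set \<Rightarrow> ennreal"
  assumes ne: "F0 \<in> \<F>" and INT: "\<And>F. (\<And>i::nat. F i \<in> \<F>) \<Longrightarrow> (\<Inter>i. F i) \<in> \<F>"
    and mono: "\<And>s F F'. F \<in> \<F> \<Longrightarrow> F' \<in> \<F> \<Longrightarrow> F \<subseteq> F' \<Longrightarrow> \<Phi> s F \<le> \<Phi> s F'"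
  obtains F where "F \<in> \<F>" "\<And>s F'. F' \<in> \<F> \<Longrightarrow> \<Phi> s F \<le> \<Phi> s F'"
proof -
  have "\<exists>F\<in>\<F>. \<forall>F'\<in>\<F>. \<Phi> s F \<le> \<Phi> s F'" for s
  proof -
    have "\<Phi> s ` \<F> \<noteq> {}" using ne by blast
    then obtain f where f: "range f \<subseteq> \<Phi> s ` \<F>" "Inf (\<Phi> s ` \<F>) = (INF i::nat. f i)"
      using ennreal_Inf_countable_INF by metis
    have "\<forall>i. \<exists>F\<in>\<F>. f i = \<Phi> s F" using f(1) by blast
    then obtain F where F: "\<And>i. F i \<in> \<F>" "\<And>i. f i = \<Phi> s (F i)" by metis
    have "\<Phi> s (\<Inter>i. F i) \<le> f i" for i
      unfolding F(2) by (rule mono) (auto simp: F INT)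
    then have "\<Phi> s (\<Inter>i. F i) \<le> Inf (\<Phi> s ` \<F>)" unfolding f(2) by (rule INF_greatest)
    then show ?thesis using INT[of F] F(1) by (meson INF_lower order_trans)
  qed
  then obtain F where F: "\<And>s. F s \<in> \<F>" "\<And>s F'. F' \<in> \<F> \<Longrightarrow> \<Phi> s (F s) \<le> \<Phi> s F'" by metis
  show ?thesis
  proof (rule that[of "\<Inter>s. F s"])
    show "(\<Inter>s. F s) \<in> \<F>" using F INT by blast
    show "\<Phi> s (\<Inter>s. F s) \<le> \<Phi> s F'" if "F' \<in> \<F>" for s F'
    proof -
      have "\<Phi> s (\<Inter>s. F s) \<le> \<Phi> s (F s)" by (rule mono) (auto simp: F INT)
      also have "\<dots> \<le> \<Phi> s F'" using F that by blast
      finally show ?thesis .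
    qed
  qed
qed

text \<open>A set \<open>F\<close> is called thin if its fibres are closed in the fibres of \<open>r\<close> and its complement is
  covered in the required way. Removing from each fibre of a thin set the points isolated in that
  fibre (the derivative of Cantor and Bendixson) leaves a thin set, since a point isolated by a
  cylinder belongs to a set on which \<open>r\<close> is injective. Instead of iterating this through the
  countable ordinals, a thin set \<open>F\<close> is chosen for which the measures of the images of \<open>F \<inter> U s\<close>, for all
  cylinders \<open>U s\<close>, are as small as possible. Its derivative has the same images up to null sets,
  so outside a null set the fibres of \<open>F\<close> are perfect; being countable, they are empty.\<close>

theorem countable_to_one_sections:
  assumes M: "standard_borel M" and X: "standard_borel X" "finite_measure X" and r: "r \<in> M \<rightarrow>\<^sub>M X"
    and fib: "\<And>x. x \<in> space X \<Longrightarrow> countable {y\<in>space M. r y = x}"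
  obtains D :: "nat \<Rightarrow> 'a set" and N where "\<And>n. D n \<in> sets M" "\<And>n. inj_on r (D n)" "N \<in> null_sets X"
    "\<And>y. y \<in> space M \<Longrightarrow> r y \<notin> N \<Longrightarrow> \<exists>n. y \<in> D n"
proof -
  interpret finite_measure X by fact
  obtain V e where "coded_map M X r V e" using coded_map_exists[OF M X(1) r sets.top] by metis
  then interpret coded_map M X r V e .
  let ?cX = "completion X"
  define U where "U s = {y\<in>space M. agree (length s) (e y) (nth s)}" for s :: "nat list"
  have U_sets: "U s \<in> sets M" for s unfolding U_def by (rule measurable_agree[OF code])
  have U_in: "y \<in> U (map (e y) [0..<k])" if "y \<in> space M" for y k
    using that by (simp add: U_def agree_def)
  have U_agree: "agree k (e y') (e y)" if "y' \<in> U (map (e y) [0..<k])" for y y' k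
    using that by (simp add: U_def agree_def)
  have img: "r ` E \<in> sets ?cX" if "E \<in> sets M" for E
    by (rule image_in_completion[OF M X r that])
  define fc where "fc F \<longleftrightarrow> (\<forall>y\<in>space M - F. \<exists>k. \<forall>y'\<in>F. r y' = r y \<longrightarrow> \<not> agree k (e y') (e y))" for F
  define thin where "thin F \<longleftrightarrow> F \<in> sets M \<and> fc F \<and>
     (\<exists>\<D> N. countable \<D> \<and> (\<forall>D\<in>\<D>. D \<in> sets M \<and> inj_on r D) \<and> N \<in> null_sets X \<and>
        space M - F \<subseteq> \<Union>\<D> \<union> r -` N)" for F
  have thin_INT: "thin (\<Inter>i::nat. F i)" if F: "\<And>i. thin (F i)" for F
  proof -
    have "\<forall>i. \<exists>\<D> N. countable \<D> \<and> (\<forall>D\<in>\<D>. D \<in> sets M \<and> inj_on r D) \<and> N \<in> null_sets X \<and>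
        space M - F i \<subseteq> \<Union>\<D> \<union> r -` N" using F unfolding thin_def by blast
    then obtain \<D> N where DN: "\<And>i. countable (\<D> i)" "\<And>i. \<forall>D\<in>\<D> i. D \<in> sets M \<and> inj_on r D"
      "\<And>i. N i \<in> null_sets X" "\<And>i. space M - F i \<subseteq> \<Union>(\<D> i) \<union> r -` N i" by metis
    have "(\<Inter>i. F i) \<in> sets M" using F unfolding thin_def by blast
    moreover have "fc (\<Inter>i. F i)"
      unfolding fc_def
    proof
      fix y assume "y \<in> space M - (\<Inter>i. F i)"
      then obtain i where "y \<in> space M - F i" by blast
      then obtain k where "\<forall>y'\<in>F i. r y' = r y \<longrightarrow> \<not> agree k (e y') (e y)"
        using F[of i] unfolding thin_def fc_def by blast
      then show "\<exists>k. \<forall>y'\<in>\<Inter>i. F i. r y' = r y \<longrightarrow> \<not> agree k (e y') (e y)" by blast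
    qed
    moreover have "countable (\<Union>i. \<D> i)" "\<forall>D\<in>(\<Union>i. \<D> i). D \<in> sets M \<and> inj_on r D" "(\<Union>i. N i) \<in> null_sets X"
      using DN by auto
    moreover have "space M - (\<Inter>i. F i) \<subseteq> \<Union>(\<Union>i. \<D> i) \<union> r -` (\<Union>i. N i)"
    proof
      fix y assume "y \<in> space M - (\<Inter>i. F i)"
      then obtain i where "y \<in> space M - F i" by blast
      then have "y \<in> \<Union>(\<D> i) \<union> r -` N i" using DN(4) by blast
      then show "y \<in> \<Union>(\<Union>i. \<D> i) \<union> r -` (\<Union>i. N i)" by blast
    qed
    ultimately show ?thesis unfolding thin_def by blast
  qed
  have thin_top: "thin (space M)"
    unfolding thin_def fc_def by (auto intro!: exI[of _ "{}"])
  obtain F where F: "thin F"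
    and min: "\<And>s F'. thin F' \<Longrightarrow>
       emeasure ?cX (r ` (F \<inter> U (from_nat s))) \<le> emeasure ?cX (r ` (F' \<inter> U (from_nat s)))"
  proof (rule minimiser_exists[of "space M" "Collect thin" "\<lambda>s F. emeasure ?cX (r ` (F \<inter> U (from_nat s)))"])
    show "space M \<in> Collect thin" using thin_top by simp
    show "\<And>F. (\<And>i::nat. F i \<in> Collect thin) \<Longrightarrow> (\<Inter>i. F i) \<in> Collect thin" using thin_INT by blast
    show "emeasure ?cX (r ` (F \<inter> U (from_nat s))) \<le> emeasure ?cX (r ` (F' \<inter> U (from_nat s)))"
      if "F \<in> Collect thin" "F' \<in> Collect thin" "F \<subseteq> F'" for s F F'
      using that U_sets by (intro emeasure_mono img) (auto simp: thin_def)
  qed auto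
  have FM: "F \<in> sets M" and Ffc: "fc F" using F by (auto simp: thin_def)
  have FsM: "y \<in> F \<Longrightarrow> y \<in> space M" for y using sets.sets_into_space[OF FM] by blast
  \<comment> \<open>Fibres that meet \<open>F \<inter> U s\<close> at least twice.\<close>
  define W where "W s = (\<Union>(t, u)\<in>{(t, u). length t = length u \<and> t \<noteq> u}.
      r ` (F \<inter> U s \<inter> U t) \<inter> r ` (F \<inter> U s \<inter> U u))" for s
  have W_iff: "x \<in> W s \<longleftrightarrow> (\<exists>y\<in>F\<inter>U s. \<exists>y'\<in>F\<inter>U s. y \<noteq> y' \<and> r y = x \<and> r y' = x)" for x s
  proof
    assume "x \<in> W s"
    then obtain t u where tu: "length t = length u" "t \<noteq> u"
      and x: "x \<in> r ` (F \<inter> U s \<inter> U t)" "x \<in> r ` (F \<inter> U s \<inter> U u)" unfolding W_def by auto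
    from x(1) obtain y where y: "y \<in> F \<inter> U s \<inter> U t" "x = r y" by (rule imageE) simp
    from x(2) obtain y' where y': "y' \<in> F \<inter> U s \<inter> U u" "x = r y'" by (rule imageE) simp
    note * = tu y(1) y(2)[symmetric] y'(1) y'(2)[symmetric]
    have "y \<noteq> y'"
    proof
      assume "y = y'"
      then have "t ! i = u ! i" if "i < length t" for i
        using * that unfolding U_def agree_def by auto
      then show False using * nth_equalityI by blast
    qed
    then show "\<exists>y\<in>F\<inter>U s. \<exists>y'\<in>F\<inter>U s. y \<noteq> y' \<and> r y = x \<and> r y' = x" using * by blast
  next
    assume "\<exists>y\<in>F\<inter>U s. \<exists>y'\<in>F\<inter>U s. y \<noteq> y' \<and> r y = x \<and> r y' = x"
    then obtain y y' where y: "y \<in> F\<inter>U s" "y' \<in> F\<inter>U s" "y \<noteq> y'" "r y = x" "r y' = x" by blast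
    have yM: "y \<in> space M" "y' \<in> space M" using y FsM by auto
    have "e y \<noteq> e y'" using polish_codeD(2)[OF code] y(3) yM by (auto dest: inj_onD)
    then obtain k where k: "\<not> agree k (e y') (e y)" using agree_eqI by metis
    let ?t = "map (e y) [0..<k]" and ?u = "map (e y') [0..<k]"
    have "?t \<noteq> ?u"
    proof
      assume "?t = ?u"
      then have "e y' i = e y i" if "i < k" for i
        using that by (auto dest!: map_eq_conv[THEN iffD1])
      then show False using k by (simp add: agree_def)
    qed
    moreover have "x \<in> r ` (F \<inter> U s \<inter> U ?t) \<inter> r ` (F \<inter> U s \<inter> U ?u)"
    proof
      show "x \<in> r ` (F \<inter> U s \<inter> U ?t)" using y U_in[OF yM(1), of k] by (intro image_eqI[of _ _ y]) auto
      show "x \<in> r ` (F \<inter> U s \<inter> U ?u)" using y U_in[OF yM(2), of k] by (intro image_eqI[of _ _ y']) auto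
    qed
    ultimately show "x \<in> W s" unfolding W_def by (intro UN_I[of "(?t, ?u)"]) auto
  qed
  have "W s \<in> sets ?cX" for s
    unfolding W_def
  proof (rule sets.countable_UN''[OF countableI_type])
    fix tu :: "nat list \<times> nat list"
    show "(case tu of (t, u) \<Rightarrow> r ` (F \<inter> U s \<inter> U t) \<inter> r ` (F \<inter> U s \<inter> U u)) \<in> sets ?cX"
      by (cases tu) (auto intro!: sets.Int img FM U_sets)
  qed
  then have "\<exists>S N'. S \<in> sets X \<and> N' \<in> null_sets X \<and> S \<subseteq> W s \<and> W s \<subseteq> S \<union> N'" for s
    using sets_completionE[of "W s" X] by (metis Un_mono Un_upper1 subset_refl)
  then obtain S N1 where S: "\<And>s. S s \<in> sets X" "\<And>s. N1 s \<in> null_sets X" "\<And>s. S s \<subseteq> W s" "\<And>s. W s \<subseteq> S s \<union> N1 s"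
    by metis
  define A where "A s = S s \<union> N1 s" for s
  have A: "A s \<in> sets X" for s using S by (auto simp: A_def)
  \<comment> \<open>Up to a null set of fibres, the points that \<open>U s\<close> isolates in their fibre of \<open>F\<close>.\<close>
  define D where "D s = {y\<in>F \<inter> U s. r y \<notin> A s}" for s
  have D_sets: "D s \<in> sets M" for s
  proof -
    have "D s = (F \<inter> U s) - (r -` A s \<inter> space M)" unfolding D_def using FsM by auto
    then show ?thesis using FM U_sets measurable_sets[OF r A] by auto
  qed
  have D_one: "y' = y" if "y \<in> D s" "y' \<in> F \<inter> U s" "r y' = r y" for y y' s
    using that S(4)[of s] W_iff[of "r y" s] unfolding D_def A_def by blast
  have D_inj: "inj_on r (D s)" for s
    by (rule inj_onI) (use D_one in \<open>auto simp: D_def\<close>)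
  define F' where "F' = F - (\<Union>s. D s)"
  have F': "thin F'"
  proof -
    obtain \<D> N where DN: "countable \<D>" "\<forall>D\<in>\<D>. D \<in> sets M \<and> inj_on r D" "N \<in> null_sets X"
        "space M - F \<subseteq> \<Union>\<D> \<union> r -` N" using F unfolding thin_def by blast
    have "F' \<in> sets M" unfolding F'_def using FM D_sets by auto
    moreover have "fc F'"
      unfolding fc_def
    proof
      fix y assume y: "y \<in> space M - F'"
      show "\<exists>k. \<forall>y'\<in>F'. r y' = r y \<longrightarrow> \<not> agree k (e y') (e y)"
      proof (cases "y \<in> F")
        case False
        then obtain k where "\<forall>y'\<in>F. r y' = r y \<longrightarrow> \<not> agree k (e y') (e y)"
          using Ffc y unfolding fc_def by blast
        moreover have "F' \<subseteq> F" by (auto simp: F'_def)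
        ultimately show ?thesis by blast
      next
        case True
        then obtain s where s: "y \<in> D s" using y by (auto simp: F'_def)
        have "\<not> agree (length s) (e y') (e y)" if y': "y' \<in> F'" "r y' = r y" for y'
        proof
          assume "agree (length s) (e y') (e y)"
          moreover have "agree (length s) (e y) (nth s)" using s by (simp add: D_def U_def)
          ultimately have "y' \<in> F \<inter> U s" using y' FsM agree_trans by (auto simp: F'_def U_def)
          then have "y' = y" using D_one s y' by blast
          then show False using s y' by (auto simp: F'_def)
        qed
        then show ?thesis by blast
      qed
    qed
    moreover have "countable (\<D> \<union> range D)" using DN by auto
    moreover have "\<forall>B\<in>\<D> \<union> range D. B \<in> sets M \<and> inj_on r B" using DN D_sets D_inj by auto
    moreover have "space M - F' \<subseteq> \<Union>(\<D> \<union> range D) \<union> r -` N" using DN(4) unfolding F'_def by auto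
    ultimately show ?thesis unfolding thin_def using DN(3) by blast
  qed
  have F'M: "F' \<in> sets M" and F'fc: "fc F'" using F' by (auto simp: thin_def)
  have "\<exists>N'\<in>null_sets X. r ` (F \<inter> U s) - r ` (F' \<inter> U s) \<subseteq> N'" for s
  proof -
    let ?P = "r ` (F \<inter> U s)" and ?Q = "r ` (F' \<inter> U s)"
    have sets: "?P \<in> sets ?cX" "?Q \<in> sets ?cX" using img FM F'M U_sets by auto
    have sub: "?Q \<subseteq> ?P" by (auto simp: F'_def)
    have "emeasure ?cX ?P \<le> emeasure ?cX ?Q" using min[OF F', of "to_nat s"] by simp
    moreover have fin: "emeasure ?cX ?P \<noteq> \<infinity>" "emeasure ?cX ?Q \<noteq> \<infinity>"
      using sets by (auto simp: emeasure_finite)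
    moreover have "emeasure ?cX (?P - ?Q) = emeasure ?cX ?P - emeasure ?cX ?Q"
      by (rule emeasure_Diff[OF fin(2) sets sub])
    ultimately have "emeasure ?cX (?P - ?Q) = 0"
      by (simp add: diff_eq_0_iff_ennreal less_top[symmetric])
    then have "?P - ?Q \<in> null_sets ?cX" using sets by auto
    then show ?thesis unfolding null_sets_completion_iff2 by blast
  qed
  then obtain N2 where N2: "\<And>s. N2 s \<in> null_sets X" "\<And>s. r ` (F \<inter> U s) - r ` (F' \<inter> U s) \<subseteq> N2 s" by metis
  obtain \<D> N3 where DN: "countable \<D>" "\<forall>D\<in>\<D>. D \<in> sets M \<and> inj_on r D" "N3 \<in> null_sets X"
        "space M - F \<subseteq> \<Union>\<D> \<union> r -` N3" using F unfolding thin_def by blast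
  define N where "N = (\<Union>s. N1 s) \<union> (\<Union>s. N2 s) \<union> N3"
  have N: "N \<in> null_sets X" unfolding N_def using S(2) N2(1) DN(3) by (intro null_sets.Un null_sets_UN) auto
  have empty: "y \<notin> F" if "r y \<notin> N" for y
  proof
    assume yF: "y \<in> F"
    let ?x = "r y"
    let ?Q = "{y\<in>F. r y = ?x}"
    \<comment> \<open>The images of \<open>F\<close> and \<open>F'\<close> agree off \<open>N\<close> and the fibres of \<open>F'\<close> are closed, so the fibres over this point agree.\<close>
    have QF': "y' \<in> F'" if y': "y' \<in> ?Q" for y'
    proof (rule ccontr)
      assume "y' \<notin> F'"
      moreover have y'M: "y' \<in> space M" using y' FsM by blast
      ultimately obtain k where k: "\<forall>y''\<in>F'. r y'' = r y' \<longrightarrow> \<not> agree k (e y'') (e y')"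
        using F'fc unfolding fc_def by blast
      let ?s = "map (e y') [0..<k]"
      have "?x \<in> r ` (F \<inter> U ?s)" using y' U_in[OF y'M, of k] by (metis (mono_tags, lifting) IntI image_iff mem_Collect_eq)
      moreover have "?x \<notin> N2 ?s" using \<open>r y \<notin> N\<close> unfolding N_def by blast
      ultimately have "?x \<in> r ` (F' \<inter> U ?s)" using N2(2) by blast
      then obtain y'' where "y'' \<in> F'" "y'' \<in> U ?s" "r y'' = r y'" using y' by auto
      then show False using k U_agree by blast
    qed
    have "e ` ?Q = {}"
    proof (rule perfect_uncountable)
      have "countable {z\<in>space M. r z = ?x}" using fib r_space FsM yF by blast
      moreover have "?Q \<subseteq> {z\<in>space M. r z = ?x}" using FsM by blast
      ultimately have "countable ?Q" by (rule countable_subset[rotated])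
      then show "countable (e ` ?Q)" by simp
    next
      fix a k assume "a \<in> e ` ?Q"
      then obtain y' where y': "y' \<in> ?Q" "a = e y'" by blast
      then have y'M: "y' \<in> space M" using FsM by blast
      let ?s = "map (e y') [0..<k]"
      have "y' \<notin> D ?s" using QF'[OF y'(1)] by (auto simp: F'_def)
      moreover have "y' \<in> F \<inter> U ?s" using y'(1) U_in[OF y'M, of k] by blast
      ultimately have "?x \<in> A ?s" using y' by (auto simp: D_def)
      then have "?x \<in> W ?s" using S(3) \<open>r y \<notin> N\<close> unfolding A_def N_def by blast
      then obtain z where z: "z \<in> F \<inter> U ?s" "r z = ?x" "z \<noteq> y'" using W_iff by blast
      have "e z \<noteq> e y'" using polish_codeD(2)[OF code] z y'M FsM by (auto dest: inj_onD)
      moreover have "agree k (e z) a" using z U_agree y'(2) by blast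
      ultimately show "\<exists>b\<in>e ` ?Q. b \<noteq> a \<and> agree k b a" using z y'(2) by blast
    next
      fix a assume a: "\<And>k. \<exists>b\<in>e ` ?Q. agree k b a"
      then have a': "\<exists>z\<in>?Q. agree k (e z) a" for k by blast
      then have "\<exists>z\<in>space M. agree k (e z) a" for k using FsM by blast
      then obtain z where z: "z \<in> space M" "e z = a" using polish_codeD(3)[OF code] by metis
      have "r z = ?x"
      proof (rule image_of_limit[OF z(1) r_space])
        show "y \<in> space M" using yF FsM by blast
        show "\<exists>y'\<in>space M. agree k (e y') (e z) \<and> (\<forall>j<m. ?x \<in> V j \<longleftrightarrow> r y' \<in> V j)" for k m
          using a'[of k] z(2) FsM by fastforce
      qed
      moreover have "z \<in> F"
      proof (rule ccontr)
        assume "z \<notin> F"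
        then obtain k where "\<forall>y''\<in>F. r y'' = r z \<longrightarrow> \<not> agree k (e y'') (e z)"
          using Ffc z unfolding fc_def by blast
        then show False using a'[of k] z \<open>r z = ?x\<close> by auto
      qed
      ultimately show "a \<in> e ` ?Q" using z by blast
    qed
    then show False using yF by blast
  qed
  let ?E = "\<D> \<union> {{}}"
  have cE: "range (from_nat_into ?E) = ?E" by (rule range_from_nat_into) (use DN(1) in auto)
  show ?thesis
  proof (rule that[of "from_nat_into ?E" N])
    fix n
    have "from_nat_into ?E n \<in> ?E" by (rule from_nat_into) simp
    then show "from_nat_into ?E n \<in> sets M" "inj_on r (from_nat_into ?E n)" using DN(2) by auto
  next
    fix y assume y: "y \<in> space M" "r y \<notin> N"
    then have "y \<notin> F" using empty by blast
    then have "y \<in> \<Union>\<D>" using DN(4) y unfolding N_def by blast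
    then show "\<exists>n. y \<in> from_nat_into ?E n" using cE by blast
  qed (rule N)
qed

section \<open>Countable p.m.p. groupoids\<close>

lemma emeasure_count_inj_le:
  assumes "inj_on h A" "h ` A \<subseteq> B"
  shows "emeasure (count_space UNIV) A \<le> emeasure (count_space UNIV) B"
proof (cases "finite B")
  case True
  then have "finite A" using assms inj_on_finite by blast
  then show ?thesis using True card_inj_on_le[OF assms] by (simp add: emeasure_count_space)
qed (simp add: emeasure_count_space)

text \<open>The number of points in a fibre need not be measurable in the base point. The comparison is
  valid nevertheless: for arbitrary functions the integral is the lower integral, which is monotone.\<close>

lemma fibre_count_mono:
  assumes "\<And>x. x \<in> space m \<Longrightarrow> \<exists>h. inj_on h {\<gamma>\<in>C. p \<gamma> = x} \<and> h ` {\<gamma>\<in>C. p \<gamma> = x} \<subseteq> {\<gamma>\<in>D. q \<gamma> = x}"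
  shows "fibre_count p m C \<le> fibre_count q m D"
  unfolding fibre_count_def by (rule nn_integral_mono) (use assms emeasure_count_inj_le in blast)

lemma fibre_count_eq_0:
  assumes "AE x in m. {\<gamma>\<in>C. p \<gamma> = x} = {}"
  shows "fibre_count p m C = 0"
proof -
  have "fibre_count p m C \<le> (\<integral>\<^sup>+ x. 0 \<partial>m)"
    unfolding fibre_count_def
    by (rule nn_integral_mono_AE) (use assms in eventually_elim, simp only: emeasure_empty order_refl)
  then show ?thesis by simp
qed

lemma count_fibre_injective:
  assumes "inj_on p C"
  shows "emeasure (count_space UNIV) {\<gamma>\<in>C. p \<gamma> = x} = indicator (p ` C) x"
proof (cases "x \<in> p ` C")
  case True
  then obtain \<gamma> where "\<gamma> \<in> C" "x = p \<gamma>" by blast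
  then have "{\<gamma>\<in>C. p \<gamma> = x} = {\<gamma>}" using assms by (auto dest: inj_onD)
  then show ?thesis using True by (simp add: emeasure_count_space)
next
  case False
  then have "{\<gamma>\<in>C. p \<gamma> = x} = {}" by blast
  show ?thesis unfolding \<open>{\<gamma>\<in>C. p \<gamma> = x} = {}\<close> using False by simp
qed

lemma fibre_count_injective:
  assumes "inj_on p C" "p ` C \<in> sets m"
  shows "fibre_count p m C = emeasure m (p ` C)"
  unfolding fibre_count_def count_fibre_injective[OF assms(1)] using assms(2) by simp

locale pmp_groupoid =
  fixes G :: "('g, 'x) groupoid"
  assumes pmp: "countable_pmp_groupoid G"
begin

abbreviation "ars \<equiv> space (arrows G)"

lemma borel: "borel_groupoid G" and prob: "prob_space (units G)"
  and countable_rng: "x \<in> space (units G) \<Longrightarrow> countable {\<gamma>\<in>ars. rng G \<gamma> = x}"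
  using pmp unfolding countable_pmp_groupoid_def by simp_all

lemma emeasure_rng: "C \<in> sets (arrows G) \<Longrightarrow> emeasure (arrows G) C = fibre_count (rng G) (units G) C"
  and emeasure_src: "C \<in> sets (arrows G) \<Longrightarrow> emeasure (arrows G) C = fibre_count (src G) (units G) C"
proof -
  have *: "\<forall>C\<in>sets (arrows G). emeasure (arrows G) C = fibre_count (rng G) (units G) C \<and>
      emeasure (arrows G) C = fibre_count (src G) (units G) C"
    using pmp unfolding countable_pmp_groupoid_def by (elim conjE)
  assume "C \<in> sets (arrows G)"
  with * have **: "emeasure (arrows G) C = fibre_count (rng G) (units G) C \<and>
      emeasure (arrows G) C = fibre_count (src G) (units G) C" by (rule bspec)
  show "emeasure (arrows G) C = fibre_count (rng G) (units G) C" using ** by (rule conjunct1)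
  show "emeasure (arrows G) C = fibre_count (src G) (units G) C" using ** by (rule conjunct2)
qed

sublocale units: prob_space "units G" by (rule prob)

lemma algebraic: "algebraic_groupoid G"
  and std_arrows: "standard_borel (arrows G)" and std_units: "standard_borel (units G)"
  and src_meas [measurable]: "src G \<in> arrows G \<rightarrow>\<^sub>M units G"
  and rng_meas [measurable]: "rng G \<in> arrows G \<rightarrow>\<^sub>M units G"
  and inv_meas [measurable]: "ginv G \<in> arrows G \<rightarrow>\<^sub>M arrows G"
  and mul_meas: "(\<lambda>(\<alpha>, \<beta>). gmul G \<alpha> \<beta>) \<in>
       restrict_space (arrows G \<Otimes>\<^sub>M arrows G) {(\<alpha>, \<beta>). src G \<alpha> = rng G \<beta>} \<rightarrow>\<^sub>M arrows G"
  using borel unfolding borel_groupoid_def by simp_all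

lemma src_sp [simp]: "\<gamma> \<in> ars \<Longrightarrow> src G \<gamma> \<in> space (units G)"
  and rng_sp [simp]: "\<gamma> \<in> ars \<Longrightarrow> rng G \<gamma> \<in> space (units G)"
  and inv_sp [simp]: "\<gamma> \<in> ars \<Longrightarrow> ginv G \<gamma> \<in> ars"
  and src_inv [simp]: "\<gamma> \<in> ars \<Longrightarrow> src G (ginv G \<gamma>) = rng G \<gamma>"
  and rng_inv [simp]: "\<gamma> \<in> ars \<Longrightarrow> rng G (ginv G \<gamma>) = src G \<gamma>"
  and mul_inv_r: "\<gamma> \<in> ars \<Longrightarrow> gmul G \<gamma> (ginv G \<gamma>) = gunit G (rng G \<gamma>)"
  and mul_inv_l: "\<gamma> \<in> ars \<Longrightarrow> gmul G (ginv G \<gamma>) \<gamma> = gunit G (src G \<gamma>)"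
  and mul_unit_r: "\<gamma> \<in> ars \<Longrightarrow> gmul G \<gamma> (gunit G (src G \<gamma>)) = \<gamma>"
  and mul_unit_l: "\<gamma> \<in> ars \<Longrightarrow> gmul G (gunit G (rng G \<gamma>)) \<gamma> = \<gamma>"
  using algebraic unfolding algebraic_groupoid_def by (simp_all add: Pi_iff)

lemma mul_sp [simp]: "\<alpha> \<in> ars \<Longrightarrow> \<beta> \<in> ars \<Longrightarrow> src G \<alpha> = rng G \<beta> \<Longrightarrow> gmul G \<alpha> \<beta> \<in> ars"
  and src_mul [simp]: "\<alpha> \<in> ars \<Longrightarrow> \<beta> \<in> ars \<Longrightarrow> src G \<alpha> = rng G \<beta> \<Longrightarrow> src G (gmul G \<alpha> \<beta>) = src G \<beta>"
  and rng_mul [simp]: "\<alpha> \<in> ars \<Longrightarrow> \<beta> \<in> ars \<Longrightarrow> src G \<alpha> = rng G \<beta> \<Longrightarrow> rng G (gmul G \<alpha> \<beta>) = rng G \<alpha>"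
  and mul_assoc: "\<alpha> \<in> ars \<Longrightarrow> \<beta> \<in> ars \<Longrightarrow> \<gamma> \<in> ars \<Longrightarrow> src G \<alpha> = rng G \<beta> \<Longrightarrow> src G \<beta> = rng G \<gamma> \<Longrightarrow>
        gmul G (gmul G \<alpha> \<beta>) \<gamma> = gmul G \<alpha> (gmul G \<beta> \<gamma>)"
  using algebraic unfolding algebraic_groupoid_def by simp_all

lemma cancel_left: "\<alpha> \<in> ars \<Longrightarrow> \<beta> \<in> ars \<Longrightarrow> src G \<alpha> = rng G \<beta> \<Longrightarrow> gmul G (ginv G \<alpha>) (gmul G \<alpha> \<beta>) = \<beta>"
  using mul_assoc[of "ginv G \<alpha>" \<alpha> \<beta>] by (simp add: mul_inv_l mul_unit_l)

lemma cancel_right: "\<alpha> \<in> ars \<Longrightarrow> \<beta> \<in> ars \<Longrightarrow> src G \<alpha> = rng G \<beta> \<Longrightarrow> gmul G (gmul G \<alpha> \<beta>) (ginv G \<beta>) = \<alpha>"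
  using mul_assoc[of \<alpha> \<beta> "ginv G \<beta>"] by (simp add: mul_inv_r) (metis mul_unit_r)

lemma inv_inv: "\<gamma> \<in> ars \<Longrightarrow> ginv G (ginv G \<gamma>) = \<gamma>"
  using cancel_left[of "ginv G \<gamma>" \<gamma>] mul_unit_r[of "ginv G (ginv G \<gamma>)"] by (simp add: mul_inv_l)

lemma cancel_left': "\<alpha> \<in> ars \<Longrightarrow> \<beta> \<in> ars \<Longrightarrow> rng G \<alpha> = rng G \<beta> \<Longrightarrow> gmul G \<alpha> (gmul G (ginv G \<alpha>) \<beta>) = \<beta>"
  using cancel_left[of "ginv G \<alpha>" \<beta>] by (simp add: inv_inv)

lemma to_sets [measurable]: "B \<in> sets (units G) \<Longrightarrow> arrows_to G B \<in> sets (arrows G)"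
  unfolding arrows_to_def using measurable_sets[OF rng_meas, of B] by (simp add: vimage_def Int_def conj_commute)

lemma from_sets [measurable]: "B \<in> sets (units G) \<Longrightarrow> arrows_from G B \<in> sets (arrows G)"
  unfolding arrows_from_def using measurable_sets[OF src_meas, of B] by (simp add: vimage_def Int_def conj_commute)

lemma to_null: "N \<in> null_sets (units G) \<Longrightarrow> arrows_to G N \<in> null_sets (arrows G)"
proof (rule null_setsI)
  assume N: "N \<in> null_sets (units G)"
  then show "arrows_to G N \<in> sets (arrows G)" by auto
  have "AE x in units G. {\<gamma> \<in> arrows_to G N. rng G \<gamma> = x} = {}"
    using AE_not_in[OF N] by eventually_elim (auto simp: arrows_to_def)
  then show "emeasure (arrows G) (arrows_to G N) = 0"
    using N by (subst emeasure_rng) (auto intro: fibre_count_eq_0)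
qed

lemma from_null: "N \<in> null_sets (units G) \<Longrightarrow> arrows_from G N \<in> null_sets (arrows G)"
proof (rule null_setsI)
  assume N: "N \<in> null_sets (units G)"
  then show "arrows_from G N \<in> sets (arrows G)" by auto
  have "AE x in units G. {\<gamma> \<in> arrows_from G N. src G \<gamma> = x} = {}"
    using AE_not_in[OF N] by eventually_elim (auto simp: arrows_from_def)
  then show "emeasure (arrows G) (arrows_from G N) = 0"
    using N by (subst emeasure_src) (auto intro: fibre_count_eq_0)
qed

lemma AE_rng: "AE x in units G. P x \<Longrightarrow> AE \<gamma> in arrows G. P (rng G \<gamma>)"
proof (erule AE_E3)
  fix N assume N: "\<And>x. x \<in> space (units G) - N \<Longrightarrow> P x" "N \<in> null_sets (units G)"
  have "AE \<gamma> in arrows G. \<gamma> \<notin> arrows_to G N" using to_null[OF N(2)] by (rule AE_not_in)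
  then show ?thesis by (rule AE_mp) (auto intro!: AE_I2 N(1) simp: arrows_to_def)
qed

lemma AE_src: "AE x in units G. P x \<Longrightarrow> AE \<gamma> in arrows G. P (src G \<gamma>)"
proof (erule AE_E3)
  fix N assume N: "\<And>x. x \<in> space (units G) - N \<Longrightarrow> P x" "N \<in> null_sets (units G)"
  have "AE \<gamma> in arrows G. \<gamma> \<notin> arrows_from G N" using from_null[OF N(2)] by (rule AE_not_in)
  then show ?thesis by (rule AE_mp) (auto intro!: AE_I2 N(1) simp: arrows_from_def)
qed

lemma rng_image: "C \<in> sets (arrows G) \<Longrightarrow> inj_on (rng G) C \<Longrightarrow> rng G ` C \<in> sets (units G)"
  by (rule injective_image_measurable[OF std_arrows std_units rng_meas])

lemma src_image: "C \<in> sets (arrows G) \<Longrightarrow> inj_on (src G) C \<Longrightarrow> src G ` C \<in> sets (units G)"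
  by (rule injective_image_measurable[OF std_arrows std_units src_meas])

lemma emeasure_rng_image:
  "C \<in> sets (arrows G) \<Longrightarrow> inj_on (rng G) C \<Longrightarrow> emeasure (units G) (rng G ` C) = emeasure (arrows G) C"
  by (simp add: emeasure_rng fibre_count_injective rng_image)

lemma emeasure_src_image:
  "C \<in> sets (arrows G) \<Longrightarrow> inj_on (src G) C \<Longrightarrow> emeasure (units G) (src G ` C) = emeasure (arrows G) C"
  by (simp add: emeasure_src fibre_count_injective src_image)

lemma bisection_sets: "\<theta> \<in> local_bisections G \<Longrightarrow> \<theta> \<in> sets (arrows G)"
  and bisection_inj_src: "\<theta> \<in> local_bisections G \<Longrightarrow> inj_on (src G) \<theta>"
  and bisection_inj_rng: "\<theta> \<in> local_bisections G \<Longrightarrow> inj_on (rng G) \<theta>"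
  by (auto simp: local_bisections_def)

lemma bisection_sub: "\<theta> \<in> local_bisections G \<Longrightarrow> \<gamma> \<in> \<theta> \<Longrightarrow> \<gamma> \<in> ars"
  using bisection_sets sets.sets_into_space by blast

lemma bisection_Int: "\<theta> \<in> local_bisections G \<Longrightarrow> C \<in> sets (arrows G) \<Longrightarrow> \<theta> \<inter> C \<in> local_bisections G"
  unfolding local_bisections_def by (auto intro: inj_on_subset)

lemma bisection_rng: "\<theta> \<in> local_bisections G \<Longrightarrow> rng G ` \<theta> \<in> sets (units G)"
  and bisection_src: "\<theta> \<in> local_bisections G \<Longrightarrow> src G ` \<theta> \<in> sets (units G)"
  using rng_image src_image bisection_sets bisection_inj_rng bisection_inj_src by blast+

lemma inv_inj: "inj_on (ginv G) ars"
  by (rule inj_onI) (metis inv_inv)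

text \<open>Arrows lying in a section \<open>D n\<close> of the range map and in the inverse \<open>E m\<close> of such a section form
  a local bisection. The null set \<open>N\<close> also contains the end points of the arrows that are lost
  because their other end lies in the exceptional set \<open>N0\<close>; hence it suffices that one end of an
  arrow avoids \<open>N\<close>.\<close>

lemma bisection_cover:
  obtains \<theta> :: "nat \<Rightarrow> 'g set" and N where
    "\<And>n. \<theta> n \<in> local_bisections G" "disjoint_family \<theta>" "N \<in> null_sets (units G)"
    "\<And>\<gamma>. \<gamma> \<in> ars \<Longrightarrow> src G \<gamma> \<notin> N \<or> rng G \<gamma> \<notin> N \<Longrightarrow> \<exists>n. \<gamma> \<in> \<theta> n"
proof -
  obtain D :: "nat \<Rightarrow> 'g set" and N0 where D: "\<And>n. D n \<in> sets (arrows G)" "\<And>n. inj_on (rng G) (D n)"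
    and N0: "N0 \<in> null_sets (units G)"
    and cover: "\<And>y. y \<in> ars \<Longrightarrow> rng G y \<notin> N0 \<Longrightarrow> \<exists>n. y \<in> D n"
    using countable_to_one_sections[OF std_arrows std_units units.finite_measure_axioms rng_meas countable_rng]
    by blast
  have Dars: "D n \<subseteq> ars" for n using D(1) by (rule sets.sets_into_space)
  define E where "E n = ginv G -` D n \<inter> ars" for n
  have E: "E n \<in> sets (arrows G)" for n unfolding E_def by (rule measurable_sets[OF inv_meas D(1)])
  have E_inj: "inj_on (src G) (E n)" for n
  proof (rule inj_onI)
    fix \<gamma> \<gamma>' assume *: "\<gamma> \<in> E n" "\<gamma>' \<in> E n" "src G \<gamma> = src G \<gamma>'"
    then have "rng G (ginv G \<gamma>) = rng G (ginv G \<gamma>')" by (simp add: E_def)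
    from inj_onD[OF D(2)[of n] this] have "ginv G \<gamma> = ginv G \<gamma>'" using * by (simp add: E_def)
    from inj_onD[OF inv_inj this] show "\<gamma> = \<gamma>'" using * by (simp add: E_def)
  qed
  define P where "P i = D (fst (prod_decode i)) \<inter> E (snd (prod_decode i))" for i
  have P: "P i \<in> local_bisections G" for i
    unfolding P_def local_bisections_def
    using D E E_inj by (auto intro: inj_on_subset[OF D(2)] inj_on_subset[OF E_inj])
  define N where "N = N0 \<union> (\<Union>n. src G ` (E n \<inter> arrows_to G N0)) \<union> (\<Union>n. rng G ` (D n \<inter> arrows_from G N0))"
  have "src G ` (E n \<inter> arrows_to G N0) \<in> null_sets (units G)" for n
  proof (rule null_setsI)
    have C: "E n \<inter> arrows_to G N0 \<in> sets (arrows G)" "inj_on (src G) (E n \<inter> arrows_to G N0)"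
      using E to_null[OF N0] by (auto intro: inj_on_subset[OF E_inj])
    show "src G ` (E n \<inter> arrows_to G N0) \<in> sets (units G)" by (rule src_image[OF C])
    show "emeasure (units G) (src G ` (E n \<inter> arrows_to G N0)) = 0"
      unfolding emeasure_src_image[OF C]
      using null_set_Int1[OF to_null[OF N0] E, of n] by (auto simp: Int_commute)
  qed
  moreover have "rng G ` (D n \<inter> arrows_from G N0) \<in> null_sets (units G)" for n
  proof (rule null_setsI)
    have C: "D n \<inter> arrows_from G N0 \<in> sets (arrows G)" "inj_on (rng G) (D n \<inter> arrows_from G N0)"
      using D(1) from_null[OF N0] by (auto intro: inj_on_subset[OF D(2)])
    show "rng G ` (D n \<inter> arrows_from G N0) \<in> sets (units G)" by (rule rng_image[OF C])
    show "emeasure (units G) (rng G ` (D n \<inter> arrows_from G N0)) = 0"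
      unfolding emeasure_rng_image[OF C]
      using null_set_Int1[OF from_null[OF N0] D(1), of n] by (auto simp: Int_commute)
  qed
  ultimately have N: "N \<in> null_sets (units G)"
    unfolding N_def using N0 by (intro null_sets.Un null_sets_UN) auto
  have PN: "\<exists>i. \<gamma> \<in> P i" if \<gamma>: "\<gamma> \<in> ars" "src G \<gamma> \<notin> N \<or> rng G \<gamma> \<notin> N" for \<gamma>
  proof -
    have inE: "\<exists>n. \<gamma> \<in> E n" if "src G \<gamma> \<notin> N0"
      using cover[of "ginv G \<gamma>"] \<gamma>(1) that by (auto simp: E_def)
    have inD: "\<exists>n. \<gamma> \<in> D n" if "rng G \<gamma> \<notin> N0"
      using cover[of \<gamma>] \<gamma>(1) that by auto
    have "src G \<gamma> \<notin> N0 \<and> rng G \<gamma> \<notin> N0"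
      using \<gamma>(2)
    proof
      assume s: "src G \<gamma> \<notin> N"
      then obtain n where "\<gamma> \<in> E n" using inE by (auto simp: N_def)
      then show ?thesis using s \<gamma>(1) unfolding N_def arrows_to_def by blast
    next
      assume s: "rng G \<gamma> \<notin> N"
      then obtain n where "\<gamma> \<in> D n" using inD by (auto simp: N_def)
      then show ?thesis using s \<gamma>(1) unfolding N_def arrows_from_def by blast
    qed
    then obtain n m where "\<gamma> \<in> D n" "\<gamma> \<in> E m" using inD inE by blast
    then show ?thesis by (intro exI[of _ "prod_encode (n, m)"]) (simp add: P_def)
  qed
  show ?thesis
  proof (rule that[of "disjointed P" N])
    show "disjointed P n \<in> local_bisections G" for n
    proof -
      have "disjointed P n = P n \<inter> disjointed P n" using disjointed_subset[of P n] by blast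
      moreover have "disjointed P n \<in> sets (arrows G)"
        using sets.range_disjointed_sets[of P "arrows G"] bisection_sets[OF P] by blast
      ultimately show ?thesis using bisection_Int[OF P[of n], of "disjointed P n"] by simp
    qed
    show "disjoint_family (disjointed P)" by (rule disjoint_family_disjointed)
    show "\<exists>n. \<gamma> \<in> disjointed P n" if "\<gamma> \<in> ars" "src G \<gamma> \<notin> N \<or> rng G \<gamma> \<notin> N" for \<gamma>
      using PN[OF that] UN_disjointed_eq[of P] by blast
  qed (rule N)
qed

text \<open>The arrow of \<open>\<theta>\<close> with a given range.\<close>

definition sec :: "'g set \<Rightarrow> 'x \<Rightarrow> 'g" where
  "sec \<theta> = the_inv_into \<theta> (rng G)"

lemma sec_eq: "\<theta> \<in> local_bisections G \<Longrightarrow> \<beta> \<in> \<theta> \<Longrightarrow> sec \<theta> (rng G \<beta>) = \<beta>"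
  unfolding sec_def by (rule the_inv_into_f_f[OF bisection_inj_rng])

lemma sec_in: "\<theta> \<in> local_bisections G \<Longrightarrow> x \<in> rng G ` \<theta> \<Longrightarrow> sec \<theta> x \<in> \<theta>"
  and rng_sec [simp]: "\<theta> \<in> local_bisections G \<Longrightarrow> x \<in> rng G ` \<theta> \<Longrightarrow> rng G (sec \<theta> x) = x"
  and sec_sp: "\<theta> \<in> local_bisections G \<Longrightarrow> x \<in> rng G ` \<theta> \<Longrightarrow> sec \<theta> x \<in> ars"
  using sec_eq bisection_sub by fastforce+

definition shift_right :: "'g set \<Rightarrow> 'g \<Rightarrow> 'g" where
  "shift_right \<theta> \<gamma> = gmul G \<gamma> (sec \<theta> (src G \<gamma>))"

definition shift_left :: "'g set \<Rightarrow> 'g \<Rightarrow> 'g" where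
  "shift_left \<theta> \<gamma> = gmul G (ginv G (sec \<theta> (rng G \<gamma>))) \<gamma>"

lemma right_translate_eq:
  "right_translate G \<theta> f \<gamma> = (if src G \<gamma> \<in> rng G ` \<theta> then f (shift_right \<theta> \<gamma>) else 0)"
  by (simp add: right_translate_def shift_right_def sec_def)

lemma left_translate_eq:
  "left_translate G \<theta> f \<gamma> = (if rng G \<gamma> \<in> rng G ` \<theta> then f (shift_left \<theta> \<gamma>) else 0)"
  by (simp add: left_translate_def shift_left_def sec_def)

lemma shift_right_props:
  assumes "\<theta> \<in> local_bisections G" "\<gamma> \<in> ars" "src G \<gamma> \<in> rng G ` \<theta>"
  shows "shift_right \<theta> \<gamma> \<in> ars" "rng G (shift_right \<theta> \<gamma>) = rng G \<gamma>"
    "src G (shift_right \<theta> \<gamma>) = src G (sec \<theta> (src G \<gamma>))"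
  unfolding shift_right_def using assms sec_sp[OF assms(1,3)] by simp_all

lemma shift_left_props:
  assumes "\<theta> \<in> local_bisections G" "\<gamma> \<in> ars" "rng G \<gamma> \<in> rng G ` \<theta>"
  shows "shift_left \<theta> \<gamma> \<in> ars" "src G (shift_left \<theta> \<gamma>) = src G \<gamma>"
    "rng G (shift_left \<theta> \<gamma>) = src G (sec \<theta> (rng G \<gamma>))"
  unfolding shift_left_def using assms sec_sp[OF assms(1,3)] by simp_all

lemma recover_right:
  assumes "\<theta> \<in> local_bisections G" "\<gamma> \<in> ars" "src G \<gamma> \<in> rng G ` \<theta>"
  shows "gmul G (shift_right \<theta> \<gamma>) (ginv G (sec \<theta> (src G \<gamma>))) = \<gamma>"
  unfolding shift_right_def by (rule cancel_right) (use assms sec_sp[OF assms(1,3)] in simp_all)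

lemma recover_left:
  assumes "\<theta> \<in> local_bisections G" "\<gamma> \<in> ars" "rng G \<gamma> \<in> rng G ` \<theta>"
  shows "gmul G (sec \<theta> (rng G \<gamma>)) (shift_left \<theta> \<gamma>) = \<gamma>"
  unfolding shift_left_def by (rule cancel_left') (use assms sec_sp[OF assms(1,3)] in simp_all)

text \<open>The preimage of \<open>C\<close> is the injective image \<open>rng G ` (\<theta> \<inter> C)\<close>, whence measurable.\<close>

lemma sec_meas:
  assumes \<theta>: "\<theta> \<in> local_bisections G"
  shows "sec \<theta> \<in> restrict_space (units G) (rng G ` \<theta>) \<rightarrow>\<^sub>M arrows G"
proof (rule measurableI)
  fix x assume "x \<in> space (restrict_space (units G) (rng G ` \<theta>))"
  then show "sec \<theta> x \<in> ars" using sec_sp[OF \<theta>] by (simp add: space_restrict_space)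
next
  fix C assume C: "C \<in> sets (arrows G)"
  have sp: "rng G ` \<theta> \<in> sets (units G)" by (rule bisection_rng[OF \<theta>])
  have "sec \<theta> -` C \<inter> space (restrict_space (units G) (rng G ` \<theta>)) = rng G ` (\<theta> \<inter> C)"
  proof -
    have "sec \<theta> -` C \<inter> rng G ` \<theta> = rng G ` (\<theta> \<inter> C)"
      using sec_eq[OF \<theta>] by force
    then show ?thesis using sets.sets_into_space[OF sp] by (simp add: space_restrict_space Int_absorb1 Int_absorb2)
  qed
  also have "\<dots> \<in> sets (restrict_space (units G) (rng G ` \<theta>))"
  proof -
    have "rng G ` (\<theta> \<inter> C) \<in> sets (units G)" by (rule bisection_rng[OF bisection_Int[OF \<theta> C]])
    then show ?thesis using sp by (subst sets_restrict_space_iff) auto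
  qed
  finally show "sec \<theta> -` C \<inter> space (restrict_space (units G) (rng G ` \<theta>)) \<in> sets (restrict_space (units G) (rng G ` \<theta>))" .
qed

lemma shift_right_meas:
  assumes \<theta>: "\<theta> \<in> local_bisections G"
  shows "shift_right \<theta> \<in> restrict_space (arrows G) (arrows_from G (rng G ` \<theta>)) \<rightarrow>\<^sub>M arrows G"
proof -
  let ?R = "restrict_space (arrows G) (arrows_from G (rng G ` \<theta>))"
  have sp: "\<And>\<gamma>. \<gamma> \<in> space ?R \<Longrightarrow> \<gamma> \<in> ars \<and> src G \<gamma> \<in> rng G ` \<theta>" by (simp add: space_restrict_space arrows_from_def)
  have id: "(\<lambda>\<gamma>. \<gamma>) \<in> ?R \<rightarrow>\<^sub>M arrows G" by (rule measurable_restrict_space1) simp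
  have "src G \<in> ?R \<rightarrow>\<^sub>M restrict_space (units G) (rng G ` \<theta>)"
    by (rule measurable_restrict_space2) (use sp in \<open>auto intro: measurable_restrict_space1\<close>)
  then have s: "(\<lambda>\<gamma>. sec \<theta> (src G \<gamma>)) \<in> ?R \<rightarrow>\<^sub>M arrows G"
    by (rule measurable_compose[OF _ sec_meas[OF \<theta>]])
  have "(\<lambda>\<gamma>. (\<gamma>, sec \<theta> (src G \<gamma>))) \<in> ?R \<rightarrow>\<^sub>M restrict_space (arrows G \<Otimes>\<^sub>M arrows G) {(\<alpha>, \<beta>). src G \<alpha> = rng G \<beta>}"
    by (rule measurable_restrict_space2) (use sp \<theta> in \<open>auto intro!: measurable_Pair id s\<close>)
  from measurable_compose[OF this mul_meas] show ?thesis
    by (simp add: shift_right_def[abs_def])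
qed

lemma shift_left_meas:
  assumes \<theta>: "\<theta> \<in> local_bisections G"
  shows "shift_left \<theta> \<in> restrict_space (arrows G) (arrows_to G (rng G ` \<theta>)) \<rightarrow>\<^sub>M arrows G"
proof -
  let ?R = "restrict_space (arrows G) (arrows_to G (rng G ` \<theta>))"
  have sp: "\<And>\<gamma>. \<gamma> \<in> space ?R \<Longrightarrow> \<gamma> \<in> ars \<and> rng G \<gamma> \<in> rng G ` \<theta>" by (simp add: space_restrict_space arrows_to_def)
  have id: "(\<lambda>\<gamma>. \<gamma>) \<in> ?R \<rightarrow>\<^sub>M arrows G" by (rule measurable_restrict_space1) simp
  have "rng G \<in> ?R \<rightarrow>\<^sub>M restrict_space (units G) (rng G ` \<theta>)"
    by (rule measurable_restrict_space2) (use sp in \<open>auto intro: measurable_restrict_space1\<close>)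
  then have s: "(\<lambda>\<gamma>. ginv G (sec \<theta> (rng G \<gamma>))) \<in> ?R \<rightarrow>\<^sub>M arrows G"
    by (rule measurable_compose[OF measurable_compose[OF _ sec_meas[OF \<theta>]] inv_meas])
  have "(\<lambda>\<gamma>. (ginv G (sec \<theta> (rng G \<gamma>)), \<gamma>)) \<in> ?R \<rightarrow>\<^sub>M restrict_space (arrows G \<Otimes>\<^sub>M arrows G) {(\<alpha>, \<beta>). src G \<alpha> = rng G \<beta>}"
    by (rule measurable_restrict_space2) (use sp \<theta> sec_sp in \<open>auto intro!: measurable_Pair id s\<close>)
  from measurable_compose[OF this mul_meas] show ?thesis
    by (simp add: shift_left_def[abs_def])
qed

lemma right_translate_meas:
  assumes \<theta>: "\<theta> \<in> local_bisections G" and f: "f \<in> borel_measurable (arrows G)"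
  shows "right_translate G \<theta> f \<in> borel_measurable (arrows G)"
proof -
  have S: "arrows_from G (rng G ` \<theta>) \<in> sets (arrows G)" by (intro from_sets bisection_rng \<theta>)
  have "(\<lambda>\<gamma>. if \<gamma> \<in> arrows_from G (rng G ` \<theta>) then f (shift_right \<theta> \<gamma>) else 0) \<in> borel_measurable (arrows G)"
    using measurable_compose[OF shift_right_meas[OF \<theta>] f] S
    by (subst measurable_If_restrict_space_iff) (auto intro: measurable_restrict_space1)
  then show ?thesis
    by (rule measurable_cong[THEN iffD1, rotated]) (simp add: right_translate_eq arrows_from_def)
qed

lemma left_translate_meas:
  assumes \<theta>: "\<theta> \<in> local_bisections G" and f: "f \<in> borel_measurable (arrows G)"
  shows "left_translate G \<theta> f \<in> borel_measurable (arrows G)"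
proof -
  have S: "arrows_to G (rng G ` \<theta>) \<in> sets (arrows G)" by (intro to_sets bisection_rng \<theta>)
  have "(\<lambda>\<gamma>. if \<gamma> \<in> arrows_to G (rng G ` \<theta>) then f (shift_left \<theta> \<gamma>) else 0) \<in> borel_measurable (arrows G)"
    using measurable_compose[OF shift_left_meas[OF \<theta>] f] S
    by (subst measurable_If_restrict_space_iff) (auto intro: measurable_restrict_space1)
  then show ?thesis
    by (rule measurable_cong[THEN iffD1, rotated]) (simp add: left_translate_eq arrows_to_def)
qed

definition right_preimage :: "'g set \<Rightarrow> 'g set \<Rightarrow> 'g set" where
  "right_preimage \<theta> C = {\<gamma>\<in>arrows_from G (rng G ` \<theta>). shift_right \<theta> \<gamma> \<in> C}"

definition left_preimage :: "'g set \<Rightarrow> 'g set \<Rightarrow> 'g set" where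
  "left_preimage \<theta> C = {\<gamma>\<in>arrows_to G (rng G ` \<theta>). shift_left \<theta> \<gamma> \<in> C}"

text \<open>A right shift preserves the range and is injective, so the fibres of the range map cannot
  grow; for left shifts the same holds with the source map.\<close>

lemma right_preimage:
  assumes \<theta>: "\<theta> \<in> local_bisections G" and C: "C \<in> sets (arrows G)"
  shows "right_preimage \<theta> C \<in> sets (arrows G)" "emeasure (arrows G) (right_preimage \<theta> C) \<le> emeasure (arrows G) C"
proof -
  let ?S = "arrows_from G (rng G ` \<theta>)"
  have S: "?S \<in> sets (arrows G)" by (intro from_sets bisection_rng \<theta>)
  have "shift_right \<theta> -` C \<inter> space (restrict_space (arrows G) ?S) \<in> sets (restrict_space (arrows G) ?S)"
    by (rule measurable_sets[OF shift_right_meas[OF \<theta>] C])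
  moreover have "shift_right \<theta> -` C \<inter> space (restrict_space (arrows G) ?S) = right_preimage \<theta> C"
    by (auto simp: right_preimage_def space_restrict_space arrows_from_def)
  ultimately show *: "right_preimage \<theta> C \<in> sets (arrows G)"
    using S by (simp add: sets_restrict_space_iff)
  show "emeasure (arrows G) (right_preimage \<theta> C) \<le> emeasure (arrows G) C"
    unfolding emeasure_rng[OF *] emeasure_rng[OF C]
  proof (rule fibre_count_mono, intro exI conjI)
    fix x
    have "inj_on (shift_right \<theta>) {\<gamma> \<in> ars. src G \<gamma> \<in> rng G ` \<theta> \<and> rng G \<gamma> = x}"
    proof (rule inj_onI)
      fix \<gamma> \<gamma>' assume \<gamma>: "\<gamma> \<in> {\<gamma> \<in> ars. src G \<gamma> \<in> rng G ` \<theta> \<and> rng G \<gamma> = x}"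
        "\<gamma>' \<in> {\<gamma> \<in> ars. src G \<gamma> \<in> rng G ` \<theta> \<and> rng G \<gamma> = x}" and eq: "shift_right \<theta> \<gamma> = shift_right \<theta> \<gamma>'"
      let ?b = "sec \<theta> (src G \<gamma>)" and ?b' = "sec \<theta> (src G \<gamma>')"
      have "src G ?b = src G ?b'"
        using shift_right_props(3)[OF \<theta>, of \<gamma>] shift_right_props(3)[OF \<theta>, of \<gamma>'] \<gamma> eq by simp
      moreover have "?b \<in> \<theta>" "?b' \<in> \<theta>" using sec_in[OF \<theta>] \<gamma> by auto
      ultimately have b: "?b = ?b'" by (rule inj_onD[OF bisection_inj_src[OF \<theta>]])
      have "\<gamma> = gmul G (shift_right \<theta> \<gamma>) (ginv G ?b)" by (rule recover_right[OF \<theta>, symmetric]) (use \<gamma> in auto)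
      also have "\<dots> = gmul G (shift_right \<theta> \<gamma>') (ginv G ?b')" by (simp only: eq b)
      also have "\<dots> = \<gamma>'" by (rule recover_right[OF \<theta>]) (use \<gamma> in auto)
      finally show "\<gamma> = \<gamma>'" .
    qed
    then show "inj_on (shift_right \<theta>) {\<gamma> \<in> right_preimage \<theta> C. rng G \<gamma> = x}"
      by (rule inj_on_subset) (auto simp: right_preimage_def arrows_from_def)
    show "shift_right \<theta> ` {\<gamma> \<in> right_preimage \<theta> C. rng G \<gamma> = x} \<subseteq> {\<gamma> \<in> C. rng G \<gamma> = x}"
      using shift_right_props[OF \<theta>] by (auto simp: right_preimage_def arrows_from_def)
  qed
qed

lemma left_preimage:
  assumes \<theta>: "\<theta> \<in> local_bisections G" and C: "C \<in> sets (arrows G)"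
  shows "left_preimage \<theta> C \<in> sets (arrows G)" "emeasure (arrows G) (left_preimage \<theta> C) \<le> emeasure (arrows G) C"
proof -
  let ?S = "arrows_to G (rng G ` \<theta>)"
  have S: "?S \<in> sets (arrows G)" by (intro to_sets bisection_rng \<theta>)
  have "shift_left \<theta> -` C \<inter> space (restrict_space (arrows G) ?S) \<in> sets (restrict_space (arrows G) ?S)"
    by (rule measurable_sets[OF shift_left_meas[OF \<theta>] C])
  moreover have "shift_left \<theta> -` C \<inter> space (restrict_space (arrows G) ?S) = left_preimage \<theta> C"
    by (auto simp: left_preimage_def space_restrict_space arrows_to_def)
  ultimately show *: "left_preimage \<theta> C \<in> sets (arrows G)"
    using S by (simp add: sets_restrict_space_iff)
  show "emeasure (arrows G) (left_preimage \<theta> C) \<le> emeasure (arrows G) C"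
    unfolding emeasure_src[OF *] emeasure_src[OF C]
  proof (rule fibre_count_mono, intro exI conjI)
    fix x
    have "inj_on (shift_left \<theta>) {\<gamma> \<in> ars. rng G \<gamma> \<in> rng G ` \<theta> \<and> src G \<gamma> = x}"
    proof (rule inj_onI)
      fix \<gamma> \<gamma>' assume \<gamma>: "\<gamma> \<in> {\<gamma> \<in> ars. rng G \<gamma> \<in> rng G ` \<theta> \<and> src G \<gamma> = x}"
        "\<gamma>' \<in> {\<gamma> \<in> ars. rng G \<gamma> \<in> rng G ` \<theta> \<and> src G \<gamma> = x}" and eq: "shift_left \<theta> \<gamma> = shift_left \<theta> \<gamma>'"
      let ?b = "sec \<theta> (rng G \<gamma>)" and ?b' = "sec \<theta> (rng G \<gamma>')"
      have "src G ?b = src G ?b'"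
        using shift_left_props(3)[OF \<theta>, of \<gamma>] shift_left_props(3)[OF \<theta>, of \<gamma>'] \<gamma> eq by simp
      moreover have "?b \<in> \<theta>" "?b' \<in> \<theta>" using sec_in[OF \<theta>] \<gamma> by auto
      ultimately have b: "?b = ?b'" by (rule inj_onD[OF bisection_inj_src[OF \<theta>]])
      have "\<gamma> = gmul G ?b (shift_left \<theta> \<gamma>)" by (rule recover_left[OF \<theta>, symmetric]) (use \<gamma> in auto)
      also have "\<dots> = gmul G ?b' (shift_left \<theta> \<gamma>')" by (simp only: eq b)
      also have "\<dots> = \<gamma>'" by (rule recover_left[OF \<theta>]) (use \<gamma> in auto)
      finally show "\<gamma> = \<gamma>'" .
    qed
    then show "inj_on (shift_left \<theta>) {\<gamma> \<in> left_preimage \<theta> C. src G \<gamma> = x}"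
      by (rule inj_on_subset) (auto simp: left_preimage_def arrows_to_def)
    show "shift_left \<theta> ` {\<gamma> \<in> left_preimage \<theta> C. src G \<gamma> = x} \<subseteq> {\<gamma> \<in> C. src G \<gamma> = x}"
      using shift_left_props[OF \<theta>] by (auto simp: left_preimage_def arrows_to_def)
  qed
qed

lemma AE_shift_right:
  assumes \<theta>: "\<theta> \<in> local_bisections G" and P: "AE \<gamma> in arrows G. P \<gamma>"
  shows "AE \<gamma> in arrows G. src G \<gamma> \<in> rng G ` \<theta> \<longrightarrow> P (shift_right \<theta> \<gamma>)"
  using P
proof (rule AE_E3)
  fix N assume N: "\<And>x. x \<in> ars - N \<Longrightarrow> P x" "N \<in> null_sets (arrows G)"
  have "right_preimage \<theta> N \<in> null_sets (arrows G)"
  proof (rule null_setsI)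
    have "N \<in> sets (arrows G)" using N(2) by auto
    from right_preimage[OF \<theta> this] show "emeasure (arrows G) (right_preimage \<theta> N) = 0"
      "right_preimage \<theta> N \<in> sets (arrows G)" using null_setsD1[OF N(2)] by simp_all
  qed
  from AE_not_in[OF this] show ?thesis
    by (rule AE_mp) (auto intro!: AE_I2 N(1) shift_right_props[OF \<theta>] simp: right_preimage_def arrows_from_def)
qed

lemma AE_shift_left:
  assumes \<theta>: "\<theta> \<in> local_bisections G" and P: "AE \<gamma> in arrows G. P \<gamma>"
  shows "AE \<gamma> in arrows G. rng G \<gamma> \<in> rng G ` \<theta> \<longrightarrow> P (shift_left \<theta> \<gamma>)"
  using P
proof (rule AE_E3)
  fix N assume N: "\<And>x. x \<in> ars - N \<Longrightarrow> P x" "N \<in> null_sets (arrows G)"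
  have "left_preimage \<theta> N \<in> null_sets (arrows G)"
  proof (rule null_setsI)
    have "N \<in> sets (arrows G)" using N(2) by auto
    from left_preimage[OF \<theta> this] show "emeasure (arrows G) (left_preimage \<theta> N) = 0"
      "left_preimage \<theta> N \<in> sets (arrows G)" using null_setsD1[OF N(2)] by simp_all
  qed
  from AE_not_in[OF this] show ?thesis
    by (rule AE_mp) (auto intro!: AE_I2 N(1) shift_left_props[OF \<theta>] simp: left_preimage_def arrows_to_def)
qed

end

section \<open>The algebras of functions on the arrows\<close>

lemma Linf_meas: "f \<in> Linf M \<Longrightarrow> f \<in> borel_measurable M"
  by (simp add: Linf_def)

lemma LinfI: "f \<in> borel_measurable M \<Longrightarrow> AE x in M. norm (f x) \<le> C \<Longrightarrow> f \<in> Linf M"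
  by (auto simp: Linf_def)

lemma LinfE:
  assumes "f \<in> Linf M"
  obtains C where "0 \<le> C" "AE x in M. norm (f x) \<le> C"
proof -
  obtain C where "AE x in M. norm (f x) \<le> C" using assms by (auto simp: Linf_def)
  then have "AE x in M. norm (f x) \<le> max 0 C" by eventually_elim simp
  then show ?thesis using that[of "max 0 C"] by simp
qed

lemma Linf_AE: "f \<in> Linf M \<Longrightarrow> g \<in> borel_measurable M \<Longrightarrow> AE x in M. g x = f x \<Longrightarrow> g \<in> Linf M"
proof -
  assume f: "f \<in> Linf M" and g: "g \<in> borel_measurable M" "AE x in M. g x = f x"
  obtain C where C: "AE x in M. norm (f x) \<le> C" using f by (rule LinfE)
  have "AE x in M. norm (g x) \<le> C" using C g(2) by eventually_elim simp
  then show ?thesis using g(1) by (intro LinfI)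
qed

lemma Linf_add: "f \<in> Linf M \<Longrightarrow> g \<in> Linf M \<Longrightarrow> (\<lambda>x. f x + g x) \<in> Linf M"
proof -
  assume f: "f \<in> Linf M" and g: "g \<in> Linf M"
  obtain C D where "AE x in M. norm (f x) \<le> C" "AE x in M. norm (g x) \<le> D"
    using f g by (auto elim!: LinfE)
  then have "AE x in M. norm (f x + g x) \<le> C + D"
    by eventually_elim (rule norm_triangle_mono)
  then show ?thesis using Linf_meas[OF f] Linf_meas[OF g] by (intro LinfI) auto
qed

lemma Linf_mult: "f \<in> Linf M \<Longrightarrow> g \<in> Linf M \<Longrightarrow> (\<lambda>x. f x * g x) \<in> Linf M"
proof -
  assume f: "f \<in> Linf M" and g: "g \<in> Linf M"
  obtain C where C: "0 \<le> C" "AE x in M. norm (f x) \<le> C" using f by (rule LinfE)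
  obtain D where D: "AE x in M. norm (g x) \<le> D" using g by (rule LinfE)
  have "AE x in M. norm (f x * g x) \<le> C * D"
    using C(2) D by eventually_elim (use C(1) in \<open>auto simp: norm_mult intro!: mult_mono\<close>)
  then show ?thesis using Linf_meas[OF f] Linf_meas[OF g] by (intro LinfI) auto
qed

lemma Linf_const: "(\<lambda>x. c) \<in> Linf M"
  by (rule LinfI[of _ _ "norm c"]) auto

lemma indicator_Linf: "A \<in> sets M \<Longrightarrow> (\<lambda>x. indicator A x :: complex) \<in> Linf M"
proof (rule LinfI[of _ _ 1])
  show "AE x in M. norm (indicator A x :: complex) \<le> 1" by (intro AE_I2) (simp add: indicator_def)
qed simp

lemma Linf_comp:
  fixes F :: "complex \<Rightarrow> complex"
  assumes F: "continuous_on UNIV F" and f: "f \<in> Linf M"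
  shows "(\<lambda>x. F (f x)) \<in> Linf M"
proof -
  obtain C where C: "AE x in M. norm (f x) \<le> C" using f by (auto elim: LinfE)
  have "compact (F ` cball 0 C)"
    by (intro compact_continuous_image continuous_on_subset[OF F]) auto
  from compact_imp_bounded[OF this] obtain D where D: "\<forall>y\<in>F ` cball 0 C. norm y \<le> D"
    unfolding bounded_iff by blast
  have "AE x in M. norm (F (f x)) \<le> D"
    using C by eventually_elim (rule D[rule_format], simp)
  then show ?thesis
    using borel_measurable_continuous_onI[OF F] Linf_meas[OF f]
    by (intro LinfI measurable_compose[of f M borel F borel]) auto
qed

context pmp_groupoid
begin

text \<open>The single tolerance of \<open>c0\<close> is split: \<open>\<delta>\<close> bounds the measures of the exceptional sets of
  units, \<open>\<epsilon>\<close> the values of the function.\<close>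

definition vanishes :: "real \<Rightarrow> real \<Rightarrow> ('g \<Rightarrow> complex) \<Rightarrow> bool" where
  "vanishes \<delta> \<epsilon> f \<longleftrightarrow> (\<exists>B\<in>sets (units G). \<exists>B'\<in>sets (units G). \<exists>F\<in>sets (arrows G).
     measure (units G) B < \<delta> \<and> measure (units G) B' < \<delta> \<and> emeasure (arrows G) F < \<infinity> \<and>
     (AE \<gamma> in arrows G. rng G \<gamma> \<notin> B \<longrightarrow> src G \<gamma> \<notin> B' \<longrightarrow> \<gamma> \<notin> F \<longrightarrow> norm (f \<gamma>) \<le> \<epsilon>))"

lemma vanishesI:
  assumes "B \<in> sets (units G)" "B' \<in> sets (units G)" "F \<in> sets (arrows G)"
    "measure (units G) B < \<delta>" "measure (units G) B' < \<delta>" "emeasure (arrows G) F < \<infinity>"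
    "AE \<gamma> in arrows G. rng G \<gamma> \<notin> B \<longrightarrow> src G \<gamma> \<notin> B' \<longrightarrow> \<gamma> \<notin> F \<longrightarrow> norm (f \<gamma>) \<le> \<epsilon>"
  shows "vanishes \<delta> \<epsilon> f"
  unfolding vanishes_def by (intro bexI[of _ B] bexI[of _ B'] bexI[of _ F] conjI assms)

lemma vanishesE:
  assumes "vanishes \<delta> \<epsilon> f"
  obtains B B' F where "B \<in> sets (units G)" "B' \<in> sets (units G)" "F \<in> sets (arrows G)"
    "measure (units G) B < \<delta>" "measure (units G) B' < \<delta>" "emeasure (arrows G) F < \<infinity>"
    "AE \<gamma> in arrows G. rng G \<gamma> \<notin> B \<longrightarrow> src G \<gamma> \<notin> B' \<longrightarrow> \<gamma> \<notin> F \<longrightarrow> norm (f \<gamma>) \<le> \<epsilon>"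
  using assms unfolding vanishes_def by (elim bexE conjE)

lemma c0_iff: "f \<in> c0 G \<longleftrightarrow> f \<in> Linf (arrows G) \<and> (\<forall>\<epsilon>>0. vanishes \<epsilon> \<epsilon> f)"
proof -
  have "(AE \<gamma> in arrows G. norm ((1 - indicator (arrows_to G B) \<gamma>) * (1 - indicator (arrows_from G B') \<gamma>)
                * f \<gamma> * (1 - indicator F \<gamma>)) \<le> \<epsilon>) \<longleftrightarrow>
     (AE \<gamma> in arrows G. rng G \<gamma> \<notin> B \<longrightarrow> src G \<gamma> \<notin> B' \<longrightarrow> \<gamma> \<notin> F \<longrightarrow> norm (f \<gamma>) \<le> \<epsilon>)"
    if "\<epsilon> > 0" for \<epsilon> B B' F
    using that by (intro AE_cong) (auto simp: arrows_to_def arrows_from_def indicator_def)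
  then show ?thesis unfolding c0_def vanishes_def by (simp cong: conj_cong)
qed

lemma vanishes_dominated:
  assumes v: "vanishes \<delta> \<epsilon> f" and dom: "AE \<gamma> in arrows G. norm (f \<gamma>) \<le> \<epsilon> \<longrightarrow> norm (g \<gamma>) \<le> \<epsilon>'" and "\<delta> \<le> \<delta>'"
  shows "vanishes \<delta>' \<epsilon>' g"
  using v
proof (rule vanishesE)
  fix B B' F assume *: "B \<in> sets (units G)" "B' \<in> sets (units G)" "F \<in> sets (arrows G)"
    "measure (units G) B < \<delta>" "measure (units G) B' < \<delta>" "emeasure (arrows G) F < \<infinity>"
    and AE: "AE \<gamma> in arrows G. rng G \<gamma> \<notin> B \<longrightarrow> src G \<gamma> \<notin> B' \<longrightarrow> \<gamma> \<notin> F \<longrightarrow> norm (f \<gamma>) \<le> \<epsilon>"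
  have "AE \<gamma> in arrows G. rng G \<gamma> \<notin> B \<longrightarrow> src G \<gamma> \<notin> B' \<longrightarrow> \<gamma> \<notin> F \<longrightarrow> norm (g \<gamma>) \<le> \<epsilon>'"
    using AE dom by eventually_elim simp
  then show ?thesis
    by (intro vanishesI[of B B' F] * less_le_trans[OF *(4) \<open>\<delta> \<le> \<delta>'\<close>] less_le_trans[OF *(5) \<open>\<delta> \<le> \<delta>'\<close>])
qed

lemma vanishes_mono: "vanishes \<delta> \<epsilon> f \<Longrightarrow> \<delta> \<le> \<delta>' \<Longrightarrow> \<epsilon> \<le> \<epsilon>' \<Longrightarrow> vanishes \<delta>' \<epsilon>' f"
  by (erule vanishes_dominated) auto

lemma c0_vanishes: "f \<in> c0 G \<Longrightarrow> 0 < \<delta> \<Longrightarrow> 0 < \<epsilon> \<Longrightarrow> vanishes \<delta> \<epsilon> f"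
  using vanishes_mono[of "min \<delta> \<epsilon>" "min \<delta> \<epsilon>" f \<delta> \<epsilon>] by (simp add: c0_iff)

lemma c0_Linf: "f \<in> c0 G \<Longrightarrow> f \<in> Linf (arrows G)"
  by (simp add: c0_iff)

text \<open>All stability properties of \<open>c0\<close> that do not move arrows are instances of this one.\<close>

lemma c0_dominated:
  assumes f: "f \<in> c0 G" and g: "g \<in> Linf (arrows G)"
    and dom: "\<And>\<epsilon>. 0 < \<epsilon> \<Longrightarrow> \<exists>\<delta>>0. AE \<gamma> in arrows G. norm (f \<gamma>) \<le> \<delta> \<longrightarrow> norm (g \<gamma>) \<le> \<epsilon>"
  shows "g \<in> c0 G"
  unfolding c0_iff
proof (intro conjI g allI impI)
  fix \<epsilon> :: real assume "\<epsilon> > 0"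
  then obtain \<delta> where \<delta>: "\<delta> > 0" "AE \<gamma> in arrows G. norm (f \<gamma>) \<le> \<delta> \<longrightarrow> norm (g \<gamma>) \<le> \<epsilon>" using dom by blast
  show "vanishes \<epsilon> \<epsilon> g"
    by (rule vanishes_dominated[OF c0_vanishes[OF f \<open>\<epsilon> > 0\<close> \<delta>(1)] \<delta>(2) order_refl])
qed

lemma c0_AE:
  assumes f: "f \<in> c0 G" and g: "g \<in> borel_measurable (arrows G)" and eq: "AE \<gamma> in arrows G. g \<gamma> = f \<gamma>"
  shows "g \<in> c0 G"
proof (rule c0_dominated[OF f Linf_AE[OF c0_Linf[OF f] g eq]])
  fix \<epsilon> :: real assume "\<epsilon> > 0"
  then show "\<exists>\<delta>>0. AE \<gamma> in arrows G. norm (f \<gamma>) \<le> \<delta> \<longrightarrow> norm (g \<gamma>) \<le> \<epsilon>"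
    using eq by (intro exI[of _ \<epsilon>]) auto
qed

lemma c0_cong:
  assumes f: "f \<in> c0 G" and eq: "\<And>\<gamma>. \<gamma> \<in> ars \<Longrightarrow> g \<gamma> = f \<gamma>"
  shows "g \<in> c0 G"
proof (rule c0_AE[OF f])
  show "g \<in> borel_measurable (arrows G)"
    using Linf_meas[OF c0_Linf[OF f]] by (rule measurable_cong[THEN iffD1, rotated]) (simp add: eq)
qed (use eq in auto)

lemma c0_mult:
  assumes f: "f \<in> c0 G" and g: "g \<in> Linf (arrows G)"
  shows "(\<lambda>\<gamma>. f \<gamma> * g \<gamma>) \<in> c0 G"
proof (rule c0_dominated[OF f Linf_mult[OF c0_Linf[OF f] g]])
  fix \<epsilon> :: real assume \<epsilon>: "\<epsilon> > 0"
  obtain C where C: "0 \<le> C" "AE \<gamma> in arrows G. norm (g \<gamma>) \<le> C" using g by (rule LinfE)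
  have "AE \<gamma> in arrows G. norm (f \<gamma>) \<le> \<epsilon> / (C + 1) \<longrightarrow> norm (f \<gamma> * g \<gamma>) \<le> \<epsilon>"
    using C(2)
  proof (eventually_elim, intro impI)
    fix \<gamma> assume *: "norm (g \<gamma>) \<le> C" "norm (f \<gamma>) \<le> \<epsilon> / (C + 1)"
    have "norm (f \<gamma> * g \<gamma>) \<le> \<epsilon> / (C + 1) * (C + 1)"
      unfolding norm_mult using * C \<epsilon> by (intro mult_mono) auto
    then show "norm (f \<gamma> * g \<gamma>) \<le> \<epsilon>" using C by simp
  qed
  then show "\<exists>\<delta>>0. AE \<gamma> in arrows G. norm (f \<gamma>) \<le> \<delta> \<longrightarrow> norm (f \<gamma> * g \<gamma>) \<le> \<epsilon>"
    using C \<epsilon> by (intro exI[of _ "\<epsilon> / (C + 1)"]) auto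
qed

lemma vanishes_add:
  assumes "vanishes \<delta> \<epsilon> f" "vanishes \<delta>' \<epsilon>' g"
  shows "vanishes (\<delta> + \<delta>') (\<epsilon> + \<epsilon>') (\<lambda>\<gamma>. f \<gamma> + g \<gamma>)"
proof -
  obtain B B' F where 1: "B \<in> sets (units G)" "B' \<in> sets (units G)" "F \<in> sets (arrows G)"
    "measure (units G) B < \<delta>" "measure (units G) B' < \<delta>" "emeasure (arrows G) F < \<infinity>"
    "AE \<gamma> in arrows G. rng G \<gamma> \<notin> B \<longrightarrow> src G \<gamma> \<notin> B' \<longrightarrow> \<gamma> \<notin> F \<longrightarrow> norm (f \<gamma>) \<le> \<epsilon>"
    using assms(1) by (rule vanishesE)
  obtain C C' H where 2: "C \<in> sets (units G)" "C' \<in> sets (units G)" "H \<in> sets (arrows G)"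
    "measure (units G) C < \<delta>'" "measure (units G) C' < \<delta>'" "emeasure (arrows G) H < \<infinity>"
    "AE \<gamma> in arrows G. rng G \<gamma> \<notin> C \<longrightarrow> src G \<gamma> \<notin> C' \<longrightarrow> \<gamma> \<notin> H \<longrightarrow> norm (g \<gamma>) \<le> \<epsilon>'"
    using assms(2) by (rule vanishesE)
  show ?thesis
  proof (rule vanishesI)
    show "measure (units G) (B \<union> C) < \<delta> + \<delta>'"
      using measure_Un_le[OF 1(1) 2(1)] 1(4) 2(4) by simp
    show "measure (units G) (B' \<union> C') < \<delta> + \<delta>'"
      using measure_Un_le[OF 1(2) 2(2)] 1(5) 2(5) by simp
    have "emeasure (arrows G) (F \<union> H) \<le> emeasure (arrows G) F + emeasure (arrows G) H"
      by (rule emeasure_subadditive[OF 1(3) 2(3)])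
    also have "\<dots> < \<infinity>" using 1(6) 2(6) by simp
    finally show "emeasure (arrows G) (F \<union> H) < \<infinity>" .
    show "AE \<gamma> in arrows G. rng G \<gamma> \<notin> B \<union> C \<longrightarrow> src G \<gamma> \<notin> B' \<union> C' \<longrightarrow> \<gamma> \<notin> F \<union> H \<longrightarrow>
        norm (f \<gamma> + g \<gamma>) \<le> \<epsilon> + \<epsilon>'"
      using 1(7) 2(7) by eventually_elim (simp add: norm_triangle_mono)
  qed (use 1(1-3) 2(1-3) in auto)
qed

lemma c0_add:
  assumes f: "f \<in> c0 G" and g: "g \<in> c0 G"
  shows "(\<lambda>\<gamma>. f \<gamma> + g \<gamma>) \<in> c0 G"
  unfolding c0_iff
proof (intro conjI allI impI)
  show "(\<lambda>\<gamma>. f \<gamma> + g \<gamma>) \<in> Linf (arrows G)" using f g by (intro Linf_add c0_Linf)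
  fix \<epsilon> :: real assume "\<epsilon> > 0"
  then show "vanishes \<epsilon> \<epsilon> (\<lambda>\<gamma>. f \<gamma> + g \<gamma>)"
    using vanishes_add[of "\<epsilon>/2" "\<epsilon>/2" f "\<epsilon>/2" "\<epsilon>/2" g] c0_vanishes f g by simp
qed

lemma left_translate_Linf:
  assumes \<theta>: "\<theta> \<in> local_bisections G" and f: "f \<in> Linf (arrows G)"
  shows "left_translate G \<theta> f \<in> Linf (arrows G)"
proof -
  obtain C where C: "0 \<le> C" "AE \<gamma> in arrows G. norm (f \<gamma>) \<le> C" using f by (rule LinfE)
  have "AE \<gamma> in arrows G. norm (left_translate G \<theta> f \<gamma>) \<le> C"
    using AE_shift_left[OF \<theta> C(2)] by eventually_elim (use C(1) in \<open>simp add: left_translate_eq\<close>)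
  then show ?thesis using left_translate_meas[OF \<theta> Linf_meas[OF f]] by (intro LinfI)
qed

lemma right_translate_Linf:
  assumes \<theta>: "\<theta> \<in> local_bisections G" and f: "f \<in> Linf (arrows G)"
  shows "right_translate G \<theta> f \<in> Linf (arrows G)"
proof -
  obtain C where C: "0 \<le> C" "AE \<gamma> in arrows G. norm (f \<gamma>) \<le> C" using f by (rule LinfE)
  have "AE \<gamma> in arrows G. norm (right_translate G \<theta> f \<gamma>) \<le> C"
    using AE_shift_right[OF \<theta> C(2)] by eventually_elim (use C(1) in \<open>simp add: right_translate_eq\<close>)
  then show ?thesis using right_translate_meas[OF \<theta> Linf_meas[OF f]] by (intro LinfI)
qed

text \<open>A left shift by \<open>\<theta>\<close> changes the range of an arrow. The exceptional set \<open>B\<close> of ranges is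
  therefore replaced by the ranges of those arrows of \<open>\<theta>\<close> that start in \<open>B\<close>, a set of no larger measure
  because the groupoid is measure preserving.\<close>

lemma c0_left_translate:
  assumes \<theta>: "\<theta> \<in> local_bisections G" and f: "f \<in> c0 G"
  shows "left_translate G \<theta> f \<in> c0 G"
  unfolding c0_iff
proof (intro conjI allI impI left_translate_Linf[OF \<theta> c0_Linf[OF f]])
  fix \<epsilon> :: real assume \<epsilon>: "\<epsilon> > 0"
  obtain B B' F where 1: "B \<in> sets (units G)" "B' \<in> sets (units G)" "F \<in> sets (arrows G)"
    "measure (units G) B < \<epsilon>" "measure (units G) B' < \<epsilon>" "emeasure (arrows G) F < \<infinity>"
    "AE \<gamma> in arrows G. rng G \<gamma> \<notin> B \<longrightarrow> src G \<gamma> \<notin> B' \<longrightarrow> \<gamma> \<notin> F \<longrightarrow> norm (f \<gamma>) \<le> \<epsilon>"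
    using c0_vanishes[OF f \<epsilon> \<epsilon>] by (rule vanishesE)
  let ?\<theta> = "\<theta> \<inter> arrows_from G B"
  have \<theta>': "?\<theta> \<in> local_bisections G" by (rule bisection_Int[OF \<theta> from_sets[OF 1(1)]])
  show "vanishes \<epsilon> \<epsilon> (left_translate G \<theta> f)"
  proof (rule vanishesI)
    have "emeasure (units G) (rng G ` ?\<theta>) = emeasure (units G) (src G ` ?\<theta>)"
      using emeasure_rng_image[OF bisection_sets[OF \<theta>'] bisection_inj_rng[OF \<theta>']]
        emeasure_src_image[OF bisection_sets[OF \<theta>'] bisection_inj_src[OF \<theta>']] by simp
    also have "\<dots> \<le> emeasure (units G) B"
      using 1(1) by (intro emeasure_mono) (auto simp: arrows_from_def)
    finally have "measure (units G) (rng G ` ?\<theta>) \<le> measure (units G) B"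
      by (simp add: units.emeasure_eq_measure)
    then show "measure (units G) (rng G ` ?\<theta>) < \<epsilon>" using 1(4) by simp
    show "measure (units G) B' < \<epsilon>" by (rule 1)
    show "emeasure (arrows G) (left_preimage \<theta> F) < \<infinity>"
      using left_preimage(2)[OF \<theta> 1(3)] 1(6) by simp
    show "AE \<gamma> in arrows G. rng G \<gamma> \<notin> rng G ` ?\<theta> \<longrightarrow> src G \<gamma> \<notin> B' \<longrightarrow> \<gamma> \<notin> left_preimage \<theta> F \<longrightarrow>
        norm (left_translate G \<theta> f \<gamma>) \<le> \<epsilon>"
      using AE_shift_left[OF \<theta> 1(7)] AE_space
    proof (eventually_elim, intro impI)
      fix \<gamma> assume H: "rng G \<gamma> \<in> rng G ` \<theta> \<longrightarrow> rng G (shift_left \<theta> \<gamma>) \<notin> B \<longrightarrow> src G (shift_left \<theta> \<gamma>) \<notin> B' \<longrightarrow>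
          shift_left \<theta> \<gamma> \<notin> F \<longrightarrow> norm (f (shift_left \<theta> \<gamma>)) \<le> \<epsilon>" and \<gamma>: "\<gamma> \<in> ars"
        and n: "rng G \<gamma> \<notin> rng G ` ?\<theta>" "src G \<gamma> \<notin> B'" "\<gamma> \<notin> left_preimage \<theta> F"
      show "norm (left_translate G \<theta> f \<gamma>) \<le> \<epsilon>"
      proof (cases "rng G \<gamma> \<in> rng G ` \<theta>")
        case True
        note p = shift_left_props[OF \<theta> \<gamma> True]
        have "rng G (shift_left \<theta> \<gamma>) \<notin> B"
        proof
          assume "rng G (shift_left \<theta> \<gamma>) \<in> B"
          then have "sec \<theta> (rng G \<gamma>) \<in> ?\<theta>"
            using p(3) sec_in[OF \<theta> True] sec_sp[OF \<theta> True] by (simp add: arrows_from_def)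
          then have "rng G (sec \<theta> (rng G \<gamma>)) \<in> rng G ` ?\<theta>" by (rule imageI)
          then show False using n(1) \<theta> True by simp
        qed
        moreover have "shift_left \<theta> \<gamma> \<notin> F" using n(3) \<gamma> True by (auto simp: left_preimage_def arrows_to_def)
        ultimately show ?thesis using H True n(2) p(2) by (simp add: left_translate_eq)
      qed (use \<epsilon> in \<open>simp add: left_translate_eq\<close>)
    qed
  qed (rule 1(2) left_preimage(1)[OF \<theta> 1(3)] bisection_rng[OF \<theta>'])+
qed

text \<open>The function that \<open>S_algebra\<close> requires to lie in \<open>c0\<close>.\<close>

definition defect :: "'g set \<Rightarrow> ('g \<Rightarrow> complex) \<Rightarrow> 'g \<Rightarrow> complex" where
  "defect \<theta> f = (\<lambda>\<gamma>. f \<gamma> * indicator (arrows_from G (rng G ` \<theta>)) \<gamma> - right_translate G \<theta> f \<gamma>)"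

lemma S_iff: "f \<in> S_algebra G \<longleftrightarrow> f \<in> Linf (arrows G) \<and> (\<forall>\<theta>\<in>local_bisections G. defect \<theta> f \<in> c0 G)"
  by (simp add: S_algebra_def defect_def)

lemma defect_eq:
  "\<gamma> \<in> ars \<Longrightarrow> defect \<theta> f \<gamma> = (if src G \<gamma> \<in> rng G ` \<theta> then f \<gamma> - f (shift_right \<theta> \<gamma>) else 0)"
  by (simp add: defect_def right_translate_eq arrows_from_def)

lemma defect_Linf:
  assumes \<theta>: "\<theta> \<in> local_bisections G" and f: "f \<in> Linf (arrows G)"
  shows "defect \<theta> f \<in> Linf (arrows G)"
proof -
  have "(\<lambda>\<gamma>. indicator (arrows_from G (rng G ` \<theta>)) \<gamma> :: complex) \<in> Linf (arrows G)"
    by (intro indicator_Linf from_sets bisection_rng \<theta>)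
  then have "(\<lambda>\<gamma>. f \<gamma> * indicator (arrows_from G (rng G ` \<theta>)) \<gamma> + (-1) * right_translate G \<theta> f \<gamma>) \<in> Linf (arrows G)"
    by (intro Linf_add Linf_mult f Linf_const right_translate_Linf[OF \<theta>])
  then show ?thesis by (simp add: defect_def)
qed

lemma S_Linf: "f \<in> S_algebra G \<Longrightarrow> f \<in> Linf (arrows G)"
  and S_defect: "f \<in> S_algebra G \<Longrightarrow> \<theta> \<in> local_bisections G \<Longrightarrow> defect \<theta> f \<in> c0 G"
  by (simp_all add: S_iff)

lemma S_AE:
  assumes f: "f \<in> S_algebra G" and g: "g \<in> borel_measurable (arrows G)" and eq: "AE \<gamma> in arrows G. g \<gamma> = f \<gamma>"
  shows "g \<in> S_algebra G"
  unfolding S_iff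
proof (intro conjI ballI)
  show gL: "g \<in> Linf (arrows G)" by (rule Linf_AE[OF S_Linf[OF f] g eq])
  fix \<theta> assume \<theta>: "\<theta> \<in> local_bisections G"
  show "defect \<theta> g \<in> c0 G"
  proof (rule c0_AE[OF S_defect[OF f \<theta>] Linf_meas[OF defect_Linf[OF \<theta> gL]]])
    show "AE \<gamma> in arrows G. defect \<theta> g \<gamma> = defect \<theta> f \<gamma>"
      using eq AE_shift_right[OF \<theta> eq] AE_space by eventually_elim (simp add: defect_eq)
  qed
qed

lemma S_cong:
  assumes f: "f \<in> S_algebra G" and eq: "\<And>\<gamma>. \<gamma> \<in> ars \<Longrightarrow> g \<gamma> = f \<gamma>"
  shows "g \<in> S_algebra G"
proof (rule S_AE[OF f])
  show "g \<in> borel_measurable (arrows G)"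
    using Linf_meas[OF S_Linf[OF f]] by (rule measurable_cong[THEN iffD1, rotated]) (simp add: eq)
qed (use eq in auto)

lemma S_add:
  assumes f: "f \<in> S_algebra G" and g: "g \<in> S_algebra G"
  shows "(\<lambda>\<gamma>. f \<gamma> + g \<gamma>) \<in> S_algebra G"
  unfolding S_iff
proof (intro conjI ballI)
  show "(\<lambda>\<gamma>. f \<gamma> + g \<gamma>) \<in> Linf (arrows G)" using f g by (intro Linf_add S_Linf)
  fix \<theta> assume \<theta>: "\<theta> \<in> local_bisections G"
  show "defect \<theta> (\<lambda>\<gamma>. f \<gamma> + g \<gamma>) \<in> c0 G"
    by (rule c0_cong[OF c0_add[OF S_defect[OF f \<theta>] S_defect[OF g \<theta>]]]) (simp add: defect_eq)
qed

text \<open>Continuous functional calculus: on the disc that contains almost all values of \<open>f\<close> the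
  function \<open>F\<close> is uniformly continuous, so the defect of \<open>F \<circ> f\<close> is small where that of \<open>f\<close> is.\<close>

lemma S_comp:
  fixes F :: "complex \<Rightarrow> complex"
  assumes F: "continuous_on UNIV F" and f: "f \<in> S_algebra G"
  shows "(\<lambda>\<gamma>. F (f \<gamma>)) \<in> S_algebra G"
  unfolding S_iff
proof (intro conjI ballI)
  show L: "(\<lambda>\<gamma>. F (f \<gamma>)) \<in> Linf (arrows G)" by (rule Linf_comp[OF F S_Linf[OF f]])
  obtain C where C: "AE \<gamma> in arrows G. norm (f \<gamma>) \<le> C" using S_Linf[OF f] by (auto elim: LinfE)
  fix \<theta> assume \<theta>: "\<theta> \<in> local_bisections G"
  show "defect \<theta> (\<lambda>\<gamma>. F (f \<gamma>)) \<in> c0 G"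
  proof (rule c0_dominated[OF S_defect[OF f \<theta>] defect_Linf[OF \<theta> L]])
    fix \<epsilon> :: real assume \<epsilon>: "\<epsilon> > 0"
    have "uniformly_continuous_on (cball 0 C) F"
      by (intro compact_uniformly_continuous continuous_on_subset[OF F]) auto
    then obtain \<delta> where \<delta>: "\<delta> > 0" "\<And>a b. norm a \<le> C \<Longrightarrow> norm b \<le> C \<Longrightarrow> dist b a < \<delta> \<Longrightarrow> dist (F b) (F a) < \<epsilon>"
      unfolding uniformly_continuous_on_def using \<epsilon> by (metis mem_cball_0)
    have "AE \<gamma> in arrows G. norm (defect \<theta> f \<gamma>) \<le> \<delta> / 2 \<longrightarrow> norm (defect \<theta> (\<lambda>\<gamma>. F (f \<gamma>)) \<gamma>) \<le> \<epsilon>"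
      using C AE_shift_right[OF \<theta> C] AE_space
    proof (eventually_elim, intro impI)
      fix \<gamma> assume *: "norm (f \<gamma>) \<le> C" "src G \<gamma> \<in> rng G ` \<theta> \<longrightarrow> norm (f (shift_right \<theta> \<gamma>)) \<le> C" "\<gamma> \<in> ars"
        "norm (defect \<theta> f \<gamma>) \<le> \<delta> / 2"
      show "norm (defect \<theta> (\<lambda>\<gamma>. F (f \<gamma>)) \<gamma>) \<le> \<epsilon>"
      proof (cases "src G \<gamma> \<in> rng G ` \<theta>")
        case True
        then have "dist (f \<gamma>) (f (shift_right \<theta> \<gamma>)) < \<delta>" using * \<delta>(1) by (simp add: defect_eq dist_norm)
        then have "dist (F (f \<gamma>)) (F (f (shift_right \<theta> \<gamma>))) < \<epsilon>" using \<delta>(2) * True by blast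
        then show ?thesis using * True by (simp add: defect_eq dist_norm)
      qed (use \<epsilon> * in \<open>simp add: defect_eq\<close>)
    qed
    then show "\<exists>\<delta>>0. AE \<gamma> in arrows G. norm (defect \<theta> f \<gamma>) \<le> \<delta> \<longrightarrow> norm (defect \<theta> (\<lambda>\<gamma>. F (f \<gamma>)) \<gamma>) \<le> \<epsilon>"
      using \<delta>(1) by (intro exI[of _ "\<delta> / 2"]) auto
  qed
qed

lemma rng_Linf: "g \<in> Linf (units G) \<Longrightarrow> (\<lambda>\<gamma>. g (rng G \<gamma>)) \<in> Linf (arrows G)"
proof -
  assume g: "g \<in> Linf (units G)"
  obtain C where C: "AE x in units G. norm (g x) \<le> C" using g by (auto elim: LinfE)
  have "AE \<gamma> in arrows G. norm (g (rng G \<gamma>)) \<le> C" by (rule AE_rng[OF C])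
  then show ?thesis using measurable_compose[OF rng_meas Linf_meas[OF g]] by (intro LinfI)
qed

lemma S_mult_rng:
  assumes f: "f \<in> S_algebra G" and g: "g \<in> Linf (units G)"
  shows "(\<lambda>\<gamma>. f \<gamma> * g (rng G \<gamma>)) \<in> S_algebra G"
  unfolding S_iff
proof (intro conjI ballI)
  show "(\<lambda>\<gamma>. f \<gamma> * g (rng G \<gamma>)) \<in> Linf (arrows G)" by (intro Linf_mult S_Linf[OF f] rng_Linf[OF g])
  fix \<theta> assume \<theta>: "\<theta> \<in> local_bisections G"
  show "defect \<theta> (\<lambda>\<gamma>. f \<gamma> * g (rng G \<gamma>)) \<in> c0 G"
    by (rule c0_cong[OF c0_mult[OF S_defect[OF f \<theta>] rng_Linf[OF g]]])
      (simp add: defect_eq shift_right_props[OF \<theta>] algebra_simps)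
qed

lemma S_const: "(\<lambda>_. c) \<in> S_algebra G"
  unfolding S_iff
proof (intro conjI ballI Linf_const)
  fix \<theta>
  have "(\<lambda>_. 0) \<in> c0 G"
    unfolding c0_iff by (auto intro!: Linf_const vanishesI[of "{}" "{}" "{}"])
  then show "defect \<theta> (\<lambda>_. c) \<in> c0 G" by (rule c0_cong) (simp add: defect_eq)
qed

lemma S_scale: "f \<in> S_algebra G \<Longrightarrow> (\<lambda>\<gamma>. c * f \<gamma>) \<in> S_algebra G"
  by (rule S_comp[of "\<lambda>t. c * t"]) (auto intro: continuous_intros)

lemma S_rng: "g \<in> Linf (units G) \<Longrightarrow> (\<lambda>\<gamma>. g (rng G \<gamma>)) \<in> S_algebra G"
  using S_mult_rng[OF S_const[of 1]] by simp

lemma shift_commute: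
  assumes \<theta>: "\<theta> \<in> local_bisections G" "\<theta>' \<in> local_bisections G" and \<gamma>: "\<gamma> \<in> ars"
    and s: "src G \<gamma> \<in> rng G ` \<theta>'" and r: "rng G \<gamma> \<in> rng G ` \<theta>"
  shows "shift_left \<theta> (shift_right \<theta>' \<gamma>) = shift_right \<theta>' (shift_left \<theta> \<gamma>)"
proof -
  have "shift_left \<theta> (shift_right \<theta>' \<gamma>) =
      gmul G (ginv G (sec \<theta> (rng G \<gamma>))) (gmul G \<gamma> (sec \<theta>' (src G \<gamma>)))"
    using shift_right_props(2)[OF \<theta>(2) \<gamma> s] unfolding shift_left_def by (simp add: shift_right_def)
  also have "\<dots> = gmul G (gmul G (ginv G (sec \<theta> (rng G \<gamma>))) \<gamma>) (sec \<theta>' (src G \<gamma>))"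
    by (rule mul_assoc[symmetric]) (use \<theta> \<gamma> s r sec_sp in auto)
  also have "\<dots> = shift_right \<theta>' (shift_left \<theta> \<gamma>)"
    using shift_left_props(2)[OF \<theta>(1) \<gamma> r] unfolding shift_right_def by (simp add: shift_left_def)
  finally show ?thesis .
qed

text \<open>Left and right shifts commute, so the defect of a left translate is the left translate of
  the defect.\<close>

lemma S_left_translate:
  assumes f: "f \<in> S_algebra G" and \<theta>: "\<theta> \<in> local_bisections G"
  shows "left_translate G \<theta> f \<in> S_algebra G"
  unfolding S_iff
proof (intro conjI ballI left_translate_Linf[OF \<theta> S_Linf[OF f]])
  fix \<theta>' assume \<theta>': "\<theta>' \<in> local_bisections G"
  show "defect \<theta>' (left_translate G \<theta> f) \<in> c0 G"
  proof (rule c0_cong[OF c0_left_translate[OF \<theta> S_defect[OF f \<theta>']]])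
    fix \<gamma> assume \<gamma>: "\<gamma> \<in> ars"
    show "defect \<theta>' (left_translate G \<theta> f) \<gamma> = left_translate G \<theta> (defect \<theta>' f) \<gamma>"
    proof (cases "src G \<gamma> \<in> rng G ` \<theta>' \<and> rng G \<gamma> \<in> rng G ` \<theta>")
      case True
      then have s: "src G \<gamma> \<in> rng G ` \<theta>'" and r: "rng G \<gamma> \<in> rng G ` \<theta>" by auto
      show ?thesis
        using s r \<gamma> shift_right_props[OF \<theta>' \<gamma> s] shift_left_props[OF \<theta> \<gamma> r] shift_commute[OF \<theta> \<theta>' \<gamma> s r]
        by (simp add: defect_eq left_translate_eq del: image_iff)
    next
      case False
      then consider "src G \<gamma> \<notin> rng G ` \<theta>'" | "src G \<gamma> \<in> rng G ` \<theta>'" "rng G \<gamma> \<notin> rng G ` \<theta>" by blast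
      then show ?thesis
      proof cases
        case 1
        then show ?thesis
          using \<gamma> shift_left_props[OF \<theta> \<gamma>] by (cases "rng G \<gamma> \<in> rng G ` \<theta>") (simp_all add: defect_eq left_translate_eq)
      next
        case 2
        then show ?thesis
          using \<gamma> shift_right_props[OF \<theta>' \<gamma> 2(1)] by (simp add: defect_eq left_translate_eq)
      qed
    qed
  qed
qed

lemma S_left_defect:
  assumes f: "f \<in> S_algebra G" and \<theta>: "\<theta> \<in> local_bisections G"
  shows "(\<lambda>\<gamma>. f \<gamma> * indicator (arrows_to G (src G ` \<theta>)) \<gamma> - left_translate G \<theta> f \<gamma>) \<in> S_algebra G"
proof -
  have "(\<lambda>\<gamma>. f \<gamma> * indicator (src G ` \<theta>) (rng G \<gamma>) + (-1) * left_translate G \<theta> f \<gamma>) \<in> S_algebra G"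
    by (intro S_add S_mult_rng[OF f] S_scale S_left_translate[OF f \<theta>] indicator_Linf bisection_src[OF \<theta>])
  then show ?thesis by (rule S_cong) (simp add: arrows_to_def indicator_def)
qed

end

section \<open>States\<close>

locale groupoid_state = pmp_groupoid G for G :: "('g, 'x) groupoid" +
  fixes \<phi> :: "('g \<Rightarrow> complex) \<Rightarrow> complex"
  assumes state: "state_on (arrows G) (S_algebra G) \<phi>"
begin

lemmas state' = state[unfolded state_on_def]

lemma state_AE: "f \<in> S_algebra G \<Longrightarrow> g \<in> S_algebra G \<Longrightarrow> AE x in arrows G. f x = g x \<Longrightarrow> \<phi> f = \<phi> g"
  by (rule state'[THEN conjunct1, rule_format])

lemma state_add: "f \<in> S_algebra G \<Longrightarrow> g \<in> S_algebra G \<Longrightarrow> \<phi> (\<lambda>x. f x + g x) = \<phi> f + \<phi> g"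
  by (rule state'[THEN conjunct2, THEN conjunct1, rule_format])

lemma state_scale: "f \<in> S_algebra G \<Longrightarrow> \<phi> (\<lambda>x. c * f x) = c * \<phi> f"
  by (rule state'[THEN conjunct2, THEN conjunct2, THEN conjunct1, rule_format])

lemma state_pos: "f \<in> S_algebra G \<Longrightarrow> \<phi> (\<lambda>x. cnj (f x) * f x) \<in> \<real>\<^sub>\<ge>\<^sub>0"
  by (rule state'[THEN conjunct2, THEN conjunct2, THEN conjunct2, THEN conjunct1, rule_format])

lemma state_one: "\<phi> (\<lambda>_. 1) = 1"
  by (rule state'[THEN conjunct2, THEN conjunct2, THEN conjunct2, THEN conjunct2])

lemma state_const: "\<phi> (\<lambda>_. c) = c"
  using state_scale[OF S_const[of 1], of c] state_one by simp

lemma state_diff: "f \<in> S_algebra G \<Longrightarrow> g \<in> S_algebra G \<Longrightarrow> \<phi> (\<lambda>x. f x - g x) = \<phi> f - \<phi> g"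
  using state_add[OF _ S_scale[of g "-1"], of f] state_scale[of g "-1"] by simp

text \<open>The definition of a state mentions only the elements \<open>cnj h * h\<close>. A nonnegative function is
  almost everywhere of this form, its square root being available by functional calculus.\<close>

lemma state_nonneg:
  assumes f: "f \<in> S_algebra G" and pos: "AE x in arrows G. f x \<in> \<real>\<^sub>\<ge>\<^sub>0"
  shows "\<phi> f \<in> \<real>\<^sub>\<ge>\<^sub>0"
proof -
  define h where "h x = complex_of_real (sqrt (max 0 (Re (f x))))" for x
  have h: "h \<in> S_algebra G"
    unfolding h_def by (rule S_comp[of "\<lambda>t. complex_of_real (sqrt (max 0 (Re t)))", OF _ f]) (intro continuous_intros)
  have "(\<lambda>x. cnj (h x) * h x) \<in> S_algebra G"
    by (rule S_comp[of "\<lambda>t. cnj t * t", OF _ h]) (intro continuous_intros)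
  moreover have "AE x in arrows G. cnj (h x) * h x = f x"
    using pos
  proof eventually_elim
    case (elim x)
    then obtain a where "f x = complex_of_real a" "0 \<le> a" by (auto elim: nonneg_Reals_cases)
    then show ?case by (simp add: h_def flip: of_real_mult)
  qed
  ultimately have "\<phi> (\<lambda>x. cnj (h x) * h x) = \<phi> f" by (rule state_AE[OF _ f])
  then show ?thesis using state_pos[OF h] by simp
qed

lemma state_real_bound:
  assumes f: "(\<lambda>x. complex_of_real (f x)) \<in> S_algebra G" and le: "AE x in arrows G. \<bar>f x\<bar> \<le> C"
  shows "Im (\<phi> (\<lambda>x. complex_of_real (f x))) = 0" "\<bar>Re (\<phi> (\<lambda>x. complex_of_real (f x)))\<bar> \<le> C"
proof -
  let ?f = "\<lambda>x. complex_of_real (f x)"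
  have d: "(\<lambda>x. complex_of_real C - ?f x) \<in> S_algebra G"
    by (rule S_comp[of "\<lambda>t. complex_of_real C - t", OF _ f]) (intro continuous_intros)
  have a: "(\<lambda>x. complex_of_real C + ?f x) \<in> S_algebra G"
    by (rule S_comp[of "\<lambda>t. complex_of_real C + t", OF _ f]) (intro continuous_intros)
  have "\<phi> (\<lambda>x. complex_of_real C - ?f x) \<in> \<real>\<^sub>\<ge>\<^sub>0"
    by (rule state_nonneg[OF d], rule eventually_mono[OF le]) (auto simp: complex_nonneg_Reals_iff)
  moreover have "\<phi> (\<lambda>x. complex_of_real C + ?f x) \<in> \<real>\<^sub>\<ge>\<^sub>0"
    by (rule state_nonneg[OF a], rule eventually_mono[OF le]) (auto simp: complex_nonneg_Reals_iff)
  moreover have "\<phi> (\<lambda>x. complex_of_real C - ?f x) = complex_of_real C - \<phi> ?f"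
    "\<phi> (\<lambda>x. complex_of_real C + ?f x) = complex_of_real C + \<phi> ?f"
    using state_diff[OF S_const f] state_add[OF S_const f] state_const by auto
  ultimately show "Im (\<phi> ?f) = 0" "\<bar>Re (\<phi> ?f)\<bar> \<le> C"
    by (auto simp: complex_nonneg_Reals_iff)
qed

lemma state_mono:
  assumes f: "(\<lambda>x. complex_of_real (f x)) \<in> S_algebra G" and g: "(\<lambda>x. complex_of_real (g x)) \<in> S_algebra G"
    and le: "AE x in arrows G. f x \<le> g x"
  shows "Re (\<phi> (\<lambda>x. complex_of_real (f x))) \<le> Re (\<phi> (\<lambda>x. complex_of_real (g x)))"
proof -
  have "(\<lambda>x. complex_of_real (g x) + (-1) * complex_of_real (f x)) \<in> S_algebra G"
    by (intro S_add S_scale f g)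
  then have "(\<lambda>x. complex_of_real (g x) - complex_of_real (f x)) \<in> S_algebra G" by simp
  then have "\<phi> (\<lambda>x. complex_of_real (g x) - complex_of_real (f x)) \<in> \<real>\<^sub>\<ge>\<^sub>0"
    by (rule state_nonneg, intro eventually_mono[OF le]) (auto simp: complex_nonneg_Reals_iff)
  then show ?thesis unfolding state_diff[OF g f] by (simp add: complex_nonneg_Reals_iff)
qed

text \<open>The factor 2 comes from treating real and imaginary part separately, which avoids the
  Cauchy-Schwarz inequality; any bound is good enough for integrating states.\<close>

lemma state_bound:
  assumes f: "f \<in> S_algebra G" and le: "AE x in arrows G. norm (f x) \<le> C"
  shows "norm (\<phi> f) \<le> 2 * C"
proof -
  have R: "(\<lambda>x. complex_of_real (Re (f x))) \<in> S_algebra G"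
    by (rule S_comp[of "\<lambda>t. complex_of_real (Re t)", OF _ f]) (intro continuous_intros)
  have I: "(\<lambda>x. complex_of_real (Im (f x))) \<in> S_algebra G"
    by (rule S_comp[of "\<lambda>t. complex_of_real (Im t)", OF _ f]) (intro continuous_intros)
  have "f = (\<lambda>x. complex_of_real (Re (f x)) + \<i> * complex_of_real (Im (f x)))"
    by (simp flip: complex_eq)
  then have "\<phi> f = \<phi> (\<lambda>x. complex_of_real (Re (f x)) + \<i> * complex_of_real (Im (f x)))" by simp
  also have "\<dots> = \<phi> (\<lambda>x. complex_of_real (Re (f x))) + \<i> * \<phi> (\<lambda>x. complex_of_real (Im (f x)))"
    unfolding state_add[OF R S_scale[OF I]] state_scale[OF I] ..
  finally have eq: "\<phi> f = \<phi> (\<lambda>x. complex_of_real (Re (f x))) + \<i> * \<phi> (\<lambda>x. complex_of_real (Im (f x)))" .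
  have bR: "AE x in arrows G. \<bar>Re (f x)\<bar> \<le> C" using le by eventually_elim (rule order_trans[OF abs_Re_le_cmod])
  have bI: "AE x in arrows G. \<bar>Im (f x)\<bar> \<le> C" using le by eventually_elim (rule order_trans[OF abs_Im_le_cmod])
  have "norm (\<phi> (\<lambda>x. complex_of_real (Re (f x)))) \<le> C"
    using state_real_bound[OF R bR] by (simp add: cmod_eq_Re)
  moreover have "norm (\<phi> (\<lambda>x. complex_of_real (Im (f x)))) \<le> C"
    using state_real_bound[OF I bI] by (simp add: cmod_eq_Re)
  ultimately show ?thesis unfolding eq by (intro norm_triangle_le) (simp add: norm_mult)
qed

end

section \<open>Normal functionals\<close>

lemma Linf_realI: "f \<in> borel_measurable M \<Longrightarrow> AE x in M. \<bar>f x\<bar> \<le> C \<Longrightarrow> f \<in> Linf_real M"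
  by (auto simp: Linf_real_def)

lemma Linf_real_meas: "f \<in> Linf_real M \<Longrightarrow> f \<in> borel_measurable M"
  by (simp add: Linf_real_def)

lemma Linf_realE:
  assumes "f \<in> Linf_real M"
  obtains C where "0 \<le> C" "AE x in M. \<bar>f x\<bar> \<le> C"
proof -
  obtain C where "AE x in M. \<bar>f x\<bar> \<le> C" using assms by (auto simp: Linf_real_def)
  then have "AE x in M. \<bar>f x\<bar> \<le> max 0 C" by eventually_elim simp
  then show ?thesis using that[of "max 0 C"] by simp
qed

lemma Linf_real_complex: "f \<in> Linf_real M \<Longrightarrow> (\<lambda>x. complex_of_real (f x)) \<in> Linf M"
  by (auto simp: Linf_real_def intro!: LinfI)

lemma (in finite_measure) Linf_real_integrable: "f \<in> Linf_real M \<Longrightarrow> integrable M f"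
  by (auto simp: Linf_real_def intro!: integrable_const_bound)

lemma Linf_real_integrable_mult:
  fixes k :: "'a \<Rightarrow> real"
  assumes f: "f \<in> Linf_real M" and k: "integrable M k"
  shows "integrable M (\<lambda>x. f x * k x)"
proof -
  obtain C where C: "0 \<le> C" "AE x in M. \<bar>f x\<bar> \<le> C" using f by (rule Linf_realE)
  show ?thesis
  proof (rule Bochner_Integration.integrable_bound)
    show "integrable M (\<lambda>x. C * \<bar>k x\<bar>)" using k by simp
    show "(\<lambda>x. f x * k x) \<in> borel_measurable M" using Linf_real_meas[OF f] k by auto
    show "AE x in M. norm (f x * k x) \<le> norm (C * \<bar>k x\<bar>)"
      using C(2) by eventually_elim (use C(1) in \<open>simp add: abs_mult mult_right_mono\<close>)
  qed
qed

lemma bounded_incseq_integral_limit: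
  fixes f :: "nat \<Rightarrow> 'a \<Rightarrow> real" and k :: "'a \<Rightarrow> real"
  assumes f: "\<And>n. f n \<in> Linf_real M" and g: "g \<in> Linf_real M" and F: "F \<in> borel_measurable M"
    and k: "integrable M k"
    and inc: "\<And>n. AE x in M. f n x \<le> f (Suc n) x" and le: "\<And>n. AE x in M. f n x \<le> g x"
    and lim: "AE x in M. (\<lambda>n. f n x) \<longlonglongrightarrow> F x"
  shows "(\<lambda>n. \<integral>x. f n x * k x \<partial>M) \<longlonglongrightarrow> (\<integral>x. F x * k x \<partial>M)"
proof -
  obtain C where C: "0 \<le> C" "AE x in M. \<bar>f 0 x\<bar> \<le> C" using f by (rule Linf_realE)
  obtain D where D: "0 \<le> D" "AE x in M. \<bar>g x\<bar> \<le> D" using g by (rule Linf_realE)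
  have "AE x in M. \<forall>n. f n x \<le> f (Suc n) x" using inc by (simp add: AE_all_countable)
  moreover have "AE x in M. \<forall>n. f n x \<le> g x" using le by (simp add: AE_all_countable)
  ultimately have bound: "AE x in M. \<forall>n. \<bar>f n x\<bar> \<le> C + D"
    using C(2) D(2)
  proof eventually_elim
    case (elim x)
    show ?case
    proof
      fix n
      have "f 0 x \<le> f n x" by (rule lift_Suc_mono_le[of "\<lambda>n. f n x", OF elim(1)[rule_format]]) simp
      then show "\<bar>f n x\<bar> \<le> C + D" using elim(2)[rule_format, of n] elim(3,4) C(1) D(1) by linarith
    qed
  qed
  show ?thesis
  proof (rule integral_dominated_convergence)
    show "integrable M (\<lambda>x. (C + D) * \<bar>k x\<bar>)" using k by simp
    show "AE x in M. (\<lambda>n. f n x * k x) \<longlonglongrightarrow> F x * k x"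
      using lim by eventually_elim (intro tendsto_intros)
    show "AE x in M. norm (f n x * k x) \<le> (C + D) * \<bar>k x\<bar>" for n
      using bound by eventually_elim (simp add: abs_mult mult_right_mono)
  qed (use F Linf_real_meas[OF f] k in auto)
qed

text \<open>From the net \<open>D\<close> an increasing sequence \<open>f\<close> is extracted whose integrals tend to the supremum
  \<open>c\<close> of all integrals over \<open>D\<close>. Its limit \<open>F\<close> dominates every \<open>h\<close> in \<open>D\<close> almost everywhere, as otherwise
  \<open>max h F\<close>, a limit of functions below members of \<open>D\<close>, would have an integral above \<open>c\<close>. So \<open>F\<close> is the supremum of the
  net, and dominated convergence along the sequence gives the claim.\<close>

lemma density_functional_normal:
  fixes k :: "'x \<Rightarrow> real"
  assumes M: "finite_measure M" and k: "integrable M k" "AE x in M. 0 \<le> k x"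
    and \<psi>: "\<And>g. g \<in> Linf_real M \<Longrightarrow> Re (\<psi> (\<lambda>x. complex_of_real (g x))) = (\<integral>x. g x * k x \<partial>M)"
  shows "normal_functional M \<psi>"
  unfolding normal_functional_def
proof (intro allI impI, elim conjE)
  interpret finite_measure M by fact
  fix D g assume ne: "D \<noteq> {}" and D: "D \<subseteq> Linf_real M" and sup: "Linf_is_sup M D g"
    and dir: "\<forall>f1\<in>D. \<forall>f2\<in>D. \<exists>f\<in>D. (AE x in M. f1 x \<le> f x) \<and> (AE x in M. f2 x \<le> f x)"
  have g: "g \<in> Linf_real M" and ub: "\<And>f. f \<in> D \<Longrightarrow> AE x in M. f x \<le> g x"
    and least: "\<And>h. h \<in> Linf_real M \<Longrightarrow> (\<And>f. f \<in> D \<Longrightarrow> AE x in M. f x \<le> h x) \<Longrightarrow> AE x in M. g x \<le> h x"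
    using sup unfolding Linf_is_sup_def by blast+
  let ?I = "\<lambda>f. \<integral>x. f x \<partial>M" and ?J = "\<lambda>f. \<integral>x. f x * k x \<partial>M"
  have DL: "f \<in> D \<Longrightarrow> f \<in> Linf_real M" for f using D by blast
  have int: "f \<in> D \<Longrightarrow> integrable M f" for f using DL Linf_real_integrable by blast
  have Ile: "?I f \<le> ?I g" if "f \<in> D" for f
    using int[OF that] Linf_real_integrable[OF g] ub[OF that] by (rule integral_mono_AE)
  have bddI: "bdd_above (?I ` D)" using Ile by (intro bdd_aboveI2)
  define c where "c = (SUP f\<in>D. ?I f)"
  have I_le_c: "f \<in> D \<Longrightarrow> ?I f \<le> c" for f unfolding c_def by (rule cSUP_upper[OF _ bddI])
  have "\<exists>d\<in>D. c - 1 / Suc n < ?I d" for n :: nat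
    using less_cSUP_iff[OF ne bddI, of "c - 1 / Suc n"] unfolding c_def by simp
  then obtain d where d: "\<And>n. d n \<in> D" "\<And>n. c - 1 / Suc n < ?I (d n)" by metis
  have "\<exists>f. \<forall>n. (f n \<in> D \<and> (AE x in M. d n x \<le> f n x)) \<and> (AE x in M. f n x \<le> f (Suc n) x)"
  proof (rule dependent_nat_choice)
    show "\<exists>f. f \<in> D \<and> (AE x in M. d 0 x \<le> f x)" using d by (intro exI[of _ "d 0"]) auto
    fix f n assume f: "f \<in> D \<and> (AE x in M. d n x \<le> f x)"
    then obtain f' where "f' \<in> D" "AE x in M. f x \<le> f' x" "AE x in M. d (Suc n) x \<le> f' x"
      using dir[rule_format, of f "d (Suc n)"] d(1) by auto
    then show "\<exists>f'. (f' \<in> D \<and> (AE x in M. d (Suc n) x \<le> f' x)) \<and> (AE x in M. f x \<le> f' x)" by blast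
  qed
  then obtain f where f: "\<And>n. f n \<in> D" "\<And>n. AE x in M. d n x \<le> f n x" "\<And>n. AE x in M. f n x \<le> f (Suc n) x"
    by blast
  have fL: "f n \<in> Linf_real M" for n using f(1) DL by blast
  define F where "F x = (SUP n. min (f n x) (g x))" for x
  have bdd: "bdd_above (range (\<lambda>n. min (f n x) (g x)))" for x by (rule bdd_aboveI2[of _ _ "g x"]) simp
  have F_meas: "F \<in> borel_measurable M"
    unfolding F_def using Linf_real_meas[OF fL] Linf_real_meas[OF g] bdd
    by (intro borel_measurable_cSUP) auto
  have all: "AE x in M. \<forall>n. f n x \<le> f (Suc n) x \<and> f n x \<le> g x"
    using f(3) ub[OF f(1)] by (simp add: AE_all_countable AE_conj_iff)
  have lim: "AE x in M. (\<lambda>n. f n x) \<longlonglongrightarrow> F x"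
    using all
  proof eventually_elim
    case (elim x)
    then have eq: "(\<lambda>n. min (f n x) (g x)) = (\<lambda>n. f n x)" by (auto simp: min_def fun_eq_iff)
    have "incseq (\<lambda>n. f n x)" using elim by (intro incseq_SucI) auto
    then show ?case using LIMSEQ_incseq_SUP[OF bdd[of x]] unfolding F_def eq by blast
  qed
  have fF: "AE x in M. \<forall>n. f n x \<le> F x"
    using all lim
  proof eventually_elim
    case (elim x)
    then have "incseq (\<lambda>n. f n x)" by (intro incseq_SucI) auto
    then show ?case using incseq_le[OF _ elim(2)] by blast
  qed
  have Fg: "F x \<le> g x" for x unfolding F_def by (intro cSUP_least) auto
  have FL: "F \<in> Linf_real M"
  proof -
    obtain C where C: "AE x in M. \<bar>f 0 x\<bar> \<le> C" using fL by (rule Linf_realE)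
    obtain D' where D': "AE x in M. \<bar>g x\<bar> \<le> D'" using g by (rule Linf_realE)
    have "AE x in M. \<bar>F x\<bar> \<le> max C D'"
      using C D' fF
    proof eventually_elim
      case (elim x)
      then show ?case using Fg[of x] elim(3)[rule_format, of 0] by linarith
    qed
    then show ?thesis using F_meas by (rule Linf_realI[rotated])
  qed
  have one: "integrable M (\<lambda>_. 1 :: real)" by simp
  have IF: "?I F = c"
  proof (rule LIMSEQ_unique)
    show "(\<lambda>n. ?I (f n)) \<longlonglongrightarrow> ?I F"
      using bounded_incseq_integral_limit[OF fL g F_meas one f(3) ub[OF f(1)] lim] by simp
    show "(\<lambda>n. ?I (f n)) \<longlonglongrightarrow> c"
    proof (rule tendsto_sandwich)
      show "(\<lambda>n. c - 1 / Suc n) \<longlonglongrightarrow> c"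
        using tendsto_diff[OF tendsto_const[of c] LIMSEQ_Suc[OF lim_1_over_n]] by (simp add: field_simps)
      show "\<forall>\<^sub>F n in sequentially. c - 1 / Suc n \<le> ?I (f n)"
      proof (rule always_eventually, rule allI)
        fix n
        have "?I (d n) \<le> ?I (f n)" by (rule integral_mono_AE[OF int[OF d(1)] int[OF f(1)] f(2)])
        then show "c - 1 / Suc n \<le> ?I (f n)" using d(2)[of n] by linarith
      qed
      show "\<forall>\<^sub>F n in sequentially. ?I (f n) \<le> c" using I_le_c[OF f(1)] by simp
    qed simp
  qed
  have F_ub: "AE x in M. h x \<le> F x" if h: "h \<in> D" for h
  proof -
    let ?m = "\<lambda>n x. max (h x) (f n x)"
    have mL: "?m n \<in> Linf_real M" for n
    proof -
      obtain C where C: "AE x in M. \<bar>h x\<bar> \<le> C" using DL[OF h] by (rule Linf_realE)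
      obtain D' where D': "AE x in M. \<bar>f n x\<bar> \<le> D'" using fL[of n] by (rule Linf_realE)
      have "AE x in M. \<bar>?m n x\<bar> \<le> max C D'" using C D' by eventually_elim auto
      then show ?thesis using Linf_real_meas[OF fL] Linf_real_meas[OF DL[OF h]] by (intro Linf_realI) auto
    qed
    have "?I (?m n) \<le> c" for n
    proof -
      obtain e where e: "e \<in> D" "AE x in M. h x \<le> e x" "AE x in M. f n x \<le> e x"
        using dir[rule_format, OF h f(1)[of n]] by auto
      have "?I (?m n) \<le> ?I e"
        using Linf_real_integrable[OF mL] int[OF e(1)]
        by (rule integral_mono_AE) (use e(2,3) in \<open>eventually_elim, simp\<close>)
      then show ?thesis using I_le_c[OF e(1)] by linarith
    qed
    moreover have mM: "(\<lambda>x. max (h x) (F x)) \<in> borel_measurable M"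
      using F_meas Linf_real_meas[OF DL[OF h]] by auto
    have "(\<lambda>n. ?I (?m n)) \<longlonglongrightarrow> ?I (\<lambda>x. max (h x) (F x))"
    proof -
      have "(\<lambda>n. \<integral>x. ?m n x * 1 \<partial>M) \<longlonglongrightarrow> (\<integral>x. max (h x) (F x) * 1 \<partial>M)"
      proof (rule bounded_incseq_integral_limit[OF mL g mM one])
        show "AE x in M. ?m n x \<le> ?m (Suc n) x" for n using f(3)[of n] by eventually_elim auto
        show "AE x in M. ?m n x \<le> g x" for n using ub[OF f(1)[of n]] ub[OF h] by eventually_elim auto
        show "AE x in M. (\<lambda>n. ?m n x) \<longlonglongrightarrow> max (h x) (F x)"
          using lim by eventually_elim (intro tendsto_max tendsto_const)
      qed
      then show ?thesis by simp
    qed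
    ultimately have le: "?I (\<lambda>x. max (h x) (F x)) \<le> c" by (intro LIMSEQ_le_const2) auto
    have intm: "integrable M (\<lambda>x. max (h x) (F x))"
      using int[OF h] Linf_real_integrable[OF FL] by (rule integrable_max)
    have intd: "integrable M (\<lambda>x. max (h x) (F x) - F x)"
      using intm Linf_real_integrable[OF FL] by simp
    have "?I (\<lambda>x. max (h x) (F x) - F x) = ?I (\<lambda>x. max (h x) (F x)) - ?I F"
      using intm Linf_real_integrable[OF FL] by simp
    also have "\<dots> \<le> 0" using le IF by simp
    finally have "?I (\<lambda>x. max (h x) (F x) - F x) = 0"
      by (intro antisym integral_nonneg_AE) auto
    then have "AE x in M. max (h x) (F x) - F x = 0"
      using integral_nonneg_eq_0_iff_AE[OF intd] by simp
    then show ?thesis by eventually_elim (simp add: max_def split: if_splits)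
  qed
  have gF: "AE x in M. g x \<le> F x" by (rule least[OF FL F_ub])
  have Jeq: "?J F = ?J g"
    by (rule integral_cong_AE) (use gF Fg Linf_real_meas[OF g] F_meas k in \<open>auto intro: antisym elim!: eventually_mono\<close>)
  have Jle: "?J h \<le> ?J g" if "h \<in> D" for h
    by (rule integral_mono_AE[OF Linf_real_integrable_mult[OF DL[OF that] k(1)] Linf_real_integrable_mult[OF g k(1)]])
      (use ub[OF that] k(2) in \<open>eventually_elim, simp add: mult_right_mono\<close>)
  have "(\<lambda>n. ?J (f n)) \<longlonglongrightarrow> ?J g"
    using bounded_incseq_integral_limit[OF fL g F_meas k(1) f(3) ub[OF f(1)] lim] Jeq by simp
  moreover have bddJ: "bdd_above (?J ` D)" using Jle by (intro bdd_aboveI2)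
  then have "?J (f n) \<le> (SUP h\<in>D. ?J h)" for n by (intro cSUP_upper f(1))
  ultimately have "?J g \<le> (SUP h\<in>D. ?J h)" by (intro LIMSEQ_le_const2) auto
  moreover have "(SUP h\<in>D. ?J h) \<le> ?J g" by (intro cSUP_least ne Jle)
  ultimately have "?J g = (SUP h\<in>D. ?J h)" by simp
  then show "Re (\<psi> (\<lambda>x. complex_of_real (g x))) = (SUP f\<in>D. Re (\<psi> (\<lambda>x. complex_of_real (f x))))"
    using \<psi>[OF g] \<psi>[OF DL] by simp
qed

section \<open>Invariant normal states of ergodic groupoids\<close>

locale invariant_state = groupoid_state G \<phi> for G :: "('g, 'x) groupoid" and \<phi> +
  assumes invariant: "\<And>f \<theta>. f \<in> S_algebra G \<Longrightarrow> \<theta> \<in> local_bisections G \<Longrightarrow>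
      \<phi> (\<lambda>\<gamma>. f \<gamma> * indicator (arrows_to G (src G ` \<theta>)) \<gamma> - left_translate G \<theta> f \<gamma>) = 0"
    and normal: "normal_functional (units G) (\<lambda>f. \<phi> (f \<circ> rng G))"
begin

definition weight :: "'x set \<Rightarrow> real" where
  "weight A = Re (\<phi> (\<lambda>\<gamma>. complex_of_real (indicator A (rng G \<gamma>))))"

lemma real_rng_S: "g \<in> Linf_real (units G) \<Longrightarrow> (\<lambda>\<gamma>. complex_of_real (g (rng G \<gamma>))) \<in> S_algebra G"
  using S_rng[OF Linf_real_complex] .

lemma indicator_Linf_real: "A \<in> sets M \<Longrightarrow> (\<lambda>x. indicator A x :: real) \<in> Linf_real M"
  by (rule Linf_realI[of _ _ 1]) (auto simp: indicator_def)

lemma ind_S: "A \<in> sets (units G) \<Longrightarrow> (\<lambda>\<gamma>. complex_of_real (indicator A (rng G \<gamma>))) \<in> S_algebra G"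
  by (rule real_rng_S[OF indicator_Linf_real])

lemma weight_phi: "A \<in> sets (units G) \<Longrightarrow> \<phi> (\<lambda>\<gamma>. complex_of_real (indicator A (rng G \<gamma>))) = complex_of_real (weight A)"
  using state_real_bound(1)[OF ind_S, of A 1] unfolding weight_def by (simp add: complex_eq_iff indicator_def)

lemma weight_mono: "A \<in> sets (units G) \<Longrightarrow> B \<in> sets (units G) \<Longrightarrow> A \<subseteq> B \<Longrightarrow> weight A \<le> weight B"
  unfolding weight_def by (rule state_mono[OF ind_S ind_S]) (auto simp: indicator_def)

lemma weight_empty: "weight {} = 0"
  using state_const[of 0] by (simp add: weight_def)

lemma weight_nonneg: "A \<in> sets (units G) \<Longrightarrow> 0 \<le> weight A"
  using weight_mono[of "{}" A] weight_empty by simp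

lemma weight_space: "weight (space (units G)) = 1"
proof -
  have "\<phi> (\<lambda>\<gamma>. complex_of_real (indicator (space (units G)) (rng G \<gamma>))) = \<phi> (\<lambda>_. 1)"
    by (rule state_AE[OF ind_S S_const]) auto
  then show ?thesis unfolding weight_def by (simp add: state_one)
qed

lemma weight_Un:
  assumes "A \<in> sets (units G)" "B \<in> sets (units G)" "A \<inter> B = {}"
  shows "weight (A \<union> B) = weight A + weight B"
proof -
  have "(\<lambda>\<gamma>. complex_of_real (indicator (A \<union> B) (rng G \<gamma>))) =
      (\<lambda>\<gamma>. complex_of_real (indicator A (rng G \<gamma>)) + complex_of_real (indicator B (rng G \<gamma>)))"
    using assms(3) by (auto simp: indicator_def fun_eq_iff)
  then show ?thesis unfolding weight_def using state_add[OF ind_S[OF assms(1)] ind_S[OF assms(2)]] by simp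
qed

text \<open>Normality, applied to an increasing sequence of indicators.\<close>

lemma weight_continuous:
  assumes A: "\<And>n::nat. A n \<in> sets (units G)" "incseq A"
  shows "(\<lambda>n. weight (A n)) \<longlonglongrightarrow> weight (\<Union>n. A n)"
proof -
  let ?D = "range (\<lambda>n x. indicator (A n) x :: real)" and ?g = "\<lambda>x. indicator (\<Union>n. A n) x :: real"
  have mono: "A m \<subseteq> A n" if "m \<le> n" for m n using A(2) that by (rule incseqD)
  have sup: "Linf_is_sup (units G) ?D ?g"
    unfolding Linf_is_sup_def
  proof (intro conjI ballI impI)
    show "?g \<in> Linf_real (units G)" using A(1) by (intro indicator_Linf_real) auto
    show "AE x in units G. f x \<le> ?g x" if "f \<in> ?D" for f
      using that by (auto simp: indicator_def)
    fix h assume "\<forall>f\<in>?D. AE x in units G. f x \<le> h x"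
    then have "AE x in units G. \<forall>n. indicator (A n) x \<le> h x" by (simp add: AE_all_countable)
    then show "AE x in units G. ?g x \<le> h x"
    proof eventually_elim
      case (elim x)
      show ?case
      proof (cases "x \<in> (\<Union>n. A n)")
        case True
        then obtain n where "x \<in> A n" by blast
        then show ?thesis using elim[rule_format, of n] True by simp
      next
        case False
        then show ?thesis using elim[rule_format, of 0] by simp
      qed
    qed
  qed
  have "Re (\<phi> ((\<lambda>x. complex_of_real (?g x)) \<circ> rng G)) =
      (SUP f\<in>?D. Re (\<phi> ((\<lambda>x. complex_of_real (f x)) \<circ> rng G)))"
  proof (rule normal[unfolded normal_functional_def, rule_format], intro conjI ballI)
    show "?D \<subseteq> Linf_real (units G)" using A(1) indicator_Linf_real by blast
    fix f1 f2 assume "f1 \<in> ?D" "f2 \<in> ?D"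
    then obtain n m where nm: "f1 = indicator (A n)" "f2 = indicator (A m)" by auto
    have "AE x in units G. f1 x \<le> indicator (A (max n m)) x" "AE x in units G. f2 x \<le> indicator (A (max n m)) x"
      using mono[of n "max n m"] mono[of m "max n m"] unfolding nm by (auto simp: indicator_def)
    then show "\<exists>f\<in>?D. (AE x in units G. f1 x \<le> f x) \<and> (AE x in units G. f2 x \<le> f x)" by blast
  qed (use sup in auto)
  then have "weight (\<Union>n. A n) = (SUP n. weight (A n))"
    unfolding weight_def by (simp add: image_image o_def)
  moreover have "(\<lambda>n. weight (A n)) \<longlonglongrightarrow> (SUP n. weight (A n))"
  proof (rule LIMSEQ_incseq_SUP)
    show "bdd_above (range (\<lambda>n. weight (A n)))"
      by (rule bdd_aboveI2[of _ _ "weight (space (units G))"])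
        (rule weight_mono[OF A(1) sets.top sets.sets_into_space[OF A(1)]])
    show "incseq (\<lambda>n. weight (A n))" using weight_mono A by (intro incseq_SucI) (auto simp: incseq_Suc_iff)
  qed
  ultimately show ?thesis by simp
qed

definition weight_measure :: "'x measure" where
  "weight_measure = measure_of (space (units G)) (sets (units G)) (\<lambda>A. ennreal (weight A))"

lemma sets_weight_measure [simp]: "sets weight_measure = sets (units G)"
  by (simp add: weight_measure_def)

lemma emeasure_weight: 
  assumes A: "A \<in> sets (units G)"
  shows "emeasure weight_measure A = ennreal (weight A)"
  unfolding weight_measure_def
proof (rule emeasure_measure_of_sigma[OF sets.sigma_algebra_axioms _ _ A])
  show pos: "positive (sets (units G)) (\<lambda>A. ennreal (weight A))"
    by (simp add: positive_def weight_empty)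
  have add: "additive (sets (units G)) (\<lambda>A. ennreal (weight A))"
    by (simp add: Measure_Space.additive_def weight_Un weight_nonneg)
  show "countably_additive (sets (units G)) (\<lambda>A. ennreal (weight A))"
    unfolding sets.countably_additive_iff_continuous_from_below[OF pos add]
    by (intro allI impI tendsto_ennrealI weight_continuous) auto
qed

lemma weight_null: "N \<in> null_sets (units G) \<Longrightarrow> weight N = 0"
proof -
  assume N: "N \<in> null_sets (units G)"
  have "\<phi> (\<lambda>\<gamma>. complex_of_real (indicator N (rng G \<gamma>))) = \<phi> (\<lambda>_. 0)"
  proof (rule state_AE[OF ind_S S_const])
    show "N \<in> sets (units G)" using N by auto
    show "AE \<gamma> in arrows G. complex_of_real (indicator N (rng G \<gamma>)) = 0"
      using AE_rng[OF AE_not_in[OF N]] by eventually_elim simp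
  qed
  then show ?thesis unfolding weight_def by (simp add: state_const)
qed

text \<open>Invariance of the state, applied to the constant function 1.\<close>

lemma weight_bisection:
  assumes \<theta>: "\<theta> \<in> local_bisections G"
  shows "weight (src G ` \<theta>) = weight (rng G ` \<theta>)"
proof -
  let ?s = "\<lambda>\<gamma>. complex_of_real (indicator (src G ` \<theta>) (rng G \<gamma>))"
  let ?r = "\<lambda>\<gamma>. complex_of_real (indicator (rng G ` \<theta>) (rng G \<gamma>))"
  have s: "?s \<in> S_algebra G" and r: "?r \<in> S_algebra G"
    using ind_S bisection_src[OF \<theta>] bisection_rng[OF \<theta>] by blast+
  have d: "(\<lambda>\<gamma>. ?s \<gamma> - ?r \<gamma>) \<in> S_algebra G"
    using S_add[OF s S_scale[OF r, of "-1"]] by simp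
  have "\<phi> (\<lambda>\<gamma>. 1 * indicator (arrows_to G (src G ` \<theta>)) \<gamma> - left_translate G \<theta> (\<lambda>_. 1) \<gamma>) = \<phi> (\<lambda>\<gamma>. ?s \<gamma> - ?r \<gamma>)"
    by (rule state_AE[OF S_left_defect[OF S_const \<theta>] d])
      (auto intro!: AE_I2 simp: arrows_to_def left_translate_eq indicator_def)
  then have "\<phi> (\<lambda>\<gamma>. ?s \<gamma> - ?r \<gamma>) = 0" using invariant[OF S_const[of 1] \<theta>] by simp
  then show ?thesis unfolding state_diff[OF s r] weight_def by simp
qed

text \<open>The weight has a density \<open>h\<close>. Let \<open>A\<close> be the set where \<open>h > 1\<close>. A bisection leading from \<open>A\<close> to its
  complement has a source and a range of equal measure and of equal weight, but \<open>h > 1\<close> on the source and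
  \<open>h \<le> 1\<close> on the range; so the source is null. Thus \<open>A\<close> is invariant, hence null or conull by
  ergodicity. It cannot be conull, since both total masses are 1, so the weight is bounded by the measure,
  and equality of the total masses forces equality.\<close>

lemma weight_eq_measure:
  assumes erg: "ergodic G" and B: "B \<in> sets (units G)"
  shows "weight B = measure (units G) B"
proof -
  let ?M = "units G" and ?E = "weight_measure"
  have ac: "absolutely_continuous ?M ?E"
    unfolding absolutely_continuous_def
  proof
    fix N assume N: "N \<in> null_sets ?M"
    then show "N \<in> null_sets ?E"
      using emeasure_weight[of N] weight_null[OF N] by (intro null_setsI) auto
  qed
  obtain h where h [measurable]: "h \<in> borel_measurable ?M" and hE: "density ?M h = ?E"
    using units.Radon_Nikodym[OF ac] by auto
  have E: "ennreal (weight P) = (\<integral>\<^sup>+x. h x * indicator P x \<partial>?M)" if "P \<in> sets ?M" for P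
    using emeasure_weight[OF that] emeasure_density[OF h that] hE by simp
  define A where "A = {x\<in>space ?M. 1 < h x}"
  have A [measurable]: "A \<in> sets ?M" unfolding A_def by measurable
  \<comment> \<open>Inside \<open>A\<close> the weight of a set that is not null exceeds its measure.\<close>
  have upper: "emeasure ?M P = 0" if P: "P \<in> sets ?M" "P \<subseteq> A" "ennreal (weight P) \<le> emeasure ?M P" for P
  proof -
    note [measurable] = P(1)
    have "(\<integral>\<^sup>+x. h x * indicator P x - indicator P x \<partial>?M) =
        (\<integral>\<^sup>+x. h x * indicator P x \<partial>?M) - (\<integral>\<^sup>+x. indicator P x \<partial>?M)"
    proof (rule nn_integral_diff)
      show "AE x in ?M. indicator P x \<le> h x * indicator P x"
        using P(2) by (auto simp: A_def indicator_def less_imp_le intro!: AE_I2)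
      show "(\<integral>\<^sup>+x. indicator P x \<partial>?M) \<noteq> \<infinity>" using P(1) by (simp add: units.emeasure_finite)
    qed auto
    also have "\<dots> = 0" using P(3) E[OF P(1), symmetric] P(1) by (simp add: diff_eq_0_iff_ennreal units.emeasure_finite less_top[symmetric])
    finally have "AE x in ?M. h x * indicator P x - indicator P x = 0"
      by (subst (asm) nn_integral_0_iff_AE) auto
    then have "AE x in ?M. x \<notin> P"
    proof eventually_elim
      case (elim x)
      show ?case
      proof
        assume "x \<in> P"
        then have "1 < h x" "h x - 1 = 0" using elim P(2) by (auto simp: A_def)
        then show False by (metis diff_gr0_ennreal ennreal_one_neq_top less_irrefl less_top top_neq_ennreal)
      qed
    qed
    moreover have "{x\<in>space ?M. \<not> x \<notin> P} = P" using sets.sets_into_space[OF P(1)] by auto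
    ultimately show ?thesis by (rule AE_iff_measurable[OF P(1), THEN iffD1, rotated])
  qed
  have lower: "ennreal (weight P) \<le> emeasure ?M P" if P: "P \<in> sets ?M" "P \<inter> A = {}" for P
  proof -
    have "(\<integral>\<^sup>+x. h x * indicator P x \<partial>?M) \<le> (\<integral>\<^sup>+x. indicator P x \<partial>?M)"
      using P(2) by (intro nn_integral_mono) (auto simp: A_def indicator_def not_less)
    then show ?thesis using E[OF P(1)] P(1) by simp
  qed
  have "invariant_mod G ?M A"
  proof -
    obtain \<theta> :: "nat \<Rightarrow> 'g set" and N where \<theta>: "\<And>n. \<theta> n \<in> local_bisections G" and N: "N \<in> null_sets ?M"
      and cover: "\<And>\<gamma>. \<gamma> \<in> ars \<Longrightarrow> src G \<gamma> \<notin> N \<or> rng G \<gamma> \<notin> N \<Longrightarrow> \<exists>n. \<gamma> \<in> \<theta> n"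
      using bisection_cover by metis
    define C where "C = arrows_from G A - arrows_to G A"
    have C: "C \<in> sets (arrows G)" unfolding C_def by (intro sets.Diff from_sets to_sets A)
    have \<rho>: "\<theta> n \<inter> C \<in> local_bisections G" for n by (rule bisection_Int[OF \<theta> C])
    have "src G ` (\<theta> n \<inter> C) \<in> null_sets ?M" for n
    proof (rule null_setsI[OF upper])
      show P: "src G ` (\<theta> n \<inter> C) \<in> sets ?M" "src G ` (\<theta> n \<inter> C) \<in> sets ?M" by (rule bisection_src[OF \<rho>])+
      show "src G ` (\<theta> n \<inter> C) \<subseteq> A" by (auto simp: C_def arrows_from_def)
      have "weight (src G ` (\<theta> n \<inter> C)) = weight (rng G ` (\<theta> n \<inter> C))" by (rule weight_bisection[OF \<rho>])
      moreover have "ennreal (weight (rng G ` (\<theta> n \<inter> C))) \<le> emeasure ?M (rng G ` (\<theta> n \<inter> C))"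
        by (rule lower[OF bisection_rng[OF \<rho>]]) (auto simp: C_def arrows_from_def arrows_to_def)
      moreover have "emeasure ?M (rng G ` (\<theta> n \<inter> C)) = emeasure ?M (src G ` (\<theta> n \<inter> C))"
        using emeasure_rng_image[OF bisection_sets[OF \<rho>] bisection_inj_rng[OF \<rho>]]
          emeasure_src_image[OF bisection_sets[OF \<rho>] bisection_inj_src[OF \<rho>]] by simp
      ultimately show "ennreal (weight (src G ` (\<theta> n \<inter> C))) \<le> emeasure ?M (src G ` (\<theta> n \<inter> C))" by simp
    qed
    then have "N \<union> (\<Union>n. src G ` (\<theta> n \<inter> C)) \<in> null_sets ?M" using N by (intro null_sets.Un null_sets_UN)
    from AE_not_in[OF this] show ?thesis
      unfolding invariant_mod_def
    proof eventually_elim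
      case (elim x)
      have "rng G \<gamma> \<in> A" if "x \<in> A" "\<gamma> \<in> arrows_from G {x}" for \<gamma>
      proof (rule ccontr)
        assume "rng G \<gamma> \<notin> A"
        then have "\<gamma> \<in> C" "\<gamma> \<in> ars" "src G \<gamma> = x" using that by (auto simp: C_def arrows_from_def arrows_to_def)
        moreover then obtain n where "\<gamma> \<in> \<theta> n" using cover[of \<gamma>] elim by auto
        ultimately show False using elim by blast
      qed
      then show ?case by blast
    qed
  qed
  then have "emeasure ?M A = 0 \<or> emeasure ?M (space ?M - A) = 0"
    using erg A unfolding ergodic_def by blast
  moreover have "emeasure ?M A = 0" if co: "emeasure ?M (space ?M - A) = 0"
  proof (rule upper[OF A subset_refl])
    have "emeasure ?M A = 1"
      using emeasure_Diff_null_set[of "space ?M - A" ?M "space ?M"] co A units.emeasure_space_1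
      by (simp add: Diff_Diff_Int null_setsI Int_absorb1 sets.sets_into_space)
    moreover have "weight A \<le> 1" using weight_mono[OF A sets.top] weight_space sets.sets_into_space[OF A] by simp
    ultimately show "ennreal (weight A) \<le> emeasure ?M A" by simp
  qed
  ultimately have A0: "emeasure ?M A = 0" by blast
  have le: "weight P \<le> measure ?M P" if P: "P \<in> sets ?M" for P
  proof -
    have "weight P \<le> weight ((P - A) \<union> A)" using P by (intro weight_mono) auto
    also have "\<dots> = weight (P - A) + weight A" using P by (intro weight_Un) auto
    also have "weight A = 0" using A0 A by (intro weight_null) auto
    also have "weight (P - A) \<le> measure ?M (P - A)"
      using lower[of "P - A"] P by (auto simp: units.emeasure_eq_measure ennreal_le_iff)
    also have "\<dots> \<le> measure ?M P" using P by (intro units.finite_measure_mono) auto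
    finally show ?thesis by simp
  qed
  have "weight B + weight (space ?M - B) = 1"
    using weight_Un[OF B, of "space ?M - B"] B weight_space sets.sets_into_space[OF B] by (simp add: Un_absorb1)
  moreover have "measure ?M B + measure ?M (space ?M - B) = 1" using units.prob_compl[OF B] by simp
  moreover have "weight B \<le> measure ?M B" "weight (space ?M - B) \<le> measure ?M (space ?M - B)"
    using le B by auto
  ultimately show ?thesis by linarith
qed

lemma state_sum:
  assumes "finite J" "\<And>j. j \<in> J \<Longrightarrow> f j \<in> S_algebra G"
  shows "(\<lambda>\<gamma>. \<Sum>j\<in>J. f j \<gamma>) \<in> S_algebra G \<and> \<phi> (\<lambda>\<gamma>. \<Sum>j\<in>J. f j \<gamma>) = (\<Sum>j\<in>J. \<phi> (f j))"
  using assms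
proof (induction J rule: finite_induct)
  case empty
  then show ?case using S_const[of 0] state_const[of 0] by simp
next
  case (insert j J)
  then show ?case using S_add[of "f j" "\<lambda>\<gamma>. \<Sum>j\<in>J. f j \<gamma>"] state_add[of "f j" "\<lambda>\<gamma>. \<Sum>j\<in>J. f j \<gamma>"] by simp
qed

text \<open>Both sides are bounded linear functionals that agree on indicators; \<open>f\<close> below approximates \<open>g\<close>
  uniformly by rounding down to multiples of \<open>1 / Suc n\<close>.\<close>

lemma state_rng_integral:
  assumes erg: "ergodic G" and g: "g \<in> Linf_real (units G)"
  shows "\<phi> (\<lambda>\<gamma>. complex_of_real (g (rng G \<gamma>))) = complex_of_real (\<integral>x. g x \<partial>units G)"
proof -
  let ?M = "units G"
  obtain C where C: "0 \<le> C" "AE x in ?M. \<bar>g x\<bar> \<le> C" using g by (rule Linf_realE)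
  have g_meas [measurable]: "g \<in> borel_measurable ?M" by (rule Linf_real_meas[OF g])
  define \<psi> where "\<psi> f = \<phi> (\<lambda>\<gamma>. complex_of_real (f (rng G \<gamma>)))" for f :: "'x \<Rightarrow> real"
  have close: "norm (\<psi> g - complex_of_real (\<integral>x. g x \<partial>?M)) \<le> 2 * (1 / Suc n)" for n :: nat
  proof -
    let ?k = "real (Suc n)"
    \<comment> \<open>Values between \<open>- C\<close> and \<open>C\<close> have their level in \<open>J\<close>.\<close>
    define m where "m = \<lceil>?k * C\<rceil> + 1"
    define J where "J = {-m..m}"
    define B where "B j = {x\<in>space ?M. \<lfloor>?k * g x\<rfloor> = j}" for j
    have B [measurable]: "B j \<in> sets ?M" for j unfolding B_def by measurable
    define f where "f x = (\<Sum>j\<in>J. (real_of_int j / ?k) * indicator (B j) x)" for x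
    have f_meas: "f \<in> borel_measurable ?M" unfolding f_def by measurable
    have fg: "\<bar>f x - g x\<bar> \<le> 1 / ?k" if "x \<in> space ?M" "\<bar>g x\<bar> \<le> C" for x
    proof -
      let ?j = "\<lfloor>?k * g x\<rfloor>"
      have "\<bar>?k * g x\<bar> \<le> ?k * C" using that by (simp add: abs_mult mult_left_mono)
      then have "?j \<in> J" unfolding J_def m_def by (auto; linarith)
      then have "f x = real_of_int ?j / ?k"
        unfolding f_def using that
        by (subst sum.remove[of J ?j]) (auto simp: J_def B_def intro!: sum.neutral)
      moreover have "real_of_int ?j \<le> ?k * g x" "?k * g x \<le> real_of_int ?j + 1" by linarith+
      then have "real_of_int ?j / ?k \<le> g x" "g x \<le> real_of_int ?j / ?k + 1 / ?k"
        by (simp_all add: field_simps)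
      ultimately show ?thesis by (simp add: abs_le_iff)
    qed
    have AE_fg: "AE x in ?M. \<bar>f x - g x\<bar> \<le> 1 / ?k" using C(2) AE_space by eventually_elim (rule fg)
    have fL: "f \<in> Linf_real ?M"
    proof (rule Linf_realI[OF f_meas])
      show "AE x in ?M. \<bar>f x\<bar> \<le> C + 1 / ?k" using AE_fg C(2) by eventually_elim linarith
    qed
    have "(\<lambda>\<gamma>. complex_of_real (f (rng G \<gamma>))) =
        (\<lambda>\<gamma>. \<Sum>j\<in>J. complex_of_real (real_of_int j / ?k) * complex_of_real (indicator (B j) (rng G \<gamma>)))"
      unfolding f_def by simp
    then have "\<psi> f = \<phi> (\<lambda>\<gamma>. \<Sum>j\<in>J. complex_of_real (real_of_int j / ?k) * complex_of_real (indicator (B j) (rng G \<gamma>)))"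
      unfolding \<psi>_def by simp
    also have "\<dots> = (\<Sum>j\<in>J. \<phi> (\<lambda>\<gamma>. complex_of_real (real_of_int j / ?k) * complex_of_real (indicator (B j) (rng G \<gamma>))))"
      by (rule state_sum[THEN conjunct2], simp add: J_def, rule S_scale[OF ind_S[OF B]])
    also have "\<dots> = (\<Sum>j\<in>J. complex_of_real (real_of_int j / ?k) * complex_of_real (measure ?M (B j)))"
      by (simp only: state_scale[OF ind_S[OF B]] weight_phi[OF B] weight_eq_measure[OF erg B])
    also have "\<dots> = complex_of_real (\<integral>x. f x \<partial>?M)"
    proof -
      have "(\<integral>x. f x \<partial>?M) = (\<Sum>j\<in>J. (real_of_int j / ?k) * measure ?M (B j))"
        unfolding f_def by (subst Bochner_Integration.integral_sum)
          (auto simp: units.emeasure_finite less_top[symmetric] intro!: integrable_mult_right integrable_real_indicator)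
      then show ?thesis by simp
    qed
    finally have \<psi>f: "\<psi> f = complex_of_real (\<integral>x. f x \<partial>?M)" .
    have dL: "(\<lambda>x. g x - f x) \<in> Linf_real ?M"
    proof (rule Linf_realI)
      show "(\<lambda>x. g x - f x) \<in> borel_measurable ?M" using f_meas by simp
      show "AE x in ?M. \<bar>g x - f x\<bar> \<le> 1 / ?k" using AE_fg by eventually_elim linarith
    qed
    have dAE: "AE \<gamma> in arrows G. \<bar>g (rng G \<gamma>) - f (rng G \<gamma>)\<bar> \<le> 1 / ?k"
      using AE_rng[OF AE_fg] by eventually_elim linarith
    have "\<psi> g - \<psi> f = \<phi> (\<lambda>\<gamma>. complex_of_real (g (rng G \<gamma>)) - complex_of_real (f (rng G \<gamma>)))"
      unfolding \<psi>_def by (rule state_diff[symmetric]) (intro real_rng_S g fL)+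
    also have "\<dots> = \<phi> (\<lambda>\<gamma>. complex_of_real (g (rng G \<gamma>) - f (rng G \<gamma>)))" by simp
    finally have "norm (\<psi> g - \<psi> f) \<le> 1 / ?k"
      using state_real_bound[OF real_rng_S[OF dL] dAE] by (simp add: cmod_eq_Re)
    moreover have "norm (complex_of_real (\<integral>x. f x \<partial>?M) - complex_of_real (\<integral>x. g x \<partial>?M)) \<le> 1 / ?k"
    proof -
      have "\<bar>\<integral>x. f x - g x \<partial>?M\<bar> \<le> (\<integral>x. \<bar>f x - g x\<bar> \<partial>?M)" by (rule integral_abs_bound)
      also have "\<dots> \<le> (\<integral>x. 1 / ?k \<partial>?M)"
        using units.Linf_real_integrable[OF fL] units.Linf_real_integrable[OF g] AE_fg
        by (intro integral_mono_AE) auto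
      also have "\<dots> = 1 / ?k" by (simp add: units.prob_space)
      finally have "\<bar>(\<integral>x. f x \<partial>?M) - (\<integral>x. g x \<partial>?M)\<bar> \<le> 1 / ?k"
        using units.Linf_real_integrable[OF fL] units.Linf_real_integrable[OF g] by simp
      then show ?thesis by (simp flip: of_real_diff)
    qed
    ultimately show ?thesis unfolding \<psi>f
      using norm_triangle_ineq[of "\<psi> g - complex_of_real (\<integral>x. f x \<partial>?M)"
          "complex_of_real (\<integral>x. f x \<partial>?M) - complex_of_real (\<integral>x. g x \<partial>?M)"] by simp
  qed
  have "(\<lambda>n. 2 * (1 / real (Suc n))) \<longlonglongrightarrow> 2 * 0"
    by (intro tendsto_intros LIMSEQ_Suc[OF lim_1_over_n])
  then have "norm (\<psi> g - complex_of_real (\<integral>x. g x \<partial>?M)) \<le> 2 * 0"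
    by (rule LIMSEQ_le_const) (use close in blast)
  then show ?thesis unfolding \<psi>_def by simp
qed

end

section \<open>Finitely additive extensions of a probability measure\<close>

definition ultra :: "'a filter \<Rightarrow> bool" where
  "ultra U \<longleftrightarrow> U \<noteq> bot \<and> (\<forall>P. eventually P U \<or> eventually (\<lambda>x. \<not> P x) U)"

lemma ultrafilter_exists:
  fixes F :: "'a filter"
  assumes "F \<noteq> bot"
  obtains U where "U \<le> F" "ultra U"
proof -
  let ?A = "{U. U \<le> F \<and> U \<noteq> bot}" and ?R = "\<lambda>U V :: 'a filter. V \<le> U"
  \<comment> \<open>Zorn's lemma for the proper filters below \<open>F\<close>, ordered by refinement.\<close>
  have po: "partial_order_on ?A (relation_of ?R ?A)"
    by (auto simp: partial_order_on_def preorder_on_def relation_of_def refl_on_def trans_def antisym_def)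
  have "\<exists>m\<in>?A. \<forall>a\<in>?A. ?R m a \<longrightarrow> a = m"
  proof (rule predicate_Zorn[OF po])
    fix C assume C: "C \<in> Chains (relation_of ?R ?A)"
    then have CA: "C \<subseteq> ?A" and chain: "\<And>U V. U \<in> C \<Longrightarrow> V \<in> C \<Longrightarrow> U \<le> V \<or> V \<le> U"
      by (auto simp: Chains_def relation_of_def)
    show "\<exists>u\<in>?A. \<forall>a\<in>C. ?R a u"
    proof (cases "C = {}")
      case True
      then show ?thesis using assms by auto
    next
      case False
      have "eventually P (Inf C) \<longleftrightarrow> (\<exists>b\<in>C. eventually P b)" for P
      proof (rule eventually_Inf_base[OF False])
        fix U V assume "U \<in> C" "V \<in> C"
        then show "\<exists>x\<in>C. x \<le> inf U V" using chain[of U V] by auto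
      qed
      then have "Inf C \<noteq> bot" using CA unfolding trivial_limit_def by auto
      moreover have "Inf C \<le> F"
      proof -
        obtain U where U: "U \<in> C" using False by blast
        then have "Inf C \<le> U" by (rule Inf_lower)
        also have "U \<le> F" using CA U by blast
        finally show ?thesis .
      qed
      ultimately show ?thesis by (intro bexI[of _ "Inf C"]) (auto intro: Inf_lower)
    qed
  qed
  then obtain U where U: "U \<le> F" "U \<noteq> bot" and max: "\<And>V. V \<le> F \<Longrightarrow> V \<noteq> bot \<Longrightarrow> V \<le> U \<Longrightarrow> V = U"
    by auto
  have "eventually P U \<or> eventually (\<lambda>x. \<not> P x) U" for P
  proof (rule disjCI)
    assume n: "\<not> eventually (\<lambda>x. \<not> P x) U"
    let ?V = "inf U (principal {x. P x})"
    have "?V \<noteq> bot"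
      using n unfolding trivial_limit_def eventually_inf_principal by simp
    then have "?V = U" using max[of ?V] U(1) by (simp add: le_infI1)
    moreover have "eventually P ?V" unfolding eventually_inf_principal by simp
    ultimately show "eventually P U" by simp
  qed
  then show ?thesis using that U unfolding ultra_def by blast
qed

lemma ultra_bounded_convergent:
  fixes f :: "'a \<Rightarrow> complex"
  assumes U: "ultra U" and b: "\<forall>\<^sub>F x in U. norm (f x) \<le> C"
  shows "\<exists>l. (f \<longlongrightarrow> l) U"
proof -
  have ne: "filtermap f U \<noteq> bot" using U by (simp add: ultra_def filtermap_bot_iff)
  have "eventually (\<lambda>y. y \<in> cball 0 C) (filtermap f U)" using b by (simp add: eventually_filtermap)
  then obtain l where l: "inf (nhds l) (filtermap f U) \<noteq> bot"
    using compact_cball[of "0 :: complex" C] ne unfolding compact_filter by blast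
  have "(f \<longlongrightarrow> l) U"
  proof (rule topological_tendstoI)
    fix S assume S: "open S" "l \<in> S"
    show "\<forall>\<^sub>F x in U. f x \<in> S"
    proof (rule ccontr)
      assume "\<not> (\<forall>\<^sub>F x in U. f x \<in> S)"
      then have "\<forall>\<^sub>F x in U. f x \<notin> S" using U unfolding ultra_def by blast
      then have "eventually (\<lambda>y. y \<notin> S) (filtermap f U)" by (simp add: eventually_filtermap)
      moreover have "eventually (\<lambda>y. y \<in> S) (nhds l)" using S by (rule eventually_nhds_in_open)
      ultimately have "eventually (\<lambda>_. False) (inf (nhds l) (filtermap f U))"
        unfolding eventually_inf by (intro exI[of _ "\<lambda>y. y \<in> S"] exI[of _ "\<lambda>y. y \<notin> S"]) auto
      then show False using l by (simp add: trivial_limit_def)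
    qed
  qed
  then show ?thesis by blast
qed

definition ess_bounded_on :: "'z measure \<Rightarrow> 'z set \<Rightarrow> ('z \<Rightarrow> complex) \<Rightarrow> bool" where
  "ess_bounded_on Z W f \<longleftrightarrow> (\<exists>N\<in>null_sets Z. \<exists>C. \<forall>z\<in>W - N. norm (f z) \<le> C)"

text \<open>The mean is a limit of finite sampling sums. Every finite family \<open>\<D>\<close> of measurable sets
  partitions the space into the pieces \<open>P \<D> S\<close>. The sum \<open>mm \<D> f\<close> weighs a value of \<open>f\<close> at a point of \<open>W\<close> in
  each piece with the normalised measure of the piece inside the measurable hull \<open>H\<close> of \<open>W\<close>; pieces of positive
  weight do meet \<open>W\<close>. The mean is the limit along an ultrafilter on the finite families, directed by inclusion.
  Once the family contains a null set, values on the null set do not count, and once it contains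
  the level sets of a measurable function, the sum is close to the integral.\<close>

theorem finitely_additive_mean:
  fixes Z :: "'z measure"
  assumes Z: "prob_space Z" and W: "W \<subseteq> space Z" "\<And>N. N \<in> null_sets Z \<Longrightarrow> \<not> W \<subseteq> N"
  obtains H and m :: "('z \<Rightarrow> complex) \<Rightarrow> complex" where
    "H \<in> sets Z" "measure Z H > 0"
    "\<And>f g. ess_bounded_on Z W f \<Longrightarrow> ess_bounded_on Z W g \<Longrightarrow> m (\<lambda>z. f z + g z) = m f + m g"
    "\<And>f c. ess_bounded_on Z W f \<Longrightarrow> m (\<lambda>z. c * f z) = c * m f"
    "\<And>f g N. ess_bounded_on Z W f \<Longrightarrow> N \<in> null_sets Z \<Longrightarrow> (\<And>z. z \<in> W - N \<Longrightarrow> g z = f z) \<Longrightarrow> m g = m f"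
    "\<And>f N. ess_bounded_on Z W f \<Longrightarrow> N \<in> null_sets Z \<Longrightarrow> (\<And>z. z \<in> W - N \<Longrightarrow> f z \<in> \<real>\<^sub>\<ge>\<^sub>0) \<Longrightarrow> m f \<in> \<real>\<^sub>\<ge>\<^sub>0"
    "\<And>f C. f \<in> borel_measurable Z \<Longrightarrow> (\<And>z. z \<in> space Z \<Longrightarrow> \<bar>f z\<bar> \<le> C) \<Longrightarrow>
       m (\<lambda>z. complex_of_real (f z)) = complex_of_real ((\<integral>z. f z * indicator H z \<partial>Z) / measure Z H)"
proof -
  interpret prob_space Z by fact
  obtain H where H: "H \<in> sets Z" "W \<subseteq> H" "outer_measure_of Z W = emeasure Z H"
    using outer_measure_of_attain[OF W(1)] by blast
  have env: "measurable_envelope Z W H"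
  proof -
    have "emeasure Z H < \<infinity>" using emeasure_finite[of H] by (simp add: less_top[symmetric])
    then show ?thesis using measurable_envelope_eq2[OF H(2,1)] H(3) by simp
  qed
  have "emeasure Z H \<noteq> 0" using W(2)[of H] H by (auto intro: null_setsI)
  then have H0: "measure Z H > 0" by (simp add: emeasure_eq_measure zero_less_measure_iff)
  define P where "P \<D> S = {z\<in>space Z. \<forall>D\<in>\<D>. z \<in> D \<longleftrightarrow> D \<in> S}" for \<D> S :: "'z set set"
  define w where "w \<D> S = measure Z (P \<D> S \<inter> H) / measure Z H" for \<D> S
  define pt where "pt \<D> S = (SOME z. z \<in> W \<inter> P \<D> S)" for \<D> S
  define mm where "mm \<D> f = (\<Sum>S\<in>Pow \<D>. complex_of_real (w \<D> S) * f (pt \<D> S))" for \<D> and f :: "'z \<Rightarrow> complex"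
  have P_sets: "P \<D> S \<in> sets Z" if "finite \<D>" "\<D> \<subseteq> sets Z" for \<D> S
  proof -
    have "P \<D> S = space Z \<inter> (\<Inter>D\<in>\<D>. if D \<in> S then D else space Z - D)"
    proof (rule set_eqI)
      fix z
      have "z \<in> (if D \<in> S then D else space Z - D) \<longleftrightarrow> (z \<in> D \<longleftrightarrow> D \<in> S)" if "z \<in> space Z" for D
        using that by auto
      then show "z \<in> P \<D> S \<longleftrightarrow> z \<in> space Z \<inter> (\<Inter>D\<in>\<D>. if D \<in> S then D else space Z - D)"
        unfolding P_def Int_iff INT_iff mem_Collect_eq by blast
    qed
    also have "\<dots> \<in> sets Z"
    proof (cases "\<D> = {}")
      case False
      then show ?thesis using that by (intro sets.Int sets.top sets.finite_INT) auto
    qed simp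
    finally show ?thesis .
  qed
  have w0: "0 \<le> w \<D> S" for \<D> S by (simp add: w_def)
  have pt: "pt \<D> S \<in> W \<inter> P \<D> S" if "finite \<D>" "\<D> \<subseteq> sets Z" "w \<D> S \<noteq> 0" for \<D> S
  proof -
    have "W \<inter> P \<D> S \<noteq> {}"
    proof
      assume "W \<inter> P \<D> S = {}"
      then have "emeasure Z (P \<D> S \<inter> H) = 0"
        using P_sets[OF that(1,2)] H(1) by (intro measurable_envelopeD1[OF env]) auto
      then show False using that(3) by (simp add: w_def measure_def)
    qed
    then show ?thesis unfolding pt_def using someI_ex[of "\<lambda>z. z \<in> W \<inter> P \<D> S"] by blast
  qed
  have partition: "(\<Sum>S\<in>Pow \<D>. indicator (P \<D> S) z) = (1::real)" if "finite \<D>" "z \<in> space Z" for \<D> z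
  proof -
    let ?S = "{D\<in>\<D>. z \<in> D}"
    have "(\<Sum>S\<in>Pow \<D>. indicator (P \<D> S) z) = (indicator (P \<D> ?S) z :: real)"
      by (rule sum.mono_neutral_right[of "Pow \<D>" "{?S}", simplified])
        (use that in \<open>auto simp: P_def indicator_def\<close>)
    also have "\<dots> = 1" using that by (simp add: P_def)
    finally show ?thesis .
  qed
  have w_sum: "(\<Sum>S\<in>Pow \<D>. w \<D> S) = 1" if \<D>: "finite \<D>" "\<D> \<subseteq> sets Z" for \<D>
  proof -
    have "(\<Sum>S\<in>Pow \<D>. measure Z (P \<D> S \<inter> H)) = (\<Sum>S\<in>Pow \<D>. \<integral>z. indicator (P \<D> S) z * indicator H z \<partial>Z)"
      using P_sets[OF \<D>] H(1) by (intro sum.cong) (auto simp flip: indicator_inter_arith)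
    also have "\<dots> = (\<integral>z. (\<Sum>S\<in>Pow \<D>. indicator (P \<D> S) z * indicator H z) \<partial>Z)"
      using P_sets[OF \<D>] H(1)
      by (intro Bochner_Integration.integral_sum[symmetric])
        (auto simp: emeasure_finite less_top[symmetric] simp flip: indicator_inter_arith)
    also have "\<dots> = (\<integral>z. indicator H z \<partial>Z)"
      by (rule Bochner_Integration.integral_cong) (simp_all add: partition[OF \<D>(1)] flip: sum_distrib_right)
    also have "\<dots> = measure Z H" using H(1) by simp
    finally show ?thesis unfolding w_def using H0 by (simp flip: sum_divide_distrib)
  qed
  \<comment> \<open>A piece sampled in a null set of the family lies inside that null set and has no weight.\<close>
  have null_pt: "pt \<D> S \<in> W - N" if "finite \<D>" "\<D> \<subseteq> sets Z" "N \<in> \<D>" "N \<in> null_sets Z" "w \<D> S \<noteq> 0" for \<D> S N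
  proof -
    have p: "pt \<D> S \<in> W \<inter> P \<D> S" by (rule pt[OF that(1,2,5)])
    have "pt \<D> S \<notin> N"
    proof
      assume "pt \<D> S \<in> N"
      then have "P \<D> S \<inter> H \<subseteq> N" using p that(3) by (auto simp: P_def)
      then have "measure Z (P \<D> S \<inter> H) \<le> measure Z N" using that(4) by (intro finite_measure_mono) auto
      also have "measure Z N = 0" using that(4) by (simp add: measure_def null_setsD1)
      finally show False using that(5) by (simp add: w_def measure_le_0_iff)
    qed
    then show ?thesis using p by blast
  qed
  let ?F = "finite_subsets_at_top (sets Z)"
  have "?F \<noteq> bot" by simp
  then obtain U where U: "U \<le> ?F" "ultra U" by (rule ultrafilter_exists)
  have Ubot: "U \<noteq> bot" using U by (simp add: ultra_def)
  have evF: "\<forall>\<^sub>F \<D> in U. finite \<D> \<and> \<D> \<subseteq> sets Z \<and> \<X> \<subseteq> \<D>" if "finite \<X>" "\<X> \<subseteq> sets Z" for \<X>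
  proof (rule filter_leD[OF U(1)])
    show "\<forall>\<^sub>F \<D> in ?F. finite \<D> \<and> \<D> \<subseteq> sets Z \<and> \<X> \<subseteq> \<D>"
      unfolding eventually_finite_subsets_at_top using that by blast
  qed
  have evN: "\<forall>\<^sub>F \<D> in U. finite \<D> \<and> \<D> \<subseteq> sets Z \<and> N \<in> \<D>" if "N \<in> null_sets Z" for N
    using evF[of "{N}"] that by auto
  define m where "m f = Lim U (\<lambda>\<D>. mm \<D> f)" for f
  have conv: "((\<lambda>\<D>. mm \<D> f) \<longlongrightarrow> m f) U" if f: "ess_bounded_on Z W f" for f
  proof -
    obtain N C where N: "N \<in> null_sets Z" "\<And>z. z \<in> W - N \<Longrightarrow> norm (f z) \<le> C"
      using f unfolding ess_bounded_on_def by blast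
    have "\<forall>\<^sub>F \<D> in U. norm (mm \<D> f) \<le> C"
      using evN[OF N(1)]
    proof eventually_elim
      case (elim \<D>)
      have "norm (mm \<D> f) \<le> (\<Sum>S\<in>Pow \<D>. w \<D> S * C)"
        unfolding mm_def
      proof (rule sum_norm_le)
        fix S
        show "norm (complex_of_real (w \<D> S) * f (pt \<D> S)) \<le> w \<D> S * C"
        proof (cases "w \<D> S = 0")
          case False
          then have "norm (f (pt \<D> S)) \<le> C" using null_pt N elim by blast
          then show ?thesis using w0 by (simp add: norm_mult mult_left_mono)
        qed simp
      qed
      also have "\<dots> = C" using w_sum[of \<D>] elim by (simp flip: sum_distrib_right)
      finally show ?case .
    qed
    from ultra_bounded_convergent[OF U(2) this] obtain l where "((\<lambda>\<D>. mm \<D> f) \<longlongrightarrow> l) U" by blast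
    then show ?thesis unfolding m_def using tendsto_Lim[OF Ubot] by metis
  qed
  have m_eq: "m f = l" if "((\<lambda>\<D>. mm \<D> f) \<longlongrightarrow> l) U" for f l
    unfolding m_def by (rule tendsto_Lim[OF Ubot that])
  have sum_in_nonneg: "sum h A \<in> \<real>\<^sub>\<ge>\<^sub>0" if "\<And>S. S \<in> A \<Longrightarrow> h S \<in> \<real>\<^sub>\<ge>\<^sub>0" for h :: "'z set set \<Rightarrow> complex" and A
    using that by (induction A rule: infinite_finite_induct) auto
  show ?thesis
  proof (rule that[of H m])
    show "m (\<lambda>z. f z + g z) = m f + m g" if "ess_bounded_on Z W f" "ess_bounded_on Z W g" for f g
    proof (rule m_eq)
      have "(\<lambda>\<D>. mm \<D> (\<lambda>z. f z + g z)) = (\<lambda>\<D>. mm \<D> f + mm \<D> g)"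
        unfolding mm_def by (simp add: distrib_left sum.distrib)
      then show "((\<lambda>\<D>. mm \<D> (\<lambda>z. f z + g z)) \<longlongrightarrow> m f + m g) U"
        using tendsto_add[OF conv[OF that(1)] conv[OF that(2)]] by simp
    qed
    show "m (\<lambda>z. c * f z) = c * m f" if "ess_bounded_on Z W f" for f c
    proof (rule m_eq)
      have "(\<lambda>\<D>. mm \<D> (\<lambda>z. c * f z)) = (\<lambda>\<D>. c * mm \<D> f)"
        unfolding mm_def by (simp add: sum_distrib_left mult.left_commute)
      then show "((\<lambda>\<D>. mm \<D> (\<lambda>z. c * f z)) \<longlongrightarrow> c * m f) U"
        using tendsto_mult[OF tendsto_const conv[OF that]] by simp
    qed
    show "m g = m f" if f: "ess_bounded_on Z W f" and N: "N \<in> null_sets Z" and eq: "\<And>z. z \<in> W - N \<Longrightarrow> g z = f z" for f g N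
    proof (rule m_eq)
      have "\<forall>\<^sub>F \<D> in U. mm \<D> f = mm \<D> g"
        using evN[OF N]
      proof eventually_elim
        case (elim \<D>)
        show ?case
          unfolding mm_def
        proof (rule sum.cong[OF refl])
          fix S
          show "complex_of_real (w \<D> S) * f (pt \<D> S) = complex_of_real (w \<D> S) * g (pt \<D> S)"
            using null_pt[of \<D> N S] elim N eq by (cases "w \<D> S = 0") auto
        qed
      qed
      then show "((\<lambda>\<D>. mm \<D> g) \<longlongrightarrow> m f) U" using conv[OF f] by (rule Lim_transform_eventually[rotated])
    qed
    show "m f \<in> \<real>\<^sub>\<ge>\<^sub>0" if f: "ess_bounded_on Z W f" and N: "N \<in> null_sets Z" and pos: "\<And>z. z \<in> W - N \<Longrightarrow> f z \<in> \<real>\<^sub>\<ge>\<^sub>0" for f N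
    proof (rule Lim_in_closed_set[OF closed_nonneg_Reals_complex _ Ubot conv[OF f]])
      show "\<forall>\<^sub>F \<D> in U. mm \<D> f \<in> \<real>\<^sub>\<ge>\<^sub>0"
        using evN[OF N]
      proof eventually_elim
        case (elim \<D>)
        show ?case
          unfolding mm_def
        proof (rule sum_in_nonneg)
          fix S
          show "complex_of_real (w \<D> S) * f (pt \<D> S) \<in> \<real>\<^sub>\<ge>\<^sub>0"
            using null_pt[of \<D> N S] elim N pos w0 by (cases "w \<D> S = 0") auto
        qed
      qed
    qed
    show "m (\<lambda>z. complex_of_real (f z)) = complex_of_real ((\<integral>z. f z * indicator H z \<partial>Z) / measure Z H)"
      if f [measurable]: "f \<in> borel_measurable Z" and C: "\<And>z. z \<in> space Z \<Longrightarrow> \<bar>f z\<bar> \<le> C" for f C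
    proof (rule m_eq, rule tendstoI)
      fix \<epsilon> :: real assume "\<epsilon> > 0"
      then obtain n where n: "1 / real (Suc n) < \<epsilon>" using nat_approx_posE by blast
      let ?k = "real (Suc n)" and ?I = "\<integral>z. f z * indicator H z \<partial>Z"
      \<comment> \<open>The sets \<open>B j\<close> with \<open>j\<close> between \<open>- M\<close> and \<open>M\<close> are all the nonempty level sets of \<open>f\<close>, rounded down to multiples of \<open>1 / ?k\<close>.\<close>
      define M where "M = \<lceil>?k * C\<rceil> + 1"
      define B where "B j = {z\<in>space Z. \<lfloor>?k * f z\<rfloor> = j}" for j
      have B: "B j \<in> sets Z" for j unfolding B_def by measurable
      have "finite (B ` {-M..M})" "B ` {-M..M} \<subseteq> sets Z" using B by auto
      from evF[OF this] show "\<forall>\<^sub>F \<D> in U. dist (mm \<D> (\<lambda>z. complex_of_real (f z))) (complex_of_real (?I / measure Z H)) < \<epsilon>"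
      proof eventually_elim
        case (elim \<D>)
        then have \<D>: "finite \<D>" "\<D> \<subseteq> sets Z" "\<And>j. j \<in> {-M..M} \<Longrightarrow> B j \<in> \<D>" by auto
        note [measurable] = P_sets[OF \<D>(1,2)] H(1)
        have osc: "\<bar>f z - f (pt \<D> S)\<bar> \<le> 1 / ?k" if "z \<in> P \<D> S" "w \<D> S \<noteq> 0" for z S
        proof -
          have zZ: "z \<in> space Z" using that by (simp add: P_def)
          let ?j = "\<lfloor>?k * f z\<rfloor>"
          have "\<bar>?k * f z\<bar> \<le> ?k * C" using C[OF zZ] by (simp add: abs_mult mult_left_mono)
          then have "?j \<in> {-M..M}" unfolding M_def by (auto; linarith)
          then have "B ?j \<in> \<D>" by (rule \<D>(3))
          moreover have "z \<in> B ?j" using zZ by (simp add: B_def)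
          ultimately have "pt \<D> S \<in> B ?j" using pt[OF \<D>(1,2) that(2)] that(1) by (auto simp: P_def)
          then have "\<lfloor>?k * f (pt \<D> S)\<rfloor> = ?j" by (simp add: B_def)
          then have "\<bar>?k * f z - ?k * f (pt \<D> S)\<bar> \<le> 1" by linarith
          then have "?k * \<bar>f z - f (pt \<D> S)\<bar> \<le> 1" by (simp add: abs_mult flip: right_diff_distrib)
          then show ?thesis by (simp add: field_simps)
        qed
        have intf: "integrable Z (\<lambda>z. f z * indicator H z)"
          using C by (intro integrable_const_bound[of _ C] AE_I2) (auto simp: indicator_def intro: order_trans[OF abs_ge_zero])
        have intp: "integrable Z (\<lambda>z. c * (indicator (P \<D> S) z * indicator H z))" for c :: real and S
          by (intro integrable_mult_right) (auto simp: emeasure_finite less_top[symmetric] simp flip: indicator_inter_arith)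
        let ?g = "\<lambda>z. \<Sum>S\<in>Pow \<D>. f (pt \<D> S) * (indicator (P \<D> S) z * indicator H z) :: real"
        have intg: "integrable Z ?g" by (intro Bochner_Integration.integrable_sum intp)
        have "(\<integral>z. ?g z \<partial>Z) = (\<Sum>S\<in>Pow \<D>. f (pt \<D> S) * measure Z (P \<D> S \<inter> H))"
          by (subst Bochner_Integration.integral_sum[OF intp]) (simp flip: indicator_inter_arith)
        also have "\<dots> = (\<Sum>S\<in>Pow \<D>. w \<D> S * f (pt \<D> S)) * measure Z H"
          unfolding w_def sum_distrib_right using H0 by (intro sum.cong) auto
        finally have g: "(\<Sum>S\<in>Pow \<D>. w \<D> S * f (pt \<D> S)) = (\<integral>z. ?g z \<partial>Z) / measure Z H"
          using H0 by (simp add: field_simps)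
        have AEw: "AE z in Z. \<forall>S\<in>Pow \<D>. z \<in> P \<D> S \<inter> H \<longrightarrow> w \<D> S \<noteq> 0"
        proof (subst AE_ball_countable)
          show "countable (Pow \<D>)" using \<D>(1) by (simp add: countable_finite)
          show "\<forall>S\<in>Pow \<D>. AE z in Z. z \<in> P \<D> S \<inter> H \<longrightarrow> w \<D> S \<noteq> 0"
          proof
            fix S
            show "AE z in Z. z \<in> P \<D> S \<inter> H \<longrightarrow> w \<D> S \<noteq> 0"
            proof (cases "w \<D> S = 0")
              case True
              then have "P \<D> S \<inter> H \<in> null_sets Z"
                using H0 by (auto intro!: null_setsI simp: w_def emeasure_eq_measure)
              from AE_not_in[OF this] show ?thesis by eventually_elim blast
            qed simp
          qed
        qed
        have AEb: "AE z in Z. \<bar>?g z - f z * indicator H z\<bar> \<le> 1 / ?k * indicator H z"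
          using AEw AE_space
        proof eventually_elim
          case (elim z)
          show ?case
          proof (cases "z \<in> H")
            case True
            let ?S = "{D\<in>\<D>. z \<in> D}"
            have zP: "z \<in> P \<D> ?S" using elim(2) by (simp add: P_def)
            have "?g z = f (pt \<D> ?S)"
            proof -
              have "?g z = f (pt \<D> ?S) * (indicator (P \<D> ?S) z * indicator H z)"
                by (rule sum.mono_neutral_right[of "Pow \<D>" "{?S}", simplified])
                  (use \<D>(1) elim(2) in \<open>auto simp: P_def indicator_def\<close>)
              then show ?thesis using True zP by simp
            qed
            moreover have "w \<D> ?S \<noteq> 0" using elim(1) zP True by blast
            ultimately show ?thesis using osc[OF zP] True by (simp add: abs_minus_commute)
          qed simp
        qed
        have "\<bar>(\<integral>z. ?g z \<partial>Z) - ?I\<bar> = \<bar>\<integral>z. ?g z - f z * indicator H z \<partial>Z\<bar>"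
          using intg intf by simp
        also have "\<dots> \<le> (\<integral>z. \<bar>?g z - f z * indicator H z\<bar> \<partial>Z)" by (rule integral_abs_bound)
        also have "\<dots> \<le> (\<integral>z. 1 / ?k * indicator H z \<partial>Z)"
          by (rule integral_mono_AE)
            (use intg intf AEb in \<open>auto simp: emeasure_finite less_top[symmetric] intro!: integrable_mult_right\<close>)
        also have "\<dots> = 1 / ?k * measure Z H" using H(1) by simp
        finally have "\<bar>(\<integral>z. ?g z \<partial>Z) - ?I\<bar> \<le> 1 / ?k * measure Z H" .
        then have "\<bar>(\<integral>z. ?g z \<partial>Z) / measure Z H - ?I / measure Z H\<bar> \<le> 1 / ?k"
          using H0 by (simp add: field_simps flip: diff_divide_distrib)
        moreover have "mm \<D> (\<lambda>z. complex_of_real (f z)) = complex_of_real (\<Sum>S\<in>Pow \<D>. w \<D> S * f (pt \<D> S))"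
          unfolding mm_def by simp
        ultimately have "dist (mm \<D> (\<lambda>z. complex_of_real (f z))) (complex_of_real (?I / measure Z H)) \<le> 1 / ?k"
          by (simp only: g dist_norm of_real_diff[symmetric] norm_of_real)
        then show ?case using n by linarith
      qed
    qed
  qed (use H H0 in auto)
qed

section \<open>Components of an ergodic decomposition\<close>

lemma component_simps [simp]:
  "src (component G \<pi> \<mu> z) = src G" "rng (component G \<pi> \<mu> z) = rng G"
  "gmul (component G \<pi> \<mu> z) = gmul G" "ginv (component G \<pi> \<mu> z) = ginv G"
  "gunit (component G \<pi> \<mu> z) = gunit G"
  by (simp_all add: component_def restrict_groupoid_def Let_def)

lemma component_units:
  "units (component G \<pi> \<mu> z) = restrict_space (\<mu> z) (\<pi> -` {z} \<inter> space (units G))"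
  by (simp add: component_def restrict_groupoid_def Let_def)

lemma component_translates [simp]:
  "left_translate (component G \<pi> \<mu> z) = left_translate G"
  "right_translate (component G \<pi> \<mu> z) = right_translate G"
  by (auto simp: left_translate_def right_translate_def fun_eq_iff)

locale decomposed_groupoid = pmp_groupoid G for G :: "('g, 'x) groupoid" +
  fixes Z :: "'z measure" and \<pi> :: "'x \<Rightarrow> 'z" and \<mu> :: "'z \<Rightarrow> 'x measure"
  assumes dec: "ergodic_decomposition G Z \<pi> \<mu>"
begin

abbreviation "fib z \<equiv> \<pi> -` {z} \<inter> space (units G)"
abbreviation "cmp z \<equiv> component G \<pi> \<mu> z"
abbreviation "cars z \<equiv> space (arrows (cmp z))"

lemmas dec' = dec[unfolded ergodic_decomposition_def]

lemmas std_Z = dec'[THEN conjunct1] and prob_Z = dec'[THEN conjunct2, THEN conjunct1]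
  and pi_meas [measurable] = dec'[THEN conjunct2, THEN conjunct2, THEN conjunct1] and distr_pi = dec'[THEN conjunct2, THEN conjunct2, THEN conjunct2, THEN conjunct1]

lemma cond_prob: "z \<in> space Z \<Longrightarrow> prob_space (\<mu> z)"
  and sets_cond: "z \<in> space Z \<Longrightarrow> sets (\<mu> z) = sets (units G)"
  using dec'[THEN conjunct2, THEN conjunct2, THEN conjunct2, THEN conjunct2, THEN conjunct1] by blast+

text \<open>The properties that an ergodic decomposition guarantees for almost every \<open>z\<close>.\<close>

definition good :: "'z \<Rightarrow> bool" where
  "good z \<longleftrightarrow> z \<in> space Z \<and> emeasure (\<mu> z) (fib z) = 1 \<and> invariant_mod G (\<mu> z) (fib z) \<and>
     countable_pmp_groupoid (cmp z) \<and> ergodic (cmp z)"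

lemma AE_good: "AE z in Z. good z"
proof -
  note a = dec'[THEN conjunct2, THEN conjunct2, THEN conjunct2, THEN conjunct2, THEN conjunct2, THEN conjunct1] dec'[THEN conjunct2, THEN conjunct2, THEN conjunct2, THEN conjunct2, THEN conjunct2, THEN conjunct2, THEN conjunct1] dec'[THEN conjunct2, THEN conjunct2, THEN conjunct2, THEN conjunct2, THEN conjunct2, THEN conjunct2, THEN conjunct2, THEN conjunct1]
  from a AE_space show ?thesis unfolding good_def by eventually_elim simp
qed

lemma disintegration:
  fixes f :: "'x \<Rightarrow> real"
  assumes "f \<in> borel_measurable (units G)" "bounded (f ` space (units G))"
  shows "(\<lambda>z. \<integral>x. f x \<partial>\<mu> z) \<in> borel_measurable Z"
    "(\<integral>x. f x \<partial>units G) = (\<integral>z. (\<integral>x. f x \<partial>\<mu> z) \<partial>Z)"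
  using dec'[THEN conjunct2, THEN conjunct2, THEN conjunct2, THEN conjunct2, THEN conjunct2, THEN conjunct2, THEN conjunct2, THEN conjunct2, rule_format, of f] assms by blast+

lemma disintegration_set:
  assumes A: "A \<in> sets (units G)"
  shows "(\<lambda>z. emeasure (\<mu> z) A) \<in> borel_measurable Z"
    "emeasure (units G) A = (\<integral>\<^sup>+z. emeasure (\<mu> z) A \<partial>Z)"
proof -
  interpret Z: prob_space Z by (rule prob_Z)
  have b: "bounded ((\<lambda>x. indicator A x :: real) ` space (units G))"
    by (rule boundedI[of _ 1]) (auto simp: indicator_def)
  have m: "(\<lambda>x. indicator A x :: real) \<in> borel_measurable (units G)" using A by simp
  have eq: "(\<integral>x. indicator A x \<partial>\<mu> z) = measure (\<mu> z) A" if "z \<in> space Z" for z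
    using A sets_cond[OF that] by simp
  have em: "emeasure (\<mu> z) A = ennreal (measure (\<mu> z) A)" if "z \<in> space Z" for z
  proof -
    interpret prob_space "\<mu> z" by (rule cond_prob[OF that])
    show ?thesis by (rule emeasure_eq_measure)
  qed
  have meas: "(\<lambda>z. measure (\<mu> z) A) \<in> borel_measurable Z"
    using disintegration(1)[OF m b] by (rule measurable_cong[THEN iffD1, rotated]) (rule eq)
  then have "(\<lambda>z. ennreal (measure (\<mu> z) A)) \<in> borel_measurable Z" by simp
  then show "(\<lambda>z. emeasure (\<mu> z) A) \<in> borel_measurable Z"
    by (rule measurable_cong[THEN iffD1, rotated]) (simp add: em)
  have le1: "measure (\<mu> z) A \<le> 1" if "z \<in> space Z" for z
    using prob_space.prob_le_1[OF cond_prob[OF that]] .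
  have int: "integrable Z (\<lambda>z. measure (\<mu> z) A)"
    by (rule Z.integrable_const_bound[of _ 1]) (use le1 meas in \<open>auto intro!: AE_I2\<close>)
  have "measure (units G) A = (\<integral>z. measure (\<mu> z) A \<partial>Z)"
  proof -
    have "measure (units G) A = (\<integral>x. indicator A x \<partial>units G)" using A by simp
    also have "\<dots> = (\<integral>z. (\<integral>x. indicator A x \<partial>\<mu> z) \<partial>Z)" by (rule disintegration(2)[OF m b])
    also have "\<dots> = (\<integral>z. measure (\<mu> z) A \<partial>Z)" by (rule Bochner_Integration.integral_cong[OF refl]) (rule eq)
    finally show ?thesis .
  qed
  then have "emeasure (units G) A = ennreal (\<integral>z. measure (\<mu> z) A \<partial>Z)" by (simp add: units.emeasure_eq_measure)
  also have "\<dots> = (\<integral>\<^sup>+z. ennreal (measure (\<mu> z) A) \<partial>Z)"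
    using nn_integral_eq_integral[OF int] by simp
  also have "\<dots> = (\<integral>\<^sup>+z. emeasure (\<mu> z) A \<partial>Z)" by (rule nn_integral_cong) (simp add: em)
  finally show "emeasure (units G) A = (\<integral>\<^sup>+z. emeasure (\<mu> z) A \<partial>Z)" .
qed

lemma cond_null:
  assumes "N \<in> null_sets (units G)" shows "AE z in Z. N \<in> null_sets (\<mu> z)"
proof -
  have N: "N \<in> sets (units G)" using assms by auto
  have "(\<integral>\<^sup>+z. emeasure (\<mu> z) N \<partial>Z) = 0" using disintegration_set(2)[OF N, symmetric] null_setsD1[OF assms] by simp
  then have "AE z in Z. emeasure (\<mu> z) N = 0"
    using nn_integral_0_iff_AE[OF disintegration_set(1)[OF N]] by simp
  then show ?thesis using AE_space by eventually_elim (use N sets_cond in auto)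
qed

lemma cond_AE: "AE x in units G. P x \<Longrightarrow> AE z in Z. AE x in \<mu> z. P x"
proof (erule AE_E3)
  fix N assume N: "\<And>x. x \<in> space (units G) - N \<Longrightarrow> P x" "N \<in> null_sets (units G)"
  show ?thesis
    using cond_null[OF N(2)] AE_space
  proof eventually_elim
    case (elim z)
    show ?case
      using AE_not_in[OF elim(1)] AE_space[of "\<mu> z"]
      by eventually_elim (use N(1) sets_eq_imp_space_eq[OF sets_cond[OF elim(2)]] in auto)
  qed
qed

lemma comp_pmp: "good z \<Longrightarrow> pmp_groupoid (cmp z)"
  by unfold_locales (simp add: good_def)

lemma good_space: "good z \<Longrightarrow> z \<in> space Z"
  by (simp add: good_def)

lemma space_cond: "good z \<Longrightarrow> space (\<mu> z) = space (units G)"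
  using sets_eq_imp_space_eq[OF sets_cond] good_space by blast

lemma fib_sets: "good z \<Longrightarrow> fib z \<in> sets (units G)"
proof (rule ccontr)
  assume z: "good z" and "fib z \<notin> sets (units G)"
  then have "fib z \<notin> sets (\<mu> z)" using sets_cond good_space by blast
  then have "emeasure (\<mu> z) (fib z) = 0" by (rule emeasure_notin_sets)
  then show False using z by (simp add: good_def)
qed

lemma AE_fib: "good z \<Longrightarrow> AE x in \<mu> z. x \<in> fib z"
proof -
  assume z: "good z"
  interpret prob_space "\<mu> z" by (rule cond_prob[OF good_space[OF z]])
  have "fib z \<in> sets (\<mu> z)" using fib_sets[OF z] sets_cond[OF good_space[OF z]] by simp
  then show ?thesis using z by (subst AE_in_set_eq_1) (simp_all add: good_def measure_def)
qed

lemma fib_Int_sets: "good z \<Longrightarrow> fib z \<inter> space (\<mu> z) \<in> sets (\<mu> z)"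
  using fib_sets sets_cond[OF good_space] space_cond by (simp add: Int_assoc)

lemma AE_comp_units: "good z \<Longrightarrow> (AE x in units (cmp z). P x) \<longleftrightarrow> (AE x in \<mu> z. P x)"
proof -
  assume z: "good z"
  have "(AE x in units (cmp z). P x) \<longleftrightarrow> (AE x in \<mu> z. x \<in> fib z \<longrightarrow> P x)"
    unfolding component_units by (rule AE_restrict_space_iff[OF fib_Int_sets[OF z]])
  also have "\<dots> \<longleftrightarrow> (AE x in \<mu> z. P x)"
    using AE_fib[OF z] by (auto elim!: AE_mp)
  finally show ?thesis .
qed

lemma space_comp_units: "good z \<Longrightarrow> space (units (cmp z)) = fib z"
  using space_cond by (auto simp: component_units space_restrict_space)

lemma sets_comp_units: "good z \<Longrightarrow> A \<in> sets (units (cmp z)) \<longleftrightarrow> A \<in> sets (units G) \<and> A \<subseteq> fib z"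
  using fib_Int_sets sets_cond[OF good_space] by (simp add: component_units sets_restrict_space_iff conj_commute)

lemma emeasure_comp_units: "good z \<Longrightarrow> A \<in> sets (units G) \<Longrightarrow> emeasure (units (cmp z)) (A \<inter> fib z) = emeasure (\<mu> z) A"
proof -
  assume z: "good z" and A: "A \<in> sets (units G)"
  have "emeasure (units (cmp z)) (A \<inter> fib z) = emeasure (\<mu> z) (A \<inter> fib z)"
    unfolding component_units by (rule emeasure_restrict_space[OF fib_Int_sets[OF z]]) auto
  also have "\<dots> = emeasure (\<mu> z) A"
    by (rule emeasure_eq_AE) (use AE_fib[OF z] A fib_sets[OF z] sets_cond[OF good_space[OF z]] in auto)
  finally show ?thesis .
qed

lemma comp_units_meas:
  fixes f :: "'x \<Rightarrow> 'b :: topological_space"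
  shows "good z \<Longrightarrow> f \<in> borel_measurable (units G) \<Longrightarrow> f \<in> borel_measurable (units (cmp z))"
  unfolding component_units
  by (rule measurable_restrict_space1) (simp add: measurable_cong_sets[OF sets_cond[OF good_space] refl])

lemma cars_eq: "cars z = {\<gamma>\<in>ars. src G \<gamma> \<in> fib z \<and> rng G \<gamma> \<in> fib z}"
  by (auto simp: component_def restrict_groupoid_def Let_def space_restrict_space arrows_from_def arrows_to_def
      space_measure_of_conv)

lemma cars_sub: "\<gamma> \<in> cars z \<Longrightarrow> \<gamma> \<in> ars"
  by (simp add: cars_eq)

lemma cars_sets: "good z \<Longrightarrow> cars z \<in> sets (arrows G)"
proof -
  assume z: "good z"
  have "cars z = arrows_from G (fib z) \<inter> arrows_to G (fib z)"
    by (auto simp: cars_eq arrows_from_def arrows_to_def)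
  then show ?thesis using from_sets[OF fib_sets[OF z]] to_sets[OF fib_sets[OF z]] by simp
qed

lemma sets_comp_arrows: "good z \<Longrightarrow> C \<in> sets (arrows (cmp z)) \<longleftrightarrow> C \<in> sets (arrows G) \<and> C \<subseteq> cars z"
proof -
  assume z: "good z"
  let ?N = "restrict_space (arrows G) (arrows_from G (fib z) \<inter> arrows_to G (fib z))"
  have "sets (arrows (cmp z)) = sets ?N"
    by (simp add: component_def restrict_groupoid_def Let_def sets.sigma_sets_eq sets.space_closed)
  moreover have "arrows_from G (fib z) \<inter> arrows_to G (fib z) = cars z"
    by (auto simp: cars_eq arrows_from_def arrows_to_def)
  ultimately show ?thesis using cars_sets[OF z] sets.sets_into_space[OF cars_sets[OF z]]
    by (simp add: sets_restrict_space_iff Int_absorb2 conj_commute)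
qed

lemma comp_arrows_meas:
  fixes f :: "'g \<Rightarrow> 'b :: topological_space"
  shows "good z \<Longrightarrow> f \<in> borel_measurable (arrows G) \<Longrightarrow> f \<in> borel_measurable (arrows (cmp z))"
proof (rule measurableI)
  assume z: "good z" and f: "f \<in> borel_measurable (arrows G)"
  fix A :: "'b set" assume A: "A \<in> sets borel"
  have "f -` A \<inter> cars z = (f -` A \<inter> ars) \<inter> cars z" using cars_sub by blast
  then show "f -` A \<inter> cars z \<in> sets (arrows (cmp z))"
    using measurable_sets[OF f A] cars_sets[OF z] by (simp add: sets_comp_arrows[OF z])
qed simp

lemma comp_bisection: "good z \<Longrightarrow> \<theta> \<in> local_bisections (cmp z) \<longleftrightarrow> \<theta> \<in> local_bisections G \<and> \<theta> \<subseteq> cars z"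
  by (auto simp: local_bisections_def sets_comp_arrows)

lemma emeasure_comp_arrows:
  assumes z: "good z" and C: "C \<in> sets (arrows (cmp z))"
  shows "emeasure (arrows (cmp z)) C = fibre_count (rng G) (units (cmp z)) C"
  using pmp_groupoid.emeasure_rng[OF comp_pmp[OF z] C] by simp

lemma invariant_fib:
  assumes z: "good z"
  shows "AE x in units (cmp z). \<forall>\<gamma>\<in>ars. (src G \<gamma> = x \<longrightarrow> rng G \<gamma> \<in> fib z) \<and> (rng G \<gamma> = x \<longrightarrow> src G \<gamma> \<in> fib z)"
proof -
  have "AE x in \<mu> z. x \<in> fib z \<longrightarrow> rng G ` arrows_from G {x} \<subseteq> fib z"
    using z unfolding good_def invariant_mod_def by blast
  then have "AE x in \<mu> z. \<forall>\<gamma>\<in>ars. (src G \<gamma> = x \<longrightarrow> rng G \<gamma> \<in> fib z) \<and> (rng G \<gamma> = x \<longrightarrow> src G \<gamma> \<in> fib z)"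
    using AE_fib[OF z]
  proof eventually_elim
    case (elim x)
    have r: "rng G \<gamma> \<in> fib z" if "\<gamma> \<in> ars" "src G \<gamma> = x" for \<gamma>
      using elim that by (auto simp: arrows_from_def)
    have "src G \<gamma> \<in> fib z" if "\<gamma> \<in> ars" "rng G \<gamma> = x" for \<gamma>
      using r[of "ginv G \<gamma>"] that by simp
    with r show ?case by blast
  qed
  then show ?thesis by (simp only: AE_comp_units[OF z])
qed

text \<open>The right-hand side, unlike the measure on the arrows of the component, is evidently
  measurable in \<open>z\<close>, and its integral over \<open>Z\<close> is at most the measure of \<open>C\<close> (\<open>comp_bound_integral\<close>).
  This replaces a disintegration of the measure on the arrows.\<close>

lemma comp_bound:
  assumes z: "good z" and \<theta>: "\<And>n::nat. \<theta> n \<in> local_bisections G"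
    and N: "N \<in> null_sets (\<mu> z)"
    and cover: "\<And>\<gamma>. \<gamma> \<in> ars \<Longrightarrow> rng G \<gamma> \<notin> N \<Longrightarrow> \<exists>n. \<gamma> \<in> \<theta> n"
    and C: "C \<in> sets (arrows G)"
  shows "emeasure (arrows (cmp z)) (C \<inter> cars z) \<le> (\<Sum>n. emeasure (\<mu> z) (rng G ` (\<theta> n \<inter> C)))"
proof -
  have \<rho>: "\<theta> n \<inter> C \<in> local_bisections G" for n by (rule bisection_Int[OF \<theta> C])
  have R: "rng G ` (\<theta> n \<inter> C) \<in> sets (units G)" for n by (rule bisection_rng[OF \<rho>])
  have CK: "C \<inter> cars z \<in> sets (arrows (cmp z))" using C cars_sets[OF z] by (simp add: sets_comp_arrows[OF z])
  have "AE x in units (cmp z). emeasure (count_space UNIV) {\<gamma> \<in> C \<inter> cars z. rng G \<gamma> = x} \<le>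
      (\<Sum>n. indicator (rng G ` (\<theta> n \<inter> C)) x)"
  proof -
    have "AE x in units (cmp z). x \<notin> N" using AE_not_in[OF N] by (simp only: AE_comp_units[OF z])
    then show ?thesis
    proof eventually_elim
      case (elim x)
      have "{\<gamma> \<in> C \<inter> cars z. rng G \<gamma> = x} \<subseteq> (\<Union>n. {\<gamma> \<in> \<theta> n \<inter> C. rng G \<gamma> = x})"
        using cover elim cars_sub by blast
      then have "emeasure (count_space UNIV) {\<gamma> \<in> C \<inter> cars z. rng G \<gamma> = x} \<le>
          emeasure (count_space UNIV) (\<Union>n. {\<gamma> \<in> \<theta> n \<inter> C. rng G \<gamma> = x})" by (rule emeasure_mono) simp
      also have "\<dots> \<le> (\<Sum>n. emeasure (count_space UNIV) {\<gamma> \<in> \<theta> n \<inter> C. rng G \<gamma> = x})"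
        by (rule emeasure_subadditive_countably) auto
      also have "\<dots> = (\<Sum>n. indicator (rng G ` (\<theta> n \<inter> C)) x)"
        by (simp only: count_fibre_injective[OF bisection_inj_rng[OF \<rho>]])
      finally show ?case .
    qed
  qed
  then have "emeasure (arrows (cmp z)) (C \<inter> cars z) \<le> (\<integral>\<^sup>+x. (\<Sum>n. indicator (rng G ` (\<theta> n \<inter> C)) x) \<partial>units (cmp z))"
    unfolding emeasure_comp_arrows[OF z CK] fibre_count_def by (rule nn_integral_mono_AE)
  also have "\<dots> = (\<Sum>n. \<integral>\<^sup>+x. indicator (rng G ` (\<theta> n \<inter> C)) x \<partial>units (cmp z))"
    by (rule nn_integral_suminf) (rule comp_units_meas[OF z borel_measurable_indicator[OF R]])
  also have "\<dots> = (\<Sum>n. emeasure (\<mu> z) (rng G ` (\<theta> n \<inter> C)))"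
  proof (rule suminf_cong)
    fix n
    have "(\<integral>\<^sup>+x. indicator (rng G ` (\<theta> n \<inter> C)) x \<partial>units (cmp z)) =
        (\<integral>\<^sup>+x. indicator (rng G ` (\<theta> n \<inter> C) \<inter> fib z) x \<partial>units (cmp z))"
      by (rule nn_integral_cong) (simp add: space_comp_units[OF z] indicator_def)
    also have "\<dots> = emeasure (units (cmp z)) (rng G ` (\<theta> n \<inter> C) \<inter> fib z)"
      by (rule nn_integral_indicator) (use R fib_sets[OF z] in \<open>auto simp: sets_comp_units[OF z]\<close>)
    also have "\<dots> = emeasure (\<mu> z) (rng G ` (\<theta> n \<inter> C))" by (rule emeasure_comp_units[OF z R])
    finally show "(\<integral>\<^sup>+x. indicator (rng G ` (\<theta> n \<inter> C)) x \<partial>units (cmp z)) = emeasure (\<mu> z) (rng G ` (\<theta> n \<inter> C))" .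
  qed
  finally show ?thesis .
qed

lemma comp_bound_integral:
  assumes \<theta>: "\<And>n::nat. \<theta> n \<in> local_bisections G" "disjoint_family \<theta>" and C: "C \<in> sets (arrows G)"
  shows "(\<lambda>z. \<Sum>n. emeasure (\<mu> z) (rng G ` (\<theta> n \<inter> C))) \<in> borel_measurable Z"
    "(\<integral>\<^sup>+z. (\<Sum>n. emeasure (\<mu> z) (rng G ` (\<theta> n \<inter> C))) \<partial>Z) \<le> emeasure (arrows G) C"
proof -
  have \<rho>: "\<theta> n \<inter> C \<in> local_bisections G" for n by (rule bisection_Int[OF \<theta>(1) C])
  have R: "rng G ` (\<theta> n \<inter> C) \<in> sets (units G)" for n by (rule bisection_rng[OF \<rho>])
  note [measurable] = disintegration_set(1)[OF R]
  show "(\<lambda>z. \<Sum>n. emeasure (\<mu> z) (rng G ` (\<theta> n \<inter> C))) \<in> borel_measurable Z" by measurable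
  have "(\<integral>\<^sup>+z. (\<Sum>n. emeasure (\<mu> z) (rng G ` (\<theta> n \<inter> C))) \<partial>Z) = (\<Sum>n. emeasure (units G) (rng G ` (\<theta> n \<inter> C)))"
    by (subst nn_integral_suminf) (simp_all add: disintegration_set(2)[OF R])
  also have "\<dots> = (\<Sum>n. emeasure (arrows G) (\<theta> n \<inter> C))"
    using emeasure_rng_image[OF bisection_sets[OF \<rho>] bisection_inj_rng[OF \<rho>]] by simp
  also have "\<dots> = emeasure (arrows G) (\<Union>n. \<theta> n \<inter> C)"
    by (rule suminf_emeasure) (use bisection_sets[OF \<rho>] \<theta>(2) in \<open>auto simp: disjoint_family_on_def\<close>)
  also have "\<dots> \<le> emeasure (arrows G) C" using C by (intro emeasure_mono) auto
  finally show "(\<integral>\<^sup>+z. (\<Sum>n. emeasure (\<mu> z) (rng G ` (\<theta> n \<inter> C))) \<partial>Z) \<le> emeasure (arrows G) C" .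
qed

lemma comp_arrows_finite:
  assumes C: "C \<in> sets (arrows G)" "emeasure (arrows G) C < \<infinity>"
  shows "AE z in Z. emeasure (arrows (cmp z)) (C \<inter> cars z) < \<infinity>"
proof -
  obtain \<theta> :: "nat \<Rightarrow> 'g set" and N where \<theta>: "\<And>n. \<theta> n \<in> local_bisections G" "disjoint_family \<theta>"
      and N: "N \<in> null_sets (units G)"
      and cover: "\<And>\<gamma>. \<gamma> \<in> ars \<Longrightarrow> src G \<gamma> \<notin> N \<or> rng G \<gamma> \<notin> N \<Longrightarrow> \<exists>n. \<gamma> \<in> \<theta> n"
    by (rule bisection_cover) (rule that)
  have "AE z in Z. (\<Sum>n. emeasure (\<mu> z) (rng G ` (\<theta> n \<inter> C))) \<noteq> \<infinity>"
    using comp_bound_integral[OF \<theta> C(1)] C(2) by (intro nn_integral_PInf_AE) auto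
  then show ?thesis
    using AE_good cond_null[OF N]
  proof eventually_elim
    case (elim z)
    have "emeasure (arrows (cmp z)) (C \<inter> cars z) \<le> (\<Sum>n. emeasure (\<mu> z) (rng G ` (\<theta> n \<inter> C)))"
      by (rule comp_bound[OF elim(2) \<theta>(1) elim(3) _ C(1)]) (use cover in blast)
    then show ?case using elim(1) by (simp add: less_top[symmetric] top_unique) (metis top_unique)
  qed
qed

lemma comp_arrows_null:
  assumes C: "C \<in> null_sets (arrows G)"
  shows "AE z in Z. C \<inter> cars z \<in> null_sets (arrows (cmp z))"
proof -
  obtain \<theta> :: "nat \<Rightarrow> 'g set" and N where \<theta>: "\<And>n. \<theta> n \<in> local_bisections G" "disjoint_family \<theta>"
      and N: "N \<in> null_sets (units G)"
      and cover: "\<And>\<gamma>. \<gamma> \<in> ars \<Longrightarrow> src G \<gamma> \<notin> N \<or> rng G \<gamma> \<notin> N \<Longrightarrow> \<exists>n. \<gamma> \<in> \<theta> n"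
    by (rule bisection_cover) (rule that)
  have Cs: "C \<in> sets (arrows G)" using C by auto
  have "(\<integral>\<^sup>+z. (\<Sum>n. emeasure (\<mu> z) (rng G ` (\<theta> n \<inter> C))) \<partial>Z) = 0"
    using comp_bound_integral(2)[OF \<theta> Cs] null_setsD1[OF C] by simp
  then have "AE z in Z. (\<Sum>n. emeasure (\<mu> z) (rng G ` (\<theta> n \<inter> C))) = 0"
    using nn_integral_0_iff_AE[OF comp_bound_integral(1)[OF \<theta> Cs]] by simp
  then show ?thesis
    using AE_good cond_null[OF N]
  proof eventually_elim
    case (elim z)
    have "emeasure (arrows (cmp z)) (C \<inter> cars z) \<le> (\<Sum>n. emeasure (\<mu> z) (rng G ` (\<theta> n \<inter> C)))"
      by (rule comp_bound[OF elim(2) \<theta>(1) elim(3) _ Cs]) (use cover in blast)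
    then have "emeasure (arrows (cmp z)) (C \<inter> cars z) = 0" using elim(1) by simp
    then show ?case using Cs cars_sets[OF elim(2)] by (intro null_setsI) (auto simp: sets_comp_arrows[OF elim(2)])
  qed
qed

lemma comp_arrows_AE:
  assumes "AE \<gamma> in arrows G. P \<gamma>"
  shows "AE z in Z. AE \<gamma> in arrows (cmp z). P \<gamma>"
  using assms
proof (rule AE_E3)
  fix C assume C: "\<And>x. x \<in> ars - C \<Longrightarrow> P x" "C \<in> null_sets (arrows G)"
  show ?thesis
    using comp_arrows_null[OF C(2)]
  proof eventually_elim
    case (elim z)
    from AE_not_in[OF elim] AE_space show ?case
      by eventually_elim (use C(1) cars_sub in blast)
  qed
qed

text \<open>The measures are summable, so almost every \<open>z\<close> has summable conditional measures.\<close>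

lemma cond_small:
  assumes A: "\<And>k. A k \<in> sets (units G)" "\<And>k::nat. measure (units G) (A k) < (1/2) ^ k"
  shows "AE z in Z. (\<lambda>k. measure (\<mu> z) (A k)) \<longlonglongrightarrow> 0"
proof -
  note [measurable] = disintegration_set(1)[OF A(1)]
  have "(\<integral>\<^sup>+z. (\<Sum>k. emeasure (\<mu> z) (A k)) \<partial>Z) = (\<Sum>k. emeasure (units G) (A k))"
    by (subst nn_integral_suminf) (simp_all add: disintegration_set(2)[OF A(1)])
  also have "\<dots> \<le> (\<Sum>k. ennreal ((1/2) ^ k))"
    using A(2) by (intro suminf_le) (auto simp: units.emeasure_eq_measure intro!: ennreal_leI less_imp_le)
  also have "\<dots> = ennreal (\<Sum>k. (1/2) ^ k)" by (rule suminf_ennreal2) auto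
  also have "\<dots> < \<infinity>" by simp
  finally have "AE z in Z. (\<Sum>k. emeasure (\<mu> z) (A k)) \<noteq> \<infinity>"
    by (intro nn_integral_PInf_AE) auto
  then show ?thesis
    using AE_good
  proof eventually_elim
    case (elim z)
    interpret prob_space "\<mu> z" by (rule cond_prob[OF good_space[OF elim(2)]])
    have "(\<Sum>k. ennreal (measure (\<mu> z) (A k))) \<noteq> \<infinity>" using elim(1) by (simp add: emeasure_eq_measure)
    then have "summable (\<lambda>k. measure (\<mu> z) (A k))" by (intro summable_suminf_not_top) auto
    then show ?case by (rule summable_LIMSEQ_zero)
  qed
qed

text \<open>Let \<open>\<rho>\<close> be a bisection of the component. Over the ranges \<open>A n\<close> of \<open>\<rho> \<inter> \<theta> n\<close> its defect coincides with
  that of \<open>\<theta> n\<close>. The sets \<open>A n\<close> are disjoint, so those with \<open>n \<ge> L\<close> have small measure together and are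
  added to the exceptional set of sources; for the finitely many others the witnesses of \<open>c0 G\<close> at
  the tolerances \<open>(1/2)^k\<close> remain witnesses for almost every component.\<close>

lemma S_component:
  assumes f: "f \<in> S_algebra G"
  shows "AE z in Z. f \<in> S_algebra (cmp z)"
proof -
  obtain \<theta> :: "nat \<Rightarrow> 'g set" and N where \<theta>: "\<And>n. \<theta> n \<in> local_bisections G" "disjoint_family \<theta>"
      and N: "N \<in> null_sets (units G)"
      and cover: "\<And>\<gamma>. \<gamma> \<in> ars \<Longrightarrow> src G \<gamma> \<notin> N \<or> rng G \<gamma> \<notin> N \<Longrightarrow> \<exists>n. \<gamma> \<in> \<theta> n"
    by (rule bisection_cover) (rule that)
  obtain Cf where Cf: "AE \<gamma> in arrows G. norm (f \<gamma>) \<le> Cf" using S_Linf[OF f] by (rule LinfE)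
  define Q where "Q n k q \<longleftrightarrow> (case q of (B, B', F) \<Rightarrow>
      B \<in> sets (units G) \<and> B' \<in> sets (units G) \<and> F \<in> sets (arrows G) \<and>
      measure (units G) B < (1/2) ^ k \<and> measure (units G) B' < (1/2) ^ k \<and> emeasure (arrows G) F < \<infinity> \<and>
      (AE \<gamma> in arrows G. rng G \<gamma> \<notin> B \<longrightarrow> src G \<gamma> \<notin> B' \<longrightarrow> \<gamma> \<notin> F \<longrightarrow> norm (defect (\<theta> n) f \<gamma>) \<le> (1/2) ^ k))" for n k :: nat and q
  have "\<exists>q. Q n k q" for n k
  proof -
    have "vanishes ((1/2) ^ k) ((1/2) ^ k) (defect (\<theta> n) f)"
      by (rule c0_vanishes[OF S_defect[OF f \<theta>(1)]]) auto
    then obtain B B' F where "Q n k (B, B', F)" unfolding Q_def prod.case by (rule vanishesE) blast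
    then show ?thesis by blast
  qed
  then obtain q where q: "\<And>n k. Q n k (q n k)" by metis
  define B B' F where "B n k = fst (q n k)" and "B' n k = fst (snd (q n k))" and "F n k = snd (snd (q n k))" for n k
  have Q: "Q n k (B n k, B' n k, F n k)" for n k using q[of n k] by (simp add: B_def B'_def F_def)
  note Q' = Q[unfolded Q_def prod.case]
  have B: "\<And>n k. B n k \<in> sets (units G)" "\<And>n k. measure (units G) (B n k) < (1/2) ^ k"
    and B': "\<And>n k. B' n k \<in> sets (units G)" "\<And>n k. measure (units G) (B' n k) < (1/2) ^ k"
    and F: "\<And>n k. F n k \<in> sets (arrows G)" "\<And>n k. emeasure (arrows G) (F n k) < \<infinity>"
    using Q' by blast+
  have small: "AE \<gamma> in arrows G. rng G \<gamma> \<notin> B n k \<longrightarrow> src G \<gamma> \<notin> B' n k \<longrightarrow> \<gamma> \<notin> F n k \<longrightarrow>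
      norm (defect (\<theta> n) f \<gamma>) \<le> (1/2) ^ k" for n k
    using Q'[of n k] by (elim conjE)
  have "AE z in Z. \<forall>n. (\<lambda>k. measure (\<mu> z) (B n k)) \<longlonglongrightarrow> 0" using cond_small[OF B] by (simp add: AE_all_countable)
  moreover have "AE z in Z. \<forall>n. (\<lambda>k. measure (\<mu> z) (B' n k)) \<longlonglongrightarrow> 0" using cond_small[OF B'] by (simp add: AE_all_countable)
  moreover have "AE z in Z. \<forall>n k. emeasure (arrows (cmp z)) (F n k \<inter> cars z) < \<infinity>"
    using comp_arrows_finite[OF F] by (simp add: AE_all_countable)
  moreover have "AE z in Z. \<forall>n k. AE \<gamma> in arrows (cmp z). rng G \<gamma> \<notin> B n k \<longrightarrow> src G \<gamma> \<notin> B' n k \<longrightarrow> \<gamma> \<notin> F n k \<longrightarrow>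
      norm (defect (\<theta> n) f \<gamma>) \<le> (1/2) ^ k"
    using comp_arrows_AE[OF small] by (simp add: AE_all_countable)
  ultimately show ?thesis
    using AE_good cond_null[OF N] comp_arrows_AE[OF Cf]
  proof eventually_elim
    case (elim z)
    note z = elim(5)
    interpret K: pmp_groupoid "cmp z" by (rule comp_pmp[OF z])
    have fL: "f \<in> Linf (arrows (cmp z))"
      using comp_arrows_meas[OF z Linf_meas[OF S_Linf[OF f]]] elim(7) by (rule LinfI)
    have meas_eq: "measure (units (cmp z)) (A \<inter> fib z) = measure (\<mu> z) A" if "A \<in> sets (units G)" for A
      using emeasure_comp_units[OF z that] by (simp add: measure_def)
    show ?case
      unfolding K.S_iff
    proof (intro conjI fL ballI)
      fix \<rho> assume \<rho>K: "\<rho> \<in> local_bisections (cmp z)"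
      then have \<rho>: "\<rho> \<in> local_bisections G" "\<rho> \<subseteq> cars z" by (simp_all add: comp_bisection[OF z])
      show "K.defect \<rho> f \<in> c0 (cmp z)"
        unfolding K.c0_iff
      proof (intro conjI K.defect_Linf[OF \<rho>K fL] allI impI)
        fix \<epsilon> :: real assume \<epsilon>: "\<epsilon> > 0"
        have \<rho>n: "\<rho> \<inter> \<theta> n \<in> local_bisections (cmp z)" for n
          using bisection_Int[OF \<rho>(1) bisection_sets[OF \<theta>(1)]] \<rho>(2) by (auto simp: comp_bisection[OF z])
        define A where "A n = rng G ` (\<rho> \<inter> \<theta> n)" for n
        have A: "A n \<in> sets (units (cmp z))" for n using K.bisection_rng[OF \<rho>n] by (simp add: A_def)
        have A_disj: "A n \<inter> A m = {}" if "n \<noteq> m" for n m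
        proof (rule ccontr)
          assume "A n \<inter> A m \<noteq> {}"
          then obtain \<beta> \<beta>' where "\<beta> \<in> \<rho> \<inter> \<theta> n" "\<beta>' \<in> \<rho> \<inter> \<theta> m" "rng G \<beta> = rng G \<beta>'" by (auto simp: A_def)
          moreover then have "\<beta> = \<beta>'" using bisection_inj_rng[OF \<rho>(1)] by (auto dest: inj_onD)
          ultimately show False using \<theta>(2) that by (auto simp: disjoint_family_on_def)
        qed
        define T where "T m = (\<Union>n\<in>{m..}. A n)" for m
        have T: "T m \<in> sets (units (cmp z))" for m using A by (auto simp: T_def)
        have "(\<lambda>m. measure (units (cmp z)) (T m)) \<longlonglongrightarrow> measure (units (cmp z)) (\<Inter>m. T m)"
        proof (rule K.units.finite_Lim_measure_decseq)
          show "decseq T"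
            unfolding decseq_def
          proof (intro allI impI)
            fix m n :: nat assume "m \<le> n"
            then show "T n \<subseteq> T m" unfolding T_def by (intro UN_mono) auto
          qed
        qed (use T in auto)
        moreover have "(\<Inter>m. T m) = {}"
        proof (rule ccontr)
          assume "(\<Inter>m. T m) \<noteq> {}"
          then obtain x where x: "\<And>m. x \<in> T m" by blast
          then obtain n where n: "x \<in> A n" unfolding T_def by blast
          obtain n' where "n' \<ge> Suc n" "x \<in> A n'" using x[of "Suc n"] unfolding T_def by blast
          then show False using A_disj[of n n'] n by auto
        qed
        ultimately have "(\<lambda>m. measure (units (cmp z)) (T m)) \<longlonglongrightarrow> 0" by simp
        then have "\<forall>\<^sub>F m in sequentially. measure (units (cmp z)) (T m) < \<epsilon> / 2"
          using \<epsilon> by (intro order_tendstoD(2)) auto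
        then obtain L where L: "measure (units (cmp z)) (T L) < \<epsilon> / 2"
          unfolding eventually_sequentially by blast
        \<comment> \<open>Chosen such that \<open>L\<close> sets of measure below \<open>\<delta>\<close> have total measure below \<open>\<epsilon> / 2\<close>.\<close>
        define \<delta> where "\<delta> = \<epsilon> / (2 * (real L + 1))"
        have \<delta>: "\<delta> > 0" using \<epsilon> by (simp add: \<delta>_def)
        have L\<delta>: "real L * \<delta> < \<epsilon> / 2" using \<epsilon> by (simp add: \<delta>_def field_simps)
        have "\<forall>\<^sub>F k in sequentially. \<forall>n\<in>{..<L}. measure (\<mu> z) (B n k) < \<delta> \<and> measure (\<mu> z) (B' n k) < \<delta>"
          by (intro eventually_ball_finite ballI eventually_conj order_tendstoD(2)[OF elim(1)[rule_format]]
              order_tendstoD(2)[OF elim(2)[rule_format]] \<delta> finite_lessThan)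
        moreover have "\<forall>\<^sub>F k in sequentially. (1/2 :: real) ^ k < \<epsilon>"
          by (rule order_tendstoD(2)[OF LIMSEQ_power_zero \<epsilon>]) simp
        ultimately obtain k where k: "\<forall>n\<in>{..<L}. measure (\<mu> z) (B n k) < \<delta> \<and> measure (\<mu> z) (B' n k) < \<delta>"
          "(1/2 :: real) ^ k < \<epsilon>"
          using eventually_happens'[OF sequentially_bot eventually_conj] by blast
        have sum_small: "measure (units (cmp z)) (\<Union>n\<in>{..<L}. D n \<inter> fib z) \<le> real L * \<delta>"
          if "\<And>n. D n \<in> sets (units G)" "\<And>n. n < L \<Longrightarrow> measure (\<mu> z) (D n) < \<delta>" for D
        proof -
          have "measure (units (cmp z)) (\<Union>n\<in>{..<L}. D n \<inter> fib z) \<le> (\<Sum>n\<in>{..<L}. measure (units (cmp z)) (D n \<inter> fib z))"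
            by (rule K.units.finite_measure_subadditive_finite)
              (use that(1) fib_sets[OF z] in \<open>auto simp: sets_comp_units[OF z]\<close>)
          also have "\<dots> \<le> (\<Sum>n\<in>{..<L}. \<delta>)"
            by (rule sum_mono) (use that(2) meas_eq[OF that(1)] in \<open>auto intro: less_imp_le\<close>)
          finally show ?thesis by simp
        qed
        let ?B = "\<Union>n\<in>{..<L}. B n k \<inter> fib z"
        let ?B' = "T L \<union> (\<Union>n\<in>{..<L}. B' n k \<inter> fib z) \<union> (N \<inter> fib z)"
        let ?F = "\<Union>n\<in>{..<L}. F n k \<inter> cars z"
        have Bs: "?B \<in> sets (units (cmp z))" "(\<Union>n\<in>{..<L}. B' n k \<inter> fib z) \<in> sets (units (cmp z))"
          "N \<inter> fib z \<in> sets (units (cmp z))"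
          using B(1) B'(1) fib_sets[OF z] null_setsD2[OF N]
          by (auto simp: sets_comp_units[OF z])
        show "K.vanishes \<epsilon> \<epsilon> (K.defect \<rho> f)"
        proof (rule K.vanishesI)
          show "?B \<in> sets (units (cmp z))" by (rule Bs)
          show "?B' \<in> sets (units (cmp z))" using T Bs by (auto)
          show "?F \<in> sets (arrows (cmp z))"
            using F(1) cars_sets[OF z] by (auto simp: sets_comp_arrows[OF z])
          show "measure (units (cmp z)) ?B < \<epsilon>"
            using sum_small[of "\<lambda>n. B n k"] B(1) k L\<delta> \<epsilon> by fastforce
          have "measure (units (cmp z)) ?B' \<le> measure (units (cmp z)) (T L \<union> (\<Union>n\<in>{..<L}. B' n k \<inter> fib z)) +
              measure (units (cmp z)) (N \<inter> fib z)"
            by (rule measure_Un_le) (use T Bs in \<open>auto\<close>)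
          also have "measure (units (cmp z)) (N \<inter> fib z) = 0"
            using meas_eq[OF null_setsD2[OF N]] elim(6) by (simp add: measure_def null_setsD1)
          also have "measure (units (cmp z)) (T L \<union> (\<Union>n\<in>{..<L}. B' n k \<inter> fib z)) \<le>
              measure (units (cmp z)) (T L) + measure (units (cmp z)) (\<Union>n\<in>{..<L}. B' n k \<inter> fib z)"
            by (rule measure_Un_le) (use T Bs in auto)
          also have "measure (units (cmp z)) (\<Union>n\<in>{..<L}. B' n k \<inter> fib z) \<le> real L * \<delta>"
            using sum_small[of "\<lambda>n. B' n k"] B'(1) k by blast
          finally show "measure (units (cmp z)) ?B' < \<epsilon>" using L L\<delta> by linarith
          have "emeasure (arrows (cmp z)) ?F \<le> (\<Sum>n\<in>{..<L}. emeasure (arrows (cmp z)) (F n k \<inter> cars z))"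
            by (rule emeasure_subadditive_finite)
              (use F(1) cars_sets[OF z] in \<open>auto simp: sets_comp_arrows[OF z]\<close>)
          also have "\<dots> < \<infinity>" using elim(3) by (simp add: less_top)
          finally show "emeasure (arrows (cmp z)) ?F < \<infinity>" .
          have "AE \<gamma> in arrows (cmp z). \<forall>n. rng G \<gamma> \<notin> B n k \<longrightarrow> src G \<gamma> \<notin> B' n k \<longrightarrow> \<gamma> \<notin> F n k \<longrightarrow>
              norm (defect (\<theta> n) f \<gamma>) \<le> (1/2) ^ k" using elim(4) by (simp add: AE_all_countable)
          then show "AE \<gamma> in arrows (cmp z). rng (cmp z) \<gamma> \<notin> ?B \<longrightarrow> src (cmp z) \<gamma> \<notin> ?B' \<longrightarrow> \<gamma> \<notin> ?F \<longrightarrow>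
              norm (K.defect \<rho> f \<gamma>) \<le> \<epsilon>"
            using AE_space
          proof (eventually_elim, intro impI)
            fix \<gamma> assume H: "\<forall>n. rng G \<gamma> \<notin> B n k \<longrightarrow> src G \<gamma> \<notin> B' n k \<longrightarrow> \<gamma> \<notin> F n k \<longrightarrow> norm (defect (\<theta> n) f \<gamma>) \<le> (1/2) ^ k"
              and \<gamma>: "\<gamma> \<in> cars z"
              and n: "rng (cmp z) \<gamma> \<notin> ?B" "src (cmp z) \<gamma> \<notin> ?B'" "\<gamma> \<notin> ?F"
            show "norm (K.defect \<rho> f \<gamma>) \<le> \<epsilon>"
            proof (cases "src G \<gamma> \<in> rng G ` \<rho>")
              case False
              then show ?thesis using \<epsilon> \<gamma> by (simp add: K.defect_eq)
            next
              case True
              then obtain \<beta> where \<beta>: "\<beta> \<in> \<rho>" "src G \<gamma> = rng G \<beta>" by blast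
              have \<gamma>': "\<gamma> \<in> ars" "src G \<gamma> \<in> fib z" "rng G \<gamma> \<in> fib z" using \<gamma> by (simp_all add: cars_eq)
              have "rng G \<beta> \<notin> N" using n(2) \<gamma>' \<beta>(2) by simp
              then obtain i where i: "\<beta> \<in> \<theta> i" using cover[of \<beta>] bisection_sub[OF \<rho>(1) \<beta>(1)] by blast
              then have "src G \<gamma> \<in> A i" using \<beta> by (simp add: A_def)
              then have iL: "i < L" using n(2) unfolding T_def by (auto simp: not_less)
              have "K.sec \<rho> (src G \<gamma>) = \<beta>" using K.sec_eq[OF \<rho>K \<beta>(1)] \<beta>(2) by simp
              moreover have "sec (\<theta> i) (src G \<gamma>) = \<beta>" using sec_eq[OF \<theta>(1) i] \<beta>(2) by simp
              ultimately have "K.shift_right \<rho> \<gamma> = shift_right (\<theta> i) \<gamma>"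
                by (simp add: K.shift_right_def shift_right_def)
              then have "K.defect \<rho> f \<gamma> = defect (\<theta> i) f \<gamma>"
                using \<gamma> \<gamma>' True i \<beta> by (simp add: K.defect_eq defect_eq)
              moreover have "norm (defect (\<theta> i) f \<gamma>) \<le> (1/2) ^ k"
                using H[rule_format, of i] n iL \<gamma>' \<gamma> by simp
              ultimately show ?thesis using k(2) by simp
            qed
          qed
        qed
      qed
    qed
  qed
qed

end

section \<open>Proper proximality passes to almost every component\<close>

lemma not_properly_proximalE:
  assumes "countable_pmp_groupoid G" "\<not> properly_proximal G"
  obtains \<phi> where "invariant_state G \<phi>"
proof -
  obtain \<phi> where \<phi>: "state_on (arrows G) (S_algebra G) \<phi>"
    "\<forall>f\<in>S_algebra G. \<forall>\<theta>\<in>local_bisections G.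
             \<phi> (\<lambda>\<gamma>. f \<gamma> * indicator (arrows_to G (src G ` \<theta>)) \<gamma> - left_translate G \<theta> f \<gamma>) = 0"
    "normal_functional (units G) (\<lambda>f. \<phi> (f \<circ> rng G))"
    using assms(2) unfolding properly_proximal_def not_not by (elim exE conjE)
  have "invariant_state G \<phi>"
  proof
    show "countable_pmp_groupoid G" by fact
    show "state_on (arrows G) (S_algebra G) \<phi>" by fact
    show "normal_functional (units G) (\<lambda>f. \<phi> (f \<circ> rng G))" by fact
    show "\<phi> (\<lambda>\<gamma>. f \<gamma> * indicator (arrows_to G (src G ` \<theta>)) \<gamma> - left_translate G \<theta> f \<gamma>) = 0"
      if "f \<in> S_algebra G" "\<theta> \<in> local_bisections G" for f \<theta>
      using \<phi>(2) that by (elim ballE) auto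
  qed
  then show ?thesis by (rule that)
qed

lemma not_properly_proximalI:
  assumes "invariant_state G \<phi>" shows "\<not> properly_proximal G"
proof -
  interpret invariant_state G \<phi> by fact
  show ?thesis
    unfolding properly_proximal_def not_not
    by (intro exI[of _ \<phi>] conjI ballI state invariant normal)
qed

context decomposed_groupoid
begin

text \<open>Almost every unit of the fibre sees only arrows inside the component, so cutting \<open>\<theta>\<close> down to the
  component does not change the translate there.\<close>

lemma left_defect_component:
  assumes z: "good z" and \<theta>: "\<theta> \<in> local_bisections G"
  shows "AE \<gamma> in arrows (cmp z).
     f \<gamma> * indicator (arrows_to G (src G ` \<theta>)) \<gamma> - left_translate G \<theta> f \<gamma> =
     f \<gamma> * indicator (arrows_to (cmp z) (src (cmp z) ` (\<theta> \<inter> cars z))) \<gamma> - left_translate (cmp z) (\<theta> \<inter> cars z) f \<gamma>"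
proof -
  interpret K: pmp_groupoid "cmp z" by (rule comp_pmp[OF z])
  let ?\<theta> = "\<theta> \<inter> cars z"
  have \<theta>z: "?\<theta> \<in> local_bisections G" by (rule bisection_Int[OF \<theta> cars_sets[OF z]])
  have "AE \<gamma> in arrows (cmp z). \<forall>\<gamma>'\<in>ars. (src G \<gamma>' = rng (cmp z) \<gamma> \<longrightarrow> rng G \<gamma>' \<in> fib z) \<and>
      (rng G \<gamma>' = rng (cmp z) \<gamma> \<longrightarrow> src G \<gamma>' \<in> fib z)"
    by (rule K.AE_rng[OF invariant_fib[OF z]])
  then show ?thesis
    using AE_space
  proof eventually_elim
    case (elim \<gamma>)
    have \<gamma>: "\<gamma> \<in> ars" "rng G \<gamma> \<in> fib z" using elim(2) by (simp_all add: cars_eq)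
    have s: "\<beta> \<in> cars z" if "\<beta> \<in> \<theta>" "src G \<beta> = rng G \<gamma>" for \<beta>
      using elim(1) that bisection_sub[OF \<theta> that(1)] \<gamma> by (simp add: cars_eq)
    have r: "\<beta> \<in> cars z" if "\<beta> \<in> \<theta>" "rng G \<beta> = rng G \<gamma>" for \<beta>
      using elim(1) that bisection_sub[OF \<theta> that(1)] \<gamma> by (simp add: cars_eq)
    have "rng G \<gamma> \<in> src G ` \<theta> \<longleftrightarrow> rng G \<gamma> \<in> src G ` ?\<theta>" using s by force
    moreover have rr: "rng G \<gamma> \<in> rng G ` \<theta> \<longleftrightarrow> rng G \<gamma> \<in> rng G ` ?\<theta>" using r by force
    moreover have "sec ?\<theta> (rng G \<gamma>) = sec \<theta> (rng G \<gamma>)" if rin: "rng G \<gamma> \<in> rng G ` \<theta>"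
    proof -
      obtain \<beta> where \<beta>: "\<beta> \<in> \<theta>" "rng G \<gamma> = rng G \<beta>" using rin by blast
      then have "\<beta> \<in> ?\<theta>" using r by simp
      then show ?thesis using sec_eq[OF \<theta> \<beta>(1)] sec_eq[OF \<theta>z] \<beta>(2) by simp
    qed
    ultimately show ?case
      using \<gamma> elim(2)
      by (cases "rng G \<gamma> \<in> rng G ` \<theta>")
        (auto simp: left_translate_eq shift_left_def arrows_to_def indicator_def)
  qed
qed

lemma integral_component:
  fixes g :: "'x \<Rightarrow> real"
  assumes z: "good z" and g: "g \<in> borel_measurable (units G)"
  shows "(\<integral>x. g x \<partial>units (cmp z)) = (\<integral>x. g x \<partial>\<mu> z)"
proof -
  have gm: "g \<in> borel_measurable (\<mu> z)" using g by (simp add: measurable_cong_sets[OF sets_cond[OF good_space[OF z]] refl])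
  have "(\<integral>x. g x \<partial>units (cmp z)) = (\<integral>x. indicator (fib z) x *\<^sub>R g x \<partial>\<mu> z)"
    unfolding component_units by (rule integral_restrict_space[OF fib_Int_sets[OF z]])
  also have "\<dots> = (\<integral>x. g x \<partial>\<mu> z)"
  proof (rule integral_cong_AE)
    show "AE x in \<mu> z. indicator (fib z) x *\<^sub>R g x = g x" using AE_fib[OF z] by eventually_elim simp
    have "fib z \<in> sets (\<mu> z)" using fib_sets[OF z] sets_cond[OF good_space[OF z]] by simp
    then show "(\<lambda>x. indicator (fib z) x *\<^sub>R g x) \<in> borel_measurable (\<mu> z)" using gm by simp
  qed (rule gm)
  finally show ?thesis .
qed

text \<open>The mean \<open>m\<close> of the invariant states \<open>\<Phi> z\<close> is an invariant state of \<open>G\<close>. All identities pass from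
  \<open>\<Phi> z\<close> to \<open>\<psi>\<close>, because they hold for almost every \<open>z\<close>. On functions of the range \<open>\<psi>\<close> is the integral
  with density \<open>k\<close>, the normalised indicator of the preimage of the hull \<open>H\<close> of \<open>W\<close>.\<close>

theorem properly_proximal_components:
  assumes pp: "properly_proximal G"
  shows "AE z in Z. properly_proximal (cmp z)"
proof (rule ccontr)
  assume nAE: "\<not> (AE z in Z. properly_proximal (cmp z))"
  define W where "W = {z. good z \<and> \<not> properly_proximal (cmp z)}"
  have W_sp: "W \<subseteq> space Z" by (auto simp: W_def good_space)
  have W_null: "\<not> W \<subseteq> N" if N: "N \<in> null_sets Z" for N
  proof
    assume WN: "W \<subseteq> N"
    have "AE z in Z. properly_proximal (cmp z)"
      using AE_good AE_not_in[OF N] by eventually_elim (use WN in \<open>auto simp: W_def\<close>)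
    then show False using nAE by contradiction
  qed
  have "\<exists>\<phi>. invariant_state (cmp z) \<phi>" if "z \<in> W" for z
    using that not_properly_proximalE[of "cmp z"] unfolding W_def good_def by blast
  then obtain \<Phi> where \<Phi>: "\<And>z. z \<in> W \<Longrightarrow> invariant_state (cmp z) (\<Phi> z)" by metis
  have goodW: "z \<in> W \<Longrightarrow> good z" for z by (simp add: W_def)
  obtain H m where H: "H \<in> sets Z" "measure Z H > 0"
    and m_add: "\<And>f g. ess_bounded_on Z W f \<Longrightarrow> ess_bounded_on Z W g \<Longrightarrow> m (\<lambda>z. f z + g z) = m f + m g"
    and m_scale: "\<And>f c. ess_bounded_on Z W f \<Longrightarrow> m (\<lambda>z. c * f z) = c * m f"
    and m_cong: "\<And>f g N. ess_bounded_on Z W f \<Longrightarrow> N \<in> null_sets Z \<Longrightarrow> (\<And>z. z \<in> W - N \<Longrightarrow> g z = f z) \<Longrightarrow> m g = m f"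
    and m_pos: "\<And>f N. ess_bounded_on Z W f \<Longrightarrow> N \<in> null_sets Z \<Longrightarrow> (\<And>z. z \<in> W - N \<Longrightarrow> f z \<in> \<real>\<^sub>\<ge>\<^sub>0) \<Longrightarrow> m f \<in> \<real>\<^sub>\<ge>\<^sub>0"
    and m_int: "\<And>f C. f \<in> borel_measurable Z \<Longrightarrow> (\<And>z. z \<in> space Z \<Longrightarrow> \<bar>f z\<bar> \<le> C) \<Longrightarrow>
       m (\<lambda>z. complex_of_real (f z)) = complex_of_real ((\<integral>z. f z * indicator H z \<partial>Z) / measure Z H)"
    using finitely_additive_mean[OF prob_Z W_sp W_null] by blast
  have m_AE: "m g = m f" if f: "ess_bounded_on Z W f" and eq: "AE z in Z. z \<in> W \<longrightarrow> g z = f z" for f g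
    using eq
  proof (rule AE_E3)
    fix N assume "\<And>x. x \<in> space Z - N \<Longrightarrow> x \<in> W \<longrightarrow> g x = f x" "N \<in> null_sets Z"
    then show ?thesis using W_sp by (intro m_cong[OF f]) blast+
  qed
  define \<psi> where "\<psi> f = m (\<lambda>z. \<Phi> z f)" for f
  have bounded: "ess_bounded_on Z W (\<lambda>z. \<Phi> z f)" if f: "f \<in> S_algebra G" for f
  proof -
    obtain C where C: "AE \<gamma> in arrows G. norm (f \<gamma>) \<le> C" using S_Linf[OF f] by (rule LinfE)
    have "AE z in Z. z \<in> W \<longrightarrow> norm (\<Phi> z f) \<le> 2 * C"
      using S_component[OF f] comp_arrows_AE[OF C]
    proof (eventually_elim, intro impI)
      fix z assume z: "f \<in> S_algebra (cmp z)" "AE \<gamma> in arrows (cmp z). norm (f \<gamma>) \<le> C" "z \<in> W"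
      interpret I: invariant_state "cmp z" "\<Phi> z" by (rule \<Phi>[OF z(3)])
      show "norm (\<Phi> z f) \<le> 2 * C" by (rule I.state_bound[OF z(1,2)])
    qed
    then show ?thesis
    proof (rule AE_E3)
      fix N assume "\<And>x. x \<in> space Z - N \<Longrightarrow> x \<in> W \<longrightarrow> norm (\<Phi> x f) \<le> 2 * C" "N \<in> null_sets Z"
      then show ?thesis unfolding ess_bounded_on_def using W_sp by blast
    qed
  qed
  have m_const: "m (\<lambda>_. c) = c" for c
  proof -
    have b1: "ess_bounded_on Z W (\<lambda>_. complex_of_real 1)" unfolding ess_bounded_on_def by auto
    have "(\<integral>z. 1 * indicator H z \<partial>Z) / measure Z H = 1" using H by simp
    then have "m (\<lambda>_. complex_of_real 1) = 1" using m_int[of "\<lambda>_. 1" 1] by simp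
    then show ?thesis using m_scale[OF b1, of c] by simp
  qed
  have b_const: "ess_bounded_on Z W (\<lambda>_. c)" for c unfolding ess_bounded_on_def by auto
  have "invariant_state G \<psi>"
  proof
    show "state_on (arrows G) (S_algebra G) \<psi>"
      unfolding state_on_def
    proof (intro conjI ballI allI impI)
      fix f g assume f: "f \<in> S_algebra G" and g: "g \<in> S_algebra G" and eq: "AE x in arrows G. f x = g x"
      show "\<psi> f = \<psi> g"
        unfolding \<psi>_def
      proof (rule m_AE[OF bounded[OF g]])
        show "AE z in Z. z \<in> W \<longrightarrow> \<Phi> z f = \<Phi> z g"
          using S_component[OF f] S_component[OF g] comp_arrows_AE[OF eq]
        proof (eventually_elim, intro impI)
          fix z assume z: "f \<in> S_algebra (cmp z)" "g \<in> S_algebra (cmp z)" "AE \<gamma> in arrows (cmp z). f \<gamma> = g \<gamma>" "z \<in> W"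
          interpret I: invariant_state "cmp z" "\<Phi> z" by (rule \<Phi>[OF z(4)])
          show "\<Phi> z f = \<Phi> z g" by (rule I.state_AE[OF z(1-3)])
        qed
      qed
    next
      fix f g assume f: "f \<in> S_algebra G" and g: "g \<in> S_algebra G"
      have "m (\<lambda>z. \<Phi> z f + \<Phi> z g) = m (\<lambda>z. \<Phi> z (\<lambda>x. f x + g x))"
      proof (rule m_AE[OF bounded[OF S_add[OF f g]]])
        show "AE z in Z. z \<in> W \<longrightarrow> \<Phi> z f + \<Phi> z g = \<Phi> z (\<lambda>x. f x + g x)"
          using S_component[OF f] S_component[OF g]
        proof (eventually_elim, intro impI)
          fix z assume z: "f \<in> S_algebra (cmp z)" "g \<in> S_algebra (cmp z)" "z \<in> W"
          interpret I: invariant_state "cmp z" "\<Phi> z" by (rule \<Phi>[OF z(3)])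
          show "\<Phi> z f + \<Phi> z g = \<Phi> z (\<lambda>x. f x + g x)" by (rule I.state_add[OF z(1,2), symmetric])
        qed
      qed
      then show "\<psi> (\<lambda>x. f x + g x) = \<psi> f + \<psi> g"
        unfolding \<psi>_def using m_add[OF bounded[OF f] bounded[OF g]] by simp
    next
      fix c f assume f: "f \<in> S_algebra G"
      have "m (\<lambda>z. c * \<Phi> z f) = m (\<lambda>z. \<Phi> z (\<lambda>x. c * f x))"
      proof (rule m_AE[OF bounded[OF S_scale[OF f]]])
        show "AE z in Z. z \<in> W \<longrightarrow> c * \<Phi> z f = \<Phi> z (\<lambda>x. c * f x)"
          using S_component[OF f]
        proof (eventually_elim, intro impI)
          fix z assume z: "f \<in> S_algebra (cmp z)" "z \<in> W"
          interpret I: invariant_state "cmp z" "\<Phi> z" by (rule \<Phi>[OF z(2)])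
          show "c * \<Phi> z f = \<Phi> z (\<lambda>x. c * f x)" by (rule I.state_scale[OF z(1), symmetric])
        qed
      qed
      then show "\<psi> (\<lambda>x. c * f x) = c * \<psi> f"
        unfolding \<psi>_def using m_scale[OF bounded[OF f]] by simp
    next
      fix f assume f: "f \<in> S_algebra G"
      have ff: "(\<lambda>x. cnj (f x) * f x) \<in> S_algebra G"
        by (rule S_comp[of "\<lambda>t. cnj t * t", OF _ f]) (intro continuous_intros)
      have "AE z in Z. z \<in> W \<longrightarrow> \<Phi> z (\<lambda>x. cnj (f x) * f x) \<in> \<real>\<^sub>\<ge>\<^sub>0"
        using S_component[OF f]
      proof (eventually_elim, intro impI)
        fix z assume z: "f \<in> S_algebra (cmp z)" "z \<in> W"
        interpret I: invariant_state "cmp z" "\<Phi> z" by (rule \<Phi>[OF z(2)])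
        show "\<Phi> z (\<lambda>x. cnj (f x) * f x) \<in> \<real>\<^sub>\<ge>\<^sub>0" by (rule I.state_pos[OF z(1)])
      qed
      then show "\<psi> (\<lambda>x. cnj (f x) * f x) \<in> \<real>\<^sub>\<ge>\<^sub>0"
      proof (rule AE_E3)
        fix N assume "\<And>x. x \<in> space Z - N \<Longrightarrow> x \<in> W \<longrightarrow> \<Phi> x (\<lambda>x. cnj (f x) * f x) \<in> \<real>\<^sub>\<ge>\<^sub>0" "N \<in> null_sets Z"
        then show ?thesis unfolding \<psi>_def using W_sp by (intro m_pos[OF bounded[OF ff]]) blast+
      qed
    next
      have "\<psi> (\<lambda>_. 1) = m (\<lambda>_. 1)"
        unfolding \<psi>_def
      proof (rule m_AE[OF b_const], intro AE_I2 impI)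
        fix z assume "z \<in> W"
        then interpret I: invariant_state "cmp z" "\<Phi> z" by (rule \<Phi>)
        show "\<Phi> z (\<lambda>_. 1) = 1" by (rule I.state_one)
      qed
      then show "\<psi> (\<lambda>_. 1) = 1" by (simp add: m_const)
    qed
  next
    fix f \<theta> assume f: "f \<in> S_algebra G" and \<theta>: "\<theta> \<in> local_bisections G"
    let ?h = "\<lambda>\<gamma>. f \<gamma> * indicator (arrows_to G (src G ` \<theta>)) \<gamma> - left_translate G \<theta> f \<gamma>"
    have h: "?h \<in> S_algebra G" by (rule S_left_defect[OF f \<theta>])
    have "\<psi> ?h = m (\<lambda>_. 0)"
      unfolding \<psi>_def
    proof (rule m_AE[OF b_const])
      show "AE z in Z. z \<in> W \<longrightarrow> \<Phi> z ?h = 0"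
        using S_component[OF f] S_component[OF h]
      proof (eventually_elim, intro impI)
        fix z assume z: "f \<in> S_algebra (cmp z)" "?h \<in> S_algebra (cmp z)" "z \<in> W"
        interpret I: invariant_state "cmp z" "\<Phi> z" by (rule \<Phi>[OF z(3)])
        have g: "good z" by (rule goodW[OF z(3)])
        have \<theta>z: "\<theta> \<inter> cars z \<in> local_bisections (cmp z)"
          using bisection_Int[OF \<theta> cars_sets[OF g]] by (simp add: comp_bisection[OF g])
        have "\<Phi> z ?h = \<Phi> z (\<lambda>\<gamma>. f \<gamma> * indicator (arrows_to (cmp z) (src (cmp z) ` (\<theta> \<inter> cars z))) \<gamma> -
            left_translate (cmp z) (\<theta> \<inter> cars z) f \<gamma>)"
          by (rule I.state_AE[OF z(2) I.S_left_defect[OF z(1) \<theta>z] left_defect_component[OF g \<theta>]])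
        also have "\<dots> = 0" by (rule I.invariant[OF z(1) \<theta>z])
        finally show "\<Phi> z ?h = 0" .
      qed
    qed
    then show "\<psi> ?h = 0" by (simp add: m_const)
  next
    let ?Y = "\<pi> -` H \<inter> space (units G)"
    have Y: "?Y \<in> sets (units G)" by (rule measurable_sets[OF pi_meas H(1)])
    define k where "k x = indicator ?Y x / measure Z H" for x
    have k_int: "integrable (units G) k"
      unfolding k_def using Y by (intro integrable_divide) (auto simp: units.emeasure_finite less_top[symmetric])
    show "normal_functional (units G) (\<lambda>f. \<psi> (f \<circ> rng G))"
    proof (rule density_functional_normal[OF units.finite_measure_axioms k_int])
      show "AE x in units G. 0 \<le> k x" by (simp add: k_def)
      fix g assume g: "g \<in> Linf_real (units G)"
      obtain C where C: "0 \<le> C" "AE x in units G. \<bar>g x\<bar> \<le> C" using g by (rule Linf_realE)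
      \<comment> \<open>The disintegration formula concerns bounded functions, whereas \<open>g\<close> is only essentially bounded.\<close>
      define g' where "g' x = max (-C) (min C (g x))" for x
      have g'_meas [measurable]: "g' \<in> borel_measurable (units G)"
        unfolding g'_def using Linf_real_meas[OF g] by measurable
      have g'_bound: "\<bar>g' x\<bar> \<le> C" for x using C(1) by (auto simp: g'_def)
      have g'_eq: "AE x in units G. g x = g' x" using C(2) by eventually_elim (auto simp: g'_def)
      define F where "F z = (\<integral>x. g' x \<partial>\<mu> z)" for z
      have bdd: "bounded (g' ` space (units G))" using g'_bound by (auto intro!: boundedI[of _ C])
      have F_meas: "F \<in> borel_measurable Z" unfolding F_def by (rule disintegration(1)[OF g'_meas bdd])
      have F_bound: "\<bar>F z\<bar> \<le> C" if z: "z \<in> space Z" for z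
      proof -
        interpret P: prob_space "\<mu> z" by (rule cond_prob[OF z])
        have "\<bar>F z\<bar> \<le> (\<integral>x. \<bar>g' x\<bar> \<partial>\<mu> z)" unfolding F_def by (rule integral_abs_bound)
        also have "\<dots> \<le> (\<integral>x. C \<partial>\<mu> z)"
        proof (rule integral_mono)
          have "g' \<in> borel_measurable (\<mu> z)" using g'_meas by (simp add: measurable_cong_sets[OF sets_cond[OF z] refl])
          then show "integrable (\<mu> z) (\<lambda>x. \<bar>g' x\<bar>)" using g'_bound by (intro P.integrable_const_bound[of _ C]) auto
        qed (use g'_bound in auto)
        also have "\<dots> = C" by (simp add: P.prob_space)
        finally show ?thesis .
      qed
      have bF: "ess_bounded_on Z W (\<lambda>z. complex_of_real (F z))"
        unfolding ess_bounded_on_def using F_bound W_sp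
        by (intro bexI[of _ "{}"] exI[of _ C]) auto
      have "\<psi> (\<lambda>\<gamma>. complex_of_real (g (rng G \<gamma>))) = m (\<lambda>z. complex_of_real (F z))"
        unfolding \<psi>_def
      proof (rule m_AE[OF bF])
        show "AE z in Z. z \<in> W \<longrightarrow> \<Phi> z (\<lambda>\<gamma>. complex_of_real (g (rng G \<gamma>))) = complex_of_real (F z)"
          using cond_AE[OF C(2)] cond_AE[OF g'_eq]
        proof (eventually_elim, intro impI)
          fix z assume z: "AE x in \<mu> z. \<bar>g x\<bar> \<le> C" "AE x in \<mu> z. g x = g' x" "z \<in> W"
          interpret I: invariant_state "cmp z" "\<Phi> z" by (rule \<Phi>[OF z(3)])
          have gd: "good z" by (rule goodW[OF z(3)])
          have gL: "g \<in> Linf_real (units (cmp z))"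
          proof (rule Linf_realI[OF comp_units_meas[OF gd Linf_real_meas[OF g]]])
            show "AE x in units (cmp z). \<bar>g x\<bar> \<le> C" using z(1) by (simp only: AE_comp_units[OF gd])
          qed
          have "\<Phi> z (\<lambda>\<gamma>. complex_of_real (g (rng (cmp z) \<gamma>))) = complex_of_real (\<integral>x. g x \<partial>units (cmp z))"
            by (rule I.state_rng_integral[OF _ gL]) (use gd in \<open>simp add: good_def\<close>)
          also have "(\<integral>x. g x \<partial>units (cmp z)) = (\<integral>x. g x \<partial>\<mu> z)" by (rule integral_component[OF gd Linf_real_meas[OF g]])
          also have "\<dots> = F z"
            unfolding F_def
            by (rule integral_cong_AE)
              (use z(2) Linf_real_meas[OF g] g'_meas in \<open>auto simp: measurable_cong_sets[OF sets_cond[OF good_space[OF gd]] refl]\<close>)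
          finally show "\<Phi> z (\<lambda>\<gamma>. complex_of_real (g (rng G \<gamma>))) = complex_of_real (F z)" by simp
        qed
      qed
      also have "\<dots> = complex_of_real ((\<integral>z. F z * indicator H z \<partial>Z) / measure Z H)" by (rule m_int[OF F_meas F_bound])
      finally have "Re (\<psi> (\<lambda>\<gamma>. complex_of_real (g (rng G \<gamma>)))) = (\<integral>z. F z * indicator H z \<partial>Z) / measure Z H" by simp
      also have "(\<integral>z. F z * indicator H z \<partial>Z) = (\<integral>z. (\<integral>x. g' x * indicator ?Y x \<partial>\<mu> z) \<partial>Z)"
      proof (rule integral_cong_AE)
        have m': "(\<lambda>x. g' x * indicator ?Y x) \<in> borel_measurable (units G)" using Y by measurable
        have b': "bounded ((\<lambda>x. g' x * indicator ?Y x) ` space (units G))"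
          using g'_bound C(1) by (intro boundedI[of _ C]) (auto simp: indicator_def)
        show "(\<lambda>z. \<integral>x. g' x * indicator ?Y x \<partial>\<mu> z) \<in> borel_measurable Z" by (rule disintegration(1)[OF m' b'])
        show "(\<lambda>z. F z * indicator H z) \<in> borel_measurable Z" using F_meas H(1) by measurable
        show "AE z in Z. F z * indicator H z = (\<integral>x. g' x * indicator ?Y x \<partial>\<mu> z)"
          using AE_good
        proof eventually_elim
          case (elim z)
          have "(\<integral>x. g' x * indicator ?Y x \<partial>\<mu> z) = (\<integral>x. g' x * indicator H z \<partial>\<mu> z)"
          proof (rule integral_cong_AE)
            show "AE x in \<mu> z. g' x * indicator ?Y x = g' x * indicator H z"
              using AE_fib[OF elim] by eventually_elim (auto simp: indicator_def)
          qed (use m' g'_meas in \<open>auto simp: measurable_cong_sets[OF sets_cond[OF good_space[OF elim]] refl]\<close>)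
          then show ?case by (simp add: F_def)
        qed
      qed
      also have "\<dots> = (\<integral>x. g' x * indicator ?Y x \<partial>units G)"
      proof (rule disintegration(2)[symmetric])
        show "(\<lambda>x. g' x * indicator ?Y x) \<in> borel_measurable (units G)" using Y by measurable
        show "bounded ((\<lambda>x. g' x * indicator ?Y x) ` space (units G))"
          using g'_bound C(1) by (intro boundedI[of _ C]) (auto simp: indicator_def)
      qed
      also have "\<dots> = (\<integral>x. g x * indicator ?Y x \<partial>units G)"
        by (rule integral_cong_AE) (use g'_eq Y Linf_real_meas[OF g] g'_meas in auto)
      finally show "Re (\<psi> ((\<lambda>x. complex_of_real (g x)) \<circ> rng G)) = (\<integral>x. g x * k x \<partial>units G)"
        unfolding k_def by (simp add: o_def)
    qed
  qed
  then show False using not_properly_proximalI pp by blast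
qed

end

section \<open>The converse for atomic unit spaces\<close>

lemma extend_by_zero_measurable:
  fixes f :: "'a \<Rightarrow> 'b :: {topological_space, zero}"
  assumes A: "A \<in> sets M" "space M' = A" "\<And>C. C \<in> sets M' \<Longrightarrow> C \<in> sets M" and f: "f \<in> borel_measurable M'"
  shows "(\<lambda>x. if x \<in> A then f x else 0) \<in> borel_measurable M"
proof (rule measurableI)
  fix B :: "'b set" assume B: "B \<in> sets borel"
  have "(\<lambda>x. if x \<in> A then f x else 0) -` B \<inter> space M =
      (f -` B \<inter> space M') \<union> (if 0 \<in> B then space M - A else {})"
    using sets.sets_into_space[OF A(1)] A(2) by (auto split: if_splits)
  also have "\<dots> \<in> sets M" using A(1) A(3)[OF measurable_sets[OF f B]] by auto
  finally show "(\<lambda>x. if x \<in> A then f x else 0) -` B \<inter> space M \<in> sets M" .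
qed simp

lemma standard_borel_singleton:
  assumes M: "standard_borel M" and x: "x \<in> space M"
  shows "{x} \<in> sets M"
proof -
  obtain e where e: "polish_code M e" using code_with_clopen_sets[OF M, of "\<lambda>_. {}"] by auto
  have "{x} = (\<Inter>i. {y\<in>space M. e y i = e x i})"
  proof
    show "(\<Inter>i. {y\<in>space M. e y i = e x i}) \<subseteq> {x}"
    proof
      fix y assume "y \<in> (\<Inter>i. {y\<in>space M. e y i = e x i})"
      then have "y \<in> space M" "e y = e x" by auto
      then show "y \<in> {x}" using inj_onD[OF polish_codeD(2)[OF e]] x by blast
    qed
  qed (use x in auto)
  also have "\<dots> \<in> sets M"
  proof (intro sets.countable_INT image_subsetI)
    fix i
    have "(\<lambda>y. e y i) -` {e x i} \<inter> space M \<in> sets M" by (rule measurable_sets[OF polish_codeD(1)[OF e]]) simp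
    moreover have "(\<lambda>y. e y i) -` {e x i} \<inter> space M = {y\<in>space M. e y i = e x i}" by auto
    ultimately show "{y\<in>space M. e y i = e x i} \<in> sets M" by simp
  qed simp
  finally show ?thesis .
qed

text \<open>Each coordinate of a code of \<open>Z\<close> is almost everywhere constant on an atom, hence so is \<open>p\<close>.\<close>

lemma atom_concentrated_on_fibre:
  assumes Z: "standard_borel Z" and p: "p \<in> M \<rightarrow>\<^sub>M Z" and B: "atom M B"
  obtains x where "x \<in> B" "emeasure M (B \<inter> p -` {p x}) > 0"
proof -
  have Bs: "B \<in> sets M" and Bpos: "emeasure M B > 0"
    and split: "\<And>C. C \<in> sets M \<Longrightarrow> C \<subseteq> B \<Longrightarrow> emeasure M C = 0 \<or> emeasure M (B - C) = 0"
    using B unfolding atom_def by auto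
  obtain e where e: "polish_code Z e" using code_with_clopen_sets[OF Z, of "\<lambda>_. {}"] by auto
  define L where "L i n = {x\<in>B. e (p x) i = n}" for i n
  have L: "L i n \<in> sets M" for i n
  proof -
    have "(\<lambda>x. e (p x) i) \<in> M \<rightarrow>\<^sub>M count_space UNIV" by (rule measurable_compose[OF p polish_codeD(1)[OF e]])
    from measurable_sets[OF this, of "{n}"] have "(\<lambda>x. e (p x) i) -` {n} \<inter> space M \<in> sets M" by simp
    moreover have "L i n = B \<inter> ((\<lambda>x. e (p x) i) -` {n} \<inter> space M)"
      using sets.sets_into_space[OF Bs] by (auto simp: L_def)
    ultimately show ?thesis using Bs by simp
  qed
  have "\<exists>n. emeasure M (B - L i n) = 0" for i
  proof (rule ccontr)
    assume "\<nexists>n. emeasure M (B - L i n) = 0"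
    then have "emeasure M (L i n) = 0" for n using split[OF L, of i n] by (auto simp: L_def)
    then have "(\<Union>n. L i n) \<in> null_sets M" using L by (intro null_sets_UN) auto
    moreover have "(\<Union>n. L i n) = B" by (auto simp: L_def)
    ultimately show False using Bpos by (auto dest: null_setsD1)
  qed
  then obtain n where n: "\<And>i. emeasure M (B - L i (n i)) = 0" by metis
  have "(\<Union>i. B - L i (n i)) \<in> null_sets M" using n L Bs by (intro null_sets_UN) auto
  then have "emeasure M (B - (\<Union>i. B - L i (n i))) = emeasure M B" using Bs by (rule emeasure_Diff_null_set)
  moreover have eq: "B - (\<Union>i. B - L i (n i)) = (\<Inter>i. L i (n i))" by (auto simp: L_def)
  ultimately have pos: "emeasure M (\<Inter>i. L i (n i)) > 0" using Bpos by simp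
  then have "(\<Inter>i. L i (n i)) \<noteq> {}" by auto
  then obtain x where x: "\<And>i. x \<in> L i (n i)" by blast
  have xB: "x \<in> B" using x[of 0] by (simp add: L_def)
  have sp: "p y \<in> space Z" if "y \<in> B" for y using measurable_space[OF p] sets.sets_into_space[OF Bs] that by blast
  have "(\<Inter>i. L i (n i)) = B \<inter> p -` {p x}"
  proof
    show "(\<Inter>i. L i (n i)) \<subseteq> B \<inter> p -` {p x}"
    proof
      fix y assume "y \<in> (\<Inter>i. L i (n i))"
      then have "y \<in> B" "e (p y) = e (p x)" using x by (auto simp: L_def fun_eq_iff)
      then show "y \<in> B \<inter> p -` {p x}" using inj_onD[OF polish_codeD(2)[OF e]] sp xB by blast
    qed
    show "B \<inter> p -` {p x} \<subseteq> (\<Inter>i. L i (n i))" using x by (auto simp: L_def)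
  qed
  then show ?thesis using that[OF xB] pos by simp
qed

text \<open>A component of positive measure. Its conditional measure is proportional to the restriction
  of the measure of the units, so that null sets of the component and of \<open>G\<close> correspond.\<close>

locale atomic_component = decomposed_groupoid G Z \<pi> \<mu>
  for G :: "('g, 'x) groupoid" and Z :: "'z measure" and \<pi> \<mu> +
  fixes z :: 'z
  assumes z: "good z" and z_pos: "emeasure Z {z} > 0"
begin

sublocale K: pmp_groupoid "cmp z" by (rule comp_pmp[OF z])

lemma z_sets: "{z} \<in> sets Z"
  by (rule standard_borel_singleton[OF std_Z good_space[OF z]])

lemma emeasure_Int_fib:
  assumes B: "B \<in> sets (units G)"
  shows "emeasure (units G) (B \<inter> fib z) = emeasure (\<mu> z) B * emeasure Z {z}"
proof -
  have Bf: "B \<inter> fib z \<in> sets (units G)" using B fib_sets[OF z] by simp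
  have "emeasure (units G) (B \<inter> fib z) = (\<integral>\<^sup>+z'. emeasure (\<mu> z') (B \<inter> fib z) \<partial>Z)" by (rule disintegration_set(2)[OF Bf])
  also have "\<dots> = (\<integral>\<^sup>+z'. emeasure (\<mu> z) B * indicator {z} z' \<partial>Z)"
  proof (rule nn_integral_cong_AE)
    show "AE z' in Z. emeasure (\<mu> z') (B \<inter> fib z) = emeasure (\<mu> z) B * indicator {z} z'"
      using AE_good
    proof eventually_elim
      case (elim z')
      have B': "B \<inter> fib z \<in> sets (\<mu> z')" "B \<in> sets (\<mu> z')" using Bf B sets_cond[OF good_space[OF elim]] by simp_all
      show ?case
      proof (cases "z' = z")
        case True
        have "emeasure (\<mu> z) (B \<inter> fib z) = emeasure (\<mu> z) B"
          by (rule emeasure_eq_AE) (use AE_fib[OF z] B' True in auto)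
        then show ?thesis using True by simp
      next
        case False
        have "AE x in \<mu> z'. x \<notin> B \<inter> fib z" using AE_fib[OF elim] by eventually_elim (use False in auto)
        then have "emeasure (\<mu> z') (B \<inter> fib z) = emeasure (\<mu> z') {}"
          by (intro emeasure_eq_AE) (use B' in auto)
        then show ?thesis using False by simp
      qed
    qed
  qed
  also have "\<dots> = emeasure (\<mu> z) B * emeasure Z {z}" by (rule nn_integral_cmult_indicator[OF z_sets])
  finally show ?thesis .
qed

lemma emeasure_units_le: "B \<in> sets (units G) \<Longrightarrow> emeasure (units G) (B \<inter> fib z) \<le> emeasure (units (cmp z)) (B \<inter> fib z)"
proof -
  assume B: "B \<in> sets (units G)"
  interpret P: prob_space Z by (rule prob_Z)
  have "emeasure (\<mu> z) B * emeasure Z {z} \<le> emeasure (\<mu> z) B * 1"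
    by (intro mult_left_mono) (auto intro: P.emeasure_le_1)
  then show ?thesis unfolding emeasure_Int_fib[OF B] emeasure_comp_units[OF z B] by simp
qed

lemma AE_units_iff: "(AE x in units G. x \<in> fib z \<longrightarrow> P x) \<longleftrightarrow> (AE x in units (cmp z). P x)"
proof
  assume "AE x in units G. x \<in> fib z \<longrightarrow> P x"
  then show "AE x in units (cmp z). P x"
  proof (rule AE_E3)
    fix N assume N: "\<And>x. x \<in> space (units G) - N \<Longrightarrow> x \<in> fib z \<longrightarrow> P x" "N \<in> null_sets (units G)"
    have Ns: "N \<in> sets (units G)" using N(2) by auto
    have "emeasure (units G) (N \<inter> fib z) \<le> emeasure (units G) N" by (intro emeasure_mono Ns) auto
    then have "emeasure (\<mu> z) N * emeasure Z {z} = 0"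
      using emeasure_Int_fib[OF Ns] null_setsD1[OF N(2)] by simp
    then have "emeasure (units (cmp z)) (N \<inter> fib z) = 0"
      using z_pos emeasure_comp_units[OF z Ns] by (auto simp: zero_less_iff_neq_zero)
    then have "N \<inter> fib z \<in> null_sets (units (cmp z))"
      using Ns fib_sets[OF z] by (intro null_setsI) (auto simp: sets_comp_units[OF z])
    from AE_not_in[OF this] AE_space show "AE x in units (cmp z). P x"
      by eventually_elim (use N(1) space_comp_units[OF z] in auto)
  qed
next
  assume "AE x in units (cmp z). P x"
  then show "AE x in units G. x \<in> fib z \<longrightarrow> P x"
  proof (rule AE_E3)
    fix N assume N: "\<And>x. x \<in> space (units (cmp z)) - N \<Longrightarrow> P x" "N \<in> null_sets (units (cmp z))"
    have Ns: "N \<in> sets (units G)" "N \<subseteq> fib z" using null_setsD2[OF N(2)] by (simp_all add: sets_comp_units[OF z])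
    then have "emeasure (units G) (N \<inter> fib z) \<le> emeasure (units (cmp z)) (N \<inter> fib z)" by (intro emeasure_units_le)
    then have "emeasure (units G) N = 0" using null_setsD1[OF N(2)] Ns(2) by (simp add: Int_absorb2)
    then have "N \<in> null_sets (units G)" using Ns by (intro null_setsI)
    from AE_not_in[OF this] AE_space show "AE x in units G. x \<in> fib z \<longrightarrow> P x"
      by eventually_elim (use N(1) space_comp_units[OF z] in auto)
  qed
qed

text \<open>Both measures are computed on the pieces of a countable cover by bisections, where they
  reduce to measures of sets of units.\<close>

lemma emeasure_arrows_le:
  assumes C: "C \<in> sets (arrows (cmp z))"
  shows "emeasure (arrows G) C \<le> emeasure (arrows (cmp z)) C"
proof -
  obtain \<theta> :: "nat \<Rightarrow> 'g set" and N where \<theta>: "\<And>n. \<theta> n \<in> local_bisections G" "disjoint_family \<theta>"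
      and N: "N \<in> null_sets (units G)"
      and cover: "\<And>\<gamma>. \<gamma> \<in> ars \<Longrightarrow> src G \<gamma> \<notin> N \<or> rng G \<gamma> \<notin> N \<Longrightarrow> \<exists>n. \<gamma> \<in> \<theta> n"
    by (rule bisection_cover) (rule that)
  have CG: "C \<in> sets (arrows G)" "C \<subseteq> cars z" using C by (simp_all add: sets_comp_arrows[OF z])
  have \<rho>: "\<theta> n \<inter> C \<in> local_bisections G" for n by (rule bisection_Int[OF \<theta>(1) CG(1)])
  have \<rho>K: "\<theta> n \<inter> C \<in> local_bisections (cmp z)" for n using \<rho> CG(2) by (auto simp: comp_bisection[OF z])
  have disj: "disjoint_family (\<lambda>n. \<theta> n \<inter> C)" using \<theta>(2) by (auto simp: disjoint_family_on_def)
  have "emeasure (arrows G) C = emeasure (arrows G) (\<Union>n. \<theta> n \<inter> C)"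
  proof (rule emeasure_eq_AE)
    show "AE \<gamma> in arrows G. \<gamma> \<in> C \<longleftrightarrow> \<gamma> \<in> (\<Union>n. \<theta> n \<inter> C)"
      using AE_rng[OF AE_not_in[OF N]] AE_space by eventually_elim (use cover in blast)
    show "(\<Union>n. \<theta> n \<inter> C) \<in> sets (arrows G)"
      by (rule sets.countable_nat_UN) (use bisection_sets[OF \<rho>] in blast)
  qed (rule CG(1))
  also have "\<dots> = (\<Sum>n. emeasure (arrows G) (\<theta> n \<inter> C))"
    by (rule suminf_emeasure[symmetric]) (use bisection_sets[OF \<rho>] disj in auto)
  also have "\<dots> \<le> (\<Sum>n. emeasure (arrows (cmp z)) (\<theta> n \<inter> C))"
  proof (rule suminf_le)
    fix n
    have sub: "rng G ` (\<theta> n \<inter> C) \<subseteq> fib z" using CG(2) by (auto simp: cars_eq)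
    have "emeasure (arrows G) (\<theta> n \<inter> C) = emeasure (units G) (rng G ` (\<theta> n \<inter> C) \<inter> fib z)"
      using emeasure_rng_image[OF bisection_sets[OF \<rho>] bisection_inj_rng[OF \<rho>]] sub by (simp add: Int_absorb2)
    also have "\<dots> \<le> emeasure (units (cmp z)) (rng G ` (\<theta> n \<inter> C) \<inter> fib z)"
      by (rule emeasure_units_le[OF bisection_rng[OF \<rho>]])
    also have "\<dots> = emeasure (arrows (cmp z)) (\<theta> n \<inter> C)"
      using K.emeasure_rng_image[OF K.bisection_sets[OF \<rho>K] K.bisection_inj_rng[OF \<rho>K]] sub by (simp add: Int_absorb2)
    finally show "emeasure (arrows G) (\<theta> n \<inter> C) \<le> emeasure (arrows (cmp z)) (\<theta> n \<inter> C)" .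
  qed auto
  also have "\<dots> = emeasure (arrows (cmp z)) (\<Union>n. \<theta> n \<inter> C)"
    by (rule suminf_emeasure) (use K.bisection_sets[OF \<rho>K] disj in auto)
  also have "\<dots> \<le> emeasure (arrows (cmp z)) C" using C by (intro emeasure_mono) auto
  finally show ?thesis .
qed

lemma AE_arrows_component:
  assumes "AE \<gamma> in arrows (cmp z). P \<gamma>"
  shows "AE \<gamma> in arrows G. \<gamma> \<in> cars z \<longrightarrow> P \<gamma>"
  using assms
proof (rule AE_E3)
  fix C assume C: "\<And>\<gamma>. \<gamma> \<in> cars z - C \<Longrightarrow> P \<gamma>" "C \<in> null_sets (arrows (cmp z))"
  have "emeasure (arrows G) C = 0" using emeasure_arrows_le[OF null_setsD2[OF C(2)]] null_setsD1[OF C(2)] by simp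
  then have "C \<in> null_sets (arrows G)" using null_setsD2[OF C(2)] by (intro null_setsI) (simp_all add: sets_comp_arrows[OF z])
  from AE_not_in[OF this] show ?thesis by eventually_elim (use C(1) in blast)
qed

text \<open>Almost no arrow leaves or enters the component.\<close>

lemma AE_invariant:
  "AE \<gamma> in arrows G. (src G \<gamma> \<in> fib z \<longleftrightarrow> rng G \<gamma> \<in> fib z) \<and>
     (\<forall>\<beta>\<in>ars. rng G \<beta> = src G \<gamma> \<longrightarrow> src G \<gamma> \<in> fib z \<longrightarrow> src G \<beta> \<in> fib z)"
proof -
  have *: "AE x in units G. x \<in> fib z \<longrightarrow>
      (\<forall>\<gamma>\<in>ars. (src G \<gamma> = x \<longrightarrow> rng G \<gamma> \<in> fib z) \<and> (rng G \<gamma> = x \<longrightarrow> src G \<gamma> \<in> fib z))"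
    using invariant_fib[OF z] by (simp only: AE_units_iff)
  show ?thesis using AE_src[OF *] AE_rng[OF *] AE_space by eventually_elim blast
qed

definition extend :: "('g \<Rightarrow> complex) \<Rightarrow> 'g \<Rightarrow> complex" where
  "extend f = (\<lambda>\<gamma>. if \<gamma> \<in> cars z then f \<gamma> else 0)"

definition extend_units :: "('x \<Rightarrow> real) \<Rightarrow> 'x \<Rightarrow> real" where
  "extend_units f = (\<lambda>x. if x \<in> fib z then f x else 0)"

lemma extend_meas: "f \<in> borel_measurable (arrows (cmp z)) \<Longrightarrow> extend f \<in> borel_measurable (arrows G)"
  unfolding extend_def by (rule extend_by_zero_measurable[OF cars_sets[OF z] refl]) (simp_all add: sets_comp_arrows[OF z])

lemma extend_units_meas: "f \<in> borel_measurable (units (cmp z)) \<Longrightarrow> extend_units f \<in> borel_measurable (units G)"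
  unfolding extend_units_def by (rule extend_by_zero_measurable[OF fib_sets[OF z] space_comp_units[OF z]]) (simp_all add: sets_comp_units[OF z])

lemma extend_Linf:
  assumes f: "f \<in> Linf (arrows (cmp z))" shows "extend f \<in> Linf (arrows G)"
proof -
  obtain C where C: "0 \<le> C" "AE \<gamma> in arrows (cmp z). norm (f \<gamma>) \<le> C" using f by (rule LinfE)
  have "AE \<gamma> in arrows G. norm (extend f \<gamma>) \<le> C"
    using AE_arrows_component[OF C(2)] by eventually_elim (use C(1) in \<open>simp add: extend_def\<close>)
  then show ?thesis using extend_meas[OF Linf_meas[OF f]] by (intro LinfI)
qed

lemma extend_units_Linf:
  assumes f: "f \<in> Linf_real (units (cmp z))" shows "extend_units f \<in> Linf_real (units G)"
proof -
  obtain C where C: "0 \<le> C" "AE x in units (cmp z). \<bar>f x\<bar> \<le> C" using f by (rule Linf_realE)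
  have "AE x in units G. x \<in> fib z \<longrightarrow> \<bar>f x\<bar> \<le> C" using C(2) by (simp only: AE_units_iff)
  then have "AE x in units G. \<bar>extend_units f x\<bar> \<le> C"
    by eventually_elim (use C(1) in \<open>simp add: extend_units_def\<close>)
  then show ?thesis using extend_units_meas[OF Linf_real_meas[OF f]] by (intro Linf_realI)
qed

lemma measure_units_le:
  assumes B: "B \<in> sets (units (cmp z))"
  shows "measure (units G) B \<le> measure (units (cmp z)) B"
proof -
  have "B \<in> sets (units G)" "B \<inter> fib z = B" using B by (auto simp: sets_comp_units[OF z])
  then have "emeasure (units G) B \<le> emeasure (units (cmp z)) B" using emeasure_units_le[of B] by simp
  then show ?thesis by (simp add: units.emeasure_eq_measure K.units.emeasure_eq_measure)
qed

lemma extend_c0: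
  assumes f: "f \<in> c0 (cmp z)" shows "extend f \<in> c0 G"
  unfolding c0_iff
proof (intro conjI extend_Linf[OF K.c0_Linf[OF f]] allI impI)
  fix \<epsilon> :: real assume \<epsilon>: "\<epsilon> > 0"
  show "vanishes \<epsilon> \<epsilon> (extend f)"
    using K.c0_vanishes[OF f \<epsilon> \<epsilon>]
  proof (rule K.vanishesE)
    fix B B' F assume *: "B \<in> sets (units (cmp z))" "B' \<in> sets (units (cmp z))" "F \<in> sets (arrows (cmp z))"
      "measure (units (cmp z)) B < \<epsilon>" "measure (units (cmp z)) B' < \<epsilon>" "emeasure (arrows (cmp z)) F < \<infinity>"
      "AE \<gamma> in arrows (cmp z). rng (cmp z) \<gamma> \<notin> B \<longrightarrow> src (cmp z) \<gamma> \<notin> B' \<longrightarrow> \<gamma> \<notin> F \<longrightarrow> norm (f \<gamma>) \<le> \<epsilon>"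
    show ?thesis
    proof (rule vanishesI)
      show "B \<in> sets (units G)" "B' \<in> sets (units G)" using *(1,2) by (simp_all add: sets_comp_units[OF z])
      show "F \<in> sets (arrows G)" using *(3) by (simp add: sets_comp_arrows[OF z])
      show "measure (units G) B < \<epsilon>" using measure_units_le[OF *(1)] *(4) by simp
      show "measure (units G) B' < \<epsilon>" using measure_units_le[OF *(2)] *(5) by simp
      show "emeasure (arrows G) F < \<infinity>" using emeasure_arrows_le[OF *(3)] *(6) by (rule le_less_trans)
      show "AE \<gamma> in arrows G. rng G \<gamma> \<notin> B \<longrightarrow> src G \<gamma> \<notin> B' \<longrightarrow> \<gamma> \<notin> F \<longrightarrow> norm (extend f \<gamma>) \<le> \<epsilon>"
        using AE_arrows_component[OF *(7)] by eventually_elim (use \<epsilon> in \<open>simp add: extend_def\<close>)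
    qed
  qed
qed

text \<open>Up to null sets, arrows outside the component stay outside under right shifts, and inside it
  the shifts by \<open>\<theta>\<close> and by \<open>\<theta> \<inter> cars z\<close> agree. So the defect of the extension is the extension of the
  defect.\<close>

lemma extend_S:
  assumes f: "f \<in> S_algebra (cmp z)" shows "extend f \<in> S_algebra G"
  unfolding S_iff
proof (intro conjI ballI)
  show L: "extend f \<in> Linf (arrows G)" by (rule extend_Linf[OF K.S_Linf[OF f]])
  fix \<theta> assume \<theta>: "\<theta> \<in> local_bisections G"
  let ?\<theta> = "\<theta> \<inter> cars z"
  have \<theta>z: "?\<theta> \<in> local_bisections G" by (rule bisection_Int[OF \<theta> cars_sets[OF z]])
  then have \<theta>K: "?\<theta> \<in> local_bisections (cmp z)" by (simp add: comp_bisection[OF z])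
  show "defect \<theta> (extend f) \<in> c0 G"
  proof (rule c0_AE[OF extend_c0[OF K.S_defect[OF f \<theta>K]] Linf_meas[OF defect_Linf[OF \<theta> L]]])
    show "AE \<gamma> in arrows G. defect \<theta> (extend f) \<gamma> = extend (K.defect ?\<theta> f) \<gamma>"
      using AE_invariant AE_space
    proof eventually_elim
      case (elim \<gamma>)
      have \<gamma>: "\<gamma> \<in> ars" by (rule elim)
      show ?case
      proof (cases "src G \<gamma> \<in> rng G ` \<theta>")
        case False
        then have "src G \<gamma> \<notin> rng G ` ?\<theta>" by blast
        then show ?thesis using False \<gamma> by (simp add: defect_eq extend_def K.defect_eq)
      next
        case True
        then obtain \<beta> where \<beta>: "\<beta> \<in> \<theta>" "src G \<gamma> = rng G \<beta>" by blast
        have \<beta>a: "\<beta> \<in> ars" by (rule bisection_sub[OF \<theta> \<beta>(1)])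
        have sec: "sec \<theta> (src G \<gamma>) = \<beta>" using sec_eq[OF \<theta> \<beta>(1)] \<beta>(2) by simp
        note p = shift_right_props[OF \<theta> \<gamma> True]
        show ?thesis
        proof (cases "\<gamma> \<in> cars z")
          case g: True
          then have fz: "src G \<gamma> \<in> fib z" "rng G \<gamma> \<in> fib z" by (simp_all add: cars_eq)
          have sb: "src G \<beta> \<in> fib z" using elim(1) \<beta>a \<beta>(2) fz(1) by metis
          then have \<beta>z: "\<beta> \<in> ?\<theta>" using \<beta> \<beta>a fz by (simp add: cars_eq)
          then have inz: "src G \<gamma> \<in> rng G ` ?\<theta>" using \<beta>(2) by blast
          have "K.sec ?\<theta> (src G \<gamma>) = \<beta>" using K.sec_eq[OF \<theta>K \<beta>z] \<beta>(2) by simp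
          then have sh: "K.shift_right ?\<theta> \<gamma> = shift_right \<theta> \<gamma>" using sec by (simp add: K.shift_right_def shift_right_def)
          have "shift_right \<theta> \<gamma> \<in> cars z" using p fz sb sec by (simp add: cars_eq)
          then show ?thesis using g \<gamma> True inz sh by (simp add: defect_eq extend_def K.defect_eq)
        next
          case g: False
          have "shift_right \<theta> \<gamma> \<notin> cars z"
          proof
            assume "shift_right \<theta> \<gamma> \<in> cars z"
            then have "rng G \<gamma> \<in> fib z" using p by (simp add: cars_eq)
            then show False using g elim(1) \<gamma> by (simp add: cars_eq)
          qed
          then show ?thesis using g \<gamma> True by (simp add: defect_eq extend_def)
        qed
      qed
    qed
  qed
qed

lemma extend_left_defect:
  assumes \<theta>: "\<theta> \<in> local_bisections (cmp z)" and \<gamma>: "\<gamma> \<in> ars"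
  shows "extend (\<lambda>\<gamma>. f \<gamma> * indicator (arrows_to (cmp z) (src (cmp z) ` \<theta>)) \<gamma> - left_translate (cmp z) \<theta> f \<gamma>) \<gamma> =
    extend f \<gamma> * indicator (arrows_to G (src G ` \<theta>)) \<gamma> - left_translate G \<theta> (extend f) \<gamma>"
proof -
  have \<theta>G: "\<theta> \<in> local_bisections G" "\<theta> \<subseteq> cars z" using \<theta> by (simp_all add: comp_bisection[OF z])
  have ind: "indicator (arrows_to (cmp z) (src (cmp z) ` \<theta>)) \<gamma> = (indicator (arrows_to G (src G ` \<theta>)) \<gamma> :: complex)" if "\<gamma> \<in> cars z"
    using that \<gamma> by (simp add: arrows_to_def indicator_def)
  show ?thesis
  proof (cases "rng G \<gamma> \<in> rng G ` \<theta>")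
    case False
    then show ?thesis using ind by (simp add: extend_def left_translate_eq)
  next
    case True
    note p = shift_left_props[OF \<theta>G(1) \<gamma> True]
    have "sec \<theta> (rng G \<gamma>) \<in> cars z" using sec_in[OF \<theta>G(1) True] \<theta>G(2) by blast
    then have f: "src G (sec \<theta> (rng G \<gamma>)) \<in> fib z" "rng G \<gamma> \<in> fib z" using True \<theta>G by (auto simp: cars_eq)
    then have "shift_left \<theta> \<gamma> \<in> cars z \<longleftrightarrow> \<gamma> \<in> cars z" using p \<gamma> by (simp add: cars_eq)
    then show ?thesis using True ind by (simp add: extend_def left_translate_eq)
  qed
qed

lemma extend_rng:
  "AE \<gamma> in arrows G. extend (\<lambda>\<gamma>. complex_of_real (g (rng G \<gamma>))) \<gamma> = complex_of_real (extend_units g (rng G \<gamma>))"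
  using AE_invariant AE_space by eventually_elim (auto simp: extend_def extend_units_def cars_eq)

text \<open>The restriction is \<open>f \<mapsto> \<phi> (extend f) / \<phi> (extend 1)\<close>. Extension by zero turns suprema of nets on the
  fibre into suprema of nets on all units, which gives normality.\<close>

lemma restrict_invariant_state:
  assumes \<phi>: "invariant_state G \<phi>" and pos: "invariant_state.weight G \<phi> (fib z) > 0"
  shows "\<exists>\<phi>'. invariant_state (cmp z) \<phi>'"
proof -
  interpret I: invariant_state G \<phi> by fact
  let ?c = "I.weight (fib z)"
  define \<phi>' where "\<phi>' f = \<phi> (extend f) / complex_of_real ?c" for f
  have fibS: "fib z \<in> sets (units G)" by (rule fib_sets[OF z])
  have "invariant_state (cmp z) \<phi>'"
  proof
    show "state_on (arrows (cmp z)) (S_algebra (cmp z)) \<phi>'"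
      unfolding state_on_def
    proof (intro conjI ballI allI impI)
      fix f g assume f: "f \<in> S_algebra (cmp z)" and g: "g \<in> S_algebra (cmp z)" and eq: "AE x in arrows (cmp z). f x = g x"
      have "\<phi> (extend f) = \<phi> (extend g)"
      proof (rule I.state_AE[OF extend_S[OF f] extend_S[OF g]])
        show "AE x in arrows G. extend f x = extend g x" using AE_arrows_component[OF eq] by eventually_elim (simp add: extend_def)
      qed
      then show "\<phi>' f = \<phi>' g" by (simp add: \<phi>'_def)
    next
      fix f g assume f: "f \<in> S_algebra (cmp z)" and g: "g \<in> S_algebra (cmp z)"
      have "extend (\<lambda>x. f x + g x) = (\<lambda>x. extend f x + extend g x)" by (auto simp: extend_def)
      then show "\<phi>' (\<lambda>x. f x + g x) = \<phi>' f + \<phi>' g"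
        using I.state_add[OF extend_S[OF f] extend_S[OF g]] by (simp add: \<phi>'_def add_divide_distrib)
    next
      fix c f assume f: "f \<in> S_algebra (cmp z)"
      have "extend (\<lambda>x. c * f x) = (\<lambda>x. c * extend f x)" by (auto simp: extend_def)
      then show "\<phi>' (\<lambda>x. c * f x) = c * \<phi>' f"
        using I.state_scale[OF extend_S[OF f]] by (simp add: \<phi>'_def)
    next
      fix f assume f: "f \<in> S_algebra (cmp z)"
      have eq: "extend (\<lambda>x. cnj (f x) * f x) = (\<lambda>x. cnj (extend f x) * extend f x)" by (auto simp: extend_def)
      have "\<phi> (\<lambda>x. cnj (extend f x) * extend f x) \<in> \<real>\<^sub>\<ge>\<^sub>0" by (rule I.state_pos[OF extend_S[OF f]])
      then show "\<phi>' (\<lambda>x. cnj (f x) * f x) \<in> \<real>\<^sub>\<ge>\<^sub>0"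
        unfolding \<phi>'_def eq using pos by (intro nonneg_Reals_divide_I) auto
    next
      have "\<phi> (extend (\<lambda>_. 1)) = \<phi> (\<lambda>\<gamma>. complex_of_real (indicator (fib z) (rng G \<gamma>)))"
      proof (rule I.state_AE[OF extend_S[OF K.S_const] I.ind_S[OF fibS]])
        show "AE \<gamma> in arrows G. extend (\<lambda>_. 1) \<gamma> = complex_of_real (indicator (fib z) (rng G \<gamma>))"
          using AE_invariant AE_space by eventually_elim (auto simp: extend_def cars_eq indicator_def)
      qed
      then show "\<phi>' (\<lambda>_. 1) = 1" using pos I.weight_phi[OF fibS] by (simp add: \<phi>'_def)
    qed
  next
    fix f \<theta> assume f: "f \<in> S_algebra (cmp z)" and \<theta>: "\<theta> \<in> local_bisections (cmp z)"
    have \<theta>G: "\<theta> \<in> local_bisections G" using \<theta> by (simp add: comp_bisection[OF z])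
    let ?h = "\<lambda>\<gamma>. f \<gamma> * indicator (arrows_to (cmp z) (src (cmp z) ` \<theta>)) \<gamma> - left_translate (cmp z) \<theta> f \<gamma>"
    have "\<phi> (extend ?h) = \<phi> (\<lambda>\<gamma>. extend f \<gamma> * indicator (arrows_to G (src G ` \<theta>)) \<gamma> - left_translate G \<theta> (extend f) \<gamma>)"
      by (rule I.state_AE[OF extend_S[OF K.S_left_defect[OF f \<theta>]] S_left_defect[OF extend_S[OF f] \<theta>G]])
        (intro AE_I2 extend_left_defect[OF \<theta>])
    also have "\<dots> = 0" by (rule I.invariant[OF extend_S[OF f] \<theta>G])
    finally show "\<phi>' ?h = 0" by (simp add: \<phi>'_def)
  next
    let ?J = "\<lambda>f. Re (\<phi>' ((\<lambda>x. complex_of_real (f x)) \<circ> rng (cmp z)))"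
    let ?I = "\<lambda>f. Re (\<phi> ((\<lambda>x. complex_of_real (f x)) \<circ> rng G))"
    have J: "?J f = ?I (extend_units f) / ?c" if f: "f \<in> Linf_real (units (cmp z))" for f
    proof -
      have "\<phi> (extend (\<lambda>\<gamma>. complex_of_real (f (rng G \<gamma>)))) = \<phi> (\<lambda>\<gamma>. complex_of_real (extend_units f (rng G \<gamma>)))"
        using K.S_rng[OF Linf_real_complex[OF f]] S_rng[OF Linf_real_complex[OF extend_units_Linf[OF f]]]
        by (intro I.state_AE[OF extend_S _ extend_rng]) simp_all
      then show ?thesis by (simp add: \<phi>'_def o_def)
    qed
    show "normal_functional (units (cmp z)) (\<lambda>f. \<phi>' (f \<circ> rng (cmp z)))"
      unfolding normal_functional_def
    proof (intro allI impI, elim conjE)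
      fix D g assume ne: "D \<noteq> {}" and D: "D \<subseteq> Linf_real (units (cmp z))" and sup: "Linf_is_sup (units (cmp z)) D g"
        and dir: "\<forall>f1\<in>D. \<forall>f2\<in>D. \<exists>f\<in>D. (AE x in units (cmp z). f1 x \<le> f x) \<and> (AE x in units (cmp z). f2 x \<le> f x)"
      have g: "g \<in> Linf_real (units (cmp z))" and ub: "\<And>f. f \<in> D \<Longrightarrow> AE x in units (cmp z). f x \<le> g x"
        and least: "\<And>h. h \<in> Linf_real (units (cmp z)) \<Longrightarrow> (\<And>f. f \<in> D \<Longrightarrow> AE x in units (cmp z). f x \<le> h x) \<Longrightarrow>
            AE x in units (cmp z). g x \<le> h x"
        using sup unfolding Linf_is_sup_def by blast+
      have DL: "f \<in> D \<Longrightarrow> f \<in> Linf_real (units (cmp z))" for f using D by blast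
      have extend_le: "AE x in units G. extend_units f1 x \<le> extend_units f2 x" if "AE x in units (cmp z). f1 x \<le> f2 x" for f1 f2
      proof -
        have "AE x in units G. x \<in> fib z \<longrightarrow> f1 x \<le> f2 x" using that by (simp only: AE_units_iff)
        then show ?thesis by eventually_elim (simp add: extend_units_def)
      qed
      have "?I (extend_units g) = (SUP f\<in>extend_units ` D. ?I f)"
      proof (rule I.normal[unfolded normal_functional_def, rule_format], intro conjI ballI)
        show "extend_units ` D \<noteq> {}" using ne by simp
        show "extend_units ` D \<subseteq> Linf_real (units G)" using DL extend_units_Linf by blast
        fix f1 f2 assume "f1 \<in> extend_units ` D" "f2 \<in> extend_units ` D"
        then obtain d1 d2 where d: "d1 \<in> D" "d2 \<in> D" "f1 = extend_units d1" "f2 = extend_units d2" by blast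
        obtain d3 where d3: "d3 \<in> D" "AE x in units (cmp z). d1 x \<le> d3 x" "AE x in units (cmp z). d2 x \<le> d3 x"
          using dir[rule_format, OF d(1,2)] by blast
        show "\<exists>f\<in>extend_units ` D. (AE x in units G. f1 x \<le> f x) \<and> (AE x in units G. f2 x \<le> f x)"
          unfolding d(3,4) using d3(1) extend_le[OF d3(2)] extend_le[OF d3(3)] by blast
      next
        show "Linf_is_sup (units G) (extend_units ` D) (extend_units g)"
          unfolding Linf_is_sup_def
        proof (intro conjI ballI impI extend_units_Linf[OF g])
          show "AE x in units G. f x \<le> extend_units g x" if "f \<in> extend_units ` D" for f
            using that extend_le[OF ub] by blast
          fix h assume h: "h \<in> Linf_real (units G)" and hub: "\<forall>f\<in>extend_units ` D. AE x in units G. f x \<le> h x"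
          have hle: "AE x in units (cmp z). d x \<le> h x" if d: "d \<in> D" for d
          proof -
            have "AE x in units G. extend_units d x \<le> h x" using hub d by blast
            then have "AE x in units G. x \<in> fib z \<longrightarrow> d x \<le> h x"
              by eventually_elim (auto simp: extend_units_def)
            then show ?thesis by (simp only: AE_units_iff)
          qed
          have hL: "h \<in> Linf_real (units (cmp z))"
          proof -
            obtain C where "AE x in units G. \<bar>h x\<bar> \<le> C" using h by (rule Linf_realE)
            then have "AE x in units G. x \<in> fib z \<longrightarrow> \<bar>h x\<bar> \<le> C" by eventually_elim simp
            then have "AE x in units (cmp z). \<bar>h x\<bar> \<le> C" by (simp only: AE_units_iff)
            then show ?thesis by (rule Linf_realI[OF comp_units_meas[OF z Linf_real_meas[OF h]]])
          qed
          have "AE x in units (cmp z). g x \<le> h x" by (rule least[OF hL hle])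
          then have 1: "AE x in units G. x \<in> fib z \<longrightarrow> g x \<le> h x" by (simp only: AE_units_iff)
          obtain d where d: "d \<in> D" using ne by blast
          then have 2: "AE x in units G. extend_units d x \<le> h x" using hub by blast
          show "AE x in units G. extend_units g x \<le> h x"
            using 1 2 by eventually_elim (simp add: extend_units_def split: if_splits)
        qed
      qed
      then have Ig: "?I (extend_units g) = (SUP f\<in>D. ?I (extend_units f))" by (simp add: image_image)
      have le: "?I (extend_units f) \<le> ?I (extend_units g)" if f: "f \<in> D" for f
        using I.state_mono[OF I.real_rng_S[OF extend_units_Linf[OF DL[OF f]]] I.real_rng_S[OF extend_units_Linf[OF g]]
            AE_rng[OF extend_le[OF ub[OF f]]]] by (simp add: o_def)
      have Jle: "?J f \<le> ?J g" if f: "f \<in> D" for f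
        unfolding J[OF DL[OF f]] J[OF g] using le[OF f] pos by (simp add: divide_right_mono)
      have bdd: "bdd_above (?J ` D)" using Jle by (intro bdd_aboveI2)
      have "?I (extend_units g) \<le> ?c * (SUP f\<in>D. ?J f)"
        unfolding Ig
      proof (rule cSUP_least[OF ne])
        fix f assume f: "f \<in> D"
        have "?I (extend_units f) = ?c * ?J f" unfolding J[OF DL[OF f]] using pos by simp
        also have "\<dots> \<le> ?c * (SUP f\<in>D. ?J f)" using pos by (intro mult_left_mono cSUP_upper[OF f bdd]) auto
        finally show "?I (extend_units f) \<le> ?c * (SUP f\<in>D. ?J f)" .
      qed
      then have "?J g \<le> (SUP f\<in>D. ?J f)" unfolding J[OF g] using pos by (simp add: field_simps)
      moreover have "(SUP f\<in>D. ?J f) \<le> ?J g" by (intro cSUP_least ne Jle)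
      ultimately show "?J g = (SUP f\<in>D. ?J f)" by (rule antisym)
    qed
  qed
  then show ?thesis by blast
qed

end

context decomposed_groupoid
begin

lemma atomic_fibres_conull:
  assumes at: "purely_atomic (units G)"
  shows "AE x in units G. emeasure Z {\<pi> x} > 0"
proof -
  interpret P: prob_space Z by (rule prob_Z)
  define S where "S = {z\<in>space Z. emeasure Z {z} > 0}"
  have "countable {z. measure Z {z} \<noteq> 0}" by (rule P.countable_support)
  moreover have "S \<subseteq> {z. measure Z {z} \<noteq> 0}" by (auto simp: S_def P.emeasure_eq_measure)
  ultimately have "countable S" by (rule countable_subset[rotated])
  then have S: "S \<in> sets Z"
    using standard_borel_singleton[OF std_Z] by (intro sets.countable[of S]) (auto simp: S_def)
  define C where "C = space (units G) - \<pi> -` S"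
  have C: "C \<in> sets (units G)"
  proof -
    have "C = space (units G) - (\<pi> -` S \<inter> space (units G))" by (auto simp: C_def)
    then show ?thesis using measurable_sets[OF pi_meas S] by auto
  qed
  have "emeasure (units G) C = 0"
  proof (rule ccontr)
    assume "emeasure (units G) C \<noteq> 0"
    then obtain B where B: "B \<subseteq> C" "atom (units G) B"
      using at C unfolding purely_atomic_def by (auto simp: zero_less_iff_neq_zero)
    obtain x where x: "x \<in> B" "emeasure (units G) (B \<inter> \<pi> -` {\<pi> x}) > 0"
      using atom_concentrated_on_fibre[OF std_Z pi_meas B(2)] .
    have Bs: "B \<in> sets (units G)" using B(2) by (simp add: atom_def)
    have xs: "x \<in> space (units G)" using x(1) sets.sets_into_space[OF Bs] by blast
    have px: "\<pi> x \<in> space Z" by (rule measurable_space[OF pi_meas xs])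
    have fs: "{\<pi> x} \<in> sets Z" by (rule standard_borel_singleton[OF std_Z px])
    have "emeasure (units G) (B \<inter> \<pi> -` {\<pi> x}) \<le> emeasure (units G) (\<pi> -` {\<pi> x} \<inter> space (units G))"
      using measurable_sets[OF pi_meas fs] sets.sets_into_space[OF Bs] by (intro emeasure_mono) auto
    also have "\<dots> = emeasure (distr (units G) Z \<pi>) {\<pi> x}" by (rule emeasure_distr[OF pi_meas fs, symmetric])
    also have "\<dots> = emeasure Z {\<pi> x}" by (simp only: distr_pi)
    finally have "\<pi> x \<in> S" using x(2) px by (simp add: S_def)
    then show False using x(1) B(1) by (auto simp: C_def)
  qed
  then have "C \<in> null_sets (units G)" using C by (intro null_setsI)
  from AE_not_in[OF this] AE_space show ?thesis by eventually_elim (auto simp: C_def S_def zero_less_iff_neq_zero)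
qed

text \<open>The fibres of positive measure are countably many and have full weight, so one of them has
  positive weight.\<close>

theorem properly_proximal_if_components:
  assumes at: "purely_atomic (units G)" and pp: "AE z in Z. properly_proximal (cmp z)"
  shows "properly_proximal G"
proof (rule ccontr)
  assume "\<not> properly_proximal G"
  then obtain \<phi> where \<phi>: "invariant_state G \<phi>" using not_properly_proximalE[OF pmp] by blast
  interpret I: invariant_state G \<phi> by fact
  interpret P: prob_space Z by (rule prob_Z)
  define S where "S = {z\<in>space Z. emeasure Z {z} > 0}"
  have "countable {z. measure Z {z} \<noteq> 0}" by (rule P.countable_support)
  moreover have "S \<subseteq> {z. measure Z {z} \<noteq> 0}" by (auto simp: S_def P.emeasure_eq_measure)
  ultimately have "countable S" by (rule countable_subset[rotated])
  have fibS: "fib z \<in> sets (units G)" if "z \<in> S" for z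
    using measurable_sets[OF pi_meas standard_borel_singleton[OF std_Z, of z]] that by (simp add: S_def)
  have "\<exists>z\<in>S. I.weight (fib z) > 0"
  proof (rule ccontr)
    assume "\<not> (\<exists>z\<in>S. I.weight (fib z) > 0)"
    then have "I.weight (fib z) = 0" if "z \<in> S" for z using I.weight_nonneg[OF fibS[OF that]] that by force
    then have "fib z \<in> null_sets I.weight_measure" if "z \<in> S" for z
      using I.emeasure_weight[OF fibS[OF that]] that fibS[OF that] by (intro null_setsI) auto
    then have "(\<Union>z\<in>S. fib z) \<in> null_sets I.weight_measure" by (intro null_sets_UN' \<open>countable S\<close>)
    from null_setsD1[OF this] null_setsD2[OF this]
    have U1: "(\<Union>z\<in>S. fib z) \<in> sets (units G)" and e0: "emeasure I.weight_measure (\<Union>z\<in>S. fib z) = 0"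
      by (simp_all only: I.sets_weight_measure)
    have "ennreal (I.weight (\<Union>z\<in>S. fib z)) = 0" using e0 by (simp only: I.emeasure_weight[OF U1])
    then have "I.weight (\<Union>z\<in>S. fib z) = 0"
      using I.weight_nonneg[OF U1] by (simp only: ennreal_eq_0_iff order_antisym)
    note U = U1 this
    let ?C = "space (units G) - (\<Union>z\<in>S. fib z)"
    have "AE x in units G. x \<notin> ?C"
      using atomic_fibres_conull[OF at] AE_space by eventually_elim (auto simp: S_def measurable_space[OF pi_meas])
    then have "?C \<in> null_sets (units G)" using U(1) by (subst AE_iff_null_sets) auto
    then have "I.weight ?C = 0" by (rule I.weight_null)
    moreover have "I.weight ((\<Union>z\<in>S. fib z) \<union> ?C) = I.weight (\<Union>z\<in>S. fib z) + I.weight ?C"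
      using U(1) by (intro I.weight_Un) auto
    moreover have "(\<Union>z\<in>S. fib z) \<union> ?C = space (units G)" by auto
    ultimately show False using U(2) I.weight_space by simp
  qed
  then obtain z where z: "z \<in> S" "I.weight (fib z) > 0" by blast
  have "AE z' in Z. good z' \<and> properly_proximal (cmp z')" using AE_good pp by eventually_elim simp
  then have gp: "good z \<and> properly_proximal (cmp z)"
  proof (rule AE_E3)
    fix N assume N: "\<And>z'. z' \<in> space Z - N \<Longrightarrow> good z' \<and> properly_proximal (cmp z')" "N \<in> null_sets Z"
    have "z \<notin> N"
    proof
      assume "z \<in> N"
      then have "emeasure Z {z} \<le> emeasure Z N" using N(2) by (intro emeasure_mono) auto
      then show False using z(1) null_setsD1[OF N(2)] by (simp add: S_def)
    qed
    then show ?thesis using N(1)[of z] z(1) by (simp add: S_def)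
  qed
  interpret A: atomic_component G Z \<pi> \<mu> z
    by unfold_locales (use gp z in \<open>auto simp: S_def\<close>)
  obtain \<phi>' where "invariant_state (cmp z) \<phi>'" using A.restrict_invariant_state[OF \<phi> z(2)] by blast
  then show False using not_properly_proximalI gp by blast
qed

end

theorem theorem4p19:
  fixes G :: "('g, 'x) groupoid"
    and Z :: "'z measure"
    and \<pi> :: "'x \<Rightarrow> 'z"
    and \<mu> :: "'z \<Rightarrow> 'x measure"
  assumes "countable_pmp_groupoid G"
    and "ergodic_decomposition G Z \<pi> \<mu>"
  shows "(properly_proximal G \<longrightarrow> (AE z in Z. properly_proximal (component G \<pi> \<mu> z))) \<and>
    (purely_atomic (units G) \<longrightarrow>
       (AE z in Z. properly_proximal (component G \<pi> \<mu> z)) \<longrightarrow> properly_proximal G)"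
proof -
  interpret decomposed_groupoid G Z \<pi> \<mu>
    using assms by unfold_locales
  show ?thesis
    using properly_proximal_components properly_proximal_if_components by blast
qed

end
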